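(* (i) The form $(\mathbb{E},\mathfrak{C}^1(\mathcal{G}_0))$, with $\mathbb{E}(u,v)=\int\langle\mathbb{D}u(g),\mathbb{D}v(g)\rangle_{L^2}d\mathbb{Q}_0^\beta(g)$, is closable in $L^2(\mathcal{G}_0,\mathbb{Q}_0^\beta)$ and its closure coincides with $(\mathbb{E},\mathrm{Dom}(\mathbb{E}))$. Similarly, $(\mathbb{D},\mathfrak{C}^1(\mathcal{G}_0))$ is closable and its closure coincides with $(\overline{\mathbb{D}},\mathrm{Dom}(\overline{\mathbb{D}}))$. (ii) For all $u,w\in\mathfrak{Z}^1(\mathcal{G}_0)\cup\mathfrak{C}^1(\mathcal{G}_0)$, $\Gamma(u,w)(g)=\langle\mathbb{D}u(g),\mathbb{D}w(g)\rangle_{L^2}$; in particular $\mathbb{E}(u,w)=\int_{\mathcal{G}_0}\langle\mathbb{D}u(g),\mathbb{D}w(g)\rangle_{L^2}d\mathbb{Q}_0^\beta(g)$. (iii) For each $f\in\mathcal{G}_0$ the function $u_f:g\mapsto\|f-g\|_{L^2}$ belongs to $\mathrm{Dom}(\mathbb{E})$ and $\Gamma(u_f,u_f)\le1$ $\mathbb{Q}_0^\beta$-a.e. on $\mathcal{G}_0$. (iv) $(\mathbb{E},\mathrm{Dom}(\mathbb{E}))$ is strongly local.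
   Context: $\mathcal{G}_0$ is the set of right continuous nondecreasing maps $g:[0,1[\,\to[0,1]$ extended by $g(1):=1$, with $L^2([0,1])$ distance. Fix $\beta>0$; $\mathbb{Q}_0^\beta$ is the probability measure on $\mathcal{G}_0$ such that for every $N$ and $0=t_0<\dots<t_{N+1}=1$ the law of $(g(t_1),\dots,g(t_N))$ is $\frac{\Gamma(\beta)}{\prod_{i=0}^{N}\Gamma(\beta(t_{i+1}-t_i))}\prod_{i=0}^{N}(x_{i+1}-x_i)^{\beta(t_{i+1}-t_i)-1}dx$ on $\{0<x_1<\dots<x_N<1\}$, $x_0:=0,x_{N+1}:=1$. $\mathfrak{Z}^1(\mathcal{G}_0)$: functions $u(g)=U(\int_0^1\vec\alpha(g_s)ds)$, $U\in\mathcal{C}^1(\mathbb{R}^m)$, $\vec\alpha\in\mathcal{C}^1([0,1],\mathbb{R}^m)$, with $\mathbb{D}u(g)=\sum_i\partial_iU(\int\vec\alpha(g_s)ds)\alpha_i'(g(\cdot))$. $\mathfrak{C}^1(\mathcal{G}_0)$: functions $u(g)=U(\int_0^1\vec f(t)g(t)dt)$, $U\in\mathcal{C}^1(\mathbb{R}^m)$, $\vec f=(f_1,\dots,f_m)\in L^2([0,1],\mathbb{R}^m)$, with $\mathbb{D}u(g)=\sum_i\partial_iU(\int\vec f(t)g(t)dt)f_i(\cdot)$. $(\overline{\mathbb{D}},\mathrm{Dom}(\overline{\mathbb{D}}))$ is the closure of $\mathbb{D}$ on $\mathfrak{Z}^1(\mathcal{G}_0)$ (as operator $L^2(\mathcal{G}_0,\mathbb{Q}_0^\beta)\to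 L^2(\mathcal{G}_0\times[0,1],\mathbb{Q}_0^\beta\otimes\mathrm{Leb})$), $(\mathbb{E},\mathrm{Dom}(\mathbb{E}))$ the closure of $\mathbb{E}$ on $\mathfrak{Z}^1(\mathcal{G}_0)$ (a Dirichlet form with $\mathrm{Dom}(\mathbb{E})=\mathrm{Dom}(\overline{\mathbb{D}})$), and $\Gamma(u,v):=\langle\overline{\mathbb{D}}u,\overline{\mathbb{D}}v\rangle_{L^2([0,1])}$ its square field operator. *)

theory Defs
  imports "HOL-Probability.Probability"
begin

definition G0 :: "(real \<Rightarrow> real) set" where
  "G0 = {g. (\<forall>s t. 0 \<le> s \<longrightarrow> s \<le> t \<longrightarrow> t < 1 \<longrightarrow> g s \<le> g t)
           \<and> (\<forall>t\<in>{0..<1}. 0 \<le> g t \<and> g t \<le> 1 \<and> continuous (at_right t) g)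
           \<and> g 1 = 1 \<and> (\<forall>t. t < 0 \<or> 1 < t \<longrightarrow> g t = 0)}"

text \<open>Measurable structure: sigma algebra generated by the evaluations g |-> g t, t in [0,1[
  (this coincides with the Borel sigma algebra of the L^2 distance).\<close>

definition G0M :: "(real \<Rightarrow> real) measure" where
  "G0M = sigma G0 {{g \<in> G0. g t \<in> A} | t A. t \<in> {0..<1} \<and> A \<in> sets borel}"

definition Leb01 :: "real measure" where
  "Leb01 = restrict_space lborel {0..1}"

definition ext_pt :: "nat \<Rightarrow> (nat \<Rightarrow> real) \<Rightarrow> nat \<Rightarrow> real" where
  "ext_pt N x i = (if i = 0 then 0 else if i = Suc N then 1 else x i)"

definition fdd_density :: "real \<Rightarrow> nat \<Rightarrow> (nat \<Rightarrow> real) \<Rightarrow> (nat \<Rightarrow> real) \<Rightarrow> ennreal" where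
  "fdd_density \<beta> N t x = ennreal
     (indicator {y. \<forall>i\<le>N. ext_pt N y i < ext_pt N y (Suc i)} x
      * (Gamma \<beta> / (\<Prod>i\<le>N. Gamma (\<beta> * (t (Suc i) - t i))))
      * (\<Prod>i\<le>N. (ext_pt N x (Suc i) - ext_pt N x i) powr (\<beta> * (t (Suc i) - t i) - 1)))"

definition is_entropic_measure :: "real \<Rightarrow> (real \<Rightarrow> real) measure \<Rightarrow> bool" where
  "is_entropic_measure \<beta> Q \<longleftrightarrow> prob_space Q \<and> sets Q = sets G0M \<and>
     (\<forall>N (t::nat \<Rightarrow> real). t 0 = 0 \<and> t (Suc N) = 1 \<and> (\<forall>i\<le>N. t i < t (Suc i)) \<longrightarrow>
        distr Q (PiM {1..N} (\<lambda>_. lborel)) (\<lambda>g. \<lambda>i\<in>{1..N}. g (t i))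
          = density (PiM {1..N} (\<lambda>_. lborel)) (fdd_density \<beta> N t))"

text \<open>U is C^1 on R^m (R^m encoded as the first m coordinates of nat => real);
  dU i is the i-th partial derivative, required to exist everywhere and be continuous.\<close>

definition C1_Rm :: "nat \<Rightarrow> ((nat \<Rightarrow> real) \<Rightarrow> real) \<Rightarrow> (nat \<Rightarrow> (nat \<Rightarrow> real) \<Rightarrow> real) \<Rightarrow> bool" where
  "C1_Rm m U dU \<longleftrightarrow>
     (\<forall>x y. (\<forall>i<m. x i = y i) \<longrightarrow> U x = U y) \<and>
     (\<forall>i<m. \<forall>x. ((\<lambda>s. U (x(i := s))) has_real_derivative dU i x) (at (x i))) \<and>
     (\<forall>i<m. \<forall>x. \<forall>\<epsilon>>0. \<exists>\<delta>>0. \<forall>y. (\<Sum>j<m. (y j - x j)\<^sup>2) < \<delta>\<^sup>2 \<longrightarrow> \<bar>dU i y - dU i x\<bar> < \<epsilon>)"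

definition C1_01 :: "(real \<Rightarrow> real) \<Rightarrow> (real \<Rightarrow> real) \<Rightarrow> bool" where
  "C1_01 a a' \<longleftrightarrow> continuous_on {0..1} a' \<and>
     (\<forall>x\<in>{0..1}. (a has_real_derivative a' x) (at x within {0..1}))"

text \<open>Graphs (u, D u) of the gradient on the two classes of cylinder functions.\<close>

definition Z1 :: "(((real \<Rightarrow> real) \<Rightarrow> real) \<times> ((real \<Rightarrow> real) \<Rightarrow> real \<Rightarrow> real)) set" where
  "Z1 = {(u, Du). \<exists>m U dU \<alpha> \<alpha>'. C1_Rm m U dU \<and> (\<forall>i<m. C1_01 (\<alpha> i) (\<alpha>' i)) \<and>
      u = (\<lambda>g. U (\<lambda>i. \<integral>s. \<alpha> i (g s) \<partial>Leb01)) \<and>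
      Du = (\<lambda>g t. \<Sum>i<m. dU i (\<lambda>j. \<integral>s. \<alpha> j (g s) \<partial>Leb01) * \<alpha>' i (g t))}"

definition C1 :: "(((real \<Rightarrow> real) \<Rightarrow> real) \<times> ((real \<Rightarrow> real) \<Rightarrow> real \<Rightarrow> real)) set" where
  "C1 = {(u, Du). \<exists>m U dU f. C1_Rm m U dU \<and>
      (\<forall>i<m. f i \<in> borel_measurable Leb01 \<and> (\<integral>\<^sup>+t. ennreal ((f i t)\<^sup>2) \<partial>Leb01) < \<infinity>) \<and>
      u = (\<lambda>g. U (\<lambda>i. \<integral>t. f i t * g t \<partial>Leb01)) \<and>
      Du = (\<lambda>g t. \<Sum>i<m. dU i (\<lambda>j. \<integral>s. f j s * g s \<partial>Leb01) * f i t)}"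

definition L2 :: "'a measure \<Rightarrow> ('a \<Rightarrow> real) \<Rightarrow> bool" where
  "L2 M f \<longleftrightarrow> f \<in> borel_measurable M \<and> (\<integral>\<^sup>+x. ennreal ((f x)\<^sup>2) \<partial>M) < \<infinity>"

definition L2conv :: "'a measure \<Rightarrow> (nat \<Rightarrow> 'a \<Rightarrow> real) \<Rightarrow> ('a \<Rightarrow> real) \<Rightarrow> bool" where
  "L2conv M fs f \<longleftrightarrow> L2 M f \<and> (\<forall>n. L2 M (fs n)) \<and>
     ((\<lambda>n. \<integral>\<^sup>+x. ennreal ((fs n x - f x)\<^sup>2) \<partial>M) \<longlonglongrightarrow> 0)"

definition L2cauchy :: "'a measure \<Rightarrow> (nat \<Rightarrow> 'a \<Rightarrow> real) \<Rightarrow> bool" where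
  "L2cauchy M fs \<longleftrightarrow> (\<forall>n. L2 M (fs n)) \<and>
     (\<forall>\<epsilon>>0. \<exists>N. \<forall>n\<ge>N. \<forall>k\<ge>N. (\<integral>\<^sup>+x. ennreal ((fs n x - fs k x)\<^sup>2) \<partial>M) < ennreal \<epsilon>)"

type_synonym gpair = "((real \<Rightarrow> real) \<Rightarrow> real) \<times> ((real \<Rightarrow> real) \<Rightarrow> real \<Rightarrow> real)"

definition grad_seq :: "(nat \<Rightarrow> gpair) \<Rightarrow> nat \<Rightarrow> (real \<Rightarrow> real) \<times> real \<Rightarrow> real" where
  "grad_seq s n = (\<lambda>(g, t). snd (s n) g t)"

definition op_closable :: "(real \<Rightarrow> real) measure \<Rightarrow> gpair set \<Rightarrow> bool" where
  "op_closable Q P \<longleftrightarrow> (\<forall>s F. (\<forall>n. s n \<in> P) \<and> L2conv Q (\<lambda>n. fst (s n)) (\<lambda>_. 0) \<and>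
      L2conv (Q \<Otimes>\<^sub>M Leb01) (grad_seq s) F \<longrightarrow> (AE x in Q \<Otimes>\<^sub>M Leb01. F x = 0))"

definition op_closure :: "(real \<Rightarrow> real) measure \<Rightarrow> gpair set \<Rightarrow> gpair set" where
  "op_closure Q P = {(u, F). \<exists>s. (\<forall>n. s n \<in> P) \<and> L2conv Q (\<lambda>n. fst (s n)) u \<and>
      L2conv (Q \<Otimes>\<^sub>M Leb01) (grad_seq s) (\<lambda>(g, t). F g t)}"

definition formE :: "(real \<Rightarrow> real) measure \<Rightarrow> gpair \<Rightarrow> gpair \<Rightarrow> real" where
  "formE Q p q = (\<integral>x. snd p (fst x) (snd x) * snd q (fst x) (snd x) \<partial>(Q \<Otimes>\<^sub>M Leb01))"

text \<open>Form closability: E-Cauchy sequences (E(u_n - u_k) -> 0) converging to 0 in L^2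
  have E(u_n) -> 0.  Here E(u_n - u_k) = int |Du_n - Du_k|^2 by linearity of D.\<close>

definition form_closable :: "(real \<Rightarrow> real) measure \<Rightarrow> gpair set \<Rightarrow> bool" where
  "form_closable Q P \<longleftrightarrow> (\<forall>s. (\<forall>n. s n \<in> P) \<and> L2conv Q (\<lambda>n. fst (s n)) (\<lambda>_. 0) \<and>
      L2cauchy (Q \<Otimes>\<^sub>M Leb01) (grad_seq s) \<longrightarrow> ((\<lambda>n. formE Q (s n) (s n)) \<longlonglongrightarrow> 0))"

definition form_closure :: "(real \<Rightarrow> real) measure \<Rightarrow> gpair set
    \<Rightarrow> (((real \<Rightarrow> real) \<Rightarrow> real) \<times> ((real \<Rightarrow> real) \<Rightarrow> real) \<times> real) set" where
  "form_closure Q P = {(u, v, c). \<exists>s r. (\<forall>n. s n \<in> P) \<and> (\<forall>n. r n \<in> P) \<and>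
      L2conv Q (\<lambda>n. fst (s n)) u \<and> L2conv Q (\<lambda>n. fst (r n)) v \<and>
      L2cauchy (Q \<Otimes>\<^sub>M Leb01) (grad_seq s) \<and> L2cauchy (Q \<Otimes>\<^sub>M Leb01) (grad_seq r) \<and>
      ((\<lambda>n. formE Q (s n) (r n)) \<longlonglongrightarrow> c)}"

definition form_dom :: "(real \<Rightarrow> real) measure \<Rightarrow> gpair set \<Rightarrow> ((real \<Rightarrow> real) \<Rightarrow> real) set" where
  "form_dom Q P = {u. \<exists>c. (u, u, c) \<in> form_closure Q P}"

definition sqfield :: "((real \<Rightarrow> real) \<Rightarrow> real \<Rightarrow> real) \<Rightarrow> ((real \<Rightarrow> real) \<Rightarrow> real \<Rightarrow> real)
    \<Rightarrow> (real \<Rightarrow> real) \<Rightarrow> real" where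
  "sqfield F G g = (\<integral>t. F g t * G g t \<partial>Leb01)"

definition L2dist :: "(real \<Rightarrow> real) \<Rightarrow> (real \<Rightarrow> real) \<Rightarrow> real" where
  "L2dist f g = sqrt (\<integral>t. (f t - g t)\<^sup>2 \<partial>Leb01)"

end

theory Submission
  imports Defs
begin

text \<open>
  For a field \<open>\<phi>\<close> on \<open>[0,1]\<close> vanishing at both end points, \<open>dir \<phi> u g = \<integral> D u g t * \<phi> (g t) dt\<close> is the
  derivative of \<open>u\<close> along \<open>g \<mapsto> \<phi> \<circ> g\<close>. Integrating by parts against the Dirichlet densities on uniform grids, whose
  logarithmic divergence along this field is bounded uniformly in the grid, yields
  \<open>\<bar>\<integral> dir \<phi> u * v + u * dir \<phi> v dQ\<bar> \<le> C * \<integral> \<bar>u * v\<bar> dQ\<close> for \<open>u\<close>, \<open>v\<close> in \<open>C1\<close>; an inequality suffices, so no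
  divergence operator on \<open>G0\<close> is needed. If \<open>u\<^sub>n \<rightarrow> 0\<close> and \<open>D u\<^sub>n \<rightarrow> F\<close>, then \<open>F\<close> is orthogonal to all \<open>\<phi> (g t) * v g\<close>.
  Since almost every path is strictly increasing, these products generate the whole product sigma algebra, and \<open>F = 0\<close>.

  An element of \<open>Z1\<close> is approximated by replacing \<open>g\<close> with its cell means. Conversely \<open>\<integral> f t * g t dt = F 1 - \<integral> F (G x) dx\<close>,
  where \<open>F' = f\<close> and \<open>G\<close> is the distribution function of the path; a Riemann sum and a smoothing of \<open>G\<close> give elements of \<open>Z1\<close>.

  The chain rule for \<open>arctan (k * (u - c)) / k\<close> and closability show that the gradient vanishes almost everywhere on
  \<open>{u = c}\<close>, which is strong locality.
\<close>

section \<open>Convergence in \<open>L\<^sup>2\<close>\<close>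

text \<open>The uniform bound on the divergence rests on a cancellation. On a grid with N interior
  points, the divergence of the field and its derivative of the log density are each of order N. The
  \<open>-1\<close> in the exponents \<open>a i - 1\<close> pairs every value of \<phi>' at a right
  end point of a gap with the divided difference of \<phi> over that gap. Each such pair differs by
  at most a constant times the gap, and the gaps add up to 1. What is left involves only the sum of
  the parameters \<open>a i\<close>, which is \<beta> on every grid. The obstacle is that these
  parameters drop below 1 on fine grids, where the density is unbounded at the faces of the simplex.
  The gap weights are therefore made C^1 first, and the regularisation is removed by dominated
  convergence. Closability, chain rule and locality are proved for \<open>C1\<close> alone. The
  equality of the two graph closures carries them over to \<open>Z1\<close>, and completeness of L^2
  reduces every statement about forms to one about graphs of the gradient.\<close>

lemma L2_iff: "L2 M f \<longleftrightarrow> f \<in> borel_measurable M \<and> integrable M (\<lambda>x. (f x)\<^sup>2)"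
  unfolding L2_def by (auto simp: integrable_iff_bounded)

lemma L2_measurable [measurable_dest]: "L2 M f \<Longrightarrow> f \<in> borel_measurable M"
  by (simp add: L2_def)

lemma L2_square_integrable: "L2 M f \<Longrightarrow> integrable M (\<lambda>x. (f x)\<^sup>2)"
  by (simp add: L2_iff)

lemma L2_bound:
  assumes "L2 M h" "f \<in> borel_measurable M" "AE x in M. \<bar>f x\<bar> \<le> \<bar>h x\<bar>"
  shows "L2 M f"
proof -
  have "AE x in M. norm ((f x)\<^sup>2) \<le> norm ((h x)\<^sup>2)"
    using assms(3)
  proof eventually_elim
    case (elim x)
    then show ?case using power_mono[OF elim, of 2] by simp
  qed
  then have "integrable M (\<lambda>x. (f x)\<^sup>2)"
    using assms(2) by (intro Bochner_Integration.integrable_bound[OF L2_square_integrable[OF assms(1)]]) auto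
  then show ?thesis using assms by (simp add: L2_iff)
qed

lemma L2_mult_integrable:
  assumes "L2 M f" "L2 M g"
  shows "integrable M (\<lambda>x. f x * g x)"
proof (rule Bochner_Integration.integrable_bound[where f="\<lambda>x. (f x)\<^sup>2 + (g x)\<^sup>2"])
  show "integrable M (\<lambda>x. (f x)\<^sup>2 + (g x)\<^sup>2)"
    using assms by (auto simp: L2_iff)
  show "(\<lambda>x. f x * g x) \<in> borel_measurable M"
    using assms by (auto simp: L2_iff)
  have "\<bar>a * b\<bar> \<le> a\<^sup>2 + b\<^sup>2" for a b :: real
    using sum_squares_bound[of "\<bar>a\<bar>" "\<bar>b\<bar>"] mult_nonneg_nonneg[of "\<bar>a\<bar>" "\<bar>b\<bar>"]
    unfolding abs_mult power2_abs by linarith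
  then show "AE x in M. norm (f x * g x) \<le> norm ((f x)\<^sup>2 + (g x)\<^sup>2)"
    by simp
qed

lemma sq_add_le: "((a::real) + b)\<^sup>2 \<le> 2 * a\<^sup>2 + 2 * b\<^sup>2"
  using sum_squares_bound[of a b] by (simp add: power2_sum)

lemma L2_add [simp]:
  assumes "L2 M f" "L2 M g"
  shows "L2 M (\<lambda>x. f x + g x)"
proof -
  have "integrable M (\<lambda>x. (f x)\<^sup>2 + (g x)\<^sup>2 + 2 * (f x * g x))"
    using assms L2_mult_integrable[OF assms] by (auto simp: L2_iff)
  then have "integrable M (\<lambda>x. (f x + g x)\<^sup>2)"
    by (simp add: power2_sum algebra_simps)
  then show ?thesis using assms by (auto simp: L2_iff)
qed

lemma L2_cmult [simp]: "L2 M f \<Longrightarrow> L2 M (\<lambda>x. c * f x)"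
  unfolding L2_iff power_mult_distrib by (intro conjI integrable_mult_right borel_measurable_times) auto

lemma L2_diff [simp]: "L2 M f \<Longrightarrow> L2 M g \<Longrightarrow> L2 M (\<lambda>x. f x - g x)"
  using L2_add[OF _ L2_cmult[of M g "-1"]] by auto

lemma L2_sum:
  "(\<And>i. i \<in> I \<Longrightarrow> L2 M (f i)) \<Longrightarrow> L2 M (\<lambda>x. \<Sum>i\<in>I. f i x)"
proof (induction I rule: infinite_finite_induct)
  case (insert i I)
  have "L2 M (\<lambda>x. f i x + (\<Sum>i\<in>I. f i x))"
    by (intro L2_add insert.IH insert.prems) auto
  then show ?case using insert.hyps by simp
qed (simp_all add: L2_def)

lemma L2_abs: "L2 M f \<Longrightarrow> L2 M (\<lambda>x. \<bar>f x\<bar>)"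
  by (rule L2_bound[of M f]) (auto intro: borel_measurable_abs L2_measurable)

lemma (in finite_measure) L2_bounded:
  assumes "f \<in> borel_measurable M" "\<And>x. x \<in> space M \<Longrightarrow> \<bar>f x\<bar> \<le> B"
  shows "L2 M f"
proof -
  have "integrable M (\<lambda>x. (f x)\<^sup>2)"
    by (rule integrable_const_bound[where B="B\<^sup>2"])
       (use assms power_mono[OF assms(2) abs_ge_zero, of _ 2] in \<open>auto intro!: AE_I2\<close>)
  then show ?thesis using assms by (auto simp: L2_iff)
qed

lemma (in finite_measure) L2_integrable:
  assumes "L2 M f" shows "integrable M f"
  using L2_mult_integrable[OF assms L2_bounded[of "\<lambda>_. 1" 1]] by simp

declare L2_square_integrable [simp]

lemma nn_integral_sq_eq:
  "L2 M f \<Longrightarrow> (\<integral>\<^sup>+x. ennreal ((f x)\<^sup>2) \<partial>M) = ennreal (\<integral>x. (f x)\<^sup>2 \<partial>M)"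
  by (rule nn_integral_eq_integral) auto

lemma L2conv_iff:
  "L2conv M fs f \<longleftrightarrow> L2 M f \<and> (\<forall>n. L2 M (fs n)) \<and> (\<lambda>n. \<integral>x. (fs n x - f x)\<^sup>2 \<partial>M) \<longlonglongrightarrow> 0"
proof -
  have "((\<lambda>n. \<integral>\<^sup>+x. ennreal ((fs n x - f x)\<^sup>2) \<partial>M) \<longlonglongrightarrow> 0) \<longleftrightarrow>
      (\<lambda>n. \<integral>x. (fs n x - f x)\<^sup>2 \<partial>M) \<longlonglongrightarrow> 0" if "L2 M f" "\<forall>n. L2 M (fs n)"
  proof -
    have "(\<lambda>n. \<integral>\<^sup>+x. ennreal ((fs n x - f x)\<^sup>2) \<partial>M) = (\<lambda>n. ennreal (\<integral>x. (fs n x - f x)\<^sup>2 \<partial>M))"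
      using that by (intro ext nn_integral_sq_eq) auto
    then show ?thesis
      using tendsto_ennreal_iff[of "\<lambda>n. \<integral>x. (fs n x - f x)\<^sup>2 \<partial>M" sequentially 0] by simp
  qed
  then show ?thesis unfolding L2conv_def by auto
qed

lemma L2cauchy_iff:
  "L2cauchy M fs \<longleftrightarrow> (\<forall>n. L2 M (fs n)) \<and>
     (\<forall>e>0. \<exists>N. \<forall>n\<ge>N. \<forall>k\<ge>N. (\<integral>x. (fs n x - fs k x)\<^sup>2 \<partial>M) < e)"
proof -
  have "(\<integral>\<^sup>+x. ennreal ((fs n x - fs k x)\<^sup>2) \<partial>M) < ennreal e \<longleftrightarrow> (\<integral>x. (fs n x - fs k x)\<^sup>2 \<partial>M) < e"
    if "\<forall>n. L2 M (fs n)" "e > 0" for n k and e :: real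
    using that by (subst nn_integral_sq_eq) (auto simp: ennreal_less_iff)
  then have "(\<forall>n. L2 M (fs n)) \<Longrightarrow> (\<forall>e>0. \<exists>N. \<forall>n\<ge>N. \<forall>k\<ge>N. (\<integral>\<^sup>+x. ennreal ((fs n x - fs k x)\<^sup>2) \<partial>M) < ennreal e) \<longleftrightarrow>
      (\<forall>e>0. \<exists>N. \<forall>n\<ge>N. \<forall>k\<ge>N. (\<integral>x. (fs n x - fs k x)\<^sup>2 \<partial>M) < e)"
    by simp
  then show ?thesis unfolding L2cauchy_def by blast
qed

lemma L2conv_const: "L2 M f \<Longrightarrow> L2conv M (\<lambda>_. f) f"
  by (simp add: L2conv_iff)

lemma L2conv_L2: "L2conv M fs f \<Longrightarrow> L2 M (fs n)" and L2conv_L2_lim: "L2conv M fs f \<Longrightarrow> L2 M f"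
  by (auto simp: L2conv_iff)

lemma integral_sq_diff_triangle:
  assumes "L2 M f" "L2 M g" "L2 M h"
  shows "(\<integral>x. (f x - h x)\<^sup>2 \<partial>M) \<le> 2 * (\<integral>x. (f x - g x)\<^sup>2 \<partial>M) + 2 * (\<integral>x. (g x - h x)\<^sup>2 \<partial>M)"
proof -
  have "(\<integral>x. (f x - h x)\<^sup>2 \<partial>M) \<le> (\<integral>x. 2 * (f x - g x)\<^sup>2 + 2 * (g x - h x)\<^sup>2 \<partial>M)"
    using assms sq_add_le[of "f x - g x" "g x - h x" for x]
    by (intro integral_mono) auto
  also have "\<dots> = 2 * (\<integral>x. (f x - g x)\<^sup>2 \<partial>M) + 2 * (\<integral>x. (g x - h x)\<^sup>2 \<partial>M)"
    using assms by (subst Bochner_Integration.integral_add) auto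
  finally show ?thesis .
qed

lemma L2conv_dominated:
  assumes h: "L2 M h" and m: "\<And>n. fs n \<in> borel_measurable M" "f \<in> borel_measurable M"
    and lim: "AE x in M. (\<lambda>n. fs n x) \<longlonglongrightarrow> f x"
    and bd: "\<And>n. AE x in M. \<bar>fs n x\<bar> \<le> h x"
  shows "L2conv M fs f"
proof -
  have h': "AE x in M. \<forall>n. \<bar>fs n x\<bar> \<le> h x"
    using bd by (simp add: AE_all_countable)
  have fb: "AE x in M. \<bar>f x\<bar> \<le> h x"
    using lim h'
  proof eventually_elim
    case (elim x)
    then show ?case
      by (intro tendsto_upperbound[OF tendsto_rabs[OF elim(1)]]) auto
  qed
  have L: "L2 M f" "L2 M (fs n)" for n
    using fb bd[of n] m by (auto intro!: L2_bound[OF h] elim: eventually_mono)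
  have "(\<lambda>n. \<integral>x. (fs n x - f x)\<^sup>2 \<partial>M) \<longlonglongrightarrow> (\<integral>x. 0 \<partial>M)"
  proof (rule integral_dominated_convergence[where w="\<lambda>x. 4 * (h x)\<^sup>2"])
    show "integrable M (\<lambda>x. 4 * (h x)\<^sup>2)" using h by simp
    show "AE x in M. (\<lambda>n. (fs n x - f x)\<^sup>2) \<longlonglongrightarrow> 0"
      using lim by eventually_elim (auto intro!: tendsto_eq_intros)
    show "AE x in M. norm ((fs n x - f x)\<^sup>2) \<le> 4 * (h x)\<^sup>2" for n
      using h' fb
    proof eventually_elim
      case (elim x)
      then have "\<bar>fs n x\<bar> \<le> h x" by auto
      then have "\<bar>fs n x - f x\<bar> \<le> \<bar>2 * h x\<bar>" using elim(2) by linarith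
      then have "(fs n x - f x)\<^sup>2 \<le> (2 * h x)\<^sup>2" by (simp only: abs_le_square_iff)
      then show ?case by (simp add: power_mult_distrib)
    qed
  qed (use m in auto)
  then show ?thesis using L by (simp add: L2conv_iff)
qed

lemma L2conv_subseq: "L2conv M fs f \<Longrightarrow> strict_mono r \<Longrightarrow> L2conv M (\<lambda>n. fs (r n)) f"
  using LIMSEQ_subseq_LIMSEQ[of "\<lambda>n. \<integral>x. (fs n x - f x)\<^sup>2 \<partial>M" 0 r]
  by (simp add: L2conv_iff o_def)

lemma L2conv_AE_subseq:
  assumes "L2conv M fs f"
  obtains r :: "nat \<Rightarrow> nat" where "strict_mono r" "AE x in M. (\<lambda>n. fs (r n) x) \<longlonglongrightarrow> f x"
proof -
  have "\<exists>r::nat\<Rightarrow>nat. strict_mono r \<and> (AE x in M. (\<lambda>n. (fs (r n) x - f x)\<^sup>2) \<longlonglongrightarrow> 0)"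
    using assms by (intro tendsto_L1_AE_subseq) (auto simp: L2conv_iff intro!: L2_square_integrable)
  then obtain r :: "nat \<Rightarrow> nat" where r: "strict_mono r"
    "AE x in M. (\<lambda>n. (fs (r n) x - f x)\<^sup>2) \<longlonglongrightarrow> 0" by auto
  have "AE x in M. (\<lambda>n. fs (r n) x) \<longlonglongrightarrow> f x"
    using r(2)
  proof eventually_elim
    case (elim x)
    then have "(\<lambda>n. sqrt ((fs (r n) x - f x)\<^sup>2)) \<longlonglongrightarrow> sqrt 0" by (rule tendsto_real_sqrt)
    then show ?case by (simp add: tendsto_rabs_zero_iff LIM_zero_iff)
  qed
  with r(1) show ?thesis by (rule that)
qed

lemma L2conv_add:
  assumes "L2conv M fs f" "L2conv M gs g"
  shows "L2conv M (\<lambda>n x. fs n x + gs n x) (\<lambda>x. f x + g x)"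
  unfolding L2conv_iff
proof (intro conjI allI)
  have L: "L2 M f" "L2 M g" "L2 M (fs n)" "L2 M (gs n)" for n
    using assms by (auto simp: L2conv_iff)
  show "L2 M (\<lambda>x. f x + g x)" "L2 M (\<lambda>x. fs n x + gs n x)" for n
    using L by auto
  show "(\<lambda>n. \<integral>x. (fs n x + gs n x - (f x + g x))\<^sup>2 \<partial>M) \<longlonglongrightarrow> 0"
  proof (rule real_tendsto_sandwich[where f="\<lambda>_. 0"])
    show "\<forall>\<^sub>F n in sequentially. (\<integral>x. (fs n x + gs n x - (f x + g x))\<^sup>2 \<partial>M)
        \<le> 2 * (\<integral>x. (fs n x - f x)\<^sup>2 \<partial>M) + 2 * (\<integral>x. (gs n x - g x)\<^sup>2 \<partial>M)"
    proof (intro always_eventually allI)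
      fix n
      have "(\<integral>x. (fs n x + gs n x - (f x + g x))\<^sup>2 \<partial>M) \<le> (\<integral>x. 2 * (fs n x - f x)\<^sup>2 + 2 * (gs n x - g x)\<^sup>2 \<partial>M)"
        using L sq_add_le[of "fs n x - f x" "gs n x - g x" for x]
        by (intro integral_mono) (auto simp: algebra_simps intro!: L2_square_integrable L2_add L2_diff)
      also have "\<dots> = 2 * (\<integral>x. (fs n x - f x)\<^sup>2 \<partial>M) + 2 * (\<integral>x. (gs n x - g x)\<^sup>2 \<partial>M)"
        using L by (subst Bochner_Integration.integral_add) auto
      finally show "(\<integral>x. (fs n x + gs n x - (f x + g x))\<^sup>2 \<partial>M)
        \<le> 2 * (\<integral>x. (fs n x - f x)\<^sup>2 \<partial>M) + 2 * (\<integral>x. (gs n x - g x)\<^sup>2 \<partial>M)" .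
    qed
    show "(\<lambda>n. 2 * (\<integral>x. (fs n x - f x)\<^sup>2 \<partial>M) + 2 * (\<integral>x. (gs n x - g x)\<^sup>2 \<partial>M)) \<longlonglongrightarrow> 0"
      using assms by (auto simp: L2conv_iff intro!: tendsto_eq_intros)
  qed auto
qed

lemma L2conv_cmult: "L2conv M fs f \<Longrightarrow> L2conv M (\<lambda>n x. c * fs n x) (\<lambda>x. c * f x)"
  unfolding L2conv_iff right_diff_distrib[symmetric] power_mult_distrib
  by (auto intro!: tendsto_mult_right_zero)

lemma L2conv_diff:
  "L2conv M fs f \<Longrightarrow> L2conv M gs g \<Longrightarrow> L2conv M (\<lambda>n x. fs n x - gs n x) (\<lambda>x. f x - g x)"
  using L2conv_add[OF _ L2conv_cmult[of M gs g "-1"]] by simp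

text \<open>Young's inequality with a free weight \<open>e\<close>. It does the work of
  Cauchy-Schwarz without square roots: the weight is chosen afterwards so that the bounded factor
  costs little, while the vanishing factor absorbs 1 / e. A factor 2 is given away.\<close>

lemma integral_L2_mult_bound:
  assumes "L2 M f" "L2 M g" "e > 0"
  shows "\<bar>\<integral>x. f x * g x \<partial>M\<bar> \<le> (\<integral>x. (f x)\<^sup>2 \<partial>M) / e + e * (\<integral>x. (g x)\<^sup>2 \<partial>M)"
proof -
  have "\<bar>\<integral>x. f x * g x \<partial>M\<bar> \<le> (\<integral>x. \<bar>f x * g x\<bar> \<partial>M)"
    by (rule integral_abs_bound)
  also have "\<dots> \<le> (\<integral>x. (f x)\<^sup>2 / e + e * (g x)\<^sup>2 \<partial>M)"
  proof (rule integral_mono)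
    show "\<bar>f x * g x\<bar> \<le> (f x)\<^sup>2 / e + e * (g x)\<^sup>2" for x
    proof -
      have "2 * (\<bar>f x\<bar> * (e * \<bar>g x\<bar>)) \<le> (f x)\<^sup>2 + (e * g x)\<^sup>2"
        using sum_squares_bound[of "\<bar>f x\<bar>" "e * \<bar>g x\<bar>"] \<open>e > 0\<close> by (simp add: power_mult_distrib)
      moreover have "0 \<le> \<bar>f x\<bar> * (e * \<bar>g x\<bar>)" using \<open>e > 0\<close> by simp
      ultimately have "e * \<bar>f x * g x\<bar> \<le> (f x)\<^sup>2 + (e * g x)\<^sup>2"
        by (simp add: abs_mult algebra_simps)
      then show ?thesis using \<open>e > 0\<close> by (simp add: field_simps power2_eq_square)
    qed
  qed (use assms in \<open>auto intro: L2_mult_integrable\<close>)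
  also have "\<dots> = (\<integral>x. (f x)\<^sup>2 \<partial>M) / e + e * (\<integral>x. (g x)\<^sup>2 \<partial>M)"
    using assms by (subst Bochner_Integration.integral_add) auto
  finally show ?thesis .
qed

lemma L2conv_integral_mult_zero:
  assumes f: "L2conv M fs (\<lambda>_. 0)" and g: "\<And>n. L2 M (gs n)" "\<And>n. (\<integral>x. (gs n x)\<^sup>2 \<partial>M) \<le> B"
  shows "(\<lambda>n. \<integral>x. fs n x * gs n x \<partial>M) \<longlonglongrightarrow> 0"
proof (rule LIMSEQ_I)
  fix r :: real assume r: "0 < r"
  have "0 \<le> B" using g(2)[of 0] by (smt (verit) integral_nonneg_AE AE_I2 zero_le_power2)
  \<comment> \<open>\<open>B + 1\<close> avoids division by zero when \<open>B = 0\<close>. The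
    weight stays fixed as n grows: the part with \<open>gs\<close> is below r / 2 for every n, and
    only the part with \<open>fs\<close> has to tend to zero.\<close>
  define e where "e = r / (2 * (B + 1))"
  have e: "e > 0" "e * B < r / 2" using r \<open>0 \<le> B\<close> by (auto simp: e_def field_simps)
  have "(\<lambda>n. (\<integral>x. (fs n x)\<^sup>2 \<partial>M) / e) \<longlonglongrightarrow> 0"
    using f by (auto simp: L2conv_iff intro!: tendsto_divide_zero)
  then have "\<forall>\<^sub>F n in sequentially. (\<integral>x. (fs n x)\<^sup>2 \<partial>M) / e < r / 2"
    using r by (intro order_tendstoD(2)[where y=0]) auto
  then have "\<forall>\<^sub>F n in sequentially. norm ((\<integral>x. fs n x * gs n x \<partial>M) - 0) < r"
  proof eventually_elim
    case (elim n)
    have "\<bar>\<integral>x. fs n x * gs n x \<partial>M\<bar> \<le> (\<integral>x. (fs n x)\<^sup>2 \<partial>M) / e + e * (\<integral>x. (gs n x)\<^sup>2 \<partial>M)"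
      using f g e by (intro integral_L2_mult_bound) (auto simp: L2conv_iff)
    moreover have "e * (\<integral>x. (gs n x)\<^sup>2 \<partial>M) \<le> e * B" using g(2)[of n] e by (simp add: mult_left_mono)
    ultimately show ?case using elim e by (simp only: diff_zero real_norm_def)
  qed
  then show "\<exists>no. \<forall>n\<ge>no. norm ((\<integral>x. fs n x * gs n x \<partial>M) - 0) < r"
    by (simp add: eventually_sequentially)
qed

lemma L2conv_norm:
  assumes "L2conv M fs f"
  shows "(\<lambda>n. \<integral>x. (fs n x)\<^sup>2 \<partial>M) \<longlonglongrightarrow> (\<integral>x. (f x)\<^sup>2 \<partial>M)"
proof -
  have L: "L2 M f" "L2 M (fs n)" for n using assms by (auto simp: L2conv_iff)
  have d: "L2conv M (\<lambda>n x. fs n x - f x) (\<lambda>_. 0)"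
    using L2conv_diff[OF assms L2conv_const[OF L(1)]] by simp
  have eq: "(\<integral>x. (fs n x)\<^sup>2 \<partial>M) = (\<integral>x. (fs n x - f x)\<^sup>2 \<partial>M) + 2 * (\<integral>x. (fs n x - f x) * f x \<partial>M) + (\<integral>x. (f x)\<^sup>2 \<partial>M)" for n
  proof -
    have i: "integrable M (\<lambda>x. (fs n x - f x)\<^sup>2)" "integrable M (\<lambda>x. (fs n x - f x) * f x)"
      "integrable M (\<lambda>x. (f x)\<^sup>2)"
      using L by (auto intro!: L2_square_integrable L2_mult_integrable)
    have "(\<integral>x. (fs n x)\<^sup>2 \<partial>M) = (\<integral>x. (fs n x - f x)\<^sup>2 + 2 * ((fs n x - f x) * f x) + (f x)\<^sup>2 \<partial>M)"
      by (rule Bochner_Integration.integral_cong) (auto simp: power2_eq_square algebra_simps)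
    also have "\<dots> = (\<integral>x. (fs n x - f x)\<^sup>2 \<partial>M) + 2 * (\<integral>x. (fs n x - f x) * f x \<partial>M) + (\<integral>x. (f x)\<^sup>2 \<partial>M)"
      using i by simp
    finally show ?thesis .
  qed
  have "(\<lambda>n. \<integral>x. (fs n x - f x) * f x \<partial>M) \<longlonglongrightarrow> 0"
    by (rule L2conv_integral_mult_zero[OF d]) (use L in auto)
  moreover have "(\<lambda>n. \<integral>x. (fs n x - f x)\<^sup>2 \<partial>M) \<longlonglongrightarrow> 0" using assms by (simp add: L2conv_iff)
  ultimately show ?thesis unfolding eq by (auto intro!: tendsto_eq_intros)
qed

text \<open>Polarisation reduces products to the convergence of norms, applied to the two sequences
  and to their sum.\<close>

lemma L2conv_integral_mult:
  assumes f: "L2conv M fs f" and g: "L2conv M gs g"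
  shows "(\<lambda>n. \<integral>x. fs n x * gs n x \<partial>M) \<longlonglongrightarrow> (\<integral>x. f x * g x \<partial>M)"
proof -
  have L: "L2 M f" "L2 M (fs n)" "L2 M g" "L2 M (gs n)" for n using f g by (auto simp: L2conv_iff)
  have eq: "(\<integral>x. fs n x * gs n x \<partial>M) = ((\<integral>x. (fs n x + gs n x)\<^sup>2 \<partial>M) - (\<integral>x. (fs n x)\<^sup>2 \<partial>M) - (\<integral>x. (gs n x)\<^sup>2 \<partial>M)) / 2"
      "(\<integral>x. f x * g x \<partial>M) = ((\<integral>x. (f x + g x)\<^sup>2 \<partial>M) - (\<integral>x. (f x)\<^sup>2 \<partial>M) - (\<integral>x. (g x)\<^sup>2 \<partial>M)) / 2" for n
  proof -
    have *: "(\<integral>x. a x * b x \<partial>M) = ((\<integral>x. (a x + b x)\<^sup>2 \<partial>M) - (\<integral>x. (a x)\<^sup>2 \<partial>M) - (\<integral>x. (b x)\<^sup>2 \<partial>M)) / 2"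
      if "L2 M a" "L2 M b" for a b
    proof -
      have "(\<integral>x. (a x + b x)\<^sup>2 \<partial>M) = (\<integral>x. (a x)\<^sup>2 + (b x)\<^sup>2 + 2 * (a x * b x) \<partial>M)"
        by (rule Bochner_Integration.integral_cong) (auto simp: power2_sum)
      also have "\<dots> = (\<integral>x. (a x)\<^sup>2 \<partial>M) + (\<integral>x. (b x)\<^sup>2 \<partial>M) + 2 * (\<integral>x. a x * b x \<partial>M)"
        using that by (simp add: L2_square_integrable L2_mult_integrable)
      finally show ?thesis by simp
    qed
    show "(\<integral>x. fs n x * gs n x \<partial>M) = ((\<integral>x. (fs n x + gs n x)\<^sup>2 \<partial>M) - (\<integral>x. (fs n x)\<^sup>2 \<partial>M) - (\<integral>x. (gs n x)\<^sup>2 \<partial>M)) / 2"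
      "(\<integral>x. f x * g x \<partial>M) = ((\<integral>x. (f x + g x)\<^sup>2 \<partial>M) - (\<integral>x. (f x)\<^sup>2 \<partial>M) - (\<integral>x. (g x)\<^sup>2 \<partial>M)) / 2"
      by (intro * L)+
  qed
  show ?thesis unfolding eq
    by (intro tendsto_intros L2conv_norm f g L2conv_add) auto
qed

lemma L2conv_cong_AE:
  assumes "L2conv M fs f" "L2 M g" "AE x in M. f x = g x"
  shows "L2conv M fs g"
proof -
  have [measurable]: "f \<in> borel_measurable M" "g \<in> borel_measurable M" "fs n \<in> borel_measurable M" for n
    using assms by (auto simp: L2conv_iff intro: L2_measurable)
  have "(\<integral>x. (fs n x - f x)\<^sup>2 \<partial>M) = (\<integral>x. (fs n x - g x)\<^sup>2 \<partial>M)" for n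
    using assms(3) by (intro integral_cong_AE) auto
  then show ?thesis using assms by (simp add: L2conv_iff)
qed

text \<open>On a finite measure space an L^2-Cauchy sequence is Cauchy in L^1, so a subsequence
  converges almost everywhere to a candidate limit. Fatou's lemma along that subsequence brings the
  L^2 estimate back.\<close>

lemma (in finite_measure) L2_complete:
  assumes "L2cauchy M fs"
  obtains f where "L2conv M fs f"
proof -
  have L: "L2 M (fs n)" for n using assms by (simp add: L2cauchy_iff)
  have C: "\<exists>N. \<forall>n\<ge>N. \<forall>k\<ge>N. (\<integral>x. (fs n x - fs k x)\<^sup>2 \<partial>M) < e" if "e > 0" for e
    using assms that by (simp add: L2cauchy_iff)
  define m where "m = measure M (space M)"
  have m0: "m \<ge> 0" by (simp add: m_def)
  have L1: "\<exists>N. \<forall>i\<ge>N. \<forall>j\<ge>N. (LINT x|M. norm (fs i x - fs j x)) < e" if e: "e > 0" for e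
  proof -
    define d where "d = e / (2 * (m + 1))"
    have d: "d > 0" "d * m < e / 2" using e m0 by (auto simp: d_def field_simps)
    obtain N where N: "\<forall>n\<ge>N. \<forall>k\<ge>N. (\<integral>x. (fs n x - fs k x)\<^sup>2 \<partial>M) < d * e / 2"
      using C[of "d * e / 2"] d e by auto
    have "(LINT x|M. norm (fs i x - fs j x)) < e" if "i \<ge> N" "j \<ge> N" for i j
    proof -
      have "\<bar>\<integral>x. \<bar>fs i x - fs j x\<bar> * 1 \<partial>M\<bar> \<le> (\<integral>x. \<bar>fs i x - fs j x\<bar>\<^sup>2 \<partial>M) / d + d * (\<integral>x. 1\<^sup>2 \<partial>M)"
        using L d by (intro integral_L2_mult_bound L2_abs L2_diff) (auto intro!: L2_bounded)
      moreover have "\<bar>\<integral>x. \<bar>fs i x - fs j x\<bar> \<partial>M\<bar> = (LINT x|M. norm (fs i x - fs j x))"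
        by simp
      moreover have "(\<integral>x. \<bar>fs i x - fs j x\<bar>\<^sup>2 \<partial>M) / d < e / 2"
        using N that d by (auto simp: field_simps)
      moreover have m: "(\<integral>x. 1\<^sup>2 \<partial>M) = m" by (simp add: m_def)
      ultimately show ?thesis using d unfolding power2_abs real_norm_def mult_1_right m by linarith
    qed
    then show ?thesis by blast
  qed
  obtain r where r: "strict_mono r" "AE x in M. Cauchy (\<lambda>i. fs (r i) x)"
    by (rule cauchy_L1_AE_cauchy_subseq[of M fs]) (use L L1 in \<open>auto intro: L2_integrable\<close>)
  have [measurable]: "fs n \<in> borel_measurable M" for n using L by (rule L2_measurable)
  define f where "f x = lim (\<lambda>i. fs (r i) x)" for x
  have fm [measurable]: "f \<in> borel_measurable M" unfolding f_def by measurable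
  have lim: "AE x in M. (\<lambda>i. fs (r i) x) \<longlonglongrightarrow> f x"
    using r(2) by eventually_elim (simp add: f_def Cauchy_convergent_iff convergent_LIMSEQ_iff)
  \<comment> \<open>The Cauchy estimate between \<open>fs n\<close> and \<open>fs (r i)\<close>
    survives the limit in i with n fixed. It yields both that \<open>f\<close> is square integrable
    and that the whole sequence converges to it.\<close>
  have fatou: "(\<integral>\<^sup>+x. ennreal ((fs n x - f x)\<^sup>2) \<partial>M) \<le> ennreal e" if "e > 0" and N: "\<forall>n\<ge>N. \<forall>k\<ge>N. (\<integral>x. (fs n x - fs k x)\<^sup>2 \<partial>M) < e" and n: "n \<ge> N" for e N n
  proof -
    have "(\<integral>\<^sup>+x. ennreal ((fs n x - f x)\<^sup>2) \<partial>M) = (\<integral>\<^sup>+x. liminf (\<lambda>i. ennreal ((fs n x - fs (r i) x)\<^sup>2)) \<partial>M)"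
    proof (rule nn_integral_cong_AE)
      show "AE x in M. ennreal ((fs n x - f x)\<^sup>2) = liminf (\<lambda>i. ennreal ((fs n x - fs (r i) x)\<^sup>2))"
        using lim
      proof eventually_elim
        case (elim x)
        then have "(\<lambda>i. ennreal ((fs n x - fs (r i) x)\<^sup>2)) \<longlonglongrightarrow> ennreal ((fs n x - f x)\<^sup>2)"
          by (intro tendsto_intros)
        then show ?case using lim_imp_Liminf[OF sequentially_bot] by metis
      qed
    qed
    also have "\<dots> \<le> liminf (\<lambda>i. \<integral>\<^sup>+x. ennreal ((fs n x - fs (r i) x)\<^sup>2) \<partial>M)"
      by (rule nn_integral_liminf) measurable
    also have "\<dots> \<le> limsup (\<lambda>i. \<integral>\<^sup>+x. ennreal ((fs n x - fs (r i) x)\<^sup>2) \<partial>M)"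
      by (rule Liminf_le_Limsup) simp
    also have "\<dots> \<le> ennreal e"
    proof (rule Limsup_bounded)
      show "\<forall>\<^sub>F i in sequentially. (\<integral>\<^sup>+x. ennreal ((fs n x - fs (r i) x)\<^sup>2) \<partial>M) \<le> ennreal e"
        using eventually_ge_at_top[of N]
      proof eventually_elim
        case (elim i)
        then have "r i \<ge> N" using seq_suble[OF r(1), of i] by linarith
        then show ?case using N n L by (subst nn_integral_sq_eq) (auto intro!: ennreal_leI intro: less_imp_le)
      qed
    qed
    finally show ?thesis .
  qed
  have "L2 M f"
  proof -
    obtain N where N: "\<forall>n\<ge>N. \<forall>k\<ge>N. (\<integral>x. (fs n x - fs k x)\<^sup>2 \<partial>M) < 1" using C[of 1] by auto
    have "L2 M (\<lambda>x. fs N x - f x)"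
      using fatou[OF _ N order_refl] by (auto simp: L2_def less_top[symmetric] top_unique)
    from L2_diff[OF L[of N] this] show ?thesis by simp
  qed
  have "(\<lambda>n. \<integral>x. (fs n x - f x)\<^sup>2 \<partial>M) \<longlonglongrightarrow> 0"
  proof (rule LIMSEQ_I)
    fix e :: real assume "e > 0"
    then obtain N where N: "\<forall>n\<ge>N. \<forall>k\<ge>N. (\<integral>x. (fs n x - fs k x)\<^sup>2 \<partial>M) < e / 2" using C[of "e/2"] by auto
    have "norm ((\<integral>x. (fs n x - f x)\<^sup>2 \<partial>M) - 0) < e" if "n \<ge> N" for n
    proof -
      have "ennreal (\<integral>x. (fs n x - f x)\<^sup>2 \<partial>M) \<le> ennreal (e / 2)"
        using fatou[OF _ N that] \<open>e > 0\<close> nn_integral_sq_eq[OF L2_diff[OF L[of n] \<open>L2 M f\<close>]] by simp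
      then show ?thesis using \<open>e > 0\<close> by (auto simp: ennreal_le_iff)
    qed
    then show "\<exists>no. \<forall>n\<ge>no. norm ((\<integral>x. (fs n x - f x)\<^sup>2 \<partial>M) - 0) < e" by blast
  qed
  then have "L2conv M fs f" using \<open>L2 M f\<close> L by (simp add: L2conv_iff)
  then show ?thesis by (rule that)
qed

lemma L2conv_imp_cauchy:
  assumes "L2conv M fs f" shows "L2cauchy M fs"
  unfolding L2cauchy_iff
proof (intro conjI allI impI)
  have L: "L2 M f" "L2 M (fs n)" for n using assms by (auto simp: L2conv_iff)
  show "L2 M (fs n)" for n by (rule L)
  fix e :: real assume "e > 0"
  have "\<forall>\<^sub>F n in sequentially. (\<integral>x. (fs n x - f x)\<^sup>2 \<partial>M) < e / 4"
    using assms \<open>e > 0\<close> by (intro order_tendstoD(2)[where y=0]) (auto simp: L2conv_iff)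
  then obtain N where N: "\<And>n. n \<ge> N \<Longrightarrow> (\<integral>x. (fs n x - f x)\<^sup>2 \<partial>M) < e / 4"
    by (auto simp: eventually_sequentially)
  have "(\<integral>x. (fs n x - fs k x)\<^sup>2 \<partial>M) < e" if "n \<ge> N" "k \<ge> N" for n k
    using integral_sq_diff_triangle[OF L(2) L(1) L(2), of n k] N[OF that(1)] N[OF that(2)]
    by (simp add: power2_commute[of "f _"])
  then show "\<exists>N. \<forall>n\<ge>N. \<forall>k\<ge>N. (\<integral>x. (fs n x - fs k x)\<^sup>2 \<partial>M) < e" by blast
qed

section \<open>Calculus of \<open>C\<^sup>1\<close> functions of finitely many variables\<close>

text \<open>The type \<open>nat => real\<close> carries the product topology, where convergence is
  tested coordinate by coordinate. Continuity, compactness and measurability for functions of m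
  variables can then be taken from the infinite product, although only finitely many coordinates are
  ever read.\<close>

lemma tendsto_coordinatewise:
  fixes f :: "'a \<Rightarrow> 'i \<Rightarrow> 'b::topological_space"
  assumes "\<And>i. ((\<lambda>x. f x i) \<longlongrightarrow> l i) F"
  shows "(f \<longlongrightarrow> l) F"
proof -
  have "limitin (product_topology (\<lambda>_. euclidean) UNIV) f l F"
    using assms by (subst limitin_componentwise) (simp_all add: limitin_canonical_iff)
  then show ?thesis
    by (simp only: euclidean_product_topology limitin_canonical_iff)
qed

lemma C1_Rm_cong: "C1_Rm m U dU \<Longrightarrow> (\<And>i. i < m \<Longrightarrow> x i = y i) \<Longrightarrow> U x = U y"
  by (auto simp: C1_Rm_def)

text \<open>\<open>C1_Rm\<close> states only for \<open>U\<close> that the coordinates from m on are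
  ignored. For the partial derivatives this follows from their continuity clause, whose distance
  sees the first m coordinates alone: points that agree there have distance zero.\<close>

lemma C1_Rm_deriv_cong:
  assumes "C1_Rm m U dU" "i < m" "\<And>i. i < m \<Longrightarrow> x i = y i"
  shows "dU i x = dU i y"
proof (rule ccontr)
  assume "dU i x \<noteq> dU i y"
  then have "0 < \<bar>dU i y - dU i x\<bar>" by simp
  then obtain d where "d > 0" "\<forall>z. (\<Sum>j<m. (z j - x j)\<^sup>2) < d\<^sup>2 \<longrightarrow> \<bar>dU i z - dU i x\<bar> < \<bar>dU i y - dU i x\<bar>"
    using assms(1,2) unfolding C1_Rm_def by blast
  moreover have "(\<Sum>j<m. (y j - x j)\<^sup>2) = 0" using assms(3) by simp
  ultimately show False by (metis less_irrefl zero_less_power)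
qed

lemma C1_Rm_DERIV:
  assumes "C1_Rm m U dU" "i < m"
  shows "((\<lambda>s. U (x(i := s))) has_real_derivative dU i (x(i := s))) (at s)"
proof -
  have "((\<lambda>r. U ((x(i := s))(i := r))) has_real_derivative dU i (x(i := s))) (at ((x(i := s)) i))"
    using assms unfolding C1_Rm_def by blast
  then show ?thesis by simp
qed

lemma C1_Rm_continuous_deriv:
  assumes "C1_Rm m U dU" "i < m"
  shows "continuous_on UNIV (dU i)"
proof -
  have "(dU i \<longlongrightarrow> dU i x) (nhds x)" for x
  proof (rule tendstoI)
    fix e :: real assume "e > 0"
    then obtain d where d: "d > 0" "\<And>y. (\<Sum>j<m. (y j - x j)\<^sup>2) < d\<^sup>2 \<Longrightarrow> \<bar>dU i y - dU i x\<bar> < e"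
      using assms unfolding C1_Rm_def by meson
    have "((\<lambda>y. \<Sum>j<m. (y j - x j)\<^sup>2) \<longlongrightarrow> (\<Sum>j<m. (x j - x j)\<^sup>2)) (nhds x)"
    proof (intro tendsto_intros)
      fix j
      have "isCont (\<lambda>y::nat \<Rightarrow> real. y j) x"
        by (rule continuous_on_interior[OF continuous_on_product_coordinates]) simp
      then show "((\<lambda>y. y j) \<longlongrightarrow> x j) (nhds x)"
        using tendsto_at_iff_tendsto_nhds[of "\<lambda>y. y j" x] by (simp add: isCont_def)
    qed
    then have "\<forall>\<^sub>F y in nhds x. (\<Sum>j<m. (y j - x j)\<^sup>2) < d\<^sup>2"
      using d(1) by (intro order_tendstoD(2)) auto
    then show "\<forall>\<^sub>F y in nhds x. dist (dU i y) (dU i x) < e"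
      by eventually_elim (use d(2) in \<open>auto simp: dist_real_def\<close>)
  qed
  then show ?thesis
    by (simp add: continuous_on_eq_continuous_at isCont_def tendsto_at_iff_tendsto_nhds)
qed

text \<open>A converse to \<open>C1_Rm_continuous_deriv\<close>: continuity in the product topology
  gives the epsilon-delta clause for the Euclidean distance of the first m coordinates. If the
  clause failed, some sequence of bad points would converge in these coordinates.\<close>

lemma C1_RmI:
  assumes U: "\<And>x y. (\<And>i. i < m \<Longrightarrow> x i = y i) \<Longrightarrow> U x = U y"
    and D: "\<And>i x. i < m \<Longrightarrow> ((\<lambda>s. U (x(i := s))) has_real_derivative dU i x) (at (x i))"
    and dU: "\<And>k x y. k < m \<Longrightarrow> (\<And>i. i < m \<Longrightarrow> x i = y i) \<Longrightarrow> dU k x = dU k y"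
    and cont: "\<And>i. i < m \<Longrightarrow> continuous_on UNIV (dU i)"
  shows "C1_Rm m U dU"
  unfolding C1_Rm_def
proof (intro conjI allI impI)
  fix i and x :: "nat \<Rightarrow> real" and e :: real assume i: "i < m" and e: "e > 0"
  show "\<exists>d>0. \<forall>y. (\<Sum>j<m. (y j - x j)\<^sup>2) < d\<^sup>2 \<longrightarrow> \<bar>dU i y - dU i x\<bar> < e"
  proof (rule ccontr)
    assume "\<not> ?thesis"
    then have "\<forall>n. \<exists>y. (\<Sum>j<m. (y j - x j)\<^sup>2) < (inverse (real (Suc n)))\<^sup>2 \<and> \<not> \<bar>dU i y - dU i x\<bar> < e"
      by (auto simp del: of_nat_Suc)
    then obtain y where y: "\<And>n. (\<Sum>j<m. (y n j - x j)\<^sup>2) < (inverse (real (Suc n)))\<^sup>2"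
      "\<And>n. \<not> \<bar>dU i (y n) - dU i x\<bar> < e" by metis
    \<comment> \<open>The remaining coordinates of the bad points are uncontrolled. Resetting them
      to those of x gives convergence in the product topology, and \<open>dU i\<close> does not see
      the change.\<close>
    define z where "z n j = (if j < m then y n j else x j)" for n j
    have "(\<lambda>n. z n j) \<longlonglongrightarrow> x j" for j
    proof (cases "j < m")
      case True
      have "\<bar>z n j - x j\<bar> \<le> inverse (real (Suc n))" for n
      proof -
        have "(y n j - x j)\<^sup>2 \<le> (\<Sum>j<m. (y n j - x j)\<^sup>2)"
          using True by (intro member_le_sum[of j "{..<m}" "\<lambda>j. (y n j - x j)\<^sup>2"]) auto
        then have "(y n j - x j)\<^sup>2 \<le> (inverse (real (Suc n)))\<^sup>2" using y(1)[of n] by linarith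
        then show ?thesis using True abs_le_square_iff[of "y n j - x j" "inverse (real (Suc n))"]
          by (simp add: z_def del: of_nat_Suc)
      qed
      then have "(\<lambda>n. z n j - x j) \<longlonglongrightarrow> 0"
        by (intro Lim_null_comparison[OF _ LIMSEQ_inverse_real_of_nat]) auto
      then show ?thesis by (simp add: LIM_zero_iff)
    qed (simp add: z_def)
    then have "z \<longlonglongrightarrow> x" by (rule tendsto_coordinatewise)
    then have "(\<lambda>n. dU i (z n)) \<longlonglongrightarrow> dU i x"
      using continuous_on_tendsto_compose[OF cont[OF i], of z x] by simp
    moreover have "dU i (y n) = dU i (z n)" for n by (rule dU[OF i]) (simp add: z_def)
    ultimately have "(\<lambda>n. dU i (y n)) \<longlonglongrightarrow> dU i x" by simp
    then have "\<forall>\<^sub>F n in sequentially. dist (dU i (y n)) (dU i x) < e" using e by (rule tendstoD)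
    then show False using y(2) by (auto simp: dist_real_def eventually_sequentially)
  qed
qed (blast intro: U D)+

text \<open>The coordinates are switched from x to y one at a time, and each switch is a mean value
  theorem in one variable. The evaluation points depend on i, but none of their coordinates is
  further from x than that of y; this is enough to serve as total differentiability.\<close>

lemma C1_Rm_mean_value:
  assumes C: "C1_Rm m U dU"
  obtains p where "U y - U x = (\<Sum>i<m. dU i (p i) * (y i - x i))"
    "\<And>i j. \<bar>p i j - x j\<bar> \<le> \<bar>y j - x j\<bar>"
proof -
  define mix where "mix k j = (if j < k then y j else x j)" for k j :: nat
  have "\<exists>p. U (mix (Suc i)) - U (mix i) = dU i p * (y i - x i) \<and> (\<forall>j. \<bar>p j - x j\<bar> \<le> \<bar>y j - x j\<bar>)"
    if i: "i < m" for i
  proof -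
    have eq: "mix (Suc i) = (mix i)(i := y i)" "mix i = (mix i)(i := x i)"
      by (auto simp: mix_def less_Suc_eq fun_eq_iff)
    have D: "((\<lambda>s. U ((mix i)(i := s))) has_real_derivative dU i ((mix i)(i := s))) (at s)" for s
      by (rule C1_Rm_DERIV[OF C i])
    have "\<exists>z. \<bar>z - x i\<bar> \<le> \<bar>y i - x i\<bar> \<and> U ((mix i)(i := y i)) - U ((mix i)(i := x i)) = dU i ((mix i)(i := z)) * (y i - x i)"
    proof (cases "x i" "y i" rule: linorder_cases)
      case less
      from MVT2[OF less, of "\<lambda>s. U ((mix i)(i := s))" "\<lambda>s. dU i ((mix i)(i := s))"] D
      obtain z where "x i < z" "z < y i"
        "U ((mix i)(i := y i)) - U ((mix i)(i := x i)) = (y i - x i) * dU i ((mix i)(i := z))" by blast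
      then show ?thesis by (intro exI[of _ z]) (auto simp: mult.commute)
    next
      case greater
      from MVT2[OF greater, of "\<lambda>s. U ((mix i)(i := s))" "\<lambda>s. dU i ((mix i)(i := s))"] D
      obtain z where "y i < z" "z < x i"
        "U ((mix i)(i := x i)) - U ((mix i)(i := y i)) = (x i - y i) * dU i ((mix i)(i := z))" by blast
      then show ?thesis by (intro exI[of _ z]) (auto simp: algebra_simps)
    qed auto
    then obtain z where z: "\<bar>z - x i\<bar> \<le> \<bar>y i - x i\<bar>"
      "U ((mix i)(i := y i)) - U ((mix i)(i := x i)) = dU i ((mix i)(i := z)) * (y i - x i)" by blast
    have "\<bar>((mix i)(i := z)) j - x j\<bar> \<le> \<bar>y j - x j\<bar>" for j
      using z(1) by (auto simp: mix_def)
    then show ?thesis using z(2) eq by metis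
  qed
  then have "\<forall>i. \<exists>p. (i < m \<longrightarrow> U (mix (Suc i)) - U (mix i) = dU i p * (y i - x i)) \<and> (\<forall>j. \<bar>p j - x j\<bar> \<le> \<bar>y j - x j\<bar>)"
    by (metis abs_ge_zero cancel_comm_monoid_add_class.diff_cancel abs_zero)
  then obtain p where p: "\<And>i. i < m \<Longrightarrow> U (mix (Suc i)) - U (mix i) = dU i (p i) * (y i - x i)"
    "\<And>i j. \<bar>p i j - x j\<bar> \<le> \<bar>y j - x j\<bar>" by metis
  have "U y - U x = U (mix m) - U (mix 0)"
    using C1_Rm_cong[OF C, of y "mix m"] C1_Rm_cong[OF C, of x "mix 0"] by (simp add: mix_def)
  also have "\<dots> = (\<Sum>i<m. U (mix (Suc i)) - U (mix i))" by (rule sum_lessThan_telescope[symmetric])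
  also have "\<dots> = (\<Sum>i<m. dU i (p i) * (y i - x i))" using p(1) by simp
  finally show ?thesis using p(2) that by blast
qed

text \<open>The intermediate points are squeezed onto x. The filter is arbitrary, so one formula
  serves for sequences, for continuity and, after division by t - s, for the chain rule.\<close>

lemma C1_Rm_tendsto_mean_value:
  assumes C: "C1_Rm m U dU" and z: "\<And>i. i < m \<Longrightarrow> ((\<lambda>t. z t i) \<longlongrightarrow> x i) F"
  obtains p where "\<And>t. U (z t) - U x = (\<Sum>i<m. p i t * (z t i - x i))"
    "\<And>i. i < m \<Longrightarrow> (p i \<longlongrightarrow> dU i x) F"
proof -
  define y where "y t i = (if i < m then z t i else x i)" for t i
  have "\<forall>t. \<exists>p. U (y t) - U x = (\<Sum>i<m. dU i (p i) * (y t i - x i)) \<and> (\<forall>i j. \<bar>p i j - x j\<bar> \<le> \<bar>y t j - x j\<bar>)"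
  proof
    fix t
    obtain p where "U (y t) - U x = (\<Sum>i<m. dU i (p i) * (y t i - x i))" "\<And>i j. \<bar>p i j - x j\<bar> \<le> \<bar>y t j - x j\<bar>"
      using C1_Rm_mean_value[OF C, where x=x and y="y t"] by blast
    then show "\<exists>p. U (y t) - U x = (\<Sum>i<m. dU i (p i) * (y t i - x i)) \<and> (\<forall>i j. \<bar>p i j - x j\<bar> \<le> \<bar>y t j - x j\<bar>)"
      by blast
  qed
  then obtain p where p: "\<And>t. U (y t) - U x = (\<Sum>i<m. dU i (p t i) * (y t i - x i))"
     "\<And>t i j. \<bar>p t i j - x j\<bar> \<le> \<bar>y t j - x j\<bar>" by metis
  have yl: "((\<lambda>t. y t j) \<longlongrightarrow> x j) F" for j using z[of j] by (cases "j < m") (auto simp: y_def)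
  have "((\<lambda>t. p t i) \<longlongrightarrow> x) F" for i
  proof (rule tendsto_coordinatewise)
    fix j
    have "((\<lambda>t. \<bar>y t j - x j\<bar>) \<longlongrightarrow> 0) F" using yl[of j] by (simp add: LIM_zero tendsto_rabs_zero)
    then have "((\<lambda>t. p t i j - x j) \<longlongrightarrow> 0) F"
      by (rule Lim_null_comparison[rotated]) (use p(2) in auto)
    then show "((\<lambda>t. p t i j) \<longlongrightarrow> x j) F" by (simp add: LIM_zero_iff)
  qed
  then have "((\<lambda>t. dU i (p t i)) \<longlongrightarrow> dU i x) F" if "i < m" for i
    using continuous_on_tendsto_compose[OF C1_Rm_continuous_deriv[OF C that], of "\<lambda>t. p t i" x F] by simp
  moreover have "U (z t) - U x = (\<Sum>i<m. dU i (p t i) * (z t i - x i))" for t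
    using p(1)[of t] C1_Rm_cong[OF C, of "y t" "z t"] by (simp add: y_def)
  ultimately show ?thesis by (intro that[of "\<lambda>i t. dU i (p t i)"]) auto
qed

lemma C1_Rm_tendsto:
  assumes "C1_Rm m U dU" "\<And>i. i < m \<Longrightarrow> ((\<lambda>t. z t i) \<longlongrightarrow> x i) F"
  shows "((\<lambda>t. U (z t)) \<longlongrightarrow> U x) F"
proof -
  obtain p where p: "\<And>t. U (z t) - U x = (\<Sum>i<m. p i t * (z t i - x i))"
    "\<And>i. i < m \<Longrightarrow> (p i \<longlongrightarrow> dU i x) F"
    by (rule C1_Rm_tendsto_mean_value[of m U dU z x F]) (use assms in auto)
  have "((\<lambda>t. \<Sum>i<m. p i t * (z t i - x i)) \<longlongrightarrow> (\<Sum>i<m. dU i x * (x i - x i))) F"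
    using p(2) assms(2) by (intro tendsto_intros) auto
  then show ?thesis by (simp add: p(1)[symmetric] LIM_zero_iff)
qed

lemma C1_Rm_deriv_tendsto:
  assumes "C1_Rm m U dU" "k < m" "\<And>i. i < m \<Longrightarrow> ((\<lambda>t. z t i) \<longlongrightarrow> x i) F"
  shows "((\<lambda>t. dU k (z t)) \<longlongrightarrow> dU k x) F"
proof -
  have "((\<lambda>t i. if i < m then z t i else x i) \<longlongrightarrow> x) F"
  proof (rule tendsto_coordinatewise)
    show "((\<lambda>t. if i < m then z t i else x i) \<longlongrightarrow> x i) F" for i
      using assms(3)[of i] by (cases "i < m") auto
  qed
  then have "((\<lambda>t. dU k (\<lambda>i. if i < m then z t i else x i)) \<longlongrightarrow> dU k x) F"
    by (rule continuous_on_tendsto_compose[OF C1_Rm_continuous_deriv[OF assms(1,2)]]) auto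
  then show ?thesis
    using C1_Rm_deriv_cong[OF assms(1,2), of "\<lambda>i. if i < m then z t i else x i" "z t" for t] by simp
qed

lemma C1_Rm_continuous: "C1_Rm m U dU \<Longrightarrow> continuous_on UNIV U"
  unfolding continuous_on_def
proof
  fix x assume C: "C1_Rm m U dU"
  have "((\<lambda>y::nat\<Rightarrow>real. y j) \<longlongrightarrow> x j) (at x)" for j
    using continuous_on_product_coordinates[of j] by (auto simp: continuous_on_def)
  then show "(U \<longlongrightarrow> U x) (at x)"
    using C1_Rm_tendsto[OF C, of "\<lambda>y. y" x] by simp
qed

lemma C1_Rm_chain:
  assumes C: "C1_Rm m U dU"
    and z: "\<And>i. i < m \<Longrightarrow> ((\<lambda>t. z t i) has_real_derivative z' i) (at s)"
  shows "((\<lambda>t. U (z t)) has_real_derivative (\<Sum>i<m. dU i (z s) * z' i)) (at s)"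
proof -
  have "((\<lambda>t. z t i) \<longlongrightarrow> z s i) (at s)" if "i < m" for i
    using DERIV_isCont[OF z[OF that]] by (simp add: isCont_def)
  then obtain p where p: "\<And>t. U (z t) - U (z s) = (\<Sum>i<m. p i t * (z t i - z s i))"
    "\<And>i. i < m \<Longrightarrow> (p i \<longlongrightarrow> dU i (z s)) (at s)"
    using C1_Rm_tendsto_mean_value[OF C, of z "z s" "at s"] by blast
  have "((\<lambda>t. \<Sum>i<m. p i t * ((z t i - z s i) / (t - s))) \<longlongrightarrow> (\<Sum>i<m. dU i (z s) * z' i)) (at s)"
    using p(2) z by (intro tendsto_intros) (auto simp: has_field_derivative_iff)
  then show ?thesis
    by (simp add: has_field_derivative_iff p(1) sum_divide_distrib)
qed

lemma C1_Rm_bounded_on_box: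
  assumes "C1_Rm m U dU"
  obtains C where "\<And>x. (\<And>i. i < m \<Longrightarrow> \<bar>x i\<bar> \<le> B) \<Longrightarrow> \<bar>U x\<bar> \<le> C"
    "\<And>i x. i < m \<Longrightarrow> (\<And>i. i < m \<Longrightarrow> \<bar>x i\<bar> \<le> B) \<Longrightarrow> \<bar>dU i x\<bar> \<le> C"
proof -
  \<comment> \<open>By Tychonoff the box over all natural numbers is compact. The bars guard against
    a negative \<open>B\<close>, and the coordinates from m on are set to 0 before a point is looked
    up in the box.\<close>
  define K where "K = (\<Pi>\<^sub>E i\<in>(UNIV::nat set). {-\<bar>B\<bar>..\<bar>B\<bar>})"
  have K: "compact K"
    unfolding K_def compactin_euclidean_iff[symmetric] euclidean_product_topology[symmetric]
    by (subst compactin_PiE) auto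
  have *: "\<exists>C. \<forall>x. (\<forall>i<m. \<bar>x i\<bar> \<le> B) \<longrightarrow> \<bar>V x\<bar> \<le> C"
    if V: "continuous_on UNIV V" "\<And>x y. (\<And>i. i < m \<Longrightarrow> x i = y i) \<Longrightarrow> V x = V y" for V :: "(nat \<Rightarrow> real) \<Rightarrow> real"
  proof -
    have "bounded (V ` K)"
      by (intro compact_imp_bounded compact_continuous_image K continuous_on_subset[OF V(1)]) auto
    then obtain C where C: "\<And>x. x \<in> K \<Longrightarrow> \<bar>V x\<bar> \<le> C" by (auto simp: bounded_iff)
    have "\<bar>V x\<bar> \<le> C" if x: "\<forall>i<m. \<bar>x i\<bar> \<le> B" for x
    proof -
      have "(\<lambda>i. if i < m then x i else 0) \<in> K" using x by (force simp: K_def PiE_iff)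
      then show ?thesis using C V(2)[of x "\<lambda>i. if i < m then x i else 0"] by simp
    qed
    then show ?thesis by blast
  qed
  obtain C0 where C0: "\<And>x. (\<forall>i<m. \<bar>x i\<bar> \<le> B) \<Longrightarrow> \<bar>U x\<bar> \<le> C0"
    using *[OF C1_Rm_continuous[OF assms] C1_Rm_cong[OF assms]] by blast
  have "\<exists>C. \<forall>x. (\<forall>i<m. \<bar>x i\<bar> \<le> B) \<longrightarrow> \<bar>dU k x\<bar> \<le> C" if "k < m" for k
    by (rule *[OF C1_Rm_continuous_deriv[OF assms that] C1_Rm_deriv_cong[OF assms that]])
  then obtain C1 where C1: "\<And>k x. k < m \<Longrightarrow> (\<forall>i<m. \<bar>x i\<bar> \<le> B) \<Longrightarrow> \<bar>dU k x\<bar> \<le> C1 k" by metis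
  define C where "C = \<bar>C0\<bar> + (\<Sum>k<m. \<bar>C1 k\<bar>)"
  have "\<bar>C1 k\<bar> \<le> (\<Sum>k<m. \<bar>C1 k\<bar>)" if "k < m" for k
    using that by (intro member_le_sum) auto
  then have "\<bar>C0\<bar> \<le> C" "k < m \<Longrightarrow> \<bar>C1 k\<bar> \<le> C" for k
    by (auto simp: C_def sum_nonneg add_increasing)
  then have "\<bar>U x\<bar> \<le> C" "k < m \<Longrightarrow> \<bar>dU k x\<bar> \<le> C" if "\<And>i. i < m \<Longrightarrow> \<bar>x i\<bar> \<le> B" for x k
    using C0[of x] C1[of k x] that by (force intro: order_trans[OF _ abs_ge_self] order_trans)+
  then show ?thesis by (rule that)
qed

lemma borel_measurable_C1_Rm:
  assumes C: "C1_Rm m U dU" and z: "\<And>i. i < m \<Longrightarrow> (\<lambda>x. z x i) \<in> borel_measurable M"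
  shows "(\<lambda>x. U (z x)) \<in> borel_measurable M"
    and "k < m \<Longrightarrow> (\<lambda>x. dU k (z x)) \<in> borel_measurable M"
proof -
  \<comment> \<open>Coordinates from m on come with no measurability assumption. They are replaced
    by 0, which neither \<open>U\<close> nor its derivatives notice.\<close>
  define y where "y x i = (if i < m then z x i else 0)" for x i
  have y: "y \<in> borel_measurable M"
  proof (rule measurable_coordinatewise_then_product)
    show "(\<lambda>x. y x i) \<in> borel_measurable M" for i
      unfolding y_def using z[of i] by (cases "i < m") auto
  qed
  have "(\<lambda>x. U (y x)) \<in> borel_measurable M"
    using y by (intro measurable_compose[OF y] borel_measurable_continuous_onI C1_Rm_continuous[OF C])
  then show "(\<lambda>x. U (z x)) \<in> borel_measurable M"
    using C1_Rm_cong[OF C, of "z x" "y x" for x] by (simp add: y_def)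
  assume k: "k < m"
  have "(\<lambda>x. dU k (y x)) \<in> borel_measurable M"
    using y by (intro measurable_compose[OF y] borel_measurable_continuous_onI C1_Rm_continuous_deriv[OF C k])
  then show "(\<lambda>x. dU k (z x)) \<in> borel_measurable M"
    using C1_Rm_deriv_cong[OF C k, of "z x" "y x" for x] by (simp add: y_def)
qed

text \<open>One composition rule for three constructions: the penalties that cut out cells, the
  Riemann sums over cell means, and the Riemann sums over the smoothed distribution function. The
  offset \<open>c i\<close> is put to use in the last of them.\<close>

lemma C1_Rm_sum_comp:
  assumes C: "C1_Rm m U dU"
    and h: "\<And>i k x. i < m \<Longrightarrow> k < N \<Longrightarrow> (h i k has_real_derivative h' i k x) (at x)"
    and h': "\<And>i k. i < m \<Longrightarrow> k < N \<Longrightarrow> continuous_on UNIV (h' i k)"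
  shows "C1_Rm N (\<lambda>y. U (\<lambda>i. c i + (\<Sum>k<N. h i k (y k))))
    (\<lambda>k y. \<Sum>i<m. dU i (\<lambda>i. c i + (\<Sum>k<N. h i k (y k))) * h' i k (y k))"
proof (rule C1_RmI)
  have hc: "continuous_on UNIV (h i k)" if "i < m" "k < N" for i k
    using h[OF that] by (intro continuous_at_imp_continuous_on) (auto intro: DERIV_isCont)
  define z where "z y i = c i + (\<Sum>k<N. h i k (y k))" for y :: "nat \<Rightarrow> real" and i
  have zc: "continuous_on UNIV (\<lambda>y. z y i)" if "i < m" for i
    unfolding z_def using hc[OF that]
    by (intro continuous_intros continuous_on_compose2[OF hc[OF that]]) auto
  fix k assume k: "k < N"
  show "((\<lambda>s. U (\<lambda>i. c i + (\<Sum>k'<N. h i k' ((x(k := s)) k')))) has_real_derivative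
      (\<Sum>i<m. dU i (\<lambda>i. c i + (\<Sum>k<N. h i k (x k))) * h' i k (x k))) (at (x k))" for x
  proof -
    have "((\<lambda>s. z (x(k := s)) i) has_real_derivative h' i k (x k)) (at (x k))" if i: "i < m" for i
    proof -
      have "((\<lambda>s. c i + (\<Sum>k'<N. h i k' ((x(k := s)) k'))) has_real_derivative
          0 + (\<Sum>k'<N. if k' = k then h' i k (x k) else 0)) (at (x k))"
        using h[OF i] by (intro derivative_intros) (auto intro!: derivative_eq_intros)
      then show ?thesis using k by (simp add: z_def sum.delta)
    qed
    from C1_Rm_chain[OF C, where z="\<lambda>s. z (x(k := s))" and s="x k", OF this] show ?thesis
      unfolding z_def fun_upd_triv .
  qed
  have "continuous_on UNIV (\<lambda>y. dU i (z y))" if i: "i < m" for i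
  proof -
    have "continuous_on UNIV (\<lambda>y j. if j < m then z y j else 0)"
    proof (rule continuous_on_coordinatewise_then_product)
      show "continuous_on UNIV (\<lambda>y. if j < m then z y j else 0)" for j
        using zc[of j] by (cases "j < m") auto
    qed
    then have "continuous_on UNIV (\<lambda>y. dU i (\<lambda>j. if j < m then z y j else 0))"
      by (intro continuous_on_compose2[OF C1_Rm_continuous_deriv[OF C i]]) auto
    then show ?thesis
      using C1_Rm_deriv_cong[OF C i, of "\<lambda>j. if j < m then z y j else 0" "z y" for y] by simp
  qed
  moreover have "continuous_on UNIV (\<lambda>y::nat\<Rightarrow>real. h' i k (y k))" if "i < m" for i
    by (intro continuous_on_compose2[OF h'[OF that k]]) (auto intro: continuous_on_product_coordinates)
  ultimately show "continuous_on UNIV (\<lambda>y. \<Sum>i<m. dU i (\<lambda>i. c i + (\<Sum>k<N. h i k (y k))) * h' i k (y k))"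
    unfolding z_def by (intro continuous_intros) auto
next
  fix x y :: "nat \<Rightarrow> real" assume xy: "\<And>i. i < N \<Longrightarrow> x i = y i"
  then have eq: "(\<Sum>k<N. h i k (x k)) = (\<Sum>k<N. h i k (y k))" for i by simp
  show "U (\<lambda>i. c i + (\<Sum>k<N. h i k (x k))) = U (\<lambda>i. c i + (\<Sum>k<N. h i k (y k)))"
    by (simp only: eq)
  show "(\<Sum>i<m. dU i (\<lambda>i. c i + (\<Sum>k<N. h i k (x k))) * h' i k (x k)) =
      (\<Sum>i<m. dU i (\<lambda>i. c i + (\<Sum>k<N. h i k (y k))) * h' i k (y k))" if "k < N" for k
    by (simp only: eq xy[OF that])
qed

lemma C1_Rm_outer:
  assumes C: "C1_Rm m U dU"
    and \<psi>: "\<And>x. (\<psi> has_real_derivative \<psi>' (U x)) (at (U x))" "\<And>x. isCont \<psi>' (U x)"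
  shows "C1_Rm m (\<lambda>x. \<psi> (U x)) (\<lambda>i x. \<psi>' (U x) * dU i x)"
proof (rule C1_RmI)
  show "((\<lambda>s. \<psi> (U (x(i := s)))) has_real_derivative \<psi>' (U x) * dU i x) (at (x i))" if "i < m" for i x
  proof -
    have "((\<lambda>s. U (x(i := s))) has_real_derivative dU i x) (at (x i))"
      using C1_Rm_DERIV[OF C that, of x "x i"] by (simp add: fun_upd_triv)
    moreover have "(\<psi> has_real_derivative \<psi>' (U x)) (at (U (x(i := x i))))"
      using \<psi>(1)[of x] by (simp add: fun_upd_triv)
    ultimately show ?thesis
      using DERIV_chain2[of \<psi> "\<psi>' (U x)" "\<lambda>s. U (x(i := s))" "x i"] by simp
  qed
  show "continuous_on UNIV (\<lambda>x. \<psi>' (U x) * dU i x)" if "i < m" for i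
  proof (intro continuous_intros C1_Rm_continuous_deriv[OF C that])
    show "continuous_on UNIV (\<lambda>x. \<psi>' (U x))"
      by (intro continuous_on_compose2[OF _ C1_Rm_continuous[OF C], of "range U" \<psi>'])
         (auto intro!: continuous_at_imp_continuous_on \<psi>(2))
  qed
next
  fix x y :: "nat \<Rightarrow> real" assume xy: "\<And>i. i < m \<Longrightarrow> x i = y i"
  have U: "U x = U y" by (rule C1_Rm_cong[OF C xy])
  then show "\<psi> (U x) = \<psi> (U y)" by simp
  show "\<psi>' (U x) * dU k x = \<psi>' (U y) * dU k y" if "k < m" for k
    using U C1_Rm_deriv_cong[OF C that, of x y] xy by simp
qed

lemma C1_Rm_proj: "m > 0 \<Longrightarrow> C1_Rm m (\<lambda>x. x 0) (\<lambda>i x. if i = 0 then 1 else 0)"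
proof (rule C1_RmI)
  show "((\<lambda>s. (x(i := s)) 0) has_real_derivative (if i = 0 then 1 else 0)) (at (x i))" for i and x :: "nat \<Rightarrow> real"
    by (cases "i = 0") simp_all
qed auto

text \<open>Two cylinder functions with unrelated coefficients are combined by letting the second
  one read its arguments from position m on. This makes \<open>C1\<close> closed under
  differences.\<close>

lemma C1_Rm_diff_append:
  assumes C: "C1_Rm m U dU" and D: "C1_Rm n V dV"
  shows "C1_Rm (m + n) (\<lambda>x. U x - V (\<lambda>i. x (i + m)))
    (\<lambda>i x. if i < m then dU i x else - dV (i - m) (\<lambda>i. x (i + m)))"
proof (rule C1_RmI)
  fix i and x :: "nat \<Rightarrow> real" assume i: "i < m + n"
  show "((\<lambda>s. U (x(i := s)) - V (\<lambda>j. (x(i := s)) (j + m))) has_real_derivative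
        (if i < m then dU i x else - dV (i - m) (\<lambda>i. x (i + m)))) (at (x i))"
  proof (cases "i < m")
    case True
    have "((\<lambda>s. U (x(i := s))) has_real_derivative dU i x) (at (x i))"
      using C1_Rm_DERIV[OF C True, of x "x i"] by (simp only: fun_upd_triv)
    moreover have "V (\<lambda>j. (x(i := s)) (j + m)) = V (\<lambda>j. x (j + m))" for s
      by (rule C1_Rm_cong[OF D]) (use True in simp)
    ultimately show ?thesis using True DERIV_diff[OF _ DERIV_const] by force
  next
    case False
    have 1: "U (x(i := s)) = U x" for s by (rule C1_Rm_cong[OF C]) (use False in simp)
    have 2: "(\<lambda>j. (x(i := s)) (j + m)) = (\<lambda>j. x (j + m))(i - m := s)" for s
      using False by (auto simp: fun_eq_iff)
    have 3: "(\<lambda>j. x (j + m))(i - m := x i) = (\<lambda>j. x (j + m))" using False by (auto simp: fun_eq_iff)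
    have "((\<lambda>s. V ((\<lambda>j. x (j + m))(i - m := s))) has_real_derivative
        dV (i - m) ((\<lambda>j. x (j + m))(i - m := x i))) (at (x i))"
      by (rule C1_Rm_DERIV[OF D]) (use i False in simp)
    from DERIV_diff[OF DERIV_const this, of "U x"] show ?thesis
      unfolding 1 2 3 using False by simp
  qed
  show "continuous_on UNIV (\<lambda>x. if i < m then dU i x else - dV (i - m) (\<lambda>i. x (i + m)))"
  proof (cases "i < m")
    case False
    have "continuous_on UNIV (\<lambda>(x::nat\<Rightarrow>real) i. x (i + m))"
      by (intro continuous_on_coordinatewise_then_product continuous_on_product_coordinates)
    then have "continuous_on UNIV (\<lambda>x. dV (i - m) (\<lambda>i. x (i + m)))"
      using False i by (intro continuous_on_compose2[OF C1_Rm_continuous_deriv[OF D, of "i - m"]]) auto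
    then show ?thesis using False by (auto intro!: continuous_intros)
  qed (use C1_Rm_continuous_deriv[OF C] in auto)
next
  fix x y :: "nat \<Rightarrow> real" assume xy: "\<And>i. i < m + n \<Longrightarrow> x i = y i"
  have "U x = U y" by (rule C1_Rm_cong[OF C]) (use xy in simp)
  moreover have "V (\<lambda>i. x (i + m)) = V (\<lambda>i. y (i + m))" by (rule C1_Rm_cong[OF D]) (use xy in simp)
  ultimately show "U x - V (\<lambda>i. x (i + m)) = U y - V (\<lambda>i. y (i + m))" by simp
next
  fix k and x y :: "nat \<Rightarrow> real" assume k: "k < m + n" and xy: "\<And>i. i < m + n \<Longrightarrow> x i = y i"
  have "dU k x = dU k y" if "k < m" by (rule C1_Rm_deriv_cong[OF C that]) (use xy in simp)
  moreover have "dV (k - m) (\<lambda>i. x (i + m)) = dV (k - m) (\<lambda>i. y (i + m))" if "\<not> k < m"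
    by (rule C1_Rm_deriv_cong[OF D]) (use xy k that in simp_all)
  ultimately show "(if k < m then dU k x else - dV (k - m) (\<lambda>i. x (i + m))) =
      (if k < m then dU k y else - dV (k - m) (\<lambda>i. y (i + m)))" by auto
qed

section \<open>Closures of graphs and step approximation on the unit interval\<close>

interpretation Leb01: prob_space Leb01
  by standard (simp add: Leb01_def emeasure_restrict_space space_restrict_space)

lemma space_Leb01 [simp]: "space Leb01 = {0..1}"
  by (simp add: Leb01_def space_restrict_space)

lemma borel_measurable_Leb01: "f \<in> borel_measurable borel \<Longrightarrow> f \<in> borel_measurable Leb01"
  unfolding Leb01_def by (intro measurable_restrict_space1) simp

lemma integral_Leb01: "(\<integral>t. f t \<partial>Leb01) = (\<integral>t. indicator {0..1} t * f t \<partial>lborel)" for f :: "real \<Rightarrow> real"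
  unfolding Leb01_def by (subst integral_restrict_space) auto

lemma AE_Leb01_neq: "AE t in Leb01. t \<noteq> c"
proof -
  have "AE t in lborel. t \<noteq> c" by (rule AE_lborel_singleton)
  then show ?thesis unfolding Leb01_def by (subst AE_restrict_space_iff) auto
qed

lemma AE_Leb01_countable: "countable A \<Longrightarrow> AE t in Leb01. t \<notin> A"
  using AE_ball_countable[of A "\<lambda>t c. t \<noteq> c" Leb01] AE_Leb01_neq by (auto elim!: eventually_mono)

lemma AE_pair_fst:
  assumes "AE x in M. P x" "sigma_finite_measure N"
  shows "AE z in M \<Otimes>\<^sub>M N. P (fst z)"
proof -
  interpret sigma_finite_measure N by fact
  obtain A where A: "{x \<in> space M. \<not> P x} \<subseteq> A" "A \<in> sets M" "emeasure M A = 0"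
    using assms(1) by (auto elim: AE_E)
  show ?thesis
  proof (rule AE_I)
    show "{z \<in> space (M \<Otimes>\<^sub>M N). \<not> P (fst z)} \<subseteq> A \<times> space N"
      using A(1) by (auto simp: space_pair_measure)
    show "emeasure (M \<Otimes>\<^sub>M N) (A \<times> space N) = 0"
      using A by (simp add: emeasure_pair_measure_Times)
    show "A \<times> space N \<in> sets (M \<Otimes>\<^sub>M N)" using A by simp
  qed
qed

lemma AE_pair_snd:
  assumes "AE x in N. P x" "sigma_finite_measure N"
  shows "AE z in M \<Otimes>\<^sub>M N. P (snd z)"
proof -
  interpret sigma_finite_measure N by fact
  obtain A where A: "{x \<in> space N. \<not> P x} \<subseteq> A" "A \<in> sets N" "emeasure N A = 0"
    using assms(1) by (auto elim: AE_E)
  show ?thesis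
  proof (rule AE_I)
    show "{z \<in> space (M \<Otimes>\<^sub>M N). \<not> P (snd z)} \<subseteq> space M \<times> A"
      using A(1) by (auto simp: space_pair_measure)
    show "emeasure (M \<Otimes>\<^sub>M N) (space M \<times> A) = 0"
      using A by (simp add: emeasure_pair_measure_Times)
    show "space M \<times> A \<in> sets (M \<Otimes>\<^sub>M N)" using A by simp
  qed
qed

lemma op_closure_iff:
  "(u, F) \<in> op_closure Q R \<longleftrightarrow> (\<exists>s. (\<forall>n. s n \<in> R) \<and> L2conv Q (\<lambda>n. fst (s n)) u \<and>
     L2conv (Q \<Otimes>\<^sub>M Leb01) (\<lambda>n. case_prod (snd (s n))) (case_prod F))"
  by (simp add: op_closure_def grad_seq_def[abs_def] case_prod_unfold)

lemma op_closureI: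
  assumes "\<And>n. (us n, Fs n) \<in> R" "L2conv Q us u" "L2conv (Q \<Otimes>\<^sub>M Leb01) (\<lambda>n. case_prod (Fs n)) (case_prod F)"
  shows "(u, F) \<in> op_closure Q R"
  unfolding op_closure_iff by (rule exI[of _ "\<lambda>n. (us n, Fs n)"]) (use assms in simp)

lemma op_closure_L2:
  assumes "(u, F) \<in> op_closure Q R"
  shows "L2 Q u" "L2 (Q \<Otimes>\<^sub>M Leb01) (case_prod F)"
  using assms by (auto simp: op_closure_iff L2conv_L2_lim)

lemma L2conv_eventually_close:
  assumes "L2conv M fs f" "e > 0"
  shows "\<forall>\<^sub>F n in sequentially. (\<integral>x. (fs n x - f x)\<^sup>2 \<partial>M) < e"
  using assms by (intro order_tendstoD(2)[where y=0]) (auto simp: L2conv_iff)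

text \<open>A diagonal choice: for each n an element of \<open>R\<close> within 1 / (n + 1) of the
  n-th member, in both components at once. Limits in a closure can therefore be taken in several
  passes.\<close>

lemma op_closure_closed:
  assumes c: "\<And>n. (us n, Fs n) \<in> op_closure Q R" and u: "L2conv Q us u"
    and F: "L2conv (Q \<Otimes>\<^sub>M Leb01) (\<lambda>n. case_prod (Fs n)) (case_prod F)"
  shows "(u, F) \<in> op_closure Q R"
proof -
  let ?P = "Q \<Otimes>\<^sub>M Leb01"
  define close where "close n p \<longleftrightarrow> p \<in> R \<and> L2 Q (fst p) \<and> L2 ?P (case_prod (snd p)) \<and> (\<integral>x. (fst p x - us n x)\<^sup>2 \<partial>Q) < inverse (real (Suc n))
      \<and> (\<integral>x. (case_prod (snd p) x - case_prod (Fs n) x)\<^sup>2 \<partial>?P) < inverse (real (Suc n))" for n p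
  have "\<exists>p. close n p" for n
  proof -
    obtain s where s: "\<forall>k. s k \<in> R" "L2conv Q (\<lambda>k. fst (s k)) (us n)"
      "L2conv ?P (\<lambda>k. case_prod (snd (s k))) (case_prod (Fs n))"
      using c[of n] by (auto simp: op_closure_iff)
    have "\<forall>\<^sub>F k in sequentially. (\<integral>x. (fst (s k) x - us n x)\<^sup>2 \<partial>Q) < inverse (real (Suc n))"
      by (rule L2conv_eventually_close[OF s(2)]) simp
    moreover have "\<forall>\<^sub>F k in sequentially. (\<integral>x. (case_prod (snd (s k)) x - case_prod (Fs n) x)\<^sup>2 \<partial>?P) < inverse (real (Suc n))"
      by (rule L2conv_eventually_close[OF s(3)]) simp
    ultimately have "\<forall>\<^sub>F k in sequentially. (\<integral>x. (fst (s k) x - us n x)\<^sup>2 \<partial>Q) < inverse (real (Suc n)) \<and>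
       (\<integral>x. (case_prod (snd (s k)) x - case_prod (Fs n) x)\<^sup>2 \<partial>?P) < inverse (real (Suc n))"
      by (rule eventually_conj)
    then obtain k where "(\<integral>x. (fst (s k) x - us n x)\<^sup>2 \<partial>Q) < inverse (real (Suc n))"
       "(\<integral>x. (case_prod (snd (s k)) x - case_prod (Fs n) x)\<^sup>2 \<partial>?P) < inverse (real (Suc n))"
      using eventually_happens'[OF sequentially_bot] by blast
    then show ?thesis using s L2conv_L2[OF s(2), of k] L2conv_L2[OF s(3), of k] unfolding close_def by blast
  qed
  then obtain p where "\<And>n. close n (p n)" by metis
  then have p: "\<And>n. p n \<in> R" "\<And>n. L2 Q (fst (p n))" "\<And>n. L2 ?P (case_prod (snd (p n)))"
    "\<And>n. (\<integral>x. (fst (p n) x - us n x)\<^sup>2 \<partial>Q) < inverse (real (Suc n))"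
    "\<And>n. (\<integral>x. (case_prod (snd (p n)) x - case_prod (Fs n) x)\<^sup>2 \<partial>?P) < inverse (real (Suc n))"
    unfolding close_def by blast+
  have conv: "L2conv M ps f"
    if "\<And>n. L2 M (ps n)" "L2conv M fs f" "\<And>n. (\<integral>x. (ps n x - fs n x)\<^sup>2 \<partial>M) < inverse (real (Suc n))"
    for ps fs f and M :: "'c measure"
    unfolding L2conv_iff
  proof (intro conjI allI that(1))
    show "L2 M f" using that by (simp add: L2conv_iff)
    show "(\<lambda>n. \<integral>x. (ps n x - f x)\<^sup>2 \<partial>M) \<longlonglongrightarrow> 0"
    proof (rule real_tendsto_sandwich[where f="\<lambda>_. 0"])
      show "\<forall>\<^sub>F n in sequentially. (\<integral>x. (ps n x - f x)\<^sup>2 \<partial>M) \<le> 2 * inverse (real (Suc n)) + 2 * (\<integral>x. (fs n x - f x)\<^sup>2 \<partial>M)"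
      proof (rule always_eventually, rule allI)
        fix n
        have "(\<integral>x. (ps n x - f x)\<^sup>2 \<partial>M) \<le> 2 * (\<integral>x. (ps n x - fs n x)\<^sup>2 \<partial>M) + 2 * (\<integral>x. (fs n x - f x)\<^sup>2 \<partial>M)"
          using that by (intro integral_sq_diff_triangle) (auto simp: L2conv_iff)
        then show "(\<integral>x. (ps n x - f x)\<^sup>2 \<partial>M) \<le> 2 * inverse (real (Suc n)) + 2 * (\<integral>x. (fs n x - f x)\<^sup>2 \<partial>M)"
          using that(3)[of n] by linarith
      qed
      have "(\<lambda>n. \<integral>x. (fs n x - f x)\<^sup>2 \<partial>M) \<longlonglongrightarrow> 0" using that(2) by (simp add: L2conv_iff)
      from tendsto_add[OF tendsto_mult_right_zero[OF LIMSEQ_inverse_real_of_nat, of 2] tendsto_mult_right_zero[OF this, of 2]]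
      show "(\<lambda>n. 2 * inverse (real (Suc n)) + 2 * (\<integral>x. (fs n x - f x)\<^sup>2 \<partial>M)) \<longlonglongrightarrow> 0" by simp
    qed auto
  qed
  show ?thesis
    unfolding op_closure_iff
  proof (intro exI[of _ p] conjI allI p(1))
    show "L2conv Q (\<lambda>n. fst (p n)) u" by (rule conv[OF p(2) u p(4)])
    show "L2conv ?P (\<lambda>n. case_prod (snd (p n))) (case_prod F)" by (rule conv[OF p(3) F p(5)])
  qed
qed

lemma op_closure_mono:
  assumes "A \<subseteq> op_closure Q B"
  shows "op_closure Q A \<subseteq> op_closure Q B"
proof
  fix p assume p: "p \<in> op_closure Q A"
  obtain u F where uF: "p = (u, F)" by (cases p)
  then obtain s where s: "\<forall>n. s n \<in> A" "L2conv Q (\<lambda>n. fst (s n)) u"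
     "L2conv (Q \<Otimes>\<^sub>M Leb01) (\<lambda>n. case_prod (snd (s n))) (case_prod F)"
    using p by (auto simp: op_closure_iff)
  have "(fst (s n), snd (s n)) \<in> op_closure Q B" for n using s(1) assms by auto
  from op_closure_closed[OF this s(2,3)] show "p \<in> op_closure Q B" by (simp add: uF)
qed

lemma op_closure_cong:
  assumes "(u, F) \<in> op_closure Q R" "L2 Q v" "L2 (Q \<Otimes>\<^sub>M Leb01) (case_prod G)"
    "AE g in Q. u g = v g" "AE x in Q \<Otimes>\<^sub>M Leb01. case_prod F x = case_prod G x"
  shows "(v, G) \<in> op_closure Q R"
  using assms by (auto simp: op_closure_iff intro: L2conv_cong_AE)

text \<open>Cauchy gradients converge by completeness of L^2 on the product, so an approximating
  sequence for the form is also one for the graph of the gradient. Later statements about the form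
  are all read off from \<open>op_closure\<close>.\<close>

lemma form_closure_iff:
  assumes Q: "prob_space Q"
  shows "(u, v, c) \<in> form_closure Q R \<longleftrightarrow> (\<exists>F G. (u, F) \<in> op_closure Q R \<and> (v, G) \<in> op_closure Q R \<and>
      c = (\<integral>x. case_prod F x * case_prod G x \<partial>(Q \<Otimes>\<^sub>M Leb01)))"
proof -
  interpret Q: prob_space Q by fact
  interpret P: pair_prob_space Q Leb01 ..
  have E: "formE Q p q = (\<integral>x. case_prod (snd p) x * case_prod (snd q) x \<partial>(Q \<Otimes>\<^sub>M Leb01))" for p q
    by (simp add: formE_def case_prod_unfold)
  have g: "grad_seq s = (\<lambda>n. case_prod (snd (s n)))" for s
    by (simp add: grad_seq_def fun_eq_iff)
  show ?thesis
  proof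
    assume "(u, v, c) \<in> form_closure Q R"
    then obtain s r where sr: "\<forall>n. s n \<in> R" "\<forall>n. r n \<in> R" "L2conv Q (\<lambda>n. fst (s n)) u"
      "L2conv Q (\<lambda>n. fst (r n)) v" "L2cauchy (Q \<Otimes>\<^sub>M Leb01) (grad_seq s)" "L2cauchy (Q \<Otimes>\<^sub>M Leb01) (grad_seq r)"
      "(\<lambda>n. formE Q (s n) (r n)) \<longlonglongrightarrow> c"
      by (auto simp: form_closure_def)
    obtain F where F: "L2conv (Q \<Otimes>\<^sub>M Leb01) (grad_seq s) F" by (rule P.L2_complete[OF sr(5)])
    obtain G where G: "L2conv (Q \<Otimes>\<^sub>M Leb01) (grad_seq r) G" by (rule P.L2_complete[OF sr(6)])
    have "(u, curry F) \<in> op_closure Q R" "(v, curry G) \<in> op_closure Q R"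
      using sr F G by (auto simp: op_closure_iff g)
    moreover have "c = (\<integral>x. F x * G x \<partial>(Q \<Otimes>\<^sub>M Leb01))"
      using L2conv_integral_mult[OF F G] sr(7) by (simp add: E g LIMSEQ_unique)
    ultimately show "\<exists>F G. (u, F) \<in> op_closure Q R \<and> (v, G) \<in> op_closure Q R \<and>
      c = (\<integral>x. case_prod F x * case_prod G x \<partial>(Q \<Otimes>\<^sub>M Leb01))"
      by (intro exI[of _ "curry F"] exI[of _ "curry G"]) (auto simp only: case_prod_curry)
  next
    assume "\<exists>F G. (u, F) \<in> op_closure Q R \<and> (v, G) \<in> op_closure Q R \<and>
      c = (\<integral>x. case_prod F x * case_prod G x \<partial>(Q \<Otimes>\<^sub>M Leb01))"
    then obtain F G s r where sr: "\<forall>n. s n \<in> R" "\<forall>n. r n \<in> R" "L2conv Q (\<lambda>n. fst (s n)) u"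
      "L2conv Q (\<lambda>n. fst (r n)) v" and
      F: "L2conv (Q \<Otimes>\<^sub>M Leb01) (grad_seq s) (case_prod F)" and
      G: "L2conv (Q \<Otimes>\<^sub>M Leb01) (grad_seq r) (case_prod G)" and
      c: "c = (\<integral>x. case_prod F x * case_prod G x \<partial>(Q \<Otimes>\<^sub>M Leb01))"
      unfolding op_closure_iff g[symmetric] by blast
    have "(\<lambda>n. formE Q (s n) (r n)) \<longlonglongrightarrow> c"
      using L2conv_integral_mult[OF F G] by (simp only: c E g)
    then show "(u, v, c) \<in> form_closure Q R"
      unfolding form_closure_def using sr L2conv_imp_cauchy[OF F] L2conv_imp_cauchy[OF G] by blast
  qed
qed

text \<open>Cells are numbered from 1 and are half-open, [(k - 1) / N, k / N); the minimum puts t =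
  1 into the last one.\<close>

definition idx :: "nat \<Rightarrow> real \<Rightarrow> nat" where
  "idx N t = min N (nat \<lfloor>real N * t\<rfloor> + 1)"

lemma measurable_idx [measurable]: "idx N \<in> measurable Leb01 (count_space UNIV)"
proof -
  have "idx N \<in> measurable borel (count_space UNIV)" unfolding idx_def by measurable
  then show ?thesis unfolding Leb01_def by (intro measurable_restrict_space1) simp
qed

lemma idx_mem: "N > 0 \<Longrightarrow> idx N t \<in> {1..N}"
  by (auto simp: idx_def)

lemma idx_eq_iff:
  assumes "t \<in> {0..<1}" "k \<in> {1..N}"
  shows "idx N t = k \<longleftrightarrow> (real k - 1) / real N \<le> t \<and> t < real k / real N"
proof -
  have N: "real N > 0" using assms by auto
  have "real N * t < real N" using assms N by simp
  then have "\<lfloor>real N * t\<rfloor> < int N" by (simp add: floor_less_iff)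
  moreover have "0 \<le> \<lfloor>real N * t\<rfloor>" using assms N by simp
  ultimately have "idx N t = k \<longleftrightarrow> \<lfloor>real N * t\<rfloor> = int k - 1"
    using assms by (auto simp: idx_def)
  also have "\<dots> \<longleftrightarrow> real k - 1 \<le> real N * t \<and> real N * t < real k"
    by (subst floor_eq_iff) auto
  finally show ?thesis using N by (simp add: field_simps)
qed

lemma idx_bounds:
  assumes "t \<in> {0..<1}" "N > 0"
  shows "(real (idx N t) - 1) / real N \<le> t" "t < real (idx N t) / real N"
  using idx_eq_iff[OF assms(1) idx_mem[OF assms(2)]] by auto

lemma idx_one: "idx N 1 = N"
  by (auto simp: idx_def)

lemma integral_step:
  fixes f \<psi> :: "_ \<Rightarrow> real"
  assumes "integrable Leb01 f" "N > 0"
  shows "(\<integral>t. f t * \<psi> (idx N t) \<partial>Leb01) = (\<Sum>k\<in>{1..N}. (\<integral>t. f t * indicator {t. idx N t = k} t \<partial>Leb01) * \<psi> k)"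
proof -
  have i: "integrable Leb01 (\<lambda>t. f t * indicator {t. idx N t = k} t)" for k
  proof (rule Bochner_Integration.integrable_bound[OF assms(1)])
    have "(\<lambda>t. f t * (if idx N t = k then 1 else 0)) \<in> borel_measurable Leb01"
      using borel_measurable_integrable[OF assms(1)] by measurable
    then show "(\<lambda>t. f t * indicator {t. idx N t = k} t) \<in> borel_measurable Leb01"
      by (simp add: indicator_def of_bool_def)
  qed (auto simp: indicator_def)
  have "f t * \<psi> (idx N t) = (\<Sum>k\<in>{1..N}. f t * indicator {t. idx N t = k} t * \<psi> k)" for t
  proof -
    have "(\<Sum>k\<in>{1..N}. f t * indicator {t. idx N t = k} t * \<psi> k) = (\<Sum>k\<in>{1..N}. if k = idx N t then f t * \<psi> k else 0)"
      by (rule sum.cong) auto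
    also have "\<dots> = f t * \<psi> (idx N t)" using idx_mem[OF assms(2), of t] by (simp add: sum.delta)
    finally show ?thesis ..
  qed
  then have "(\<integral>t. f t * \<psi> (idx N t) \<partial>Leb01) = (\<integral>t. (\<Sum>k\<in>{1..N}. f t * indicator {t. idx N t = k} t * \<psi> k) \<partial>Leb01)"
    by simp
  also have "\<dots> = (\<Sum>k\<in>{1..N}. (\<integral>t. f t * indicator {t. idx N t = k} t * \<psi> k \<partial>Leb01))"
    by (rule Bochner_Integration.integral_sum) (use i in auto)
  finally show ?thesis by simp
qed

lemma integral_cell:
  assumes "k \<in> {1..N}"
  shows "(\<integral>t. indicator {t. idx N t = k} t \<partial>Leb01) = 1 / real N" (is "?I = _")
proof -
  have N: "real N > 0" "1 \<le> k" "k \<le> N" using assms by auto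
  have *: "0 \<le> (real k - 1) / real N" "real k / real N \<le> 1" "(real k - 1) / real N \<le> real k / real N"
    using N by (auto simp: divide_simps)
  have "?I = (\<integral>t. indicator {0..1} t * indicator {t. idx N t = k} t \<partial>lborel)"
    by (subst integral_Leb01) simp
  also have "\<dots> = (\<integral>t. indicator {(real k - 1) / real N..<real k / real N} t \<partial>lborel)"
  proof (rule integral_cong_AE)
    have "(\<lambda>t. indicator {t. idx N t = k} t :: real) \<in> borel_measurable borel"
      unfolding idx_def by measurable
    then show "(\<lambda>t. indicator {0..1} t * indicator {t. idx N t = k} t :: real) \<in> borel_measurable lborel" by simp
    have "AE t in lborel. t \<noteq> (1::real)" by (rule AE_lborel_singleton)
    then show "AE t in lborel. indicator {0..1} t * indicator {t. idx N t = k} t = (indicator {(real k - 1) / real N..<real k / real N} t :: real)"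
    proof eventually_elim
      case (elim t)
      show ?case
      proof (cases "t \<in> {0..<1}")
        case True
        then show ?thesis using idx_eq_iff[OF True assms] by (auto simp: indicator_def)
      next
        case False
        then have "t \<notin> {0..1}" using elim by auto
        moreover have "t \<notin> {(real k - 1) / real N..<real k / real N}" using * False by auto
        ultimately show ?thesis by simp
      qed
    qed
  qed auto
  also have "\<dots> = real k / real N - (real k - 1) / real N" using * by simp
  also have "\<dots> = 1 / real N" by (simp add: diff_divide_distrib)
  finally show ?thesis .
qed

lemma integral_step_mean:
  fixes \<psi> :: "nat \<Rightarrow> real"
  assumes "N > 0"
  shows "(\<integral>t. \<psi> (idx N t) \<partial>Leb01) = (\<Sum>k\<in>{1..N}. \<psi> k) / real N"
proof -
  have I: "(\<integral>t. 1 * indicator {t. idx N t = k} t \<partial>Leb01) = 1 / real N" if "k \<in> {1..N}" for k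
    using integral_cell[OF that] by (simp only: mult_1)
  have "(\<integral>t. 1 * \<psi> (idx N t) \<partial>Leb01) = (\<Sum>k\<in>{1..N}. (\<integral>t. 1 * indicator {t. idx N t = k} t \<partial>Leb01) * \<psi> k)"
    by (rule integral_step) (use assms in auto)
  also have "\<dots> = (\<Sum>k\<in>{1..N}. (1 / real N) * \<psi> k)"
    by (rule sum.cong[OF refl]) (simp only: I)
  finally show ?thesis by (simp add: sum_divide_distrib)
qed

section \<open>Paths and their samples on a uniform grid\<close>

lemma G0_bounds: "g \<in> G0 \<Longrightarrow> t \<in> {0..1} \<Longrightarrow> 0 \<le> g t \<and> g t \<le> 1"
  by (cases "t = 1") (auto simp: G0_def)

lemma G0_mono:
  assumes "g \<in> G0" "0 \<le> s" "s \<le> t" "t \<le> 1" shows "g s \<le> g t"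
proof (cases "t = 1")
  case True
  then show ?thesis using assms G0_bounds[OF assms(1), of s] by (auto simp: G0_def)
qed (use assms in \<open>auto simp: G0_def\<close>)

lemma G0_one: "g \<in> G0 \<Longrightarrow> g 1 = 1" by (simp add: G0_def)

text \<open>Sampling takes place at the right end point of the cell, which for t < 1 lies strictly
  to the right of t. Right continuity therefore suffices at every t, with no exceptional set of
  jumps; at t = 1 the sample is the value itself.\<close>

lemma G0_step_tendsto:
  assumes g: "g \<in> G0" and t: "t \<in> {0..1}"
  shows "(\<lambda>n. g (real (idx (Suc n) t) / real (Suc n))) \<longlonglongrightarrow> g t"
proof (cases "t = 1")
  case True
  have "real (Suc n) / real (Suc n) = 1" for n by simp
  then show ?thesis using True by (simp add: idx_one del: of_nat_Suc)
next
  case False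
  then have t: "t \<in> {0..<1}" using t by auto
  have "(\<lambda>n. real (idx (Suc n) t) / real (Suc n)) \<longlonglongrightarrow> t"
  proof (rule real_tendsto_sandwich)
    show "\<forall>\<^sub>F n in sequentially. t \<le> real (idx (Suc n) t) / real (Suc n)"
      using idx_bounds(2)[OF t, of "Suc _"] by (auto intro!: always_eventually less_imp_le simp del: of_nat_Suc)
    show "\<forall>\<^sub>F n in sequentially. real (idx (Suc n) t) / real (Suc n) \<le> t + inverse (real (Suc n))"
    proof (rule always_eventually, rule allI)
      fix n show "real (idx (Suc n) t) / real (Suc n) \<le> t + inverse (real (Suc n))"
        using idx_bounds(1)[OF t, of "Suc n"] by (simp add: diff_divide_distrib inverse_eq_divide del: of_nat_Suc)
    qed
    show "(\<lambda>n. t + inverse (real (Suc n))) \<longlonglongrightarrow> t"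
      using tendsto_add[OF tendsto_const LIMSEQ_inverse_real_of_nat, of t] by simp
  qed simp
  moreover have "\<forall>n. real (idx (Suc n) t) / real (Suc n) > t"
    using idx_bounds(2)[OF t] by blast
  ultimately have "filterlim (\<lambda>n. real (idx (Suc n) t) / real (Suc n)) (at_right t) sequentially"
    unfolding filterlim_at by (metis (mono_tags, lifting) always_eventually greaterThan_iff less_irrefl)
  moreover have "(g \<longlongrightarrow> g t) (at_right t)"
    using g t by (auto simp: G0_def continuous_within)
  ultimately show ?thesis by (rule filterlim_compose[rotated])
qed

lemma G0_step_mem: "t \<in> {0..1} \<Longrightarrow> real (idx (Suc n) t) / real (Suc n) \<in> {0..1}"
  using idx_mem[of "Suc n" t] by (auto simp: divide_simps)

section \<open>Integration by parts on the simplex\<close>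

text \<open>An exponent above 1 makes the power of the positive part C^1 across 0, where the
  difference quotient is at most the b-th power of |h|. The exponent has the shape
  \<open>b + 1\<close>, which is why exponents below are written \<open>1 + 1\<close> and
  \<open>2 + 1\<close>.\<close>

lemma has_real_derivative_max0_powr:
  assumes b: "b > 0"
  shows "((\<lambda>y. max 0 y powr (b + 1)) has_real_derivative (b + 1) * max 0 y powr b) (at y)"
proof (cases y "0::real" rule: linorder_cases)
  case less
  have "((\<lambda>y. 0) has_real_derivative (b + 1) * max 0 y powr b) (at y)" using less by simp
  moreover have "\<forall>\<^sub>F x in nhds y. max 0 x powr (b + 1) = 0"
    using eventually_nhds_in_open[of "{..<0}" y] less by (auto elim: eventually_mono)
  ultimately show ?thesis by (subst DERIV_cong_ev[OF refl _ refl]) auto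
next
  case greater
  have "((\<lambda>x. x powr (b + 1)) has_real_derivative (b + 1) * max 0 y powr b) (at y)"
    using greater by (auto intro!: derivative_eq_intros)
  moreover have "\<forall>\<^sub>F x in nhds y. max 0 x powr (b + 1) = x powr (b + 1)"
    using eventually_nhds_in_open[of "{0<..}" y] greater by (auto elim: eventually_mono)
  ultimately show ?thesis by (subst DERIV_cong_ev[OF refl _ refl]) auto
next
  case equal
  have "((\<lambda>h. \<bar>h\<bar> powr b) \<longlongrightarrow> \<bar>0\<bar> powr b) (at 0)"
    using b by (intro tendsto_powr' tendsto_intros) auto
  then have "((\<lambda>h. \<bar>h\<bar> powr b) \<longlongrightarrow> 0) (at (0::real))" using b by simp
  then have "((\<lambda>h. max 0 h powr (b + 1) / h) \<longlongrightarrow> 0) (at (0::real))"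
  proof (rule Lim_null_comparison[rotated])
    have "norm (max 0 h powr (b + 1) / h) \<le> \<bar>h\<bar> powr b" for h :: real
      by (cases "h > 0") (auto simp: powr_add max_def)
    then show "\<forall>\<^sub>F h in at 0. norm (max 0 h powr (b + 1) / h) \<le> \<bar>h\<bar> powr b" by (auto intro: always_eventually)
  qed
  then show ?thesis using equal b by (simp add: has_field_derivative_iff)
qed

lemma continuous_on_max0_powr: "b > 0 \<Longrightarrow> continuous_on S (\<lambda>y. max 0 y powr b)" for b :: real
  by (intro continuous_on_powr' continuous_intros) auto

text \<open>A C1 regularisation of the singular gap weight \<open>y powr (a - 1)\<close>; the factor
  \<open>c y\<^sup>2 / (1 + c y\<^sup>2)\<close> only perturbs the logarithmic derivative \<open>y r' / r = a - 1\<close> by a bounded term.\<close>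

definition rgap :: "real \<Rightarrow> real \<Rightarrow> real \<Rightarrow> real" where
  "rgap c a y = c * max 0 y powr (a + 1) / (1 + c * max 0 y powr (1 + 1))"

text \<open>For y > 0 this is the logarithmic derivative y r'(y) / r(y) of \<open>rgap\<close>: the
  exponent a + 1 of the numerator minus twice the fraction c y^2 / (1 + c y^2). The derivative
  \<open>drgap\<close> is written through it without dividing by the vanishing weight.\<close>

definition qgap :: "real \<Rightarrow> real \<Rightarrow> real \<Rightarrow> real" where
  "qgap c a y = a - 1 + 2 / (1 + c * max 0 y powr (1 + 1))"

definition drgap :: "real \<Rightarrow> real \<Rightarrow> real \<Rightarrow> real" where
  "drgap c a y = qgap c a y * (c * max 0 y powr a / (1 + c * max 0 y powr (1 + 1)))"

lemma gap_denom: "c \<ge> 0 \<Longrightarrow> 1 + c * max 0 y powr (1 + 1) \<ge> 1" for c y :: real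
  by simp

lemma gap_denom2: "c \<ge> 0 \<Longrightarrow> 1 + c * (max 0 y)\<^sup>2 > 0" for c y :: real
  by (intro add_pos_nonneg mult_nonneg_nonneg) auto

lemma rgap_DERIV:
  assumes "c > 0" "a > 0"
  shows "(rgap c a has_real_derivative drgap c a y) (at y)"
proof -
  define p where "p = max 0 y"
  define d where "d = 1 + c * p powr (1 + 1)"
  have d: "d \<ge> 1" using assms by (simp add: d_def)
  have p: "p powr (a + 1) = p * p powr a" "p powr 1 = p" "p powr (1 + 1) = p * p"
    by (auto simp: powr_add p_def power2_eq_square)
  have "(rgap c a has_real_derivative
     ((c * ((a + 1) * p powr a)) * d - c * p powr (a + 1) * (0 + c * ((1 + 1) * p powr 1))) / (d * d)) (at y)"
    unfolding rgap_def[abs_def] p_def d_def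
    by (intro DERIV_divide DERIV_add DERIV_const DERIV_cmult has_real_derivative_max0_powr)
       (use assms gap_denom2[of c y] in auto)
  moreover have "((c * ((a + 1) * p powr a)) * d - c * p powr (a + 1) * (0 + c * ((1 + 1) * p powr 1))) / (d * d) = drgap c a y"
  proof -
    have cp: "c * (p * p) = d - 1" unfolding d_def p(3) by simp
    have "c * p powr (a + 1) * (0 + c * ((1 + 1) * p powr 1)) = 2 * c * p powr a * (c * (p * p))"
      unfolding p(1,2) by algebra
    also have "\<dots> = 2 * c * p powr a * (d - 1)" by (simp only: cp)
    finally have e: "c * p powr (a + 1) * (0 + c * ((1 + 1) * p powr 1)) = 2 * c * p powr a * (d - 1)" .
    have "drgap c a y = (a - 1 + 2 / d) * (c * p powr a / d)"
      by (simp add: drgap_def qgap_def p_def d_def)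
    then show ?thesis using d unfolding e by (simp add: field_simps)
  qed
  ultimately show ?thesis by simp
qed

lemma drgap_continuous:
  assumes "c > 0" "a > 0" shows "continuous_on S (drgap c a)"
  unfolding drgap_def[abs_def] qgap_def
proof -
  have "1 + c * max 0 y powr (1 + 1) \<noteq> 0" for y using gap_denom[of c y] assms by linarith
  then show "continuous_on S (\<lambda>y. (a - 1 + 2 / (1 + c * max 0 y powr (1 + 1))) * (c * max 0 y powr a / (1 + c * max 0 y powr (1 + 1))))"
    by (intro continuous_intros continuous_on_max0_powr) (use assms in auto)
qed

lemma rgap_continuous:
  assumes "c > 0" "a > 0" shows "continuous_on S (rgap c a)"
  by (meson DERIV_isCont assms continuous_at_imp_continuous_on rgap_DERIV)

lemma rgap_nonpos: "y \<le> 0 \<Longrightarrow> rgap c a y = 0" "y \<le> 0 \<Longrightarrow> drgap c a y = 0"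
  by (simp_all add: rgap_def drgap_def)

lemma rgap_nonneg: "c > 0 \<Longrightarrow> 0 \<le> rgap c a y"
  by (simp add: rgap_def)

lemma mult_drgap: "y * drgap c a y = qgap c a y * rgap c a y"
  by (cases "y > 0") (simp_all add: rgap_def drgap_def powr_add)

lemma qgap_bound:
  assumes "c > 0" shows "\<bar>qgap c a y\<bar> \<le> \<bar>a - 1\<bar> + 2"
proof -
  have "2 / (1 + c * max 0 y powr (1 + 1)) \<le> 2 / 1"
    by (rule divide_left_mono) (use gap_denom2[of c y] assms in auto)
  moreover have "0 \<le> 2 / (1 + c * max 0 y powr (1 + 1))" using gap_denom[of c y] assms by simp
  ultimately show ?thesis unfolding qgap_def by linarith
qed

lemma rgap_bounds:
  assumes "c > 0" "a > 0" "y \<le> 1"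
  shows "\<bar>rgap c a y\<bar> \<le> c" "\<bar>drgap c a y\<bar> \<le> (\<bar>a - 1\<bar> + 2) * c"
proof -
  have p: "max 0 y powr b \<le> 1" if "b \<ge> 0" for b
    using assms that by (intro powr_le1) auto
  have q: "\<bar>c * max 0 y powr b / (1 + c * max 0 y powr (1 + 1))\<bar> \<le> c" if "b \<ge> 0" for b
  proof -
    have "c * max 0 y powr b / (1 + c * max 0 y powr (1 + 1)) \<le> c * 1 / 1"
      by (rule frac_le) (use assms p[OF that] gap_denom[of c y] in auto)
    moreover have "0 \<le> c * max 0 y powr b / (1 + c * max 0 y powr (1 + 1))"
      using assms gap_denom[of c y] by simp
    ultimately show ?thesis by linarith
  qed
  show "\<bar>rgap c a y\<bar> \<le> c" unfolding rgap_def by (rule q) (use assms in auto)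
  show "\<bar>drgap c a y\<bar> \<le> (\<bar>a - 1\<bar> + 2) * c"
    unfolding drgap_def abs_mult by (intro mult_mono qgap_bound q) (use assms in auto)
qed

lemma rgap_eq:
  assumes "c > 0" "y > 0"
  shows "rgap c a y = y powr (a - 1) * (1 - 1 / (1 + c * y powr 2))"
proof -
  have d: "1 + c * y powr 2 > 0" using assms by (simp add: add_pos_nonneg)
  have y: "y powr (a + 1) = y powr (a - 1) * y powr 2" by (simp add: add.commute flip: powr_add)
  have "y powr (a - 1) * (1 - 1 / (1 + c * y powr 2)) = y powr (a - 1) * (c * y powr 2) / (1 + c * y powr 2)"
    using d by (simp add: field_simps)
  then show ?thesis using assms by (simp add: rgap_def y)
qed

lemma rgap_le:
  assumes "c > 0" "y > 0" shows "rgap c a y \<le> y powr (a - 1)"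
proof -
  have "y powr (a - 1) * (1 - 1 / (1 + c * y powr 2)) \<le> y powr (a - 1) * 1"
    by (rule mult_left_mono) (use assms in auto)
  then show ?thesis using rgap_eq[OF assms] by simp
qed

lemma gap_limit:
  assumes "y > 0" shows "(\<lambda>n. 1 / (1 + real (Suc n) * y powr 2)) \<longlonglongrightarrow> 0"
proof (rule Lim_null_comparison)
  have y: "y powr 2 > 0" using assms by simp
  show "\<forall>\<^sub>F n in sequentially. norm (1 / (1 + real (Suc n) * y powr 2)) \<le> inverse (real (Suc n)) * (1 / y powr 2)"
  proof (rule always_eventually, rule allI)
    fix n
    have "0 < real (Suc n) * y powr 2" using y by (intro mult_pos_pos) simp_all
    then have "1 / (1 + real (Suc n) * y powr 2) \<le> 1 / (real (Suc n) * y powr 2)" "0 \<le> 1 / (1 + real (Suc n) * y powr 2)"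
      by (auto intro!: divide_left_mono mult_pos_pos add_pos_pos simp del: of_nat_Suc)
    then show "norm (1 / (1 + real (Suc n) * y powr 2)) \<le> inverse (real (Suc n)) * (1 / y powr 2)"
      by (simp add: inverse_eq_divide)
  qed
  show "(\<lambda>n. inverse (real (Suc n)) * (1 / y powr 2)) \<longlonglongrightarrow> 0"
    by (rule tendsto_mult_left_zero[OF LIMSEQ_inverse_real_of_nat])
qed

lemma rgap_tendsto:
  assumes "y > 0" shows "(\<lambda>n. rgap (real (Suc n)) a y) \<longlonglongrightarrow> y powr (a - 1)"
proof -
  have "(\<lambda>n. y powr (a - 1) * (1 - 1 / (1 + real (Suc n) * y powr 2))) \<longlonglongrightarrow> y powr (a - 1) * (1 - 0)"
    by (intro tendsto_intros gap_limit assms)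
  then show ?thesis using assms by (simp add: rgap_eq)
qed

lemma qgap_tendsto:
  assumes "y > 0" shows "(\<lambda>n. qgap (real (Suc n)) a y) \<longlonglongrightarrow> a - 1"
proof -
  have "(\<lambda>n. a - 1 + 2 * (1 / (1 + real (Suc n) * y powr 2))) \<longlonglongrightarrow> a - 1 + 2 * 0"
    by (intro tendsto_intros gap_limit assms)
  then show ?thesis using assms by (simp add: qgap_def)
qed

text \<open>The zeros at 0 and 1 sit at the fixed outer points of the simplex: they remove the
  boundary values of every one-dimensional integration, and they let the outer points join sums over
  grid points at no cost. The Lipschitz bound on \<phi>' controls the pairing of derivatives with
  divided differences. Both bounds refer to the unit interval, where paths take their
  values.\<close>

locale test_field =
  fixes \<phi> \<phi>' :: "real \<Rightarrow> real" and K L :: real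
  assumes phi0: "\<phi> 0 = 0" and phi1: "\<phi> 1 = 0"
    and phi_DERIV: "\<And>x. (\<phi> has_real_derivative \<phi>' x) (at x)"
    and phi'_cont: "continuous_on UNIV \<phi>'"
    and phi'_bound: "\<And>x. x \<in> {0..1} \<Longrightarrow> \<bar>\<phi>' x\<bar> \<le> L"
    and phi'_lipschitz: "\<And>x y. x \<in> {0..1} \<Longrightarrow> y \<in> {0..1} \<Longrightarrow> \<bar>\<phi>' x - \<phi>' y\<bar> \<le> K * \<bar>x - y\<bar>"
begin

lemma L_nonneg: "0 \<le> L" using phi'_bound[of 0] by simp

lemma K_nonneg: "0 \<le> K" using phi'_lipschitz[of 0 1] by simp

lemma phi_cont: "continuous_on S \<phi>"
  using phi_DERIV by (meson DERIV_isCont continuous_at_imp_continuous_on)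

lemma phi_measurable [measurable]: "\<phi> \<in> borel_measurable borel" "\<phi>' \<in> borel_measurable borel"
  by (auto intro!: borel_measurable_continuous_onI phi_cont phi'_cont)

lemma divided_difference:
  assumes "0 \<le> x" "x < y" "y \<le> 1"
  shows "\<bar>(\<phi> y - \<phi> x) / (y - x)\<bar> \<le> L" "\<bar>\<phi>' y - (\<phi> y - \<phi> x) / (y - x)\<bar> \<le> K * (y - x)"
proof -
  obtain z where z: "x < z" "z < y" "\<phi> y - \<phi> x = (y - x) * \<phi>' z"
    using MVT2[OF assms(2), of \<phi> \<phi>'] phi_DERIV by blast
  then have eq: "(\<phi> y - \<phi> x) / (y - x) = \<phi>' z" using assms by simp
  show "\<bar>(\<phi> y - \<phi> x) / (y - x)\<bar> \<le> L" unfolding eq by (rule phi'_bound) (use z assms in auto)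
  have "\<bar>\<phi>' y - \<phi>' z\<bar> \<le> K * \<bar>y - z\<bar>" by (rule phi'_lipschitz) (use z assms in auto)
  also have "\<dots> \<le> K * (y - x)" using z K_nonneg by (intro mult_left_mono) auto
  finally show "\<bar>\<phi>' y - (\<phi> y - \<phi> x) / (y - x)\<bar> \<le> K * (y - x)" unfolding eq .
qed

lemma phi_bound: "x \<in> {0..1} \<Longrightarrow> \<bar>\<phi> x\<bar> \<le> L"
proof (cases "x = 0")
  case False
  assume x: "x \<in> {0..1}"
  then have "\<bar>\<phi> x / x\<bar> \<le> L" using divided_difference(1)[of 0 x] False by (simp add: phi0)
  then have "\<bar>\<phi> x\<bar> \<le> L * x" using x False by (simp add: field_simps)
  also have "\<dots> \<le> L * 1" using x L_nonneg by (intro mult_left_mono) auto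
  finally show ?thesis by simp
qed (simp add: phi0 L_nonneg)

end

section \<open>Points, gaps and admissible functions on the simplex\<close>

lemma ext_pt_upd:
  assumes "k \<in> {1..N}"
  shows "ext_pt N (x(k := s)) i = (if i = k then s else ext_pt N x i)"
  using assms by (auto simp: ext_pt_def)

lemma ext_pt_upd_DERIV:
  assumes "k \<in> {1..N}"
  shows "((\<lambda>s. ext_pt N (x(k := s)) i) has_real_derivative (if i = k then 1 else 0)) (at s)"
  unfolding ext_pt_upd[OF assms] by (cases "i = k") simp_all

lemma ext_pt_chain_mono:
  assumes "\<And>i. i \<le> N \<Longrightarrow> ext_pt N x i < ext_pt N x (Suc i)" "i < j" "j \<le> Suc N"
  shows "ext_pt N x i < ext_pt N x j"
  using assms(2,3)
proof (induction j)
  case (Suc j)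
  then show ?case using assms(1)[of j] by (cases "i = j") force+
qed simp

lemma ext_pt_in_unit:
  assumes "\<And>i. i \<le> N \<Longrightarrow> ext_pt N x i < ext_pt N x (Suc i)"
  shows "i \<in> {1..N} \<Longrightarrow> 0 < x i \<and> x i < 1" "i \<le> Suc N \<Longrightarrow> ext_pt N x i \<in> {0..1}"
proof -
  show *: "0 < x i \<and> x i < 1" if "i \<in> {1..N}" for i
    using ext_pt_chain_mono[OF assms, of 0 i] ext_pt_chain_mono[OF assms, of i "Suc N"] that
    by (simp add: ext_pt_def)
  show "ext_pt N x i \<in> {0..1}" if "i \<le> Suc N"
    using *[of i] that by (auto simp: ext_pt_def)
qed

lemma measurable_ext_pt [measurable]:
  assumes "i \<le> Suc N"
  shows "(\<lambda>x. ext_pt N x i) \<in> borel_measurable (PiM {1..N} (\<lambda>_. lborel))"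
proof -
  consider "i = 0" | "i = Suc N" | "i \<in> {1..N}" using assms by force
  then show ?thesis
  proof cases
    case 3
    then have "(\<lambda>x. x i) \<in> measurable (PiM {1..N} (\<lambda>_. lborel)) (lborel :: real measure)"
      by (rule measurable_component_singleton)
    then show ?thesis using 3 by (simp add: ext_pt_def)
  qed (simp_all add: ext_pt_def)
qed

definition gap_simplex :: "nat \<Rightarrow> (nat \<Rightarrow> real) set" where
  "gap_simplex N = {x. \<forall>i\<le>N. ext_pt N x i < ext_pt N x (Suc i)}"

definition gap :: "nat \<Rightarrow> (nat \<Rightarrow> real) \<Rightarrow> nat \<Rightarrow> real" where
  "gap N x i = ext_pt N x (Suc i) - ext_pt N x i"

lemma simplex_iff_gap: "x \<in> gap_simplex N \<longleftrightarrow> (\<forall>i\<le>N. 0 < gap N x i)"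
  by (simp add: gap_simplex_def gap_def)

lemma simplex_unit: "x \<in> gap_simplex N \<Longrightarrow> i \<in> {1..N} \<Longrightarrow> x i \<in> {0..1}"
  using ext_pt_in_unit(1)[of N x i] by (auto simp: gap_simplex_def)

lemma simplex_ext_unit: "x \<in> gap_simplex N \<Longrightarrow> i \<le> Suc N \<Longrightarrow> ext_pt N x i \<in> {0..1}"
  using ext_pt_in_unit(2)[of N x i] by (auto simp: gap_simplex_def)

lemma simplex_gap_le: "x \<in> gap_simplex N \<Longrightarrow> i \<le> N \<Longrightarrow> gap N x i \<le> 1"
  using simplex_ext_unit[of x N i] simplex_ext_unit[of x N "Suc i"] by (auto simp: gap_def)

lemma measurable_gap [measurable]:
  "i \<le> N \<Longrightarrow> (\<lambda>x. gap N x i) \<in> borel_measurable (PiM {1..N} (\<lambda>_. lborel))"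
  unfolding gap_def by measurable

lemma simplex_sets [measurable]:
  "gap_simplex N \<inter> space (PiM {1..N} (\<lambda>_. lborel)) \<in> sets (PiM {1..N} (\<lambda>_. lborel :: real measure))"
proof -
  have "{x \<in> space (PiM {1..N} (\<lambda>_. lborel)). \<forall>i\<in>{..N}. 0 < gap N x i} \<in> sets (PiM {1..N} (\<lambda>_. lborel :: real measure))"
    by (intro sets.sets_Collect_finite_All borel_measurable_less borel_measurable_const measurable_gap) auto
  moreover have "{x \<in> space (PiM {1..N} (\<lambda>_. lborel)). \<forall>i\<in>{..N}. 0 < gap N x i} = gap_simplex N \<inter> space (PiM {1..N} (\<lambda>_. lborel))"
    by (auto simp: simplex_iff_gap)
  ultimately show ?thesis by simp
qed

text \<open>Each partial derivative is continuous along its own coordinate line, which is what the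
  fundamental theorem of calculus in one variable asks for. The bound is required on the unit cube,
  which contains the simplex.\<close>

definition admissible :: "nat \<Rightarrow> ((nat \<Rightarrow> real) \<Rightarrow> real) \<Rightarrow> (nat \<Rightarrow> (nat \<Rightarrow> real) \<Rightarrow> real) \<Rightarrow> bool" where
  "admissible N W dW \<longleftrightarrow>
     W \<in> borel_measurable (PiM {1..N} (\<lambda>_. lborel)) \<and>
     (\<forall>k\<in>{1..N}. dW k \<in> borel_measurable (PiM {1..N} (\<lambda>_. lborel)) \<and>
        (\<forall>x s. ((\<lambda>s. W (x(k := s))) has_real_derivative dW k (x(k := s))) (at s)) \<and>
        (\<forall>x. continuous_on UNIV (\<lambda>s. dW k (x(k := s))))) \<and>
     (\<exists>B. \<forall>x. (\<forall>i\<in>{1..N}. x i \<in> {0..1}) \<longrightarrow> \<bar>W x\<bar> \<le> B \<and> (\<forall>k\<in>{1..N}. \<bar>dW k x\<bar> \<le> B))"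

lemma admissible_mult:
  assumes V: "admissible N V dV" and W: "admissible N W dW"
  shows "admissible N (\<lambda>x. V x * W x) (\<lambda>k x. dV k x * W x + V x * dW k x)"
proof -
  have cont: "continuous_on UNIV (\<lambda>s. X (x(k := s)))" if "admissible N X dX" "k \<in> {1..N}" for X dX k x
    using that unfolding admissible_def by (intro continuous_at_imp_continuous_on) (meson DERIV_isCont)
  obtain B where B: "\<And>x. (\<forall>i\<in>{1..N}. x i \<in> {0..1}) \<Longrightarrow> \<bar>V x\<bar> \<le> B \<and> (\<forall>k\<in>{1..N}. \<bar>dV k x\<bar> \<le> B)"
    using V unfolding admissible_def by blast
  obtain C where C: "\<And>x. (\<forall>i\<in>{1..N}. x i \<in> {0..1}) \<Longrightarrow> \<bar>W x\<bar> \<le> C \<and> (\<forall>k\<in>{1..N}. \<bar>dW k x\<bar> \<le> C)"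
    using W unfolding admissible_def by blast
  have "\<bar>V x * W x\<bar> \<le> 2 * (\<bar>B\<bar> * \<bar>C\<bar>) \<and> (\<forall>k\<in>{1..N}. \<bar>dV k x * W x + V x * dW k x\<bar> \<le> 2 * (\<bar>B\<bar> * \<bar>C\<bar>))"
    if x: "\<forall>i\<in>{1..N}. x i \<in> {0..1}" for x
  proof -
    have m: "\<bar>b * c\<bar> \<le> \<bar>B\<bar> * \<bar>C\<bar>" if "\<bar>b\<bar> \<le> B" "\<bar>c\<bar> \<le> C" for b c
      unfolding abs_mult using that by (intro mult_mono) auto
    have "\<bar>dV k x * W x + V x * dW k x\<bar> \<le> 2 * (\<bar>B\<bar> * \<bar>C\<bar>)" if "k \<in> {1..N}" for k
      using m[of "dV k x" "W x"] m[of "V x" "dW k x"] B[OF x] C[OF x] that by fastforce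
    moreover have "\<bar>V x * W x\<bar> \<le> 2 * (\<bar>B\<bar> * \<bar>C\<bar>)"
      using m[of "V x" "W x"] B[OF x] C[OF x] by fastforce
    ultimately show ?thesis by blast
  qed
  then have b: "\<exists>D. \<forall>x. (\<forall>i\<in>{1..N}. x i \<in> {0..1}) \<longrightarrow> \<bar>V x * W x\<bar> \<le> D \<and> (\<forall>k\<in>{1..N}. \<bar>dV k x * W x + V x * dW k x\<bar> \<le> D)"
    by blast
  have m: "V \<in> borel_measurable (PiM {1..N} (\<lambda>_. lborel))" "W \<in> borel_measurable (PiM {1..N} (\<lambda>_. lborel))"
    "k \<in> {1..N} \<Longrightarrow> dV k \<in> borel_measurable (PiM {1..N} (\<lambda>_. lborel))"
    "k \<in> {1..N} \<Longrightarrow> dW k \<in> borel_measurable (PiM {1..N} (\<lambda>_. lborel))" for k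
    using V W unfolding admissible_def by blast+
  show ?thesis
    unfolding admissible_def
  proof (intro conjI ballI allI b)
    show "(\<lambda>x. V x * W x) \<in> borel_measurable (PiM {1..N} (\<lambda>_. lborel))"
      by (intro borel_measurable_times m)
    fix k assume k: "k \<in> {1..N}"
    show "(\<lambda>x. dV k x * W x + V x * dW k x) \<in> borel_measurable (PiM {1..N} (\<lambda>_. lborel))"
      by (intro borel_measurable_times borel_measurable_add m k)
    have D: "((\<lambda>s. V (x(k := s))) has_real_derivative dV k (x(k := s))) (at s)"
       "((\<lambda>s. W (x(k := s))) has_real_derivative dW k (x(k := s))) (at s)" for x s
      using V W k unfolding admissible_def by blast+
    show "((\<lambda>s. V (x(k := s)) * W (x(k := s))) has_real_derivative
         dV k (x(k := s)) * W (x(k := s)) + V (x(k := s)) * dW k (x(k := s))) (at s)" for x s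
      using DERIV_mult[OF D(1)[of x s] D(2)[of x s]] by (simp add: mult.commute add.commute)
    have c: "continuous_on UNIV (\<lambda>s. dV k (x(k := s)))" "continuous_on UNIV (\<lambda>s. dW k (x(k := s)))" for x
      using V W k unfolding admissible_def by blast+
    show "continuous_on UNIV (\<lambda>s. dV k (x(k := s)) * W (x(k := s)) + V (x(k := s)) * dW k (x(k := s)))" for x
      by (intro continuous_intros c cont[OF V k] cont[OF W k])
  qed
qed

section \<open>Integration by parts against the regularised Dirichlet density\<close>

locale finite_ibp = test_field +
  fixes N :: nat and a :: "nat \<Rightarrow> real"
  assumes N: "N > 0" and a: "\<And>i. i \<le> N \<Longrightarrow> a i > 0"
begin

abbreviation LN :: "(nat \<Rightarrow> real) measure" where "LN \<equiv> PiM {1..N} (\<lambda>_. lborel)"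

definition rho :: "real \<Rightarrow> (nat \<Rightarrow> real) \<Rightarrow> real" where
  "rho c x = (\<Prod>i\<in>{..N}. rgap c (a i) (gap N x i))"

definition drho :: "real \<Rightarrow> nat \<Rightarrow> (nat \<Rightarrow> real) \<Rightarrow> real" where
  "drho c k x = (\<Sum>i\<in>{..N}. drgap c (a i) (gap N x i) * ((if Suc i = k then 1 else 0) - (if i = k then 1 else 0)) *
      (\<Prod>j\<in>{..N} - {i}. rgap c (a j) (gap N x j)))"

lemma gap_upd_DERIV:
  assumes "k \<in> {1..N}"
  shows "((\<lambda>s. gap N (x(k := s)) i) has_real_derivative ((if Suc i = k then 1 else 0) - (if i = k then 1 else 0))) (at s)"
  unfolding gap_def by (intro DERIV_diff ext_pt_upd_DERIV assms)

lemma gap_upd_cont: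
  assumes "k \<in> {1..N}"
  shows "continuous_on UNIV (\<lambda>s. gap N (x(k := s)) i)"
  by (intro continuous_at_imp_continuous_on ballI DERIV_isCont[OF gap_upd_DERIV[OF assms]])

lemma rho_DERIV:
  assumes c: "c > 0" and k: "k \<in> {1..N}"
  shows "((\<lambda>s. rho c (x(k := s))) has_real_derivative drho c k (x(k := s))) (at s)"
  unfolding rho_def drho_def
  by (rule has_field_derivative_prod) (intro DERIV_chain2[OF rgap_DERIV gap_upd_DERIV] c k a; simp)

lemma drho_cont:
  assumes c: "c > 0" and k: "k \<in> {1..N}"
  shows "continuous_on UNIV (\<lambda>s. drho c k (x(k := s)))"
  unfolding drho_def
  by (intro continuous_on_sum continuous_on_mult continuous_on_prod continuous_on_const
      continuous_on_compose2[OF rgap_continuous[OF c, of _ UNIV] gap_upd_cont[OF k]]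
      continuous_on_compose2[OF drgap_continuous[OF c, of _ UNIV] gap_upd_cont[OF k]] a) auto

lemma rho_cont:
  assumes c: "c > 0" and k: "k \<in> {1..N}"
  shows "continuous_on UNIV (\<lambda>s. rho c (x(k := s)))"
  by (intro continuous_at_imp_continuous_on ballI DERIV_isCont[OF rho_DERIV[OF assms]])

text \<open>Outside the simplex some gap is nonpositive. Its weight kills every product in which it
  occurs, and in the one summand of \<open>drho\<close> where this weight is differentiated, the
  derivative vanishes too.\<close>

lemma rho_zero:
  assumes "x \<notin> gap_simplex N" shows "rho c x = 0" "drho c k x = 0"
proof -
  obtain i where i: "i \<le> N" "gap N x i \<le> 0" using assms by (auto simp: simplex_iff_gap not_less)
  then show "rho c x = 0" unfolding rho_def by (auto simp: rgap_nonpos intro!: prod_zero bexI[of _ i])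
  have "drgap c (a l) (gap N x l) * ((if Suc l = k then 1 else 0) - (if l = k then 1 else 0)) *
      (\<Prod>j\<in>{..N} - {l}. rgap c (a j) (gap N x j)) = 0" for l
  proof (cases "l = i")
    case False
    then have "(\<Prod>j\<in>{..N} - {l}. rgap c (a j) (gap N x j)) = 0"
      using i by (auto simp: rgap_nonpos intro!: bexI[of _ i])
    then show ?thesis by simp
  qed (use i in \<open>simp add: rgap_nonpos\<close>)
  then show "drho c k x = 0" unfolding drho_def by (intro sum.neutral ballI)
qed

lemma rho_nonneg: "c > 0 \<Longrightarrow> 0 \<le> rho c x"
  unfolding rho_def by (intro prod_nonneg ballI rgap_nonneg)

lemma rho_measurable:
  assumes c: "c > 0"
  shows "rho c \<in> borel_measurable LN" "drho c k \<in> borel_measurable LN"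
proof -
  have r: "(\<lambda>x. rgap c (a i) (gap N x i)) \<in> borel_measurable LN"
    "(\<lambda>x. drgap c (a i) (gap N x i)) \<in> borel_measurable LN" if "i \<le> N" for i
    by (intro measurable_compose[OF measurable_gap[OF that]] borel_measurable_continuous_onI
        rgap_continuous drgap_continuous c a that)+
  show "rho c \<in> borel_measurable LN" unfolding rho_def[abs_def]
    by (intro borel_measurable_prod r) simp
  show "drho c k \<in> borel_measurable LN" unfolding drho_def[abs_def]
    by (intro borel_measurable_prod borel_measurable_sum borel_measurable_times r borel_measurable_const) auto
qed

lemma rho_bounded:
  assumes c: "c > 0"
  shows "\<exists>M\<ge>0. \<forall>x. \<bar>rho c x\<bar> \<le> M \<and> (\<forall>k. \<bar>drho c k x\<bar> \<le> M)"
proof -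
  define B where "B = 1 + c + (\<Sum>i\<in>{..N}. (\<bar>a i - 1\<bar> + 2) * c)"
  have B0: "0 \<le> (\<Sum>i\<in>{..N}. (\<bar>a i - 1\<bar> + 2) * c)" using c by (intro sum_nonneg) auto
  have B: "1 \<le> B" "c \<le> B" using c B0 by (auto simp: B_def)
  have B': "(\<bar>a i - 1\<bar> + 2) * c \<le> B" if "i \<le> N" for i
  proof -
    have "(\<bar>a i - 1\<bar> + 2) * c \<le> (\<Sum>i\<in>{..N}. (\<bar>a i - 1\<bar> + 2) * c)"
      by (rule member_le_sum) (use that c in auto)
    then show ?thesis using c by (simp add: B_def)
  qed
  define M where "M = B ^ Suc N + (\<Sum>i\<in>{..N}. B * 2 * B ^ N)"
  have M1: "B ^ Suc N \<ge> 0" "(\<Sum>i\<in>{..N}. B * 2 * B ^ N) \<ge> 0" using B by (auto intro!: sum_nonneg)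
  have "\<bar>rho c x\<bar> \<le> M \<and> (\<forall>k. \<bar>drho c k x\<bar> \<le> M)" for x
  proof (cases "x \<in> gap_simplex N")
    case True
    have r: "\<bar>rgap c (a i) (gap N x i)\<bar> \<le> B" "\<bar>drgap c (a i) (gap N x i)\<bar> \<le> B" if "i \<le> N" for i
      using rgap_bounds[OF c a[OF that] simplex_gap_le[OF True that]] B B'[OF that] by linarith+
    have p: "\<bar>\<Prod>i\<in>A. rgap c (a i) (gap N x i)\<bar> \<le> B ^ card A" if "A \<subseteq> {..N}" for A
    proof -
      have "(\<Prod>i\<in>A. \<bar>rgap c (a i) (gap N x i)\<bar>) \<le> (\<Prod>i\<in>A. B)"
        by (rule prod_mono) (use r that in auto)
      then show ?thesis by (simp add: abs_prod)
    qed
    have "\<bar>rho c x\<bar> \<le> B ^ Suc N" using p[of "{..N}"] by (simp add: rho_def)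
    moreover have "\<bar>drho c k x\<bar> \<le> (\<Sum>i\<in>{..N}. B * 2 * B ^ N)" for k
      unfolding drho_def
    proof (rule order_trans[OF sum_abs], rule sum_mono)
      fix i assume i: "i \<in> {..N}"
      have "\<bar>\<Prod>j\<in>{..N} - {i}. rgap c (a j) (gap N x j)\<bar> \<le> B ^ N" using p[of "{..N} - {i}"] i by simp
      then show "\<bar>drgap c (a i) (gap N x i) * ((if Suc i = k then 1 else 0) - (if i = k then 1 else 0)) *
          (\<Prod>j\<in>{..N} - {i}. rgap c (a j) (gap N x j))\<bar> \<le> B * 2 * B ^ N"
        unfolding abs_mult using r i B by (intro mult_mono) auto
    qed
    ultimately show ?thesis using M1 unfolding M_def by (meson add_increasing add_increasing2)
  next
    case False
    then show ?thesis using rho_zero[OF False] M1 by (simp add: M_def)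
  qed
  moreover have "M \<ge> 0" using M1 by (simp add: M_def)
  ultimately show ?thesis by blast
qed

lemma integrable_simplex_supported:
  fixes f :: "_ \<Rightarrow> real"
  assumes f: "f \<in> borel_measurable LN" and z: "\<And>x. x \<notin> gap_simplex N \<Longrightarrow> f x = 0"
    and b: "\<And>x. x \<in> gap_simplex N \<Longrightarrow> \<bar>f x\<bar> \<le> M"
  shows "integrable LN f"
proof -
  interpret product_sigma_finite "\<lambda>_::nat. lborel :: real measure" ..
  define A where "A = (\<Pi>\<^sub>E i\<in>{1..N}. {0..1::real})"
  have A: "A \<in> sets LN" unfolding A_def by (rule sets_PiM_I_finite) auto
  have "emeasure LN A = 1" unfolding A_def by (subst emeasure_PiM) auto
  then have i: "integrable LN (\<lambda>x. \<bar>M\<bar> * indicator A x)" using A by (intro integrable_mult_right integrable_real_indicator) auto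
  show ?thesis
  proof (rule Bochner_Integration.integrable_bound[OF i f], rule AE_I2)
    fix x assume x: "x \<in> space LN"
    show "norm (f x) \<le> norm (\<bar>M\<bar> * indicator A x)"
    proof (cases "x \<in> gap_simplex N")
      case True
      then have "x \<in> A" using x simplex_unit[OF True] unfolding A_def space_PiM by (auto simp: PiE_iff)
      then show ?thesis using b[OF True] by simp
    qed (simp add: z)
  qed
qed

text \<open>In each coordinate the regularised density is C^1 on the whole line and vanishes with
  its derivative off the simplex, so the faces contribute nothing. The values at 0 and 1 vanish with
  \<phi>. Fubini carries the one-dimensional identity to the product.\<close>

lemma integral_partial_zero:
  assumes W: "admissible N W dW" and c: "c > 0" and k: "k \<in> {1..N}"
  defines "dH \<equiv> \<lambda>x. dW k x * \<phi> (x k) * rho c x + W x * \<phi>' (x k) * rho c x + W x * \<phi> (x k) * drho c k x"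
  shows "integrable LN dH" "(\<integral>x. dH x \<partial>LN) = 0"
proof -
  interpret product_sigma_finite "\<lambda>_::nat. lborel :: real measure" ..
  obtain B where B: "\<And>x. (\<forall>i\<in>{1..N}. x i \<in> {0..1}) \<Longrightarrow> \<bar>W x\<bar> \<le> B \<and> (\<forall>k\<in>{1..N}. \<bar>dW k x\<bar> \<le> B)"
    using W unfolding admissible_def by blast
  have Wm [measurable]: "W \<in> borel_measurable LN" "dW k \<in> borel_measurable LN"
    and WD: "((\<lambda>s. W (x(k := s))) has_real_derivative dW k (x(k := s))) (at s)"
    and dWc: "continuous_on UNIV (\<lambda>s. dW k (x(k := s)))" for x s
    using W k unfolding admissible_def by blast+
  have Wc: "continuous_on UNIV (\<lambda>s. W (x(k := s)))" for x
    by (intro continuous_at_imp_continuous_on ballI DERIV_isCont[OF WD])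
  note [measurable] = rho_measurable[OF c]
  have xk [measurable]: "(\<lambda>x. x k) \<in> borel_measurable LN"
    using measurable_component_singleton[OF k, of "\<lambda>_. lborel :: real measure"] by simp
  obtain M where M: "M \<ge> 0" "\<And>x. \<bar>rho c x\<bar> \<le> M" "\<And>x k. \<bar>drho c k x\<bar> \<le> M"
    using rho_bounded[OF c] by blast
  show int: "integrable LN dH"
  proof (rule integrable_simplex_supported)
    show "dH \<in> borel_measurable LN" unfolding dH_def by measurable
    show "dH x = 0" if "x \<notin> gap_simplex N" for x using rho_zero[OF that] by (simp add: dH_def)
    fix x assume x: "x \<in> gap_simplex N"
    then have b: "\<bar>W x\<bar> \<le> \<bar>B\<bar>" "\<bar>dW k x\<bar> \<le> \<bar>B\<bar>" "\<bar>\<phi> (x k)\<bar> \<le> L" "\<bar>\<phi>' (x k)\<bar> \<le> L"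
      using B[of x] simplex_unit[OF x] k phi_bound phi'_bound by (auto intro: order_trans)
    have t: "\<bar>p * q * r\<bar> \<le> \<bar>B\<bar> * L * M" if "\<bar>p\<bar> \<le> \<bar>B\<bar>" "\<bar>q\<bar> \<le> L" "\<bar>r\<bar> \<le> M" for p q r
      unfolding abs_mult using that L_nonneg by (intro mult_mono) auto
    show "\<bar>dH x\<bar> \<le> 3 * (\<bar>B\<bar> * L * M)"
      unfolding dH_def
      using t[of "dW k x" "\<phi> (x k)" "rho c x"] t[of "W x" "\<phi>' (x k)" "rho c x"] t[of "W x" "\<phi> (x k)" "drho c k x"] b M
      by (smt (verit))
  qed
  have ins: "{1..N} = insert k ({1..N} - {k})" using k by auto
  have inner: "(\<integral>s. dH (x(k := s)) \<partial>lborel) = 0" for x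
  proof -
    define h where "h s = W (x(k := s)) * \<phi> s * rho c (x(k := s))" for s
    have D: "(h has_real_derivative dH (x(k := s))) (at s)" for s
      unfolding h_def dH_def
      by (rule derivative_eq_intros WD phi_DERIV rho_DERIV[OF c k] refl)+ (simp add: algebra_simps)
    have cont: "continuous_on UNIV (\<lambda>s. dH (x(k := s)))"
      unfolding dH_def
      by (simp only: fun_upd_same) (intro continuous_intros dWc Wc phi_cont phi'_cont rho_cont[OF c k] drho_cont[OF c k])
    have off: "dH (x(k := s)) = 0" if "s \<notin> {0..1}" for s
    proof -
      have "x(k := s) \<notin> gap_simplex N" using simplex_unit[of "x(k := s)" N k] that k by auto
      from rho_zero[OF this] show ?thesis by (simp add: dH_def)
    qed
    have "(\<integral>s. dH (x(k := s)) \<partial>lborel) = (\<integral>s. dH (x(k := s)) * indicator {0..1} s \<partial>lborel)"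
      by (rule Bochner_Integration.integral_cong) (use off in \<open>auto simp: indicator_def\<close>)
    also have "\<dots> = h 1 - h 0"
      by (rule integral_FTC_Icc_real) (use D cont in \<open>auto simp: continuous_on_eq_continuous_at\<close>)
    also have "\<dots> = 0" by (simp add: h_def phi0 phi1)
    finally show ?thesis .
  qed
  have "(\<integral>x. dH x \<partial>LN) = (\<integral>x. (\<integral>s. dH (x(k := s)) \<partial>lborel) \<partial>PiM ({1..N} - {k}) (\<lambda>_. lborel))"
    by (subst ins, rule product_integral_insert) (use int ins[symmetric] in auto)
  then show "(\<integral>x. dH x \<partial>LN) = 0" by (simp add: inner)
qed

end

context finite_ibp
begin

definition ddiff :: "(nat \<Rightarrow> real) \<Rightarrow> nat \<Rightarrow> real" where
  "ddiff x i = (\<phi> (ext_pt N x (Suc i)) - \<phi> (ext_pt N x i)) / gap N x i"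

text \<open>Summation by parts: moving point k to the right lengthens gap k - 1 and shortens gap k,
  so collecting terms by gaps turns values of \<phi> into differences over gaps. The outer points
  join the sum because \<phi> vanishes there, and \<open>mult_drgap\<close> trades the derivative of
  a weight for its logarithmic derivative.\<close>

lemma sum_phi_drho:
  "(\<Sum>k\<in>{1..N}. \<phi> (x k) * drho c k x) = rho c x * (\<Sum>i\<in>{..N}. qgap c (a i) (gap N x i) * ddiff x i)"
proof -
  define A where "A i = drgap c (a i) (gap N x i)" for i
  define P where "P i = (\<Prod>j\<in>{..N} - {i}. rgap c (a j) (gap N x j))" for i
  have inner: "(\<Sum>k\<in>{1..N}. \<phi> (x k) * ((if Suc i = k then 1 else 0) - (if i = k then 1 else 0))) =
      \<phi> (ext_pt N x (Suc i)) - \<phi> (ext_pt N x i)" if "i \<le> N" for i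
  proof -
    have s: "(\<Sum>k\<in>{1..N}. \<phi> (x k) * (if j = k then 1 else 0)) = \<phi> (ext_pt N x j)" if "j \<le> Suc N" for j
    proof -
      have "(\<Sum>k\<in>{1..N}. \<phi> (x k) * (if j = k then 1 else 0)) = (\<Sum>k\<in>{1..N}. if j = k then \<phi> (x k) else 0)"
        by (rule sum.cong) auto
      also have "\<dots> = (if j \<in> {1..N} then \<phi> (x j) else 0)" by (rule sum.delta') simp
      also have "\<dots> = \<phi> (ext_pt N x j)" using that by (auto simp: ext_pt_def phi0 phi1 le_Suc_eq)
      finally show ?thesis .
    qed
    have "(\<Sum>k\<in>{1..N}. \<phi> (x k) * ((if Suc i = k then 1 else 0) - (if i = k then 1 else 0))) =
      (\<Sum>k\<in>{1..N}. \<phi> (x k) * (if Suc i = k then 1 else 0)) - (\<Sum>k\<in>{1..N}. \<phi> (x k) * (if i = k then 1 else 0))"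
      unfolding right_diff_distrib sum_subtractf ..
    then show ?thesis using that by (simp only: s le_SucI Suc_le_mono)
  qed
  have "(\<Sum>k\<in>{1..N}. \<phi> (x k) * drho c k x) =
     (\<Sum>k\<in>{1..N}. \<Sum>i\<in>{..N}. A i * P i * (\<phi> (x k) * ((if Suc i = k then 1 else 0) - (if i = k then 1 else 0))))"
    unfolding drho_def A_def P_def sum_distrib_left by (intro sum.cong refl) (simp only: mult_ac)
  also have "\<dots> = (\<Sum>i\<in>{..N}. \<Sum>k\<in>{1..N}. A i * P i * (\<phi> (x k) * ((if Suc i = k then 1 else 0) - (if i = k then 1 else 0))))"
    by (rule sum.swap)
  also have "\<dots> = (\<Sum>i\<in>{..N}. A i * P i * (\<phi> (ext_pt N x (Suc i)) - \<phi> (ext_pt N x i)))"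
    unfolding sum_distrib_left[symmetric] by (intro sum.cong refl) (simp only: inner atMost_iff)
  also have "\<dots> = (\<Sum>i\<in>{..N}. rho c x * (qgap c (a i) (gap N x i) * ddiff x i))"
  proof (rule sum.cong[OF refl])
    fix i assume i: "i \<in> {..N}"
    have r: "rho c x = rgap c (a i) (gap N x i) * P i"
      unfolding rho_def P_def by (rule prod.remove) (use i in auto)
    \<comment> \<open>At an empty gap the divided difference is 0 by division by zero; the identity
      survives because \<open>drgap\<close> and \<open>rgap\<close> vanish there as well.\<close>
    have "A i * (\<phi> (ext_pt N x (Suc i)) - \<phi> (ext_pt N x i)) = qgap c (a i) (gap N x i) * ddiff x i * rgap c (a i) (gap N x i)"
    proof (cases "gap N x i = 0")
      case False
      then have "\<phi> (ext_pt N x (Suc i)) - \<phi> (ext_pt N x i) = gap N x i * ddiff x i" by (simp add: ddiff_def)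
      then have "A i * (\<phi> (ext_pt N x (Suc i)) - \<phi> (ext_pt N x i)) = (gap N x i * drgap c (a i) (gap N x i)) * ddiff x i"
        by (simp add: A_def)
      then show ?thesis unfolding mult_drgap by (simp only: mult_ac)
    qed (simp add: A_def rgap_nonpos)
    then show "A i * P i * (\<phi> (ext_pt N x (Suc i)) - \<phi> (ext_pt N x i)) = rho c x * (qgap c (a i) (gap N x i) * ddiff x i)"
      unfolding r by algebra
  qed
  finally show ?thesis by (simp only: sum_distrib_left)
qed

definition reg_integrand :: "((nat \<Rightarrow> real) \<Rightarrow> real) \<Rightarrow> (nat \<Rightarrow> (nat \<Rightarrow> real) \<Rightarrow> real) \<Rightarrow> real \<Rightarrow> (nat \<Rightarrow> real) \<Rightarrow> real" where
  "reg_integrand W dW c x = (\<Sum>k\<in>{1..N}. \<phi> (x k) * dW k x) +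
     W x * ((\<Sum>k\<in>{1..N}. \<phi>' (x k)) + (\<Sum>i\<in>{..N}. qgap c (a i) (gap N x i) * ddiff x i))"

lemma reg_ibp:
  assumes W: "admissible N W dW" and c: "c > 0"
  shows "integrable LN (\<lambda>x. reg_integrand W dW c x * rho c x)" "(\<integral>x. reg_integrand W dW c x * rho c x \<partial>LN) = 0"
proof -
  define dH where "dH k x = dW k x * \<phi> (x k) * rho c x + W x * \<phi>' (x k) * rho c x + W x * \<phi> (x k) * drho c k x" for k x
  have dH: "integrable LN (dH k)" "(\<integral>x. dH k x \<partial>LN) = 0" if "k \<in> {1..N}" for k
    unfolding dH_def using integral_partial_zero[OF W c that] by auto
  have "(\<Sum>k\<in>{1..N}. dH k x) = reg_integrand W dW c x * rho c x" for x
  proof -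
    have "(\<Sum>k\<in>{1..N}. dH k x) = (\<Sum>k\<in>{1..N}. \<phi> (x k) * dW k x) * rho c x + W x * (\<Sum>k\<in>{1..N}. \<phi>' (x k)) * rho c x
        + W x * (\<Sum>k\<in>{1..N}. \<phi> (x k) * drho c k x)"
      unfolding dH_def sum.distrib sum_distrib_left sum_distrib_right by (simp only: mult_ac)
    then show ?thesis unfolding sum_phi_drho reg_integrand_def by algebra
  qed
  moreover have "integrable LN (\<lambda>x. \<Sum>k\<in>{1..N}. dH k x)"
    by (rule Bochner_Integration.integrable_sum) (rule dH)
  moreover have "(\<integral>x. (\<Sum>k\<in>{1..N}. dH k x) \<partial>LN) = (\<Sum>k\<in>{1..N}. (\<integral>x. dH k x \<partial>LN))"
    by (rule Bochner_Integration.integral_sum) (rule dH)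
  ultimately show "integrable LN (\<lambda>x. reg_integrand W dW c x * rho c x)" "(\<integral>x. reg_integrand W dW c x * rho c x \<partial>LN) = 0"
    using dH(2) by simp_all
qed

section \<open>Removing the regularisation of the density\<close>

definition rho_lim :: "(nat \<Rightarrow> real) \<Rightarrow> real" where
  "rho_lim x = indicator (gap_simplex N) x * (\<Prod>i\<in>{..N}. gap N x i powr (a i - 1))"

text \<open>The first sum is the divergence of the field, the second its derivative of the logarithm
  of \<open>rho_lim\<close>, already summed by parts.\<close>

definition divg :: "(nat \<Rightarrow> real) \<Rightarrow> real" where
  "divg x = (\<Sum>k\<in>{1..N}. \<phi>' (x k)) + (\<Sum>i\<in>{..N}. (a i - 1) * ddiff x i)"

lemma ddiff_bounds:
  assumes "x \<in> gap_simplex N" "i \<le> N"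
  shows "\<bar>ddiff x i\<bar> \<le> L" "\<bar>\<phi>' (ext_pt N x (Suc i)) - ddiff x i\<bar> \<le> K * gap N x i"
  using divided_difference[of "ext_pt N x i" "ext_pt N x (Suc i)"]
    simplex_ext_unit[OF assms(1), of i] simplex_ext_unit[OF assms(1), of "Suc i"] assms
  by (auto simp: ddiff_def gap_def gap_simplex_def)

lemma sum_gap: "(\<Sum>i\<in>{..N}. gap N x i) = 1"
  using sum_lessThan_telescope[of "ext_pt N x" "Suc N"]
  by (simp only: gap_def lessThan_Suc_atMost) (simp add: ext_pt_def)

text \<open>K bounds the paired differences, since the gaps add up to 1. L is the one unpaired value
  \<phi>' 1. The last term is what remains of the exponents once the pairing has used up their
  \<open>-1\<close>. Nothing here grows with N for a fixed sum of the \<open>a i\<close>.\<close>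

lemma divg_bound:
  assumes x: "x \<in> gap_simplex N"
  shows "\<bar>divg x\<bar> \<le> K + L + (\<Sum>i\<in>{..N}. a i) * L"
proof -
  \<comment> \<open>There are N grid points but N + 1 gaps. The right end points of the gaps are the
    grid points and the outer point 1, which accounts for the extra term \<phi>' 1.\<close>
  have "(\<Sum>i\<in>{..N}. \<phi>' (ext_pt N x (Suc i))) = (\<Sum>i<N. \<phi>' (ext_pt N x (Suc i))) + \<phi>' 1"
    unfolding lessThan_Suc_atMost[symmetric] sum.lessThan_Suc by (simp add: ext_pt_def)
  also have "(\<Sum>i<N. \<phi>' (ext_pt N x (Suc i))) = (\<Sum>i<N. \<phi>' (x (Suc i)))"
    by (rule sum.cong) (auto simp: ext_pt_def)
  also have "\<dots> = (\<Sum>k\<in>{1..N}. \<phi>' (x k))" by (simp add: sum.atLeast1_atMost_eq)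
  finally have s: "(\<Sum>k\<in>{1..N}. \<phi>' (x k)) = (\<Sum>i\<in>{..N}. \<phi>' (ext_pt N x (Suc i))) - \<phi>' 1" by simp
  have eq: "divg x = (\<Sum>i\<in>{..N}. \<phi>' (ext_pt N x (Suc i)) - ddiff x i) - \<phi>' 1 + (\<Sum>i\<in>{..N}. a i * ddiff x i)"
    unfolding divg_def s by (simp add: sum_subtractf left_diff_distrib)
  have "\<bar>\<Sum>i\<in>{..N}. \<phi>' (ext_pt N x (Suc i)) - ddiff x i\<bar> \<le> (\<Sum>i\<in>{..N}. K * gap N x i)"
    by (rule order_trans[OF sum_abs]) (intro sum_mono ddiff_bounds x, simp)
  also have "\<dots> = K" unfolding sum_distrib_left[symmetric] sum_gap by simp
  finally have 1: "\<bar>\<Sum>i\<in>{..N}. \<phi>' (ext_pt N x (Suc i)) - ddiff x i\<bar> \<le> K" .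
  have "\<bar>\<Sum>i\<in>{..N}. a i * ddiff x i\<bar> \<le> (\<Sum>i\<in>{..N}. a i * L)"
    by (rule order_trans[OF sum_abs], rule sum_mono)
       (use a ddiff_bounds(1)[OF x] in \<open>auto simp: abs_mult less_imp_le intro!: mult_mono\<close>)
  then have 2: "\<bar>\<Sum>i\<in>{..N}. a i * ddiff x i\<bar> \<le> (\<Sum>i\<in>{..N}. a i) * L" by (simp only: sum_distrib_right)
  have 3: "\<bar>\<phi>' 1\<bar> \<le> L" by (rule phi'_bound) simp
  show ?thesis unfolding eq using 1 2 3 by linarith
qed

lemma rho_lim_zero: "x \<notin> gap_simplex N \<Longrightarrow> rho_lim x = 0"
  by (simp add: rho_lim_def)

lemma rho_lim_nonneg: "0 \<le> rho_lim x"
  by (auto simp: rho_lim_def intro!: mult_nonneg_nonneg prod_nonneg)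

lemma rho_le_lim:
  assumes "c > 0" shows "rho c x \<le> rho_lim x"
proof (cases "x \<in> gap_simplex N")
  case True
  have "rho c x \<le> (\<Prod>i\<in>{..N}. gap N x i powr (a i - 1))"
    unfolding rho_def using True assms by (intro prod_mono) (auto simp: simplex_iff_gap rgap_nonneg rgap_le)
  then show ?thesis using True by (simp add: rho_lim_def)
qed (simp add: rho_zero rho_lim_zero)

lemma rho_tendsto: "(\<lambda>n. rho (real (Suc n)) x) \<longlonglongrightarrow> rho_lim x"
proof (cases "x \<in> gap_simplex N")
  case True
  have "(\<lambda>n. rho (real (Suc n)) x) \<longlonglongrightarrow> (\<Prod>i\<in>{..N}. gap N x i powr (a i - 1))"
    unfolding rho_def using True by (intro tendsto_prod rgap_tendsto) (auto simp: simplex_iff_gap)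
  then show ?thesis using True by (simp add: rho_lim_def)
next
  case False
  then show ?thesis by (simp only: rho_zero[OF False] rho_lim_zero[OF False] tendsto_const)
qed

text \<open>The bound does not depend on \<open>c\<close>: \<open>qgap\<close> stays within |a i -
  1| + 2 and the divided differences within L. Together with \<open>rho_le_lim\<close> this gives
  one integrable majorant for all regularisations.\<close>

lemma admissible_bounds:
  assumes "admissible N W dW"
  obtains B where "B \<ge> 0" "\<And>x. x \<in> gap_simplex N \<Longrightarrow> \<bar>W x\<bar> \<le> B"
    "\<And>x. x \<in> gap_simplex N \<Longrightarrow> \<bar>\<Sum>k\<in>{1..N}. \<phi> (x k) * dW k x\<bar> \<le> B"
    "\<And>x c. x \<in> gap_simplex N \<Longrightarrow> c > 0 \<Longrightarrow> \<bar>reg_integrand W dW c x\<bar> \<le> B"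
proof -
  obtain B where B: "\<And>x. (\<forall>i\<in>{1..N}. x i \<in> {0..1}) \<Longrightarrow> \<bar>W x\<bar> \<le> B \<and> (\<forall>k\<in>{1..N}. \<bar>dW k x\<bar> \<le> B)"
    using assms unfolding admissible_def by blast
  have B0: "B \<ge> 0" using B[of "\<lambda>_. 0"] by auto
  define E where "E = (\<Sum>k\<in>{1..N}. L) + (\<Sum>i\<in>{..N}. (\<bar>a i - 1\<bar> + 2) * L)"
  define D where "D = (\<Sum>k\<in>{1..N}. L * B)"
  have E0: "E \<ge> 0" unfolding E_def by (intro add_nonneg_nonneg sum_nonneg mult_nonneg_nonneg L_nonneg) auto
  have D0: "D \<ge> 0" unfolding D_def by (intro sum_nonneg mult_nonneg_nonneg L_nonneg B0)
  show ?thesis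
  proof (rule that[of "B + D + B * E"])
    show "B + D + B * E \<ge> 0" using B0 D0 E0 by simp
    fix x assume x: "x \<in> gap_simplex N"
    have bx: "\<bar>W x\<bar> \<le> B" "\<And>k. k \<in> {1..N} \<Longrightarrow> \<bar>dW k x\<bar> \<le> B" using B[of x] simplex_unit[OF x] by auto
    have BE: "B * E \<ge> 0" using B0 E0 by simp
    show "\<bar>W x\<bar> \<le> B + D + B * E" using bx(1) D0 BE by linarith
    have 1: "\<bar>\<Sum>k\<in>{1..N}. \<phi> (x k) * dW k x\<bar> \<le> D"
      unfolding D_def
      by (rule order_trans[OF sum_abs], rule sum_mono)
         (use phi_bound simplex_unit[OF x] bx(2) L_nonneg in \<open>auto simp: abs_mult intro!: mult_mono\<close>)
    then show "\<bar>\<Sum>k\<in>{1..N}. \<phi> (x k) * dW k x\<bar> \<le> B + D + B * E" using B0 BE by linarith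
    fix c :: real assume c: "c > 0"
    have 2: "\<bar>\<Sum>k\<in>{1..N}. \<phi>' (x k)\<bar> \<le> (\<Sum>k\<in>{1..N}. L)"
      by (rule order_trans[OF sum_abs], rule sum_mono) (use phi'_bound simplex_unit[OF x] in auto)
    have 3: "\<bar>\<Sum>i\<in>{..N}. qgap c (a i) (gap N x i) * ddiff x i\<bar> \<le> (\<Sum>i\<in>{..N}. (\<bar>a i - 1\<bar> + 2) * L)"
      by (rule order_trans[OF sum_abs], rule sum_mono)
         (use qgap_bound[OF c] ddiff_bounds(1)[OF x] in \<open>auto simp: abs_mult intro!: mult_mono\<close>)
    have "\<bar>W x * ((\<Sum>k\<in>{1..N}. \<phi>' (x k)) + (\<Sum>i\<in>{..N}. qgap c (a i) (gap N x i) * ddiff x i))\<bar> \<le> B * E"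
      unfolding abs_mult E_def using bx(1) B0 2 3 by (intro mult_mono) auto
    then show "\<bar>reg_integrand W dW c x\<bar> \<le> B + D + B * E"
      unfolding reg_integrand_def using 1 B0 by linarith
  qed
qed

lemma admissible_sum_measurable:
  assumes "admissible N W dW"
  shows "(\<lambda>x. \<Sum>k\<in>{1..N}. \<phi> (x k) * dW k x) \<in> borel_measurable LN"
proof (intro borel_measurable_sum borel_measurable_times)
  fix k assume k: "k \<in> {1..N}"
  show "dW k \<in> borel_measurable LN" using assms k unfolding admissible_def by blast
  have "(\<lambda>x. x k) \<in> borel_measurable LN"
    using measurable_component_singleton[OF k, of "\<lambda>_. lborel :: real measure"] by simp
  then show "(\<lambda>x. \<phi> (x k)) \<in> borel_measurable LN" by (rule measurable_compose[OF _ phi_measurable(1)])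
qed

text \<open>As \<open>c\<close> runs to infinity, the derivative along the field plus
  \<open>W * divg\<close> is seen to have integral zero against \<open>rho_lim\<close>. Only then is
  the divergence estimated, so that the resulting inequality no longer mentions it and can be passed
  to ever finer grids.\<close>

lemma ibp:
  assumes W: "admissible N W dW" and int: "integrable LN rho_lim"
  shows "\<bar>\<integral>x. (\<Sum>k\<in>{1..N}. \<phi> (x k) * dW k x) * rho_lim x \<partial>LN\<bar>
    \<le> (K + L + (\<Sum>i\<in>{..N}. a i) * L) * (\<integral>x. \<bar>W x\<bar> * rho_lim x \<partial>LN)"
proof -
  define D where "D x = (\<Sum>k\<in>{1..N}. \<phi> (x k) * dW k x)" for x
  obtain B where B: "B \<ge> 0" "\<And>x. x \<in> gap_simplex N \<Longrightarrow> \<bar>W x\<bar> \<le> B"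
    "\<And>x. x \<in> gap_simplex N \<Longrightarrow> \<bar>D x\<bar> \<le> B"
    "\<And>x c. x \<in> gap_simplex N \<Longrightarrow> c > 0 \<Longrightarrow> \<bar>reg_integrand W dW c x\<bar> \<le> B"
    using admissible_bounds[OF W] unfolding D_def by metis
  have lim: "(\<lambda>n. reg_integrand W dW (real (Suc n)) x * rho (real (Suc n)) x) \<longlonglongrightarrow> (D x + W x * divg x) * rho_lim x" for x
  proof (cases "x \<in> gap_simplex N")
    case True
    then show ?thesis unfolding reg_integrand_def D_def divg_def
      by (intro tendsto_intros qgap_tendsto rho_tendsto) (auto simp: simplex_iff_gap)
  next
    case False
    then show ?thesis by (simp only: rho_zero[OF False] rho_lim_zero[OF False] mult_zero_right tendsto_const)
  qed
  have m: "(\<lambda>x. reg_integrand W dW (real (Suc n)) x * rho (real (Suc n)) x) \<in> borel_measurable LN" for n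
    by (rule borel_measurable_integrable[OF reg_ibp(1)[OF W]]) simp
  have mlim: "(\<lambda>x. (D x + W x * divg x) * rho_lim x) \<in> borel_measurable LN"
    by (rule borel_measurable_LIMSEQ_real[OF lim m])
  have bd: "norm (reg_integrand W dW (real (Suc n)) x * rho (real (Suc n)) x) \<le> B * rho_lim x" for n x
  proof (cases "x \<in> gap_simplex N")
    case True
    have "\<bar>rho (real (Suc n)) x\<bar> \<le> rho_lim x"
      using rho_nonneg[of "real (Suc n)" x] rho_le_lim[of "real (Suc n)" x] by simp
    then show ?thesis using B(1) B(4)[OF True, of "real (Suc n)"] unfolding real_norm_def abs_mult
      by (intro mult_mono) auto
  qed (simp add: rho_zero rho_lim_zero)
  have "(\<lambda>n. \<integral>x. reg_integrand W dW (real (Suc n)) x * rho (real (Suc n)) x \<partial>LN) \<longlonglongrightarrow> (\<integral>x. (D x + W x * divg x) * rho_lim x \<partial>LN)"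
    by (rule integral_dominated_convergence[where w="\<lambda>x. B * rho_lim x"])
       (use int lim bd m mlim in auto)
  moreover have "(\<integral>x. reg_integrand W dW (real (Suc n)) x * rho (real (Suc n)) x \<partial>LN) = 0" for n
    by (rule reg_ibp(2)[OF W]) simp
  ultimately have zero: "(\<integral>x. (D x + W x * divg x) * rho_lim x \<partial>LN) = 0"
    by (simp add: LIMSEQ_const_iff)
  have ilim: "integrable LN (\<lambda>x. (D x + W x * divg x) * rho_lim x)"
    by (rule integrable_dominated_convergence[where w="\<lambda>x. B * rho_lim x"
          and s="\<lambda>n x. reg_integrand W dW (real (Suc n)) x * rho (real (Suc n)) x"])
       (use int lim bd m mlim in auto)
  have rm: "rho_lim \<in> borel_measurable LN" using int by (rule borel_measurable_integrable)
  have Wm: "W \<in> borel_measurable LN" using W unfolding admissible_def by blast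
  have iD: "integrable LN (\<lambda>x. D x * rho_lim x)"
  proof (rule Bochner_Integration.integrable_bound[OF integrable_mult_right[OF int, of B]])
    show "(\<lambda>x. D x * rho_lim x) \<in> borel_measurable LN"
      unfolding D_def by (intro borel_measurable_times admissible_sum_measurable[OF W] rm)
    show "AE x in LN. norm (D x * rho_lim x) \<le> norm (B * rho_lim x)"
    proof (rule AE_I2)
      show "norm (D x * rho_lim x) \<le> norm (B * rho_lim x)" for x
        using B(1) B(3)[of x] by (cases "x \<in> gap_simplex N") (auto simp: abs_mult rho_lim_zero intro!: mult_right_mono)
    qed
  qed
  have iW: "integrable LN (\<lambda>x. \<bar>W x\<bar> * rho_lim x)"
  proof (rule Bochner_Integration.integrable_bound[OF integrable_mult_right[OF int, of B]])
    show "(\<lambda>x. \<bar>W x\<bar> * rho_lim x) \<in> borel_measurable LN"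
      by (intro borel_measurable_times borel_measurable_abs Wm rm)
    show "AE x in LN. norm (\<bar>W x\<bar> * rho_lim x) \<le> norm (B * rho_lim x)"
    proof (rule AE_I2)
      show "norm (\<bar>W x\<bar> * rho_lim x) \<le> norm (B * rho_lim x)" for x
        using B(1) B(2)[of x] by (cases "x \<in> gap_simplex N") (auto simp: abs_mult rho_lim_zero intro!: mult_right_mono)
    qed
  qed
  let ?C = "K + L + (\<Sum>i\<in>{..N}. a i) * L"
  have iV: "integrable LN (\<lambda>x. W x * divg x * rho_lim x)"
    using Bochner_Integration.integrable_diff[OF ilim iD] by (simp add: algebra_simps)
  have "(\<integral>x. (D x + W x * divg x) * rho_lim x \<partial>LN) = (\<integral>x. D x * rho_lim x \<partial>LN) + (\<integral>x. W x * divg x * rho_lim x \<partial>LN)"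
    unfolding distrib_right by (rule Bochner_Integration.integral_add[OF iD iV])
  then have "\<bar>\<integral>x. D x * rho_lim x \<partial>LN\<bar> = \<bar>\<integral>x. W x * divg x * rho_lim x \<partial>LN\<bar>" using zero by linarith
  also have "\<dots> \<le> (\<integral>x. \<bar>W x * divg x * rho_lim x\<bar> \<partial>LN)" by (rule integral_abs_bound)
  also have "\<dots> \<le> (\<integral>x. ?C * (\<bar>W x\<bar> * rho_lim x) \<partial>LN)"
  proof (rule integral_mono)
    show "\<bar>W x * divg x * rho_lim x\<bar> \<le> ?C * (\<bar>W x\<bar> * rho_lim x)" for x
    proof (cases "x \<in> gap_simplex N")
      case True
      have "\<bar>W x * divg x * rho_lim x\<bar> = \<bar>divg x\<bar> * (\<bar>W x\<bar> * rho_lim x)"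
        using rho_lim_nonneg[of x] by (simp add: abs_mult)
      also have "\<dots> \<le> ?C * (\<bar>W x\<bar> * rho_lim x)"
        by (intro mult_right_mono divg_bound True mult_nonneg_nonneg rho_lim_nonneg) simp
      finally show ?thesis .
    qed (simp add: rho_lim_zero)
  qed (intro integrable_abs iV integrable_mult_right iW)+
  finally show ?thesis by (simp add: D_def)
qed

end

section \<open>The entropic measure\<close>

lemma gap_density_measurable:
  "(\<lambda>x. indicator (gap_simplex N) x * (\<Prod>i\<in>{..N}. gap N x i powr b i) :: real) \<in> borel_measurable (PiM {1..N} (\<lambda>_. lborel))"
proof (rule borel_measurable_times)
  have "(\<lambda>x. indicator (gap_simplex N \<inter> space (PiM {1..N} (\<lambda>_. lborel))) x :: real) \<in> borel_measurable (PiM {1..N} (\<lambda>_. lborel))"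
    by (intro borel_measurable_indicator simplex_sets)
  then show "(indicator (gap_simplex N) :: _ \<Rightarrow> real) \<in> borel_measurable (PiM {1..N} (\<lambda>_. lborel))"
    by (rule measurable_cong[THEN iffD1, rotated]) (auto simp: indicator_def)
  show "(\<lambda>x. \<Prod>i\<in>{..N}. gap N x i powr b i) \<in> borel_measurable (PiM {1..N} (\<lambda>_. lborel))"
  proof (rule borel_measurable_prod)
    fix i assume "i \<in> {..N}"
    moreover have "(\<lambda>y. y powr b i) \<in> borel_measurable borel" by measurable
    ultimately show "(\<lambda>x. gap N x i powr b i) \<in> borel_measurable (PiM {1..N} (\<lambda>_. lborel))"
      by (intro measurable_compose[OF measurable_gap]) auto
  qed
qed

lemma fdd_density_eq:
  "fdd_density \<beta> N t x = ennreal (Gamma \<beta> / (\<Prod>i\<le>N. Gamma (\<beta> * (t (Suc i) - t i))) *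
     (indicator (gap_simplex N) x * (\<Prod>i\<in>{..N}. gap N x i powr (\<beta> * (t (Suc i) - t i) - 1))))"
  by (simp add: fdd_density_def gap_def gap_simplex_def mult_ac)

locale entropic =
  fixes \<beta> :: real and Q :: "(real \<Rightarrow> real) measure"
  assumes beta: "\<beta> > 0" and entropic: "is_entropic_measure \<beta> Q"
begin

sublocale Q: prob_space Q using entropic by (simp add: is_entropic_measure_def)

sublocale P: pair_prob_space Q Leb01 ..

abbreviation "QL \<equiv> Q \<Otimes>\<^sub>M Leb01"

lemma sets_Q: "sets Q = sets G0M" using entropic by (simp add: is_entropic_measure_def)

lemma space_Q [simp]: "space Q = G0"
proof -
  have "space Q = space G0M" using sets_Q by (rule sets_eq_imp_space_eq)
  then show ?thesis by (simp add: G0M_def space_measure_of_conv)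
qed

lemma space_QL [simp]: "space QL = G0 \<times> {0..1}"
  by (simp add: space_pair_measure)

lemma eval_measurable:
  assumes "t \<in> {0..1}" shows "(\<lambda>g. g t) \<in> borel_measurable Q"
proof (cases "t = 1")
  case True
  have "(\<lambda>g. 1::real) \<in> borel_measurable Q" by simp
  then show ?thesis by (rule measurable_cong[THEN iffD1, rotated]) (simp add: True G0_one)
next
  case False
  have gen: "{{g \<in> G0. g t \<in> A} |t A. t \<in> {0..<1} \<and> A \<in> sets borel} \<subseteq> Pow G0" by auto
  show ?thesis
  proof (rule measurableI)
    fix A :: "real set" assume "A \<in> sets borel"
    then have "{g \<in> G0. g t \<in> A} \<in> sets G0M"
      unfolding G0M_def sets_measure_of[OF gen] using assms False
      by (intro sigma_sets.Basic CollectI exI[of _ t] exI[of _ A]) auto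
    moreover have "(\<lambda>g. g t) -` A \<inter> space Q = {g \<in> G0. g t \<in> A}" by auto
    ultimately show "(\<lambda>g. g t) -` A \<inter> space Q \<in> sets Q" by (simp add: sets_Q)
  qed simp
qed

lemma step_measurable:
  "(\<lambda>x. fst x (real (idx (Suc n) (snd x)) / real (Suc n))) \<in> borel_measurable QL"
proof -
  \<comment> \<open>The value 0 is never attained, as \<open>idx\<close> lies in {1..Suc n}. For
    these indices the sample point belongs to [0,1], where evaluation is measurable.\<close>
  define f where "f k x = (if k \<in> {1..Suc n} then fst x (real k / real (Suc n)) else 0)"
    for k and x :: "(real \<Rightarrow> real) \<times> real"
  have "(\<lambda>x. f (idx (Suc n) (snd x)) x) \<in> borel_measurable QL"
  proof (rule measurable_compose_countable)
    show "f k \<in> borel_measurable QL" for k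
    proof (cases "k \<in> {1..Suc n}")
      case True
      then have "real k / real (Suc n) \<in> {0..1}" by (auto simp: divide_simps)
      then have "(\<lambda>x. fst x (real k / real (Suc n))) \<in> borel_measurable QL"
        by (intro measurable_compose[OF measurable_fst eval_measurable])
      then show ?thesis unfolding f_def if_P[OF True] .
    next
      case False
      show ?thesis unfolding f_def if_not_P[OF False] by simp
    qed
    show "(\<lambda>x. idx (Suc n) (snd x)) \<in> measurable QL (count_space UNIV)"
      by (rule measurable_compose[OF measurable_snd measurable_idx])
  qed
  moreover have "idx (Suc n) t \<in> {1..Suc n}" for t by (rule idx_mem) simp
  ultimately show ?thesis unfolding f_def by simp
qed

text \<open>A step path is jointly measurable as a countable choice among evaluations. Sampling at
  right end points converges for every path and every t, so no null set intervenes.\<close>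

lemma joint_measurable [measurable]: "(\<lambda>x. fst x (snd x)) \<in> borel_measurable QL"
proof (rule borel_measurable_LIMSEQ_real[OF _ step_measurable])
  show "(\<lambda>n. fst x (real (idx (Suc n) (snd x)) / real (Suc n))) \<longlonglongrightarrow> fst x (snd x)" if "x \<in> space QL" for x
    by (rule G0_step_tendsto) (use that in auto)
qed

lemma path_measurable: "g \<in> G0 \<Longrightarrow> g \<in> borel_measurable Leb01"
  using measurable_Pair2[OF joint_measurable, of g] by simp

lemma path_step_measurable:
  "g \<in> G0 \<Longrightarrow> (\<lambda>t. g (real (idx (Suc n) t) / real (Suc n))) \<in> borel_measurable Leb01"
  using measurable_Pair2[OF step_measurable, of g n] by simp

lemma grid_measurable:
  assumes "\<And>i. i \<in> {1..N} \<Longrightarrow> t i \<in> {0..1}"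
  shows "(\<lambda>g. \<lambda>i\<in>{1..N}. g (t i)) \<in> measurable Q (PiM {1..N} (\<lambda>_. lborel))"
  by (rule measurable_restrict) (use eval_measurable[OF assms] in simp)

lemma fdd:
  assumes "t 0 = 0" "t (Suc N) = 1" "\<And>i. i \<le> N \<Longrightarrow> t i < t (Suc i)"
  shows "distr Q (PiM {1..N} (\<lambda>_. lborel)) (\<lambda>g. \<lambda>i\<in>{1..N}. g (t i)) = density (PiM {1..N} (\<lambda>_. lborel)) (fdd_density \<beta> N t)"
  using entropic assms unfolding is_entropic_measure_def by blast

lemma fdd_AE_simplex:
  assumes t: "t 0 = 0" "t (Suc N) = 1" "\<And>i. i \<le> N \<Longrightarrow> t i < t (Suc i)" "\<And>i. i \<in> {1..N} \<Longrightarrow> t i \<in> {0..1}"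
  shows "AE g in Q. (\<lambda>i\<in>{1..N}. g (t i)) \<in> gap_simplex N"
proof (rule AE_distrD[OF grid_measurable[OF t(4)]])
  have m: "fdd_density \<beta> N t \<in> borel_measurable (PiM {1..N} (\<lambda>_. lborel))"
    unfolding fdd_density_eq[abs_def] by (intro measurable_compose[OF _ measurable_ennreal] borel_measurable_times borel_measurable_const gap_density_measurable)
  have "AE x in density (PiM {1..N} (\<lambda>_. lborel)) (fdd_density \<beta> N t). x \<in> gap_simplex N"
    unfolding AE_density[OF m] by (rule AE_I2) (auto simp: fdd_density_eq indicator_def split: if_splits)
  then show "AE x in distr Q (PiM {1..N} (\<lambda>_. lborel)) (\<lambda>g. \<lambda>i\<in>{1..N}. g (t i)). x \<in> gap_simplex N"
    by (subst fdd[OF t(1-3)])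
qed

lemma AE_strict_pair:
  assumes "0 < s" "s < t" "t < 1"
  shows "AE g in Q. 0 < g s \<and> g s < g t \<and> g t < 1"
proof -
  define T where "T i = (if i = 0 then 0 else if i = 1 then s else if i = 2 then t else 1)" for i :: nat
  have i2: "i = 0 \<or> i = 1 \<or> i = 2" if "i \<le> 2" for i :: nat using that by auto
  have "AE g in Q. (\<lambda>i\<in>{1..2}. g (T i)) \<in> gap_simplex 2"
  proof (rule fdd_AE_simplex)
    show "T i < T (Suc i)" if "i \<le> 2" for i using i2[OF that] assms by (auto simp: T_def)
    show "T i \<in> {0..1}" for i using assms by (auto simp: T_def)
  qed (auto simp: T_def)
  then show ?thesis
  proof eventually_elim
    case (elim g)
    have "gap 2 (\<lambda>i\<in>{1..2}. g (T i)) i > 0" if "i \<le> 2" for i using elim that by (simp add: simplex_iff_gap)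
    from this[of 0] this[of 1] this[of 2] show ?case by (simp add: gap_def ext_pt_def T_def)
  qed
qed

definition strict_path :: "(real \<Rightarrow> real) \<Rightarrow> bool" where
  "strict_path g \<longleftrightarrow> (\<forall>s t. 0 \<le> s \<and> s < t \<and> t \<le> 1 \<longrightarrow> g s < g t) \<and> (\<forall>t\<in>{0<..<1}. 0 < g t \<and> g t < 1)"

text \<open>Countably many rational pairs suffice. Two rationals are inserted between s and t:
  monotonicity gives weak inequalities at s and t, and the strict one comes from the pair. This also
  reaches the end points 0 and 1, which are not interior grid points.\<close>

lemma AE_strict_path: "AE g in Q. strict_path g"
proof -
  define R where "R = {(s, t). s \<in> \<rat> \<and> t \<in> \<rat> \<and> 0 < s \<and> s < t \<and> t < (1::real)}"
  have "countable R"
    by (rule countable_subset[of _ "\<rat> \<times> \<rat>"]) (auto simp: R_def countable_rat)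
  then have "AE g in Q. \<forall>p\<in>R. 0 < g (fst p) \<and> g (fst p) < g (snd p) \<and> g (snd p) < 1"
    by (subst AE_ball_countable) (auto simp: R_def intro!: AE_strict_pair simp del: AE_conj_iff)
  moreover have "AE g in Q. g \<in> G0" using AE_space[of Q] by simp
  ultimately show ?thesis
  proof eventually_elim
    case (elim g)
    have less: "g s < g t" "g s < 1" "0 < g t" if st: "0 \<le> s" "s < t" "t \<le> 1" for s t
    proof -
      obtain p where p: "p \<in> \<rat>" "s < p" "p < t" using Rats_dense_in_real[OF st(2)] by (elim bexE conjE)
      obtain q where q: "q \<in> \<rat>" "p < q" "q < t" using Rats_dense_in_real[OF p(3)] by (elim bexE conjE)
      have "(p, q) \<in> R" using p q st by (simp add: R_def)
      from elim(1)[rule_format, OF this] have "0 < g p" "g p < g q" "g q < 1" by simp_all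
      moreover have "g s \<le> g p" "g q \<le> g t" using st p q by (auto intro!: G0_mono[OF elim(2)])
      ultimately show "g s < g t" "g s < 1" "0 < g t" by auto
    qed
    show ?case unfolding strict_path_def
    proof (intro conjI allI impI ballI)
      show "g s < g t" if "0 \<le> s \<and> s < t \<and> t \<le> 1" for s t using less(1) that by blast
      show "0 < g t" if "t \<in> {0<..<1}" for t using less(3)[of 0 t] that by simp
      show "g t < 1" if "t \<in> {0<..<1}" for t using less(2)[of t 1] that by simp
    qed
  qed
qed

abbreviation grid :: "nat \<Rightarrow> (real \<Rightarrow> real) \<Rightarrow> nat \<Rightarrow> real" where
  "grid N g \<equiv> (\<lambda>i\<in>{1..N}. g (real i / real (Suc N)))"

lemma grid_simplex_measurable: "grid N \<in> measurable Q (PiM {1..N} (\<lambda>_. lborel))"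
  by (rule grid_measurable) (auto simp: divide_simps)

text \<open>On the uniform grid every parameter is \<beta> / (N + 1), and over the N + 1 gaps they
  add up to \<beta>. Hence the constant is the same for all N.\<close>

lemma ibp_grid:
  assumes tf: "test_field \<phi> \<phi>' K L" and N: "N > 0" and W: "admissible N W dW"
  shows "\<bar>\<integral>g. (\<Sum>k\<in>{1..N}. \<phi> (grid N g k) * dW k (grid N g)) \<partial>Q\<bar> \<le> (K + L + \<beta> * L) * (\<integral>g. \<bar>W (grid N g)\<bar> \<partial>Q)"
proof -
  define t where "t i = real i / real (Suc N)" for i
  define a where "a i = \<beta> * (t (Suc i) - t i)" for i
  have dt: "t (Suc i) - t i = 1 / real (Suc N)" for i by (simp add: t_def diff_divide_distrib[symmetric])
  have apos: "a i > 0" for i using beta by (simp add: a_def dt)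
  interpret finite_ibp \<phi> \<phi>' K L N a
    using tf N apos by (simp add: finite_ibp_def finite_ibp_axioms_def)
  have asum: "(\<Sum>i\<in>{..N}. a i) = \<beta>" by (simp add: a_def dt)
  define C where "C = Gamma \<beta> / (\<Prod>i\<le>N. Gamma (a i))"
  have C: "C > 0" unfolding C_def by (intro divide_pos_pos prod_pos Gamma_real_pos beta) (use apos in auto)
  have fd: "fdd_density \<beta> N t = (\<lambda>x. ennreal (C * rho_lim x))"
    by (simp add: fdd_density_eq fun_eq_iff rho_lim_def C_def a_def)
  have rm [measurable]: "rho_lim \<in> borel_measurable LN"
    unfolding rho_lim_def[abs_def] by (rule gap_density_measurable)
  have "distr Q LN (\<lambda>g. \<lambda>i\<in>{1..N}. g (t i)) = density LN (fdd_density \<beta> N t)"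
  proof (rule fdd)
    show "t i < t (Suc i)" for i using dt[of i] by (simp add: t_def divide_strict_right_mono)
  qed (simp_all add: t_def)
  then have D: "distr Q LN (grid N) = density LN (\<lambda>x. ennreal (C * rho_lim x))"
    unfolding fd by (simp add: t_def[abs_def])
  \<comment> \<open>Up to the factor \<open>C\<close>, \<open>rho_lim\<close> is the density of a
    probability law. Its integral is therefore finite, without any evaluation of Dirichlet
    integrals.\<close>
  have int: "integrable LN rho_lim"
  proof -
    interpret D: prob_space "distr Q LN (grid N)" by (rule Q.prob_space_distr[OF grid_simplex_measurable])
    have m: "(\<lambda>x. ennreal (C * rho_lim x)) \<in> borel_measurable LN"
      by (intro measurable_compose[OF _ measurable_ennreal] borel_measurable_times borel_measurable_const rm)
    have "(\<integral>\<^sup>+x. ennreal (C * rho_lim x) \<partial>LN) = (\<integral>\<^sup>+x. ennreal (C * rho_lim x) * indicator (space LN) x \<partial>LN)"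
      by (rule nn_integral_cong) simp
    also have "\<dots> = emeasure (density LN (\<lambda>x. ennreal (C * rho_lim x))) (space LN)"
      by (rule emeasure_density[symmetric, OF m sets.top])
    also have "\<dots> = 1" using D.emeasure_space_1 unfolding D space_density .
    finally have "(\<integral>\<^sup>+x. ennreal (C * rho_lim x) \<partial>LN) = 1" .
    then have "integrable LN (\<lambda>x. C * rho_lim x)"
      using C rho_lim_nonneg by (intro integrableI_nonneg borel_measurable_times borel_measurable_const rm) auto
    then show ?thesis using C by (simp add: integrable_mult_left_iff)
  qed
  have tr: "(\<integral>g. h (grid N g) \<partial>Q) = C * (\<integral>x. h x * rho_lim x \<partial>LN)" if h: "h \<in> borel_measurable LN" for h :: "_ \<Rightarrow> real"
  proof -
    have "(\<integral>g. h (grid N g) \<partial>Q) = (\<integral>x. h x \<partial>distr Q LN (grid N))"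
      by (rule integral_distr[symmetric, OF grid_simplex_measurable h])
    also have "\<dots> = (\<integral>x. (C * rho_lim x) * h x \<partial>LN)"
      unfolding D
    proof (rule integral_real_density)
      show "(\<lambda>x. C * rho_lim x) \<in> borel_measurable LN"
        by (intro borel_measurable_times borel_measurable_const rm)
      show "AE x in LN. 0 \<le> C * rho_lim x" using C rho_lim_nonneg by (intro AE_I2) simp
    qed (rule h)
    also have "\<dots> = (\<integral>x. C * (h x * rho_lim x) \<partial>LN)" by (simp only: mult_ac)
    also have "\<dots> = C * (\<integral>x. h x * rho_lim x \<partial>LN)" by simp
    finally show ?thesis .
  qed
  have Wm: "W \<in> borel_measurable LN" using W unfolding admissible_def by blast
  have "\<bar>\<integral>g. (\<Sum>k\<in>{1..N}. \<phi> (grid N g k) * dW k (grid N g)) \<partial>Q\<bar>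
     = C * \<bar>\<integral>x. (\<Sum>k\<in>{1..N}. \<phi> (x k) * dW k x) * rho_lim x \<partial>LN\<bar>"
    using C by (subst tr[OF admissible_sum_measurable[OF W]]) (simp add: abs_mult)
  also have "\<dots> \<le> C * ((K + L + (\<Sum>i\<in>{..N}. a i) * L) * (\<integral>x. \<bar>W x\<bar> * rho_lim x \<partial>LN))"
    by (intro mult_left_mono ibp W int) (use C in simp)
  also have "\<dots> = (K + L + \<beta> * L) * (C * (\<integral>x. \<bar>W x\<bar> * rho_lim x \<partial>LN))"
    unfolding asum by (simp only: mult_ac)
  also have "C * (\<integral>x. \<bar>W x\<bar> * rho_lim x \<partial>LN) = (\<integral>g. \<bar>W (grid N g)\<bar> \<partial>Q)"
    by (rule tr[symmetric]) (use Wm in simp)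
  finally show ?thesis .
qed

text \<open>A common frame for the approximations in both directions: functionals
  \<open>ls n i\<close> of the path and kernels \<open>ks n i\<close> of path and time. The uniform
  bound \<open>B\<close> confines the arguments to a box on which \<open>U\<close> and its partial
  derivatives are bounded, and dominated convergence does the rest. Constant sequences give plain
  membership in L^2.\<close>

lemma cylinder_L2conv:
  assumes C: "C1_Rm m U dU"
    and lm: "\<And>n i. i < m \<Longrightarrow> ls n i \<in> borel_measurable Q" "\<And>i. i < m \<Longrightarrow> l i \<in> borel_measurable Q"
    and km: "\<And>n i. i < m \<Longrightarrow> ks n i \<in> borel_measurable QL" "\<And>i. i < m \<Longrightarrow> k i \<in> borel_measurable QL"
    and lb: "\<And>n i g. i < m \<Longrightarrow> g \<in> G0 \<Longrightarrow> \<bar>ls n i g\<bar> \<le> B"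
    and ll: "\<And>i. i < m \<Longrightarrow> AE g in Q. (\<lambda>n. ls n i g) \<longlonglongrightarrow> l i g"
    and kl: "\<And>i. i < m \<Longrightarrow> AE x in QL. (\<lambda>n. ks n i x) \<longlonglongrightarrow> k i x"
    and h: "\<And>i. i < m \<Longrightarrow> L2 QL (h i)"
    and kb: "\<And>n i x. i < m \<Longrightarrow> x \<in> space QL \<Longrightarrow> \<bar>ks n i x\<bar> \<le> h i x"
  shows "L2conv Q (\<lambda>n g. U (\<lambda>i. ls n i g)) (\<lambda>g. U (\<lambda>i. l i g))"
    "L2conv QL (\<lambda>n x. \<Sum>i<m. dU i (\<lambda>j. ls n j (fst x)) * ks n i x) (\<lambda>x. \<Sum>i<m. dU i (\<lambda>j. l j (fst x)) * k i x)"
proof -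
  obtain D where D: "\<And>x. (\<And>i. i < m \<Longrightarrow> \<bar>x i\<bar> \<le> B) \<Longrightarrow> \<bar>U x\<bar> \<le> D"
    "\<And>i x. i < m \<Longrightarrow> (\<And>i. i < m \<Longrightarrow> \<bar>x i\<bar> \<le> B) \<Longrightarrow> \<bar>dU i x\<bar> \<le> D"
    using C1_Rm_bounded_on_box[OF C] by metis
  have ll': "AE g in Q. \<forall>i\<in>{..<m}. (\<lambda>n. ls n i g) \<longlonglongrightarrow> l i g"
    by (rule AE_finite_allI) (use ll in auto)
  have kl': "AE x in QL. \<forall>i\<in>{..<m}. (\<lambda>n. ks n i x) \<longlonglongrightarrow> k i x"
    by (rule AE_finite_allI) (use kl in auto)
  show "L2conv Q (\<lambda>n g. U (\<lambda>i. ls n i g)) (\<lambda>g. U (\<lambda>i. l i g))"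
  proof (rule L2conv_dominated[where h="\<lambda>_. D"])
    show "L2 Q (\<lambda>_. D)" by (rule Q.L2_bounded[of _ "\<bar>D\<bar>"]) auto
    show "(\<lambda>g. U (\<lambda>i. ls n i g)) \<in> borel_measurable Q" for n
      by (rule borel_measurable_C1_Rm(1)[OF C]) (use lm in auto)
    show "(\<lambda>g. U (\<lambda>i. l i g)) \<in> borel_measurable Q"
      by (rule borel_measurable_C1_Rm(1)[OF C]) (use lm in auto)
    show "AE g in Q. (\<lambda>n. U (\<lambda>i. ls n i g)) \<longlonglongrightarrow> U (\<lambda>i. l i g)"
      using ll' by eventually_elim (rule C1_Rm_tendsto[OF C], simp)
    show "AE g in Q. \<bar>U (\<lambda>i. ls n i g)\<bar> \<le> D" for n
      by (rule AE_I2) (use D(1) lb in simp)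
  qed
  have ll'': "AE x in QL. \<forall>i\<in>{..<m}. (\<lambda>n. ls n i (fst x)) \<longlonglongrightarrow> l i (fst x)"
    by (rule AE_pair_fst[OF ll']) (rule Leb01.sigma_finite_measure_axioms)
  show "L2conv QL (\<lambda>n x. \<Sum>i<m. dU i (\<lambda>j. ls n j (fst x)) * ks n i x) (\<lambda>x. \<Sum>i<m. dU i (\<lambda>j. l j (fst x)) * k i x)"
  proof (rule L2conv_dominated[where h="\<lambda>x. D * (\<Sum>i<m. h i x)"])
    show "L2 QL (\<lambda>x. D * (\<Sum>i<m. h i x))" by (intro L2_cmult L2_sum h) simp
    show "(\<lambda>x. \<Sum>i<m. dU i (\<lambda>j. ls n j (fst x)) * ks n i x) \<in> borel_measurable QL" for n
      by (intro borel_measurable_sum borel_measurable_times km borel_measurable_C1_Rm(2)[OF C]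
          measurable_compose[OF measurable_fst lm(1)]) auto
    show "(\<lambda>x. \<Sum>i<m. dU i (\<lambda>j. l j (fst x)) * k i x) \<in> borel_measurable QL"
      by (intro borel_measurable_sum borel_measurable_times km borel_measurable_C1_Rm(2)[OF C]
          measurable_compose[OF measurable_fst lm(2)]) auto
    show "AE x in QL. (\<lambda>n. \<Sum>i<m. dU i (\<lambda>j. ls n j (fst x)) * ks n i x) \<longlonglongrightarrow> (\<Sum>i<m. dU i (\<lambda>j. l j (fst x)) * k i x)"
      using ll'' kl'
    proof eventually_elim
      case (elim x)
      show ?case
        by (intro tendsto_sum tendsto_mult C1_Rm_deriv_tendsto[OF C]) (use elim in auto)
    qed
    show "AE x in QL. \<bar>\<Sum>i<m. dU i (\<lambda>j. ls n j (fst x)) * ks n i x\<bar> \<le> D * (\<Sum>i<m. h i x)" for n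
    proof (rule AE_I2)
      fix x assume x: "x \<in> space QL"
      have "\<bar>\<Sum>i<m. dU i (\<lambda>j. ls n j (fst x)) * ks n i x\<bar> \<le> (\<Sum>i<m. D * h i x)"
      proof (rule order_trans[OF sum_abs], rule sum_mono)
        fix i assume i: "i \<in> {..<m}"
        have "\<bar>dU i (\<lambda>j. ls n j (fst x))\<bar> \<le> D" by (rule D(2)) (use i lb x in auto)
        moreover have "\<bar>ks n i x\<bar> \<le> h i x" using kb i x by blast
        ultimately show "\<bar>dU i (\<lambda>j. ls n j (fst x)) * ks n i x\<bar> \<le> D * h i x"
          unfolding abs_mult by (intro mult_mono) auto
      qed
      then show "\<bar>\<Sum>i<m. dU i (\<lambda>j. ls n j (fst x)) * ks n i x\<bar> \<le> D * (\<Sum>i<m. h i x)"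
        by (simp add: sum_distrib_left)
    qed
  qed
qed

end

section \<open>Integration by parts for cylinder functions\<close>

lemma C1_iff:
  "(u, Du) \<in> C1 \<longleftrightarrow> (\<exists>m U dU f. C1_Rm m U dU \<and> (\<forall>i<m. L2 Leb01 (f i)) \<and>
      u = (\<lambda>g. U (\<lambda>i. \<integral>t. f i t * g t \<partial>Leb01)) \<and>
      Du = (\<lambda>g t. \<Sum>i<m. dU i (\<lambda>j. \<integral>s. f j s * g s \<partial>Leb01) * f i t))"
  by (simp add: C1_def L2_def)

definition cellint :: "nat \<Rightarrow> (real \<Rightarrow> real) \<Rightarrow> nat \<Rightarrow> real" where
  "cellint N f k = (\<integral>t. f t * indicator {t. idx (Suc N) t = k} t \<partial>Leb01)"

text \<open>The i-th linear functional of the path sampled at the right end points of N + 1 cells,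
  seen as a function of the N interior samples. The last cell is sampled at 1, where
  \<open>ext_pt\<close> supplies the constant value 1; so the functional is affine in the samples,
  with slopes \<open>cellint\<close>.\<close>

definition coarse :: "nat \<Rightarrow> (nat \<Rightarrow> real \<Rightarrow> real) \<Rightarrow> (nat \<Rightarrow> real) \<Rightarrow> nat \<Rightarrow> real" where
  "coarse N f x i = (\<Sum>k\<in>{1..Suc N}. cellint N (f i) k * ext_pt N x k)"

lemma coarse_admissible:
  assumes C: "C1_Rm m U dU"
  shows "admissible N (\<lambda>x. U (coarse N f x)) (\<lambda>k x. \<Sum>i<m. dU i (coarse N f x) * cellint N (f i) k)"
proof -
  have D: "((\<lambda>s. coarse N f (x(k := s)) i) has_real_derivative cellint N (f i) k) (at s)"
    if k: "k \<in> {1..N}" for k x s i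
  proof -
    have "((\<lambda>s. coarse N f (x(k := s)) i) has_real_derivative
        (\<Sum>j\<in>{1..Suc N}. cellint N (f i) j * (if j = k then 1 else 0))) (at s)"
      unfolding coarse_def by (intro DERIV_sum DERIV_cmult ext_pt_upd_DERIV k)
    also have "(\<Sum>j\<in>{1..Suc N}. cellint N (f i) j * (if j = k then 1 else 0)) = (\<Sum>j\<in>{1..Suc N}. if j = k then cellint N (f i) j else 0)"
      by (rule sum.cong) auto
    also have "\<dots> = cellint N (f i) k" using k by (subst sum.delta) auto
    finally show ?thesis .
  qed
  have m: "(\<lambda>x. coarse N f x i) \<in> borel_measurable (PiM {1..N} (\<lambda>_. lborel))" for i
    unfolding coarse_def by (intro borel_measurable_sum borel_measurable_times borel_measurable_const measurable_ext_pt) simp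
  define B where "B = (\<Sum>i<m. \<Sum>k\<in>{1..Suc N}. \<bar>cellint N (f i) k\<bar>)"
  have cb: "\<bar>coarse N f x i\<bar> \<le> B" if x: "\<forall>i\<in>{1..N}. x i \<in> {0..1}" and i: "i < m" for x i
  proof -
    have e: "\<bar>ext_pt N x k\<bar> \<le> 1" if "k \<in> {1..Suc N}" for k using x that by (auto simp: ext_pt_def)
    have "\<bar>coarse N f x i\<bar> \<le> (\<Sum>k\<in>{1..Suc N}. \<bar>cellint N (f i) k\<bar>)"
      unfolding coarse_def
    proof (rule order_trans[OF sum_abs], rule sum_mono)
      fix k assume "k \<in> {1..Suc N}"
      then show "\<bar>cellint N (f i) k * ext_pt N x k\<bar> \<le> \<bar>cellint N (f i) k\<bar>"
        using mult_left_mono[OF e, of k "\<bar>cellint N (f i) k\<bar>"] by (simp add: abs_mult)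
    qed
    also have "\<dots> \<le> B" unfolding B_def
      by (rule member_le_sum[of i "{..<m}" "\<lambda>i. \<Sum>k\<in>{1..Suc N}. \<bar>cellint N (f i) k\<bar>"]) (use i in \<open>auto intro: sum_nonneg\<close>)
    finally show ?thesis .
  qed
  obtain M where M: "\<And>x. (\<And>i. i < m \<Longrightarrow> \<bar>x i\<bar> \<le> B) \<Longrightarrow> \<bar>U x\<bar> \<le> M"
    "\<And>i x. i < m \<Longrightarrow> (\<And>i. i < m \<Longrightarrow> \<bar>x i\<bar> \<le> B) \<Longrightarrow> \<bar>dU i x\<bar> \<le> M"
    using C1_Rm_bounded_on_box[OF C] by metis
  define M' where "M' = \<bar>M\<bar> + (\<Sum>k\<in>{1..N}. \<Sum>i<m. \<bar>M\<bar> * \<bar>cellint N (f i) k\<bar>)"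
  have M'0: "0 \<le> (\<Sum>k\<in>{1..N}. \<Sum>i<m. \<bar>M\<bar> * \<bar>cellint N (f i) k\<bar>)" by (intro sum_nonneg) auto
  have bound: "\<bar>U (coarse N f x)\<bar> \<le> M' \<and> (\<forall>k\<in>{1..N}. \<bar>\<Sum>i<m. dU i (coarse N f x) * cellint N (f i) k\<bar> \<le> M')"
    if x: "\<forall>i\<in>{1..N}. x i \<in> {0..1}" for x
  proof (intro conjI ballI)
    have "\<bar>U (coarse N f x)\<bar> \<le> M" by (rule M(1)) (rule cb[OF x])
    then show "\<bar>U (coarse N f x)\<bar> \<le> M'" using M'0 unfolding M'_def by linarith
    fix k assume k: "k \<in> {1..N}"
    have "\<bar>\<Sum>i<m. dU i (coarse N f x) * cellint N (f i) k\<bar> \<le> (\<Sum>i<m. \<bar>M\<bar> * \<bar>cellint N (f i) k\<bar>)"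
    proof (rule order_trans[OF sum_abs], rule sum_mono)
      fix i assume "i \<in> {..<m}"
      then have "\<bar>dU i (coarse N f x)\<bar> \<le> M" by (intro M(2) cb[OF x]) auto
      then show "\<bar>dU i (coarse N f x) * cellint N (f i) k\<bar> \<le> \<bar>M\<bar> * \<bar>cellint N (f i) k\<bar>"
        unfolding abs_mult by (intro mult_right_mono) auto
    qed
    also have "\<dots> \<le> (\<Sum>k\<in>{1..N}. \<Sum>i<m. \<bar>M\<bar> * \<bar>cellint N (f i) k\<bar>)"
      by (rule member_le_sum[of k "{1..N}" "\<lambda>k. \<Sum>i<m. \<bar>M\<bar> * \<bar>cellint N (f i) k\<bar>"]) (use k in \<open>auto intro: sum_nonneg\<close>)
    finally show "\<bar>\<Sum>i<m. dU i (coarse N f x) * cellint N (f i) k\<bar> \<le> M'" unfolding M'_def by linarith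
  qed
  show ?thesis
    unfolding admissible_def
  proof (intro conjI ballI allI)
    show "(\<lambda>x. U (coarse N f x)) \<in> borel_measurable (PiM {1..N} (\<lambda>_. lborel))"
      by (rule borel_measurable_C1_Rm(1)[OF C]) (rule m)
    fix k assume k: "k \<in> {1..N}"
    show "(\<lambda>x. \<Sum>i<m. dU i (coarse N f x) * cellint N (f i) k) \<in> borel_measurable (PiM {1..N} (\<lambda>_. lborel))"
      by (intro borel_measurable_sum borel_measurable_times borel_measurable_const borel_measurable_C1_Rm(2)[OF C] m) simp
    show "((\<lambda>s. U (coarse N f (x(k := s)))) has_real_derivative
         (\<Sum>i<m. dU i (coarse N f (x(k := s))) * cellint N (f i) k)) (at s)" for x s
      by (rule C1_Rm_chain[OF C]) (rule D[OF k])
    show "continuous_on UNIV (\<lambda>s. \<Sum>i<m. dU i (coarse N f (x(k := s))) * cellint N (f i) k)" for x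
    proof (intro continuous_on_sum continuous_on_mult continuous_on_const)
      fix i assume i: "i \<in> {..<m}"
      show "continuous_on UNIV (\<lambda>s. dU i (coarse N f (x(k := s))))"
        unfolding continuous_on_def
      proof
        fix s
        have "((\<lambda>t. coarse N f (x(k := t)) j) \<longlongrightarrow> coarse N f (x(k := s)) j) (at s)" for j
          using DERIV_isCont[OF D[OF k, of x j s]] by (simp add: isCont_def)
        then show "((\<lambda>s. dU i (coarse N f (x(k := s)))) \<longlongrightarrow> dU i (coarse N f (x(k := s)))) (at s)"
          by (intro C1_Rm_deriv_tendsto[OF C]) (use i in auto)
      qed
    qed
  next
    show "\<exists>B. \<forall>x. (\<forall>i\<in>{1..N}. x i \<in> {0..1}) \<longrightarrow> \<bar>U (coarse N f x)\<bar> \<le> B \<and>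
        (\<forall>k\<in>{1..N}. \<bar>\<Sum>i<m. dU i (coarse N f x) * cellint N (f i) k\<bar> \<le> B)"
      using bound by blast
  qed
qed

context entropic
begin

abbreviation stepped :: "nat \<Rightarrow> (real \<Rightarrow> real) \<Rightarrow> real \<Rightarrow> real" where
  "stepped N g t \<equiv> g (real (idx (Suc N) t) / real (Suc N))"

lemma ext_pt_grid: "g \<in> G0 \<Longrightarrow> k \<in> {1..Suc N} \<Longrightarrow> ext_pt N (grid N g) k = g (real k / real (Suc N))"
  by (auto simp: ext_pt_def G0_one simp del: of_nat_Suc)

text \<open>\<psi> is arbitrary, so that one identity covers the functional itself and, with \<phi>
  in its place, its derivative along the field.\<close>

lemma cellint_sum:
  assumes g: "g \<in> G0" and f: "L2 Leb01 f"
  shows "(\<Sum>k\<in>{1..Suc N}. cellint N f k * \<psi> (ext_pt N (grid N g) k)) = (\<integral>t. f t * \<psi> (stepped N g t) \<partial>Leb01)"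
proof -
  have "(\<integral>t. f t * \<psi> (stepped N g t) \<partial>Leb01) = (\<Sum>k\<in>{1..Suc N}. cellint N f k * \<psi> (g (real k / real (Suc N))))"
    unfolding cellint_def
    by (rule integral_step[where \<psi>="\<lambda>k. \<psi> (g (real k / real (Suc N)))"]) (use Leb01.L2_integrable[OF f] in auto)
  also have "\<dots> = (\<Sum>k\<in>{1..Suc N}. cellint N f k * \<psi> (ext_pt N (grid N g) k))"
    by (rule sum.cong) (simp_all only: ext_pt_grid[OF g])
  finally show ?thesis ..
qed

lemma coarse_grid:
  "g \<in> G0 \<Longrightarrow> L2 Leb01 (f i) \<Longrightarrow> coarse N f (grid N g) i = (\<integral>t. f i t * stepped N g t \<partial>Leb01)"
  unfolding coarse_def using cellint_sum[where \<psi>="\<lambda>y. y"] by simp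

lemma stepped_unit: "g \<in> G0 \<Longrightarrow> t \<in> {0..1} \<Longrightarrow> stepped N g t \<in> {0..1}"
  using G0_bounds G0_step_mem by simp

lemma stepped_integral_bound:
  assumes g: "g \<in> G0" and f: "L2 Leb01 f" and \<psi>: "\<psi> \<in> borel_measurable borel" "\<And>y. y \<in> {0..1} \<Longrightarrow> \<bar>\<psi> y\<bar> \<le> c"
  shows "\<bar>\<integral>t. f t * \<psi> (stepped N g t) \<partial>Leb01\<bar> \<le> c * (\<integral>t. \<bar>f t\<bar> \<partial>Leb01)"
proof -
  have i: "integrable Leb01 f" by (rule Leb01.L2_integrable[OF f])
  have b: "\<bar>f t * \<psi> (stepped N g t)\<bar> \<le> c * \<bar>f t\<bar>" if "t \<in> {0..1}" for t
    using mult_right_mono[OF \<psi>(2)[OF stepped_unit[OF g that]], of "\<bar>f t\<bar>"] by (simp add: abs_mult mult.commute)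
  have "\<bar>\<integral>t. f t * \<psi> (stepped N g t) \<partial>Leb01\<bar> \<le> (\<integral>t. \<bar>f t * \<psi> (stepped N g t)\<bar> \<partial>Leb01)"
    by (rule integral_abs_bound)
  also have "\<dots> \<le> (\<integral>t. c * \<bar>f t\<bar> \<partial>Leb01)"
  proof (rule integral_mono)
    show "integrable Leb01 (\<lambda>t. \<bar>f t * \<psi> (stepped N g t)\<bar>)"
    proof (rule Bochner_Integration.integrable_bound[OF integrable_mult_right[OF integrable_abs[OF i], of c]])
      show "(\<lambda>t. \<bar>f t * \<psi> (stepped N g t)\<bar>) \<in> borel_measurable Leb01"
        by (intro borel_measurable_abs borel_measurable_times L2_measurable[OF f]
            measurable_compose[OF path_step_measurable[OF g] \<psi>(1)])
      show "AE t in Leb01. norm \<bar>f t * \<psi> (stepped N g t)\<bar> \<le> norm (c * \<bar>f t\<bar>)"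
      proof (rule AE_I2)
        fix t assume "t \<in> space Leb01"
        then show "norm \<bar>f t * \<psi> (stepped N g t)\<bar> \<le> norm (c * \<bar>f t\<bar>)" using b[of t] by (simp only: space_Leb01) simp
      qed
    qed
  qed (use i b in auto)
  finally show ?thesis by simp
qed

lemma stepped_integral_tendsto:
  assumes g: "g \<in> G0" and f: "L2 Leb01 f" and \<psi>: "continuous_on UNIV \<psi>" "\<And>y. y \<in> {0..1} \<Longrightarrow> \<bar>\<psi> y\<bar> \<le> c"
  shows "(\<lambda>n. \<integral>t. f t * \<psi> (stepped n g t) \<partial>Leb01) \<longlonglongrightarrow> (\<integral>t. f t * \<psi> (g t) \<partial>Leb01)"
proof (rule integral_dominated_convergence[where w="\<lambda>t. c * \<bar>f t\<bar>"])
  have \<psi>m: "\<psi> \<in> borel_measurable borel" by (rule borel_measurable_continuous_onI[OF \<psi>(1)])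
  show "(\<lambda>t. f t * \<psi> (g t)) \<in> borel_measurable Leb01"
    by (intro borel_measurable_times L2_measurable[OF f] measurable_compose[OF path_measurable[OF g] \<psi>m])
  show "(\<lambda>t. f t * \<psi> (stepped n g t)) \<in> borel_measurable Leb01" for n
    by (intro borel_measurable_times L2_measurable[OF f] measurable_compose[OF path_step_measurable[OF g] \<psi>m])
  show "integrable Leb01 (\<lambda>t. c * \<bar>f t\<bar>)" using Leb01.L2_integrable[OF f] by simp
  show "AE t in Leb01. (\<lambda>n. f t * \<psi> (stepped n g t)) \<longlonglongrightarrow> f t * \<psi> (g t)"
  proof (rule AE_I2)
    fix t assume "t \<in> space Leb01"
    then have "(\<lambda>n. stepped n g t) \<longlonglongrightarrow> g t" by (intro G0_step_tendsto[OF g]) simp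
    then have "(\<lambda>n. \<psi> (stepped n g t)) \<longlonglongrightarrow> \<psi> (g t)"
      using continuous_on_tendsto_compose[OF \<psi>(1)] by simp
    then show "(\<lambda>n. f t * \<psi> (stepped n g t)) \<longlonglongrightarrow> f t * \<psi> (g t)" by (rule tendsto_mult_left)
  qed
  show "AE t in Leb01. norm (f t * \<psi> (stepped n g t)) \<le> c * \<bar>f t\<bar>" for n
  proof (rule AE_I2)
    fix t assume "t \<in> space Leb01"
    then have "\<bar>\<psi> (stepped n g t)\<bar> \<le> c" by (intro \<psi>(2) stepped_unit[OF g]) simp
    then show "norm (f t * \<psi> (stepped n g t)) \<le> c * \<bar>f t\<bar>"
      using mult_right_mono[of "\<bar>\<psi> (stepped n g t)\<bar>" c "\<bar>f t\<bar>"] by (simp add: abs_mult mult.commute)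
  qed
qed

text \<open>The directional derivative along the vector field \<open>\<phi> \<circ> g\<close>.\<close>

definition dir :: "(real \<Rightarrow> real) \<Rightarrow> ((real \<Rightarrow> real) \<Rightarrow> real \<Rightarrow> real) \<Rightarrow> (real \<Rightarrow> real) \<Rightarrow> real" where
  "dir \<phi> Du g = (\<integral>t. Du g t * \<phi> (g t) \<partial>Leb01)"

text \<open>The bound \<open>M\<close> is uniform in the grid and in the path, so that both limits
  can be taken under the integral. The second limit concerns the derivatives along the grid field as
  a whole, not single partial derivatives.\<close>

definition approximates where
  "approximates \<phi> u Du W dW M \<longleftrightarrow> (\<forall>N. admissible N (W N) (dW N)) \<and>
    (\<forall>N. \<forall>g\<in>G0. \<bar>W N (grid N g)\<bar> \<le> M) \<and>
    (\<forall>N. \<forall>g\<in>G0. \<bar>\<Sum>k\<in>{1..N}. \<phi> (grid N g k) * dW N k (grid N g)\<bar> \<le> M) \<and>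
    (\<forall>g\<in>G0. (\<lambda>N. W N (grid N g)) \<longlonglongrightarrow> u g) \<and>
    (\<forall>g\<in>G0. (\<lambda>N. \<Sum>k\<in>{1..N}. \<phi> (grid N g k) * dW N k (grid N g)) \<longlonglongrightarrow> dir \<phi> Du g)"

lemma approximatesD:
  assumes "approximates \<phi> u Du W dW M"
  shows "admissible N (W N) (dW N)"
    "g \<in> G0 \<Longrightarrow> \<bar>W N (grid N g)\<bar> \<le> M"
    "g \<in> G0 \<Longrightarrow> \<bar>\<Sum>k\<in>{1..N}. \<phi> (grid N g k) * dW N k (grid N g)\<bar> \<le> M"
    "g \<in> G0 \<Longrightarrow> (\<lambda>N. W N (grid N g)) \<longlonglongrightarrow> u g"
    "g \<in> G0 \<Longrightarrow> (\<lambda>N. \<Sum>k\<in>{1..N}. \<phi> (grid N g k) * dW N k (grid N g)) \<longlonglongrightarrow> dir \<phi> Du g"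
  using assms unfolding approximates_def by blast+

text \<open>Differentiation along the grid field puts \<phi> of the sampled path in place of the
  sampled path under the coefficient integral. Both integrals converge for every path, by right
  continuity.\<close>

lemma coarse_approx:
  assumes tf: "test_field \<phi> \<phi>' K L" and u: "(u, Du) \<in> C1"
  obtains W dW M where "approximates \<phi> u Du W dW M"
proof -
  interpret test_field \<phi> \<phi>' K L by fact
  obtain m U dU f where C: "C1_Rm m U dU" and f: "\<And>i. i < m \<Longrightarrow> L2 Leb01 (f i)" and
    u_eq: "u = (\<lambda>g. U (\<lambda>i. \<integral>t. f i t * g t \<partial>Leb01))" and
    Du: "Du = (\<lambda>g t. \<Sum>i<m. dU i (\<lambda>j. \<integral>s. f j s * g s \<partial>Leb01) * f i t)"
    using u unfolding C1_iff by blast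
  define l where "l N g i = (\<integral>t. f i t * stepped N g t \<partial>Leb01)" for N g i
  define p where "p N g i = (\<integral>t. f i t * \<phi> (stepped N g t) \<partial>Leb01)" for N g i
  define B where "B = (\<Sum>i<m. (\<integral>t. \<bar>f i t\<bar> \<partial>Leb01))"
  have fB: "(\<integral>t. \<bar>f i t\<bar> \<partial>Leb01) \<le> B" if "i < m" for i
    unfolding B_def by (rule member_le_sum[of i "{..<m}" "\<lambda>i. \<integral>t. \<bar>f i t\<bar> \<partial>Leb01"]) (use that in auto)
  have lb: "\<bar>l N g i\<bar> \<le> B" if "g \<in> G0" "i < m" for N g i
    using stepped_integral_bound[OF that(1) f[OF that(2)], of "\<lambda>y. y" 1 N] fB[OF that(2)] by (simp add: l_def)
  have pb: "\<bar>p N g i\<bar> \<le> L * B" if "g \<in> G0" "i < m" for N g i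
    unfolding p_def
    by (rule order_trans[OF stepped_integral_bound[OF that(1) f[OF that(2)] phi_measurable(1) phi_bound]
          mult_left_mono[OF fB[OF that(2)] L_nonneg]])
  obtain M where M: "\<And>x. (\<And>i. i < m \<Longrightarrow> \<bar>x i\<bar> \<le> B) \<Longrightarrow> \<bar>U x\<bar> \<le> M"
    "\<And>i x. i < m \<Longrightarrow> (\<And>i. i < m \<Longrightarrow> \<bar>x i\<bar> \<le> B) \<Longrightarrow> \<bar>dU i x\<bar> \<le> M"
    using C1_Rm_bounded_on_box[OF C] by metis
  have ll: "(\<lambda>N. l N g i) \<longlonglongrightarrow> (\<integral>t. f i t * g t \<partial>Leb01)" if "g \<in> G0" "i < m" for g i
    unfolding l_def using stepped_integral_tendsto[OF that(1) f[OF that(2)], of "\<lambda>y. y" 1] by simp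
  have pl: "(\<lambda>N. p N g i) \<longlonglongrightarrow> (\<integral>t. f i t * \<phi> (g t) \<partial>Leb01)" if "g \<in> G0" "i < m" for g i
    unfolding p_def by (rule stepped_integral_tendsto[OF that(1) f[OF that(2)] phi_cont phi_bound])
  have cl: "U (coarse N f (grid N g)) = U (l N g)" "i < m \<Longrightarrow> dU i (coarse N f (grid N g)) = dU i (l N g)" if "g \<in> G0" for N g i
    using C1_Rm_cong[OF C, of "coarse N f (grid N g)" "l N g"] C1_Rm_deriv_cong[OF C, of i "coarse N f (grid N g)" "l N g"]
      coarse_grid[OF that f] unfolding l_def by auto
  have D: "(\<Sum>k\<in>{1..N}. \<phi> (grid N g k) * (\<Sum>i<m. dU i (coarse N f (grid N g)) * cellint N (f i) k)) = (\<Sum>i<m. dU i (l N g) * p N g i)"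
    if g: "g \<in> G0" for N g
  proof -
    have "(\<Sum>k\<in>{1..N}. \<phi> (grid N g k) * (\<Sum>i<m. dU i (coarse N f (grid N g)) * cellint N (f i) k)) =
      (\<Sum>k\<in>{1..N}. \<Sum>i<m. dU i (coarse N f (grid N g)) * (cellint N (f i) k * \<phi> (ext_pt N (grid N g) k)))"
      unfolding sum_distrib_left by (intro sum.cong refl) (auto simp: ext_pt_def)
    also have "\<dots> = (\<Sum>i<m. dU i (coarse N f (grid N g)) * (\<Sum>k\<in>{1..N}. cellint N (f i) k * \<phi> (ext_pt N (grid N g) k)))"
      unfolding sum_distrib_left by (rule sum.swap)
    also have "\<dots> = (\<Sum>i<m. dU i (l N g) * p N g i)"
    proof (rule sum.cong[OF refl])
      fix i assume "i \<in> {..<m}"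
      then have i: "i < m" by simp
      \<comment> \<open>The sum over N interior points equals the sum over N + 1 cells, because the
        last cell is sampled at 1 and \<phi> vanishes there.\<close>
      have "(\<Sum>k\<in>{1..Suc N}. cellint N (f i) k * \<phi> (ext_pt N (grid N g) k)) = (\<Sum>k\<in>{1..N}. cellint N (f i) k * \<phi> (ext_pt N (grid N g) k))"
        by (simp add: ext_pt_def phi1)
      then show "dU i (coarse N f (grid N g)) * (\<Sum>k\<in>{1..N}. cellint N (f i) k * \<phi> (ext_pt N (grid N g) k)) = dU i (l N g) * p N g i"
        using cellint_sum[OF g f[OF i], of N \<phi>] cl(2)[OF g i] by (simp only: p_def)
    qed
    finally show ?thesis .
  qed
  show ?thesis
  proof (rule that[of "\<lambda>N x. U (coarse N f x)" "\<lambda>N k x. \<Sum>i<m. dU i (coarse N f x) * cellint N (f i) k" "\<bar>M\<bar> + (\<Sum>i<m. \<bar>M\<bar> * (L * B))"],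
      unfold approximates_def, intro conjI allI ballI)
    show "admissible N (\<lambda>x. U (coarse N f x)) (\<lambda>k x. \<Sum>i<m. dU i (coarse N f x) * cellint N (f i) k)" for N
      by (rule coarse_admissible[OF C])
    fix g assume g: "g \<in> G0"
    have B0: "B \<ge> 0" unfolding B_def by (intro sum_nonneg) auto
    have s0: "0 \<le> (\<Sum>i<m. \<bar>M\<bar> * (L * B))" using L_nonneg B0 by (intro sum_nonneg) auto
    show "\<bar>U (coarse N f (grid N g))\<bar> \<le> \<bar>M\<bar> + (\<Sum>i<m. \<bar>M\<bar> * (L * B))" for N
    proof -
      have "\<bar>U (l N g)\<bar> \<le> M" by (rule M(1)) (rule lb[OF g])
      then show ?thesis unfolding cl(1)[OF g] using s0 by linarith
    qed
    show "\<bar>\<Sum>k\<in>{1..N}. \<phi> (grid N g k) * (\<Sum>i<m. dU i (coarse N f (grid N g)) * cellint N (f i) k)\<bar> \<le> \<bar>M\<bar> + (\<Sum>i<m. \<bar>M\<bar> * (L * B))" for N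
      unfolding D[OF g]
    proof -
      have "\<bar>\<Sum>i<m. dU i (l N g) * p N g i\<bar> \<le> (\<Sum>i<m. \<bar>M\<bar> * (L * B))"
      proof (rule order_trans[OF sum_abs], rule sum_mono)
        fix i assume "i \<in> {..<m}"
        then have i: "i < m" by simp
        have "\<bar>dU i (l N g)\<bar> \<le> M" by (rule M(2)[OF i]) (rule lb[OF g])
        then show "\<bar>dU i (l N g) * p N g i\<bar> \<le> \<bar>M\<bar> * (L * B)"
          unfolding abs_mult using pb[OF g i] by (intro mult_mono) auto
      qed
      then show "\<bar>\<Sum>i<m. dU i (l N g) * p N g i\<bar> \<le> \<bar>M\<bar> + (\<Sum>i<m. \<bar>M\<bar> * (L * B))" by simp
    qed
    show "(\<lambda>N. U (coarse N f (grid N g))) \<longlonglongrightarrow> u g"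
      unfolding cl(1)[OF g] u_eq by (rule C1_Rm_tendsto[OF C]) (rule ll[OF g])
    have "dir \<phi> Du g = (\<integral>t. (\<Sum>i<m. dU i (\<lambda>j. \<integral>s. f j s * g s \<partial>Leb01) * (f i t * \<phi> (g t))) \<partial>Leb01)"
      unfolding dir_def Du sum_distrib_right by (simp only: mult.assoc)
    also have "\<dots> = (\<Sum>i<m. \<integral>t. dU i (\<lambda>j. \<integral>s. f j s * g s \<partial>Leb01) * (f i t * \<phi> (g t)) \<partial>Leb01)"
    proof (rule Bochner_Integration.integral_sum)
      fix i assume "i \<in> {..<m}"
      then have i: "i < m" by simp
      have "L2 Leb01 (\<lambda>t. \<phi> (g t))"
        by (rule Leb01.L2_bounded[of _ L])
           (use phi_bound G0_bounds[OF g] measurable_compose[OF path_measurable[OF g] phi_measurable(1)] in auto)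
      then show "integrable Leb01 (\<lambda>t. dU i (\<lambda>j. \<integral>s. f j s * g s \<partial>Leb01) * (f i t * \<phi> (g t)))"
        by (intro integrable_mult_right L2_mult_integrable f[OF i])
    qed
    also have "\<dots> = (\<Sum>i<m. dU i (\<lambda>j. \<integral>s. f j s * g s \<partial>Leb01) * (\<integral>t. f i t * \<phi> (g t) \<partial>Leb01))" by simp
    finally have dir: "dir \<phi> Du g = (\<Sum>i<m. dU i (\<lambda>j. \<integral>s. f j s * g s \<partial>Leb01) * (\<integral>t. f i t * \<phi> (g t) \<partial>Leb01))" .
    show "(\<lambda>N. \<Sum>k\<in>{1..N}. \<phi> (grid N g k) * (\<Sum>i<m. dU i (coarse N f (grid N g)) * cellint N (f i) k)) \<longlonglongrightarrow> dir \<phi> Du g"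
      unfolding D[OF g] dir
      by (intro tendsto_sum tendsto_mult C1_Rm_deriv_tendsto[OF C] pl[OF g] ll[OF g]) auto
  qed
qed

lemma dir_facts:
  assumes tf: "test_field \<phi> \<phi>' K L" and u: "(u, Du) \<in> C1"
  shows "u \<in> borel_measurable Q" "dir \<phi> Du \<in> borel_measurable Q"
    "\<exists>M. \<forall>g\<in>G0. \<bar>u g\<bar> \<le> M \<and> \<bar>dir \<phi> Du g\<bar> \<le> M"
proof -
  obtain W dW M where "approximates \<phi> u Du W dW M"
    by (rule coarse_approx[OF tf u])
  note W = approximatesD[OF this]
  have Wm: "(\<lambda>g. W N (grid N g)) \<in> borel_measurable Q" for N
    by (rule measurable_compose[OF grid_simplex_measurable]) (use W(1) in \<open>auto simp: admissible_def\<close>)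
  have Dm: "(\<lambda>g. \<Sum>k\<in>{1..Suc N}. \<phi> (grid (Suc N) g k) * dW (Suc N) k (grid (Suc N) g)) \<in> borel_measurable Q" for N
  proof -
    \<comment> \<open>The locale requires at least one grid point, hence \<open>Suc N\<close>. The
      parameters 1 are an arbitrary positive choice; the measurability statement does not depend on
      them.\<close>
    interpret finite_ibp \<phi> \<phi>' K L "Suc N" "\<lambda>_. 1"
      using tf by (simp add: finite_ibp_def finite_ibp_axioms_def)
    show ?thesis by (rule measurable_compose[OF grid_simplex_measurable admissible_sum_measurable[OF W(1)]])
  qed
  show "u \<in> borel_measurable Q"
    by (rule borel_measurable_LIMSEQ_real[OF W(4) Wm]) simp
  show "dir \<phi> Du \<in> borel_measurable Q"
    by (rule borel_measurable_LIMSEQ_real[OF LIMSEQ_Suc[OF W(5)] Dm]) simp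
  have "\<bar>u g\<bar> \<le> M \<and> \<bar>dir \<phi> Du g\<bar> \<le> M" if "g \<in> G0" for g
    using tendsto_upperbound[OF tendsto_rabs[OF W(4)[OF that]], of M] tendsto_upperbound[OF tendsto_rabs[OF W(5)[OF that]], of M]
      W(2,3)[OF that] by auto
  then show "\<exists>M. \<forall>g\<in>G0. \<bar>u g\<bar> \<le> M \<and> \<bar>dir \<phi> Du g\<bar> \<le> M" by blast
qed

text \<open>The product of two coarse functions is admissible, so the grid inequality applies to it
  and the product rule splits its left side. All grid quantities are uniformly bounded and converge
  at each path, which takes the inequality to the limit with the same constant.\<close>

lemma ibp_C1:
  assumes tf: "test_field \<phi> \<phi>' K L" and u: "(u, Du) \<in> C1" and v: "(v, Dv) \<in> C1"
  shows "\<bar>\<integral>g. dir \<phi> Du g * v g + u g * dir \<phi> Dv g \<partial>Q\<bar> \<le> (K + L + \<beta> * L) * (\<integral>g. \<bar>u g * v g\<bar> \<partial>Q)"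
proof -
  obtain W dW M where "approximates \<phi> u Du W dW M"
    by (rule coarse_approx[OF tf u])
  note W = approximatesD[OF this]
  obtain V dV R where "approximates \<phi> v Dv V dV R"
    by (rule coarse_approx[OF tf v])
  note V = approximatesD[OF this]
  define I where "I N g = (\<Sum>k\<in>{1..N}. \<phi> (grid N g k) * (dW N k (grid N g) * V N (grid N g) + W N (grid N g) * dV N k (grid N g)))" for N g
  define A where "A N g = W N (grid N g) * V N (grid N g)" for N g
  have I_eq: "I N g = (\<Sum>k\<in>{1..N}. \<phi> (grid N g k) * dW N k (grid N g)) * V N (grid N g) +
     W N (grid N g) * (\<Sum>k\<in>{1..N}. \<phi> (grid N g k) * dV N k (grid N g))" for N g
    unfolding I_def sum_distrib_left sum_distrib_right sum.distrib[symmetric] by (intro sum.cong refl) algebra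
  have adm: "admissible N (\<lambda>x. W N x * V N x) (\<lambda>k x. dW N k x * V N x + W N x * dV N k x)" for N
    by (rule admissible_mult[OF W(1) V(1)])
  have ineq: "\<bar>\<integral>g. I (Suc N) g \<partial>Q\<bar> \<le> (K + L + \<beta> * L) * (\<integral>g. \<bar>A (Suc N) g\<bar> \<partial>Q)" for N
    unfolding I_def A_def by (rule ibp_grid[OF tf _ adm]) simp
  have Im: "I (Suc N) \<in> borel_measurable Q" for N
  proof -
    interpret finite_ibp \<phi> \<phi>' K L "Suc N" "\<lambda>_. 1"
      using tf by (simp add: finite_ibp_def finite_ibp_axioms_def)
    show ?thesis unfolding I_def[abs_def]
      by (rule measurable_compose[OF grid_simplex_measurable admissible_sum_measurable[OF adm]])
  qed
  have Am: "A N \<in> borel_measurable Q" for N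
    unfolding A_def[abs_def]
    using measurable_compose[OF grid_simplex_measurable, of "\<lambda>x. W N x * V N x" N borel] adm[of N]
    by (simp add: admissible_def)
  have Il: "(\<lambda>N. I (Suc N) g) \<longlonglongrightarrow> dir \<phi> Du g * v g + u g * dir \<phi> Dv g" if "g \<in> G0" for g
    unfolding I_eq by (intro tendsto_intros LIMSEQ_Suc[OF W(4)[OF that]] LIMSEQ_Suc[OF W(5)[OF that]] LIMSEQ_Suc[OF V(4)[OF that]] LIMSEQ_Suc[OF V(5)[OF that]])
  have Al: "(\<lambda>N. \<bar>A (Suc N) g\<bar>) \<longlonglongrightarrow> \<bar>u g * v g\<bar>" if "g \<in> G0" for g
    unfolding A_def by (intro tendsto_intros LIMSEQ_Suc[OF W(4)[OF that]] LIMSEQ_Suc[OF V(4)[OF that]])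
  have b: "\<bar>a * b\<bar> \<le> \<bar>M\<bar> * \<bar>R\<bar>" if "\<bar>a\<bar> \<le> M" "\<bar>b\<bar> \<le> R" for a b
    unfolding abs_mult using that by (intro mult_mono) auto
  have Ib: "\<bar>I N g\<bar> \<le> 2 * (\<bar>M\<bar> * \<bar>R\<bar>)" if "g \<in> G0" for N g
    unfolding I_eq using b[OF W(3)[OF that, of N] V(2)[OF that, of N]] b[OF W(2)[OF that, of N] V(3)[OF that, of N]] by linarith
  have Ab: "\<bar>A N g\<bar> \<le> \<bar>M\<bar> * \<bar>R\<bar>" if "g \<in> G0" for N g
    unfolding A_def by (rule b[OF W(2)[OF that, of N] V(2)[OF that, of N]])
  have 1: "(\<lambda>N. \<integral>g. I (Suc N) g \<partial>Q) \<longlonglongrightarrow> (\<integral>g. dir \<phi> Du g * v g + u g * dir \<phi> Dv g \<partial>Q)"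
  proof (rule integral_dominated_convergence[where w="\<lambda>_. 2 * (\<bar>M\<bar> * \<bar>R\<bar>)"])
    show "(\<lambda>g. dir \<phi> Du g * v g + u g * dir \<phi> Dv g) \<in> borel_measurable Q"
      by (rule borel_measurable_LIMSEQ_real[OF Il Im]) simp
  qed (use Im in \<open>auto intro!: AE_I2 Il Ib\<close>)
  have 2: "(\<lambda>N. \<integral>g. \<bar>A (Suc N) g\<bar> \<partial>Q) \<longlonglongrightarrow> (\<integral>g. \<bar>u g * v g\<bar> \<partial>Q)"
  proof (rule integral_dominated_convergence[where w="\<lambda>_. \<bar>M\<bar> * \<bar>R\<bar>"])
    show "(\<lambda>g. \<bar>u g * v g\<bar>) \<in> borel_measurable Q"
      by (rule borel_measurable_LIMSEQ_real[OF Al borel_measurable_abs[OF Am]]) simp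
  qed (use Am in \<open>auto intro!: AE_I2 Al Ab\<close>)
  show ?thesis
    by (rule LIMSEQ_le[OF tendsto_rabs[OF 1] tendsto_mult_left[OF 2]]) (use ineq in auto)
qed

end

section \<open>Smooth test functions that approximate indicators\<close>

lemma test_fieldI_C2:
  assumes "\<phi> 0 = 0" "\<phi> 1 = 0" and D: "\<And>x. (\<phi> has_real_derivative \<phi>' x) (at x)"
    and D2: "\<And>x. (\<phi>' has_real_derivative \<phi>'' x) (at x)" and c: "continuous_on UNIV \<phi>''"
  obtains K L where "test_field \<phi> \<phi>' K L"
proof -
  have c': "continuous_on UNIV \<phi>'" by (intro continuous_at_imp_continuous_on ballI DERIV_isCont[OF D2])
  have "bounded (\<phi>' ` {0..1})" "bounded (\<phi>'' ` {0..1})"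
    by (intro compact_imp_bounded compact_continuous_image continuous_on_subset[OF c'] continuous_on_subset[OF c]; simp)+
  then have "\<exists>L. \<forall>x\<in>{0..1}. \<bar>\<phi>' x\<bar> \<le> L" "\<exists>K. \<forall>x\<in>{0..1}. \<bar>\<phi>'' x\<bar> \<le> K"
    by (simp_all add: bounded_iff)
  then obtain L K where L: "\<And>x. x \<in> {0..1} \<Longrightarrow> \<bar>\<phi>' x\<bar> \<le> L" and K: "\<And>x. x \<in> {0..1} \<Longrightarrow> \<bar>\<phi>'' x\<bar> \<le> K"
    by blast
  have lip: "\<bar>\<phi>' y - \<phi>' x\<bar> \<le> K * \<bar>y - x\<bar>" if xy: "x \<in> {0..1}" "y \<in> {0..1}" "x < y" for x y
  proof -
    obtain z where z: "x < z" "z < y" "\<phi>' y - \<phi>' x = (y - x) * \<phi>'' z"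
      using MVT2[OF xy(3), of \<phi>' \<phi>''] D2 by blast
    have "\<bar>\<phi>'' z\<bar> \<le> K" by (rule K) (use z xy in auto)
    then show ?thesis unfolding z(3) abs_mult using mult_left_mono[of "\<bar>\<phi>'' z\<bar>" K "\<bar>y - x\<bar>"]
      by (simp add: mult.commute)
  qed
  have "test_field \<phi> \<phi>' K L"
  proof
    show "\<bar>\<phi>' x - \<phi>' y\<bar> \<le> K * \<bar>x - y\<bar>" if "x \<in> {0..1}" "y \<in> {0..1}" for x y
      using lip[of x y] lip[of y x] that by (cases x y rule: linorder_cases) (auto simp: abs_minus_commute)
  qed (use assms L c' in auto)
  then show ?thesis by (rule that)
qed

lemma has_real_derivative_max0_powr_shift:
  fixes b c y :: real
  assumes "b > 0"
  shows "((\<lambda>y. max 0 (y - c) powr (b + 1)) has_real_derivative (b + 1) * max 0 (y - c) powr b) (at y)"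
proof -
  have "((\<lambda>y. y - c) has_real_derivative 1) (at y)" by (auto intro!: derivative_eq_intros)
  with has_real_derivative_max0_powr[OF assms, of "y - c"]
  show ?thesis
    using DERIV_chain2[where f="\<lambda>y. max 0 y powr (b + 1)" and g="\<lambda>y. y - c" and x=y and Db=1
        and Da="(b + 1) * max 0 (y - c) powr b" and s=UNIV] by simp
qed

text \<open>The factor x (1 - x) enforces the zeros at 0 and 1, and the exponential tends to the
  indicator of x \<le> c as r grows. The third power of the positive part makes \<phi> twice
  continuously differentiable, which provides the Lipschitz bound on \<phi>'.\<close>

lemma smooth_cutoff_test_field:
  fixes c r :: real
  defines "\<phi> \<equiv> \<lambda>x. x * (1 - x) * exp (- (r * max 0 (x - c) powr (2 + 1)))"
  obtains \<phi>' K L where "test_field \<phi> \<phi>' K L"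
proof -
  define p where "p k x = max 0 (x - c) powr k" for k x :: real
  define E where "E x = exp (- (r * p (2 + 1) x))" for x
  have pD: "((p (k + 1)) has_real_derivative (k + 1) * p k x) (at x)" if "k > 0" for k x
    unfolding p_def by (rule has_real_derivative_max0_powr_shift[OF that])
  have pc: "continuous_on UNIV (p k)" if "k > 0" for k
    unfolding p_def using that by (intro continuous_on_powr' continuous_intros) auto
  have ED: "(E has_real_derivative - (3 * r) * p 2 x * E x) (at x)" for x
    unfolding E_def by (rule derivative_eq_intros pD refl | simp)+
  have Ec: "continuous_on UNIV E" by (intro continuous_at_imp_continuous_on ballI DERIV_isCont[OF ED])
  define \<phi>' where "\<phi>' x = (1 - 2 * x) * E x + x * (1 - x) * (- (3 * r) * p 2 x * E x)" for x
  define \<phi>'' where "\<phi>'' x = - 2 * E x + 2 * (1 - 2 * x) * (- (3 * r) * p 2 x * E x)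
      + x * (1 - x) * (- (3 * r) * (2 * p 1 x * E x + p 2 x * (- (3 * r) * p 2 x * E x)))" for x
  have \<phi>_eq: "\<phi> = (\<lambda>x. x * (1 - x) * E x)" by (simp add: \<phi>_def E_def p_def)
  have p2: "(p 2 has_real_derivative 2 * p 1 x) (at x)" for x using pD[of 1 x] by simp
  show ?thesis
  proof (rule test_fieldI_C2[of \<phi> \<phi>' \<phi>''])
    show "\<phi> 0 = 0" "\<phi> 1 = 0" by (simp_all add: \<phi>_def)
    show "(\<phi> has_real_derivative \<phi>' x) (at x)" for x
      unfolding \<phi>_eq \<phi>'_def
      by (rule derivative_eq_intros ED refl)+ (simp add: algebra_simps)
    show "(\<phi>' has_real_derivative \<phi>'' x) (at x)" for x
      unfolding \<phi>'_def \<phi>''_def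
      by (rule derivative_eq_intros ED p2 refl)+ (simp add: algebra_simps)
    show "continuous_on UNIV \<phi>''"
      unfolding \<phi>''_def by (intro continuous_intros Ec pc) auto
  qed (rule that)
qed

lemma exp_penalty_tendsto:
  fixes p :: real assumes "p \<ge> 0"
  shows "(\<lambda>n. exp (- (real n * p))) \<longlonglongrightarrow> (if p = 0 then 1 else 0)"
proof (cases "p = 0")
  case False
  have "(\<lambda>n. exp (- p) ^ n) \<longlonglongrightarrow> 0" by (rule LIMSEQ_realpow_zero) (use assms False in auto)
  then show ?thesis using False by (simp add: exp_of_nat_mult[symmetric] mult.commute)
qed simp

text \<open>As r grows, the exponential tends to the indicator of the event that all J linear
  functionals stay below their levels. Here the square of the positive part is enough, since the
  outer function of a cylinder function is only C^1.\<close>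

lemma smooth_cutoff_cylinder:
  fixes f :: "nat \<Rightarrow> real \<Rightarrow> real" and d :: "nat \<Rightarrow> real" and r :: real
  assumes f: "\<And>j. j < J \<Longrightarrow> L2 Leb01 (f j)"
  obtains Dv where "((\<lambda>g. exp (- (r * (\<Sum>j<J. max 0 ((\<integral>t. f j t * g t \<partial>Leb01) - d j) powr (1 + 1))))), Dv) \<in> C1"
proof -
  have D: "((\<lambda>y. max 0 (y - d k) powr (1 + 1)) has_real_derivative (1 + 1) * max 0 (y - d k) powr 1) (at y)" for k y
    by (rule has_real_derivative_max0_powr_shift) simp
  \<comment> \<open>The outer function is the projection to coordinate 0, so that the composition
    rule with m = 1 delivers the plain sum of penalties.\<close>
  have "C1_Rm J (\<lambda>y. (\<lambda>x. x 0) (\<lambda>i::nat. 0 + (\<Sum>k<J. max 0 (y k - d k) powr (1 + 1))))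
    (\<lambda>k y. \<Sum>i<(1::nat). (\<lambda>i x. if i = 0 then 1 else 0) i (\<lambda>i::nat. 0 + (\<Sum>k<J. max 0 (y k - d k) powr (1 + 1))) * ((1 + 1) * max 0 (y k - d k) powr 1))"
  proof (rule C1_Rm_sum_comp[OF C1_Rm_proj])
    show "((\<lambda>y. max 0 (y - d k) powr (1 + 1)) has_real_derivative (1 + 1) * max 0 (x - d k) powr 1) (at x)" for k x
      by (rule D)
    show "continuous_on UNIV (\<lambda>y. (1 + 1) * max 0 (y - d k) powr 1)" for k
      by (intro continuous_intros continuous_on_powr') auto
  qed simp
  then have "\<exists>dV. C1_Rm J (\<lambda>y. \<Sum>k<J. max 0 (y k - d k) powr (1 + 1)) dV"
    unfolding add_0 by (rule exI[where P="\<lambda>dV. C1_Rm J (\<lambda>y. \<Sum>k<J. max 0 (y k - d k) powr (1 + 1)) dV"])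
  then obtain dV where "C1_Rm J (\<lambda>y. \<Sum>k<J. max 0 (y k - d k) powr (1 + 1)) dV" ..
  then have "C1_Rm J (\<lambda>y. exp (- (r * (\<Sum>k<J. max 0 (y k - d k) powr (1 + 1))))) (\<lambda>i y. (- r * exp (- (r * (\<Sum>k<J. max 0 (y k - d k) powr (1 + 1))))) * dV i y)"
    by (rule C1_Rm_outer[where \<psi>="\<lambda>s. exp (- (r * s))" and \<psi>'="\<lambda>s. - r * exp (- (r * s))"])
       (auto intro!: derivative_eq_intros continuous_intros)
  then show ?thesis
    by (intro that) (unfold C1_iff, use f in blast)
qed

text \<open>The pi-lambda argument for the signed measure with density \<open>H\<close>. Complements
  use that the whole space belongs to \<open>G\<close>; disjoint unions use dominated convergence
  with majorant |H|.\<close>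

lemma integral_indicator_zero_sigma:
  fixes H :: "'a \<Rightarrow> real"
  assumes H: "integrable M H" and G: "Int_stable G" "G \<subseteq> sets M" "space M \<in> G"
    and z: "\<And>E. E \<in> G \<Longrightarrow> (\<integral>x. H x * indicator E x \<partial>M) = 0"
    and E: "E \<in> sigma_sets (space M) G"
  shows "(\<integral>x. H x * indicator E x \<partial>M) = 0"
proof -
  have sub: "sigma_sets (space M) G \<subseteq> sets M" using G(2) by (rule sets.sigma_sets_subset)
  have tot: "(\<integral>x. H x \<partial>M) = 0"
  proof -
    have "(\<integral>x. H x \<partial>M) = (\<integral>x. H x * indicator (space M) x \<partial>M)"
      by (rule Bochner_Integration.integral_cong) auto
    then show ?thesis using z[OF G(3)] by simp
  qed
  have i: "integrable M (\<lambda>x. H x * indicator A x)" if "A \<in> sets M" for A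
    using integrable_mult_indicator[OF that H] by (simp add: mult.commute)
  show ?thesis
  proof (rule sigma_sets_induct_disjoint[OF G(1) _ E, where P="\<lambda>E. (\<integral>x. H x * indicator E x \<partial>M) = 0"])
    show "G \<subseteq> Pow (space M)" using G(2) sets.sets_into_space by blast
    fix A assume A: "A \<in> sigma_sets (space M) G" and IH: "(\<integral>x. H x * indicator A x \<partial>M) = 0"
    have "(\<integral>x. H x * indicator (space M - A) x \<partial>M) = (\<integral>x. H x - H x * indicator A x \<partial>M)"
      by (rule Bochner_Integration.integral_cong) (auto simp: indicator_def)
    also have "\<dots> = 0" using i[of A] A sub H by (subst Bochner_Integration.integral_diff) (auto simp: tot IH)
    finally show "(\<integral>x. H x * indicator (space M - A) x \<partial>M) = 0" .
  next
    fix A :: "nat \<Rightarrow> 'a set" assume dis: "disjoint_family A" and A: "range A \<subseteq> sigma_sets (space M) G"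
      and IH: "\<And>i. (\<integral>x. H x * indicator (A i) x \<partial>M) = 0"
    have Am: "A i \<in> sets M" for i using A sub by blast
    have Um: "(\<Union>i. A i) \<in> sets M" using Am by blast
    have "(\<lambda>n. \<integral>x. H x * indicator (\<Union>i<n. A i) x \<partial>M) \<longlonglongrightarrow> (\<integral>x. H x * indicator (\<Union>i. A i) x \<partial>M)"
    proof (rule integral_dominated_convergence[where w="\<lambda>x. \<bar>H x\<bar>"])
      show "(\<lambda>x. H x * indicator (\<Union>i. A i) x) \<in> borel_measurable M" using i[OF Um] by simp
      show "(\<lambda>x. H x * indicator (\<Union>i<n. A i) x) \<in> borel_measurable M" for n
        using i[of "\<Union>i<n. A i"] Am by auto
      show "AE x in M. (\<lambda>n. H x * indicator (\<Union>i<n. A i) x) \<longlonglongrightarrow> H x * indicator (\<Union>i. A i) x"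
        by (intro AE_I2 tendsto_intros LIMSEQ_indicator_UN)
      show "AE x in M. norm (H x * indicator (\<Union>i<n. A i) x) \<le> \<bar>H x\<bar>" for n
        by (intro AE_I2) (auto simp: indicator_def)
    qed (use H in auto)
    moreover have "(\<integral>x. H x * indicator (\<Union>i<n. A i) x \<partial>M) = 0" for n
    proof -
      have "H x * indicator (\<Union>i<n. A i) x = (\<Sum>i<n. H x * indicator (A i) x)" for x
        unfolding sum_distrib_left[symmetric]
        by (subst indicator_UN_disjoint) (use dis in \<open>auto simp: disjoint_family_on_def\<close>)
      then have "(\<integral>x. H x * indicator (\<Union>i<n. A i) x \<partial>M) = (\<Sum>i<n. \<integral>x. H x * indicator (A i) x \<partial>M)"
        by (simp only: i[OF Am] Bochner_Integration.integral_sum)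
      then show ?thesis by (simp add: IH)
    qed
    ultimately show "(\<integral>x. H x * indicator (\<Union>i. A i) x \<partial>M) = 0" by (simp add: LIMSEQ_const_iff)
  qed (simp_all add: z)
qed

lemma AE_zero_if_integrals_zero:
  fixes H :: "'a \<Rightarrow> real"
  assumes H: "integrable M H" and z: "\<And>E. E \<in> sets M \<Longrightarrow> (\<integral>x. H x * indicator E x \<partial>M) = 0"
  shows "AE x in M. H x = 0"
proof -
  have [measurable]: "H \<in> borel_measurable M" using H by simp
  \<comment> \<open>Testing on the set where s H is nonnegative isolates the positive part of
    \<open>H\<close> for s = 1 and the negative part for s = -1.\<close>
  have *: "AE x in M. max 0 (s * H x) = 0" if "s = 1 \<or> s = -1" for s
  proof -
    define E where "E = {x \<in> space M. 0 \<le> s * H x}"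
    have E: "E \<in> sets M" unfolding E_def by measurable
    have "(\<integral>x. max 0 (s * H x) \<partial>M) = (\<integral>x. s * (H x * indicator E x) \<partial>M)"
      by (rule Bochner_Integration.integral_cong) (auto simp: E_def indicator_def)
    also have "\<dots> = 0" using z[OF E] by simp
    finally have "(\<integral>x. max 0 (s * H x) \<partial>M) = 0" .
    moreover have "integrable M (\<lambda>x. max 0 (s * H x))" using H by (intro integrable_max) auto
    ultimately show ?thesis by (subst (asm) integral_nonneg_eq_0_iff_AE) auto
  qed
  from *[of 1] *[of "-1"] show ?thesis by (simp, elim eventually_elim2) (auto simp: max_def split: if_splits)
qed

lemma sum_lessThan_add: "(\<Sum>i<m + n. h i) = (\<Sum>i<m. h i) + (\<Sum>i<n. h (i + m))" for h :: "nat \<Rightarrow> real"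
  by (induction n) (simp_all add: add_ac)

lemma C1_diff:
  assumes "(u, Du) \<in> C1" "(v, Dv) \<in> C1"
  shows "(\<lambda>g. u g - v g, \<lambda>g t. Du g t - Dv g t) \<in> C1"
proof -
  obtain m U dU f where U: "C1_Rm m U dU" "\<forall>i<m. L2 Leb01 (f i)" "u = (\<lambda>g. U (\<lambda>i. \<integral>t. f i t * g t \<partial>Leb01))"
    "Du = (\<lambda>g t. \<Sum>i<m. dU i (\<lambda>j. \<integral>s. f j s * g s \<partial>Leb01) * f i t)"
    using assms(1) unfolding C1_iff by blast
  obtain n V dV e where V: "C1_Rm n V dV" "\<forall>i<n. L2 Leb01 (e i)" "v = (\<lambda>g. V (\<lambda>i. \<integral>t. e i t * g t \<partial>Leb01))"
    "Dv = (\<lambda>g t. \<Sum>i<n. dV i (\<lambda>j. \<integral>s. e j s * g s \<partial>Leb01) * e i t)"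
    using assms(2) unfolding C1_iff by blast
  define h where "h i = (if i < m then f i else e (i - m))" for i
  define dW where "dW i x = (if i < m then dU i x else - dV (i - m) (\<lambda>i. x (i + m)))" for i and x :: "nat \<Rightarrow> real"
  have hf: "U (\<lambda>i. \<integral>t. h i t * g t \<partial>Leb01) = U (\<lambda>i. \<integral>t. f i t * g t \<partial>Leb01)"
    "i < m \<Longrightarrow> dU i (\<lambda>i. \<integral>t. h i t * g t \<partial>Leb01) = dU i (\<lambda>i. \<integral>t. f i t * g t \<partial>Leb01)" for g i
    by (rule C1_Rm_cong[OF U(1)] C1_Rm_deriv_cong[OF U(1)]; simp add: h_def)+
  have he: "h (i + m) = e i" for i by (simp add: h_def)
  have "(\<Sum>i<m + n. dW i (\<lambda>j. \<integral>s. h j s * g s \<partial>Leb01) * h i t) = Du g t - Dv g t" for g t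
  proof -
    have "(\<Sum>i<m + n. dW i (\<lambda>j. \<integral>s. h j s * g s \<partial>Leb01) * h i t) =
      (\<Sum>i<m. dW i (\<lambda>j. \<integral>s. h j s * g s \<partial>Leb01) * h i t) + (\<Sum>i<n. dW (i + m) (\<lambda>j. \<integral>s. h j s * g s \<partial>Leb01) * h (i + m) t)"
      by (rule sum_lessThan_add)
    also have "(\<Sum>i<m. dW i (\<lambda>j. \<integral>s. h j s * g s \<partial>Leb01) * h i t) = Du g t"
      unfolding U(4)
    proof (rule sum.cong[OF refl])
      fix i assume "i \<in> {..<m}"
      then have "i < m" "h i = f i" by (simp_all add: h_def)
      then show "dW i (\<lambda>j. \<integral>s. h j s * g s \<partial>Leb01) * h i t = dU i (\<lambda>j. \<integral>s. f j s * g s \<partial>Leb01) * f i t"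
        using hf(2)[of i g] by (simp add: dW_def)
    qed
    also have "(\<Sum>i<n. dW (i + m) (\<lambda>j. \<integral>s. h j s * g s \<partial>Leb01) * h (i + m) t) = - Dv g t"
      unfolding V(4) sum_negf[symmetric] by (rule sum.cong) (auto simp: dW_def he)
    finally show ?thesis by simp
  qed
  moreover have "C1_Rm (m + n) (\<lambda>x. U x - V (\<lambda>i. x (i + m))) dW"
    unfolding dW_def by (rule C1_Rm_diff_append[OF U(1) V(1)])
  moreover have "\<forall>i<m + n. L2 Leb01 (h i)" using U(2) V(2) by (auto simp: h_def)
  moreover have "(\<lambda>g. u g - v g) = (\<lambda>g. (\<lambda>x. U x - V (\<lambda>i. x (i + m))) (\<lambda>i. \<integral>t. h i t * g t \<partial>Leb01))"
    by (simp add: U(3) V(3) hf(1) he)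
  ultimately show ?thesis unfolding C1_iff
    by (intro exI[of _ "m + n"] exI[of _ "\<lambda>x. U x - V (\<lambda>i. x (i + m))"] exI[of _ dW] exI[of _ h]) auto
qed

section \<open>Closability\<close>

lemma L2conv_abs_zero: "L2conv M fs (\<lambda>_. 0) \<Longrightarrow> L2conv M (\<lambda>n x. \<bar>fs n x\<bar>) (\<lambda>_. 0)"
  by (simp add: L2conv_iff L2_abs)

context entropic
begin

lemma linear_measurable:
  assumes "L2 Leb01 f" shows "(\<lambda>g. \<integral>t. f t * g t \<partial>Leb01) \<in> borel_measurable Q"
proof -
  have "(\<lambda>x. f (snd x) * fst x (snd x)) \<in> borel_measurable QL"
    by (intro borel_measurable_times joint_measurable measurable_compose[OF measurable_snd L2_measurable[OF assms]])
  then show ?thesis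
    by (intro Leb01.borel_measurable_lebesgue_integral) (simp add: case_prod_unfold)
qed

text \<open>The derivative is moved from \<open>fst (s n)\<close> to the fixed function v. The
  derivative of v and the divergence bound are both paired with \<open>fst (s n)\<close> and vanish
  with it, while the remaining term converges to the pairing of \<open>F\<close> with the test
  function.\<close>

lemma weak_limit_orthogonal:
  assumes tf: "test_field \<phi> \<phi>' K L" and v: "(v, Dv) \<in> C1"
    and s: "\<And>n. s n \<in> C1" and u0: "L2conv Q (\<lambda>n. fst (s n)) (\<lambda>_. 0)"
    and F: "L2conv QL (\<lambda>n. case_prod (snd (s n))) F"
  shows "(\<integral>x. F x * (\<phi> (fst x (snd x)) * v (fst x)) \<partial>QL) = 0"
proof -
  interpret test_field \<phi> \<phi>' K L by fact
  define \<psi> where "\<psi> x = \<phi> (fst x (snd x)) * v (fst x)" for x :: "(real \<Rightarrow> real) \<times> real"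
  obtain M where M: "\<forall>g\<in>G0. \<bar>v g\<bar> \<le> M \<and> \<bar>dir \<phi> Dv g\<bar> \<le> M" using dir_facts(3)[OF tf v] by blast
  have vm: "v \<in> borel_measurable Q" "dir \<phi> Dv \<in> borel_measurable Q" using dir_facts[OF tf v] by auto
  have L2v: "L2 Q v" "L2 Q (dir \<phi> Dv)" using M vm by (auto intro!: Q.L2_bounded[of _ M])
  have \<psi>: "L2 QL \<psi>"
  proof (rule P.L2_bounded[of _ "L * \<bar>M\<bar>"])
    show "\<psi> \<in> borel_measurable QL" unfolding \<psi>_def
      by (intro borel_measurable_times measurable_compose[OF joint_measurable phi_measurable(1)] measurable_compose[OF measurable_fst vm(1)])
    fix x assume x: "x \<in> space QL"
    then have "\<bar>\<phi> (fst x (snd x))\<bar> \<le> L" using G0_bounds by (intro phi_bound) auto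
    moreover have "\<bar>v (fst x)\<bar> \<le> \<bar>M\<bar>" using M x by force
    ultimately show "\<bar>\<psi> x\<bar> \<le> L * \<bar>M\<bar>" unfolding \<psi>_def abs_mult using L_nonneg by (intro mult_mono) auto
  qed
  define a where "a n = (\<integral>g. dir \<phi> (snd (s n)) g * v g \<partial>Q)" for n
  define b where "b n = (\<integral>g. fst (s n) g * dir \<phi> Dv g \<partial>Q)" for n
  define c where "c n = (\<integral>g. \<bar>fst (s n) g\<bar> * \<bar>v g\<bar> \<partial>Q)" for n
  have sn: "(fst (s n), snd (s n)) \<in> C1" for n using s[of n] by simp
  have L2u: "L2 Q (fst (s n))" "L2 QL (case_prod (snd (s n)))" for n
    using L2conv_L2[OF u0] L2conv_L2[OF F] by auto
  have a_eq: "a n = (\<integral>x. case_prod (snd (s n)) x * \<psi> x \<partial>QL)" for n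
  proof -
    have "(\<integral>x. case_prod (snd (s n)) x * \<psi> x \<partial>QL) = (\<integral>g. (\<integral>t. case_prod (snd (s n)) (g, t) * \<psi> (g, t) \<partial>Leb01) \<partial>Q)"
      by (rule P.integral_fst'[symmetric]) (rule L2_mult_integrable[OF L2u(2) \<psi>])
    also have "\<dots> = a n" unfolding a_def dir_def
      by (rule Bochner_Integration.integral_cong) (simp_all add: \<psi>_def mult.assoc[symmetric])
    finally show ?thesis ..
  qed
  have L2d: "L2 Q (dir \<phi> (snd (s n)))" for n
  proof -
    obtain R where "\<forall>g\<in>G0. \<bar>fst (s n) g\<bar> \<le> R \<and> \<bar>dir \<phi> (snd (s n)) g\<bar> \<le> R" using dir_facts(3)[OF tf sn] by blast
    then show ?thesis using dir_facts(2)[OF tf sn] by (auto intro!: Q.L2_bounded[of _ R])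
  qed
  have "\<bar>a n + b n\<bar> \<le> (K + L + \<beta> * L) * c n" for n
    using ibp_C1[OF tf sn v] unfolding a_def b_def c_def
    by (subst Bochner_Integration.integral_add[symmetric]) (auto intro!: L2_mult_integrable L2d L2v L2u simp: abs_mult)
  then have ab: "\<bar>a n\<bar> \<le> \<bar>b n\<bar> + (K + L + \<beta> * L) * c n" for n by (smt (verit))
  have b0: "b \<longlonglongrightarrow> 0"
    using L2conv_integral_mult[OF u0 L2conv_const[OF L2v(2)]] by (simp add: b_def[abs_def])
  have c0: "c \<longlonglongrightarrow> 0"
    using L2conv_integral_mult[OF L2conv_abs_zero[OF u0] L2conv_const[OF L2_abs[OF L2v(1)]]] by (simp add: c_def[abs_def])
  have "a \<longlonglongrightarrow> 0"
  proof (rule Lim_null_comparison)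
    show "\<forall>\<^sub>F n in sequentially. norm (a n) \<le> \<bar>b n\<bar> + (K + L + \<beta> * L) * c n" using ab by simp
    show "(\<lambda>n. \<bar>b n\<bar> + (K + L + \<beta> * L) * c n) \<longlonglongrightarrow> 0"
      using tendsto_add[OF tendsto_rabs_zero[OF b0] tendsto_mult_right_zero[OF c0]] by simp
  qed
  moreover have "a \<longlonglongrightarrow> (\<integral>x. F x * \<psi> x \<partial>QL)"
    using L2conv_integral_mult[OF F L2conv_const[OF \<psi>]] by (simp add: a_eq[abs_def])
  ultimately show ?thesis unfolding \<psi>_def by (rule LIMSEQ_unique[symmetric])
qed

text \<open>The sets whose indicators are limits of the smooth test functions: one condition on g t,
  coming from the field, and finitely many on linear functionals, coming from the cylinder function.
  Time enters through g t only.\<close>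

definition cells :: "((real \<Rightarrow> real) \<times> real) set set" where
  "cells = {{x \<in> space QL. fst x (snd x) \<le> c \<and> (\<forall>j<J. (\<integral>t. f j t * fst x t \<partial>Leb01) \<le> d j)} | c (J::nat) f d.
     \<forall>j<J. L2 Leb01 (f j)}"

lemma cellsI:
  fixes J :: nat
  shows "(\<And>j. j < J \<Longrightarrow> L2 Leb01 (f j)) \<Longrightarrow>
    {x \<in> space QL. fst x (snd x) \<le> c \<and> (\<forall>j<J. (\<integral>t. f j t * fst x t \<partial>Leb01) \<le> d j)} \<in> cells"
  unfolding cells_def by blast

lemma cellsE:
  assumes "E \<in> cells"
  obtains c and J :: nat and f d
  where "E = {x \<in> space QL. fst x (snd x) \<le> c \<and> (\<forall>j<J. (\<integral>t. f j t * fst x t \<partial>Leb01) \<le> d j)}" "\<forall>j<J. L2 Leb01 (f j)"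
  using assms unfolding cells_def mem_Collect_eq by blast

lemma cells_sets: "cells \<subseteq> sets QL"
proof
  fix E assume "E \<in> cells"
  then obtain c and J :: nat and f d where E': "E = {x \<in> space QL. fst x (snd x) \<le> c \<and> (\<forall>j<J. (\<integral>t. f j t * fst x t \<partial>Leb01) \<le> d j)}"
    and f: "\<forall>j<J. L2 Leb01 (f j)" by (rule cellsE)
  have E: "E = {x \<in> space QL. fst x (snd x) \<le> c \<and> (\<forall>j\<in>{..<J}. (\<integral>t. f j t * fst x t \<partial>Leb01) \<le> d j)}"
    unfolding E' by (simp only: Ball_def lessThan_iff)
  show "E \<in> sets QL" unfolding E
    by (intro sets.sets_Collect_conj sets.sets_Collect_finite_All borel_measurable_le joint_measurable borel_measurable_const
        measurable_compose[OF measurable_fst linear_measurable]) (use f in auto)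
qed

lemma cells_stable: "Int_stable cells"
proof (rule Int_stableI)
  fix A B assume "A \<in> cells" "B \<in> cells"
  obtain c and J :: nat and f d where
    A: "A = {x \<in> space QL. fst x (snd x) \<le> c \<and> (\<forall>j<J. (\<integral>t. f j t * fst x t \<partial>Leb01) \<le> d j)}" "\<forall>j<J. L2 Leb01 (f j)"
    using \<open>A \<in> cells\<close> by (rule cellsE)
  obtain c' and J' :: nat and f' d' where
    B: "B = {x \<in> space QL. fst x (snd x) \<le> c' \<and> (\<forall>j<J'. (\<integral>t. f' j t * fst x t \<partial>Leb01) \<le> d' j)}" "\<forall>j<J'. L2 Leb01 (f' j)"
    using \<open>B \<in> cells\<close> by (rule cellsE)
  define h where "h j = (if j < J then f j else f' (j - J))" for j
  define e where "e j = (if j < J then d j else d' (j - J))" for j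
  have "(\<forall>j<J + J'. (\<integral>t. h j t * g t \<partial>Leb01) \<le> e j) \<longleftrightarrow>
     (\<forall>j<J. (\<integral>t. f j t * g t \<partial>Leb01) \<le> d j) \<and> (\<forall>j<J'. (\<integral>t. f' j t * g t \<partial>Leb01) \<le> d' j)" for g
  proof (intro iffI conjI allI impI)
    fix j assume *: "\<forall>j<J + J'. (\<integral>t. h j t * g t \<partial>Leb01) \<le> e j"
    show "(\<integral>t. f j t * g t \<partial>Leb01) \<le> d j" if "j < J" using *[rule_format, of j] that by (simp add: h_def e_def)
    show "(\<integral>t. f' j t * g t \<partial>Leb01) \<le> d' j" if "j < J'" using *[rule_format, of "j + J"] that by (simp add: h_def e_def)
  next
    fix j assume *: "(\<forall>j<J. (\<integral>t. f j t * g t \<partial>Leb01) \<le> d j) \<and> (\<forall>j<J'. (\<integral>t. f' j t * g t \<partial>Leb01) \<le> d' j)" and "j < J + J'"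
    then show "(\<integral>t. h j t * g t \<partial>Leb01) \<le> e j" by (cases "j < J") (simp_all add: h_def e_def)
  qed
  then have "A \<inter> B = {x \<in> space QL. fst x (snd x) \<le> min c c' \<and> (\<forall>j<J + J'. (\<integral>t. h j t * fst x t \<partial>Leb01) \<le> e j)}"
    unfolding A(1) B(1) by auto
  then show "A \<inter> B \<in> cells" using cellsI[of "J + J'" h "min c c'" e] A(2) B(2) by (simp add: h_def)
qed

lemma cells_space: "space QL \<in> cells"
proof -
  have "{x \<in> space QL. fst x (snd x) \<le> 1 \<and> (\<forall>j<0::nat. (\<integral>t. (\<lambda>_ _. 0) j t * fst x t \<partial>Leb01) \<le> (\<lambda>_. 0) j)} \<in> cells"
    by (rule cellsI) simp
  moreover have "{x \<in> space QL. fst x (snd x) \<le> 1 \<and> (\<forall>j<0::nat. (\<integral>t. (\<lambda>_ _. 0) j t * fst x t \<partial>Leb01) \<le> (\<lambda>_. 0) j)} = space QL"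
    using G0_bounds by auto
  ultimately show ?thesis by simp
qed

text \<open>The penalties are driven to infinity in the orthogonality relation. The weight g t (1 -
  g t) is the part of the test field that forces its zeros at 0 and 1 and stays in the limit; it is
  divided out in the proof of closability, where it is positive almost everywhere.\<close>

lemma cells_integral_zero:
  assumes s: "\<And>n. s n \<in> C1" and u0: "L2conv Q (\<lambda>n. fst (s n)) (\<lambda>_. 0)"
    and F: "L2conv QL (\<lambda>n. case_prod (snd (s n))) F" and E: "E \<in> cells"
  shows "(\<integral>x. (F x * (fst x (snd x) * (1 - fst x (snd x)))) * indicator E x \<partial>QL) = 0"
proof -
  obtain c and J :: nat and f d where E: "E = {x \<in> space QL. fst x (snd x) \<le> c \<and> (\<forall>j<J. (\<integral>t. f j t * fst x t \<partial>Leb01) \<le> d j)}"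
    and f': "\<forall>j<J. L2 Leb01 (f j)" using E by (rule cellsE)
  have f: "\<And>j. j < J \<Longrightarrow> L2 Leb01 (f j)" using f' by blast
  define w where "w x = fst x (snd x) * (1 - fst x (snd x))" for x :: "(real \<Rightarrow> real) \<times> real"
  define p where "p x = max 0 (fst x (snd x) - c) powr (2 + 1)" for x :: "(real \<Rightarrow> real) \<times> real"
  define q where "q x = (\<Sum>j<J. max 0 ((\<integral>t. f j t * fst x t \<partial>Leb01) - d j) powr (1 + 1))" for x :: "(real \<Rightarrow> real) \<times> real"
  have p0: "p x \<ge> 0" and q0: "q x \<ge> 0" for x by (auto simp: p_def q_def intro!: sum_nonneg)
  have L2F: "L2 QL F" by (rule L2conv_L2_lim[OF F])
  have zero: "(\<integral>x. F x * (w x * exp (- (real n * p x)) * exp (- (real n * q x))) \<partial>QL) = 0" for n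
  proof -
    obtain \<phi>' K L where tf: "test_field (\<lambda>x. x * (1 - x) * exp (- (real n * max 0 (x - c) powr (2 + 1)))) \<phi>' K L"
      by (rule smooth_cutoff_test_field)
    obtain Dv where v: "((\<lambda>g. exp (- (real n * (\<Sum>j<J. max 0 ((\<integral>t. f j t * g t \<partial>Leb01) - d j) powr (1 + 1))))), Dv) \<in> C1"
      by (rule smooth_cutoff_cylinder[OF f])
    show ?thesis using weak_limit_orthogonal[OF tf v s u0 F] unfolding w_def p_def q_def .
  qed
  have fm: "F \<in> borel_measurable QL" using L2F by (rule L2_measurable)
  have wm: "w \<in> borel_measurable QL" unfolding w_def by measurable
  have pm: "p \<in> borel_measurable QL"
  proof -
    have "(\<lambda>y. max 0 (y - c) powr (2 + 1)) \<in> borel_measurable borel" by measurable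
    from measurable_compose[OF joint_measurable this] show ?thesis by (simp add: p_def[abs_def])
  qed
  have qm: "q \<in> borel_measurable QL" unfolding q_def[abs_def]
  proof (rule borel_measurable_sum)
    fix j assume "j \<in> {..<J}"
    then have l: "(\<lambda>x. \<integral>t. f j t * fst x t \<partial>Leb01) \<in> borel_measurable QL"
      by (intro measurable_compose[OF measurable_fst linear_measurable]) (auto intro: f)
    have "(\<lambda>y. max 0 (y - d j) powr (1 + 1)) \<in> borel_measurable borel" by measurable
    from measurable_compose[OF l this] show "(\<lambda>x. max 0 ((\<integral>t. f j t * fst x t \<partial>Leb01) - d j) powr (1 + 1)) \<in> borel_measurable QL" .
  qed
  have Em: "E \<in> sets QL" unfolding E by (rule subsetD[OF cells_sets cellsI]) (rule f)
  have wb: "\<bar>w x\<bar> \<le> 1" if "x \<in> space QL" for x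
  proof -
    have "0 \<le> fst x (snd x)" "fst x (snd x) \<le> 1" using that G0_bounds by auto
    then show ?thesis unfolding w_def abs_mult by (intro mult_le_one) auto
  qed
  have "(\<lambda>n. \<integral>x. F x * (w x * exp (- (real n * p x)) * exp (- (real n * q x))) \<partial>QL) \<longlonglongrightarrow> (\<integral>x. F x * w x * indicator E x \<partial>QL)"
  proof (rule integral_dominated_convergence[where w="\<lambda>x. \<bar>F x\<bar>"])
    show "integrable QL (\<lambda>x. \<bar>F x\<bar>)" by (intro integrable_abs P.L2_integrable L2F)
    show "(\<lambda>x. F x * w x * indicator E x) \<in> borel_measurable QL"
      by (intro borel_measurable_times fm wm borel_measurable_indicator Em)
    show "(\<lambda>x. F x * (w x * exp (- (real n * p x)) * exp (- (real n * q x)))) \<in> borel_measurable QL" for n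
      using fm wm pm qm by measurable
    show "AE x in QL. (\<lambda>n. F x * (w x * exp (- (real n * p x)) * exp (- (real n * q x)))) \<longlonglongrightarrow> F x * w x * indicator E x"
    proof (rule AE_I2)
      fix x assume x: "x \<in> space QL"
      have pz: "p x = 0 \<longleftrightarrow> fst x (snd x) \<le> c" by (auto simp: p_def max_def)
      have qz: "q x = 0 \<longleftrightarrow> (\<forall>j<J. (\<integral>t. f j t * fst x t \<partial>Leb01) \<le> d j)"
      proof -
        have m: "(max 0 z powr (1 + 1) = 0) = (z \<le> 0)" for z :: real by (auto simp: max_def)
        have "q x = 0 \<longleftrightarrow> (\<forall>j\<in>{..<J}. max 0 ((\<integral>t. f j t * fst x t \<partial>Leb01) - d j) powr (1 + 1) = 0)"
          unfolding q_def by (rule sum_nonneg_eq_0_iff) auto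
        then show ?thesis unfolding m diff_le_0_iff_le by (simp only: Ball_def lessThan_iff)
      qed
      have "(\<lambda>n. F x * (w x * exp (- (real n * p x)) * exp (- (real n * q x)))) \<longlonglongrightarrow>
          F x * (w x * (if p x = 0 then 1 else 0) * (if q x = 0 then 1 else 0))"
        by (intro tendsto_mult tendsto_const exp_penalty_tendsto p0 q0)
      also have "F x * (w x * (if p x = 0 then 1 else 0) * (if q x = 0 then 1 else 0)) = F x * w x * indicator E x"
        using x by (auto simp: E pz qz)
      finally show "(\<lambda>n. F x * (w x * exp (- (real n * p x)) * exp (- (real n * q x)))) \<longlonglongrightarrow> F x * w x * indicator E x" .
    qed
    show "AE x in QL. norm (F x * (w x * exp (- (real n * p x)) * exp (- (real n * q x)))) \<le> \<bar>F x\<bar>" for n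
    proof (rule AE_I2)
      fix x assume "x \<in> space QL"
      then have "\<bar>w x\<bar> * exp (- (real n * p x)) * exp (- (real n * q x)) \<le> 1"
        using wb p0 q0 by (intro mult_le_one) auto
      then have "\<bar>F x\<bar> * (\<bar>w x\<bar> * exp (- (real n * p x)) * exp (- (real n * q x))) \<le> \<bar>F x\<bar> * 1"
        by (intro mult_left_mono) auto
      then show "norm (F x * (w x * exp (- (real n * p x)) * exp (- (real n * q x)))) \<le> \<bar>F x\<bar>"
        by (simp add: abs_mult)
    qed
  qed
  then have "(\<integral>x. F x * w x * indicator E x \<partial>QL) = 0" by (simp add: zero LIMSEQ_const_iff)
  then show ?thesis unfolding w_def .
qed

end

section \<open>Recovering evaluations from linear functionals\<close>

lemma weighted_mean_bound:
  fixes g :: "real \<Rightarrow> real"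
  assumes f: "integrable Leb01 f" "\<And>s. 0 \<le> f s" "(\<integral>s. f s \<partial>Leb01) = 1" and fg: "integrable Leb01 (\<lambda>s. f s * g s)"
    and e: "\<And>s. s \<in> {0..1} \<Longrightarrow> f s \<noteq> 0 \<Longrightarrow> \<bar>g s - c\<bar> \<le> e"
  shows "\<bar>(\<integral>s. f s * g s \<partial>Leb01) - c\<bar> \<le> e"
proof -
  have i: "integrable Leb01 (\<lambda>s. f s * (g s - c))"
    unfolding right_diff_distrib using f fg by auto
  have "(\<integral>s. f s * g s \<partial>Leb01) - c = (\<integral>s. f s * g s \<partial>Leb01) - (\<integral>s. f s * c \<partial>Leb01)"
    using f(3) by simp
  also have "\<dots> = (\<integral>s. f s * (g s - c) \<partial>Leb01)"
    unfolding right_diff_distrib using f fg by (subst Bochner_Integration.integral_diff) auto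
  finally have "\<bar>(\<integral>s. f s * g s \<partial>Leb01) - c\<bar> \<le> (\<integral>s. \<bar>f s * (g s - c)\<bar> \<partial>Leb01)"
    by (simp only: integral_abs_bound)
  also have "\<dots> \<le> (\<integral>s. f s * e \<partial>Leb01)"
  proof (rule integral_mono)
    fix s assume "s \<in> space Leb01"
    then have s: "s \<in> {0..1}" by simp
    show "\<bar>f s * (g s - c)\<bar> \<le> f s * e"
      using e[OF s] f(2)[of s] by (cases "f s = 0") (auto simp: abs_mult intro!: mult_left_mono)
  qed (use i f in auto)
  also have "\<dots> = e" using f(3) by simp
  finally show ?thesis .
qed

lemma integral_interval_Leb01:
  assumes "0 \<le> a" "a \<le> b" "b \<le> 1"
  shows "(\<integral>s. indicator {a..b} s \<partial>Leb01) = b - a" (is "?I = _")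
proof -
  have "?I = (\<integral>s. indicator {0..1} s * indicator {a..b} s \<partial>lborel)"
    by (subst integral_Leb01) simp
  also have "\<dots> = (\<integral>s. indicator {a..b} s \<partial>lborel)"
    by (rule Bochner_Integration.integral_cong) (use assms in \<open>auto simp: indicator_def\<close>)
  finally show ?thesis using assms by simp
qed

text \<open>The window lies to the right of t because paths are right continuous, and its length is
  a fraction of 1 - t so that it stays inside the unit interval.\<close>

definition window :: "real \<Rightarrow> nat \<Rightarrow> real \<Rightarrow> real" where
  "window t n s = indicator {t..t + (1 - t) / real (Suc n)} s / ((1 - t) / real (Suc n))"

lemma window_facts:
  assumes t: "t \<in> {0..<1}"
  shows "L2 Leb01 (window t n)" "0 \<le> window t n s" "(\<integral>s. window t n s \<partial>Leb01) = 1"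
proof -
  have d: "(1 - t) / real (Suc n) > 0" "(1 - t) / real (Suc n) \<le> 1 - t"
    using t by (auto simp: divide_le_eq mult_left_mono simp del: of_nat_Suc)
  have m: "window t n \<in> borel_measurable Leb01" unfolding window_def
    by (intro borel_measurable_Leb01) measurable
  show "L2 Leb01 (window t n)"
    by (rule Leb01.L2_bounded[OF m, of "1 / ((1 - t) / real (Suc n))"])
       (use d in \<open>auto simp: window_def indicator_def simp del: of_nat_Suc\<close>)
  show "0 \<le> window t n s" unfolding window_def by (rule divide_nonneg_pos[OF _ d(1)]) simp
  have "(\<integral>s. window t n s \<partial>Leb01) = (\<integral>s. indicator {t..t + (1 - t) / real (Suc n)} s \<partial>Leb01) / ((1 - t) / real (Suc n))"
    unfolding window_def by simp
  also have "(\<integral>s. indicator {t..t + (1 - t) / real (Suc n)} s \<partial>Leb01) = (1 - t) / real (Suc n)"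
    by (subst integral_interval_Leb01) (use t d in auto)
  also have "(1 - t) / real (Suc n) / ((1 - t) / real (Suc n)) = 1" using d(1) by (intro divide_self) linarith
  finally show "(\<integral>s. window t n s \<partial>Leb01) = 1" .
qed

lemma window_tendsto:
  assumes g: "g \<in> G0" "g \<in> borel_measurable Leb01" and t: "t \<in> {0..<1}"
  shows "(\<lambda>n. \<integral>s. window t n s * g s \<partial>Leb01) \<longlonglongrightarrow> g t"
proof (rule LIMSEQ_I)
  fix r :: real assume r: "0 < r"
  have "(g \<longlongrightarrow> g t) (at_right t)" using g t by (auto simp: G0_def continuous_within)
  then have "\<forall>\<^sub>F s in at_right t. dist (g s) (g t) < r / 2" by (rule tendstoD) (use r in simp)
  then obtain b where b: "b > t" "\<And>s. t < s \<Longrightarrow> s < b \<Longrightarrow> dist (g s) (g t) < r / 2"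
    unfolding eventually_at_right_field by blast
  have "(\<lambda>n. t + (1 - t) * inverse (real (Suc n))) \<longlonglongrightarrow> t + (1 - t) * 0"
    by (intro tendsto_intros LIMSEQ_inverse_real_of_nat)
  then have "\<forall>\<^sub>F n in sequentially. t + (1 - t) * inverse (real (Suc n)) < b"
    by (rule order_tendstoD) (use b in simp)
  then obtain n0 where n0: "\<And>n. n \<ge> n0 \<Longrightarrow> t + (1 - t) * inverse (real (Suc n)) < b"
    unfolding eventually_sequentially by blast
  have "norm ((\<integral>s. window t n s * g s \<partial>Leb01) - g t) < r" if n: "n \<ge> n0" for n
  proof -
    have L2g: "L2 Leb01 g" by (rule Leb01.L2_bounded[OF g(2), of 1]) (use G0_bounds[OF g(1)] in auto)
    have "\<bar>(\<integral>s. window t n s * g s \<partial>Leb01) - g t\<bar> \<le> r / 2"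
    proof (rule weighted_mean_bound)
      show "integrable Leb01 (window t n)" by (intro Leb01.L2_integrable window_facts t)
      show "integrable Leb01 (\<lambda>s. window t n s * g s)" by (intro L2_mult_integrable window_facts t L2g)
      fix s assume "window t n s \<noteq> 0"
      then have "t \<le> s" "s < b" using n0[OF n] by (auto simp: window_def indicator_def divide_inverse split: if_splits simp del: of_nat_Suc)
      then show "\<bar>g s - g t\<bar> \<le> r / 2" using b(2)[of s] r by (cases "s = t") (auto simp: dist_real_def)
    qed (use window_facts[OF t] in auto)
    then show ?thesis using r by simp
  qed
  then show "\<exists>no. \<forall>n\<ge>no. norm ((\<integral>s. window t n s * g s \<partial>Leb01) - g t) < r" by blast
qed

context entropic
begin

text \<open>The sigma algebra reached by the test functions. It contains every event of
  \<open>Q\<close> in the first variable and makes g t measurable, whereas t itself is recovered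
  only after a null set is discarded.\<close>

abbreviation "CM \<equiv> sigma (G0 \<times> {0..1}) cells"

lemma space_CM [simp]: "space CM = G0 \<times> {0..1}"
  by (simp add: space_measure_of_conv)

lemma sets_CM: "sets CM = sigma_sets (G0 \<times> {0..1}) cells"
proof (rule sets_measure_of)
  have "cells \<subseteq> Pow (space QL)" using cells_sets sets.space_closed[of QL] by blast
  then show "cells \<subseteq> Pow (G0 \<times> {0..1})" by simp
qed

lemma CM_coordinate: "(\<lambda>x. fst x (snd x)) \<in> borel_measurable CM"
proof (rule borel_measurableI_le)
  fix c
  have "{x \<in> space QL. fst x (snd x) \<le> c \<and> (\<forall>j<0::nat. (\<integral>t. (\<lambda>_ _. 0) j t * fst x t \<partial>Leb01) \<le> (\<lambda>_. 0) j)} \<in> cells"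
    by (rule cellsI) simp
  then have "{x \<in> space QL. fst x (snd x) \<le> c} \<in> cells" by simp
  then show "{x \<in> space CM. fst x (snd x) \<le> c} \<in> sets CM" unfolding sets_CM by (intro sigma_sets.Basic) simp
qed

lemma CM_linear: "L2 Leb01 f \<Longrightarrow> (\<lambda>x. \<integral>t. f t * fst x t \<partial>Leb01) \<in> borel_measurable CM"
proof (rule borel_measurableI_le)
  fix d assume f: "L2 Leb01 f"
  have "{x \<in> space QL. fst x (snd x) \<le> 1 \<and> (\<forall>j<1::nat. (\<integral>t. (\<lambda>_. f) j t * fst x t \<partial>Leb01) \<le> (\<lambda>_. d) j)} \<in> cells"
    by (rule cellsI) (rule f)
  moreover have "{x \<in> space QL. fst x (snd x) \<le> 1 \<and> (\<forall>j<1::nat. (\<integral>t. (\<lambda>_. f) j t * fst x t \<partial>Leb01) \<le> (\<lambda>_. d) j)} =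
      {x \<in> space CM. (\<integral>t. f t * fst x t \<partial>Leb01) \<le> d}"
    using G0_bounds by auto
  ultimately show "{x \<in> space CM. (\<integral>t. f t * fst x t \<partial>Leb01) \<le> d} \<in> sets CM" unfolding sets_CM by (intro sigma_sets.Basic) simp
qed

text \<open>Cells constrain the path through square integrable coefficients. An evaluation is the
  limit of averages over shrinking windows, and these averages are of that kind.\<close>

lemma CM_eval:
  assumes "t \<in> {0..1}" shows "(\<lambda>x. fst x t) \<in> borel_measurable CM"
proof (cases "t = 1")
  case True
  have "(\<lambda>x. 1::real) \<in> borel_measurable CM" by simp
  then show ?thesis by (rule measurable_cong[THEN iffD1, rotated]) (auto simp: True G0_one)
next
  case False
  then have t: "t \<in> {0..<1}" using assms by auto
  show ?thesis
  proof (rule borel_measurable_LIMSEQ_real)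
    show "(\<lambda>x. \<integral>s. window t n s * fst x s \<partial>Leb01) \<in> borel_measurable CM" for n
      by (rule CM_linear[OF window_facts(1)[OF t]])
    show "(\<lambda>n. \<integral>s. window t n s * fst x s \<partial>Leb01) \<longlonglongrightarrow> fst x t" if "x \<in> space CM" for x
      by (rule window_tendsto) (use that path_measurable t in auto)
  qed
qed

lemma CM_fst: "fst \<in> measurable CM Q"
proof -
  have gen: "{{g \<in> G0. g t \<in> A} |t A. t \<in> {0..<1} \<and> A \<in> sets borel} \<subseteq> Pow G0" by auto
  have "fst \<in> measurable CM G0M"
    unfolding G0M_def
  proof (rule measurable_measure_of[OF gen])
    show "fst \<in> space CM \<rightarrow> G0" by auto
    fix B assume "B \<in> {{g \<in> G0. g t \<in> A} |t A. t \<in> {0..<1} \<and> A \<in> sets borel}"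
    then obtain t and A :: "real set" where B: "B = {g \<in> G0. g t \<in> A}" "t \<in> {0..<1}" "A \<in> sets borel" by blast
    have "(\<lambda>x. fst x t) -` A \<inter> space CM \<in> sets CM"
      by (rule measurable_sets[OF CM_eval B(3)]) (use B in auto)
    also have "(\<lambda>x. fst x t) -` A \<inter> space CM = fst -` B \<inter> space CM" by (auto simp: B)
    finally show "fst -` B \<inter> space CM \<in> sets CM" .
  qed
  then show ?thesis using sets_Q by (simp cong: measurable_cong_sets)
qed

text \<open>The pi-lambda argument is used twice, first from the cells to \<open>CM\<close> and then
  from the rectangles in \<open>R\<close> to the product sigma algebra. The change of generators in
  between costs a null set, which the integrals do not see.\<close>

theorem op_closable_C1: "op_closable Q C1"
  unfolding op_closable_def
proof (intro allI impI, elim conjE)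
  fix s F assume s: "\<forall>n. s n \<in> C1" and u0: "L2conv Q (\<lambda>n. fst (s n)) (\<lambda>_. 0)"
    and "L2conv QL (grad_seq s) F"
  then have F: "L2conv QL (\<lambda>n. case_prod (snd (s n))) F"
    by (simp add: grad_seq_def[abs_def] case_prod_unfold)
  define H where "H x = F x * (fst x (snd x) * (1 - fst x (snd x)))" for x
  have L2F: "L2 QL F" by (rule L2conv_L2_lim[OF F])
  have H: "integrable QL H"
    unfolding H_def
  proof (rule L2_mult_integrable[OF L2F], rule P.L2_bounded[of _ 1])
    fix x assume "x \<in> space QL"
    then have "0 \<le> fst x (snd x)" "fst x (snd x) \<le> 1" using G0_bounds by auto
    then show "\<bar>fst x (snd x) * (1 - fst x (snd x))\<bar> \<le> 1" unfolding abs_mult by (intro mult_le_one) auto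
  qed measurable
  have zCM: "(\<integral>x. H x * indicator E x \<partial>QL) = 0" if "E \<in> sets CM" for E
    unfolding H_def
    by (rule integral_indicator_zero_sigma[OF H[unfolded H_def] cells_stable cells_sets cells_space])
       (use cells_integral_zero[OF _ u0 F] s that in \<open>auto simp: sets_CM\<close>)
  \<comment> \<open>Almost every path is strictly increasing, so \<open>t < r\<close> can be read off from \<open>g t < g r\<close>:
    the integrals over \<open>CM\<close>, generated by \<open>g t\<close> and the linear functionals, already determine \<open>H\<close>.\<close>
  define R where "R = {A \<times> {t \<in> {0..1::real}. t < r} | A r. A \<in> sets Q}"
  have zR: "(\<integral>x. H x * indicator E x \<partial>QL) = 0" if E: "E \<in> R" for E
  proof -
    obtain A r where A: "A \<in> sets Q" and E: "E = A \<times> {t \<in> {0..1}. t < r}" using E by (auto simp: R_def)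
    have A1: "fst -` A \<inter> space CM \<in> sets CM" by (rule measurable_sets[OF CM_fst A])
    have AG: "A \<subseteq> G0" using sets.sets_into_space[OF A] by simp
    consider "r \<le> 0" | "r > 1" | "r \<in> {0..1}" by force
    then show ?thesis
    proof cases
      case 1
      then have "E = {}" using E by auto
      then show ?thesis by simp
    next
      case 2
      then have "E = fst -` A \<inter> space CM" using E AG by auto
      then show ?thesis using zCM[OF A1] by simp
    next
      case 3
      define B where "B = (fst -` A \<inter> space CM) \<inter> {x \<in> space CM. fst x (snd x) < fst x r}"
      have Bm: "B \<in> sets CM" unfolding B_def
        by (intro sets.Int A1 borel_measurable_less CM_coordinate CM_eval[OF 3])
      have Em: "E \<in> sets QL" unfolding E
        by (intro pair_measureI A) (auto simp: Leb01_def sets_restrict_space image_iff intro!: bexI[of _ "{..<r}"])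
      have Bm': "B \<in> sets QL" using Bm sets.sigma_sets_subset[OF cells_sets] unfolding sets_CM space_QL by blast
      have "AE x in QL. strict_path (fst x)"
        by (rule AE_pair_fst[OF AE_strict_path Leb01.sigma_finite_measure_axioms])
      moreover have "AE x in QL. x \<in> space QL" by (rule AE_space)
      ultimately have "AE x in QL. H x * indicator E x = H x * indicator B x"
      proof eventually_elim
        case (elim x)
        obtain g t where x: "x = (g, t)" by (cases x)
        have str: "\<And>s t. 0 \<le> s \<Longrightarrow> s < t \<Longrightarrow> t \<le> 1 \<Longrightarrow> g s < g t" using elim(1) by (auto simp: x strict_path_def)
        have gt: "g \<in> G0" "t \<in> {0..1}" using elim(2) by (auto simp: x)
        have "g t < g r \<longleftrightarrow> t < r"
          using str[of t r] str[of r t] gt(2) 3 by (cases t r rule: linorder_cases) auto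
        then show ?case using gt by (auto simp: x E B_def indicator_def)
      qed
      then have "(\<integral>x. H x * indicator E x \<partial>QL) = (\<integral>x. H x * indicator B x \<partial>QL)"
        by (intro integral_cong_AE borel_measurable_times borel_measurable_indicator Em Bm' borel_measurable_integrable[OF H])
      then show ?thesis using zCM[OF Bm] by simp
    qed
  qed
  have Rsub: "R \<subseteq> sets QL"
  proof
    fix E assume "E \<in> R"
    then obtain A r where "A \<in> sets Q" and E: "E = A \<times> {t \<in> {0..1}. t < r}" by (auto simp: R_def)
    then show "E \<in> sets QL" unfolding E
      by (intro pair_measureI) (auto simp: Leb01_def sets_restrict_space image_iff intro!: bexI[of _ "{..<r}"])
  qed
  define RM where "RM = sigma (space QL) R"
  have RMs: "space RM = G0 \<times> {0..1}" by (simp add: RM_def space_measure_of_conv)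
  have RMsets: "sets RM = sigma_sets (space QL) R"
    unfolding RM_def using Rsub sets.space_closed[of QL] by (intro sets_measure_of) blast
  have inR: "A \<times> {t \<in> {0..1}. t < r} \<in> sets RM" if "A \<in> sets Q" for A r
    unfolding RMsets by (rule sigma_sets.Basic) (use that in \<open>auto simp: R_def\<close>)
  have f1: "fst \<in> measurable RM Q"
  proof (rule measurableI)
    show "fst x \<in> space Q" if "x \<in> space RM" for x using that by (auto simp: RMs)
    fix A assume A: "A \<in> sets Q"
    have "fst -` A \<inter> space RM = A \<times> {t \<in> {0..1}. t < 2}"
      using sets.sets_into_space[OF A] by (auto simp: RMs)
    then show "fst -` A \<inter> space RM \<in> sets RM" using inR[OF A] by simp
  qed
  have "snd \<in> borel_measurable RM"
  proof (rule borel_measurableI_less)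
    fix r :: real
    have "{x \<in> space RM. snd x < r} = space Q \<times> {t \<in> {0..1}. t < r}" by (auto simp: RMs)
    then show "{x \<in> space RM. snd x < r} \<in> sets RM" using inR[OF sets.top] by simp
  qed
  then have f2: "snd \<in> measurable RM Leb01"
    unfolding Leb01_def by (intro measurable_restrict_space2) (auto simp: RMs)
  \<comment> \<open>Both coordinates are measurable for the sigma algebra generated by
    \<open>R\<close>, hence so is the identity into the product space. This is how \<open>R\<close>
    is seen to generate the whole product sigma algebra.\<close>
  have "(\<lambda>x. (fst x, snd x)) \<in> measurable RM QL" by (rule measurable_Pair[OF f1 f2])
  then have id: "(\<lambda>x. x) \<in> measurable RM QL" by simp
  have sub: "E \<in> sigma_sets (space QL) R" if "E \<in> sets QL" for E
  proof -
    have "(\<lambda>x. x) -` E \<inter> space RM \<in> sets RM" by (rule measurable_sets[OF id that])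
    moreover have "(\<lambda>x. x) -` E \<inter> space RM = E" using sets.sets_into_space[OF that] by (auto simp: RMs)
    ultimately show ?thesis by (simp add: RMsets)
  qed
  have Rst: "Int_stable R"
  proof (rule Int_stableI)
    fix E E' assume "E \<in> R" "E' \<in> R"
    then obtain A r A' r' where "A \<in> sets Q" "A' \<in> sets Q" "E = A \<times> {t \<in> {0..1}. t < r}" "E' = A' \<times> {t \<in> {0..1}. t < r'}"
      by (auto simp: R_def)
    then have "E \<inter> E' = (A \<inter> A') \<times> {t \<in> {0..1}. t < min r r'}" "A \<inter> A' \<in> sets Q" by auto
    then show "E \<inter> E' \<in> R" unfolding R_def by blast
  qed
  have Rsp: "space QL \<in> R"
  proof -
    have "space QL = space Q \<times> {t \<in> {0..1}. t < 2}" by auto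
    then show ?thesis unfolding R_def by blast
  qed
  have "AE x in QL. H x = 0"
    by (rule AE_zero_if_integrals_zero[OF H integral_indicator_zero_sigma[OF H Rst Rsub Rsp zR sub]])
  moreover have "AE x in QL. strict_path (fst x)"
    by (rule AE_pair_fst[OF AE_strict_path Leb01.sigma_finite_measure_axioms])
  moreover have "AE x in QL. snd x \<noteq> 0" "AE x in QL. snd x \<noteq> 1"
    by (rule AE_pair_snd[OF AE_Leb01_neq Leb01.sigma_finite_measure_axioms])+
  moreover have "AE x in QL. x \<in> space QL" by (rule AE_space)
  \<comment> \<open>At interior times a strictly increasing path takes values in the open unit
    interval, so the weight in \<open>H\<close> can be cancelled.\<close>
  ultimately show "AE x in QL. F x = 0"
  proof eventually_elim
    case (elim x)
    then have "snd x \<in> {0<..<1}" by auto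
    then have "0 < fst x (snd x)" "fst x (snd x) < 1" using elim(2) by (auto simp: strict_path_def)
    then show ?case using elim(1) by (simp add: H_def)
  qed
qed

end

section \<open>\<open>Z1\<close> lies in the closure of \<open>C1\<close>\<close>

lemma continuous_antiderivative:
  fixes f :: "real \<Rightarrow> real"
  assumes "continuous_on UNIV f"
  obtains F where "\<And>x. (F has_real_derivative f x) (at x)"
proof -
  have "\<exists>F. \<forall>x::real. (-\<infinity>::ereal) < x \<longrightarrow> ereal x < \<infinity> \<longrightarrow> (F has_vector_derivative f x) (at x)"
    using assms by (intro einterval_antiderivative) (auto simp: continuous_on_eq_continuous_at)
  then show ?thesis using that by (auto simp: has_real_derivative_iff_has_vector_derivative)
qed

text \<open>Outside [0,1] the derivative is frozen at its end values. An antiderivative of this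
  extension differs from \<open>a\<close> by a constant on the interval, and one-sided
  differentiability at the end points becomes two-sided. Paths never leave [0,1], so the functions
  in \<open>Z1\<close> keep their values on \<open>G0\<close>.\<close>

lemma C1_01_extend:
  assumes a: "C1_01 a a'"
  obtains b b' where "\<And>x. (b has_real_derivative b' x) (at x)" "continuous_on UNIV b'"
    "\<And>x. x \<in> {0..1} \<Longrightarrow> b x = a x" "\<And>x. x \<in> {0..1} \<Longrightarrow> b' x = a' x"
proof -
  define b' where "b' x = a' (max 0 (min 1 x))" for x
  have c: "continuous_on UNIV b'" unfolding b'_def
    by (rule continuous_on_compose2[of "{0..1}" a']) (use a in \<open>auto simp: C1_01_def intro!: continuous_intros\<close>)
  obtain F where F: "\<And>x. (F has_real_derivative b' x) (at x)" by (rule continuous_antiderivative[OF c]) blast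
  have eq: "b' x = a' x" if "x \<in> {0..1}" for x using that by (simp add: b'_def)
  have "\<exists>c. \<forall>x\<in>{0..1}. a x - F x = c"
  proof (rule has_field_derivative_zero_constant)
    show "((\<lambda>x. a x - F x) has_field_derivative 0) (at x within {0..1})" if "x \<in> {0..1}" for x
    proof -
      have "(a has_real_derivative a' x) (at x within {0..1})" using a that by (simp add: C1_01_def)
      moreover have "(F has_real_derivative a' x) (at x within {0..1})"
        using F[of x] eq[OF that] by (auto intro: has_field_derivative_at_within)
      ultimately show ?thesis using DERIV_diff by fastforce
    qed
  qed simp
  then obtain k where k: "\<And>x. x \<in> {0..1} \<Longrightarrow> a x - F x = k" by blast
  show ?thesis
  proof (rule that[of "\<lambda>x. F x + k" b'])
    show "((\<lambda>x. F x + k) has_real_derivative b' x) (at x)" for x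
      by (rule DERIV_cong[OF DERIV_add[OF F DERIV_const]]) simp
    show "F x + k = a x" if "x \<in> {0..1}" for x using k[OF that] by simp
  qed (use c eq in auto)
qed

lemma continuous_bounded_unit:
  fixes f :: "real \<Rightarrow> real"
  assumes "continuous_on UNIV f"
  obtains M where "\<And>x. x \<in> {0..1} \<Longrightarrow> \<bar>f x\<bar> \<le> M"
proof -
  have "bounded (f ` {0..1})"
    by (intro compact_imp_bounded compact_continuous_image continuous_on_subset[OF assms]) auto
  then obtain a where "\<forall>x\<in>{0..1}. \<bar>f x\<bar> \<le> a" by (auto simp: bounded_iff)
  then show ?thesis by (intro that[of a]) blast
qed

lemma continuous_on_DERIV: "(\<And>x. (b has_real_derivative b' x) (at x)) \<Longrightarrow> continuous_on UNIV b"
  by (intro continuous_at_imp_continuous_on ballI DERIV_isCont) blast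

context entropic
begin

lemma Z1_extend:
  assumes "(u, Du) \<in> Z1"
  obtains m U dU b b' where "C1_Rm m U dU"
    "\<And>i x. i < m \<Longrightarrow> (b i has_real_derivative b' i x) (at x)" "\<And>i. i < m \<Longrightarrow> continuous_on UNIV (b' i)"
    "\<And>g. g \<in> G0 \<Longrightarrow> u g = U (\<lambda>i. \<integral>s. b i (g s) \<partial>Leb01)"
    "\<And>g t. g \<in> G0 \<Longrightarrow> t \<in> {0..1} \<Longrightarrow> Du g t = (\<Sum>i<m. dU i (\<lambda>j. \<integral>s. b j (g s) \<partial>Leb01) * b' i (g t))"
proof -
  obtain m U dU a a' where C: "C1_Rm m U dU" and a: "\<forall>i<m. C1_01 (a i) (a' i)" and
    u: "u = (\<lambda>g. U (\<lambda>i. \<integral>s. a i (g s) \<partial>Leb01))" and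
    Du: "Du = (\<lambda>g t. \<Sum>i<m. dU i (\<lambda>j. \<integral>s. a j (g s) \<partial>Leb01) * a' i (g t))"
    using assms unfolding Z1_def by blast
  have "\<exists>b b'. (\<forall>x. (b has_real_derivative b' x) (at x)) \<and> continuous_on UNIV b' \<and> (\<forall>x\<in>{0..1}. b x = a i x \<and> b' x = a' i x)"
    if "i < m" for i
  proof -
    have "C1_01 (a i) (a' i)" using a that by blast
    then obtain b b' where "\<And>x. (b has_real_derivative b' x) (at x)" "continuous_on UNIV b'"
      "\<And>x. x \<in> {0..1} \<Longrightarrow> b x = a i x" "\<And>x. x \<in> {0..1} \<Longrightarrow> b' x = a' i x" by (rule C1_01_extend) blast
    then show ?thesis by blast
  qed
  then obtain b b' where b: "\<And>i. i < m \<Longrightarrow> (\<forall>x. (b i has_real_derivative b' i x) (at x)) \<and> continuous_on UNIV (b' i) \<and>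
     (\<forall>x\<in>{0..1}. b i x = a i x \<and> b' i x = a' i x)" by metis
  have int: "(\<integral>s. a i (g s) \<partial>Leb01) = (\<integral>s. b i (g s) \<partial>Leb01)" if "g \<in> G0" "i < m" for g i
    by (rule Bochner_Integration.integral_cong) (use b[OF that(2)] G0_bounds[OF that(1)] in auto)
  show ?thesis
  proof (rule that[of m U dU b b', OF C])
    show "u g = U (\<lambda>i. \<integral>s. b i (g s) \<partial>Leb01)" if "g \<in> G0" for g
      unfolding u by (rule C1_Rm_cong[OF C int[OF that]])
    show "Du g t = (\<Sum>i<m. dU i (\<lambda>j. \<integral>s. b j (g s) \<partial>Leb01) * b' i (g t))" if "g \<in> G0" "t \<in> {0..1}" for g t
      unfolding Du
    proof (rule sum.cong[OF refl])
      fix i assume "i \<in> {..<m}"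
      then have i: "i < m" by simp
      have "dU i (\<lambda>j. \<integral>s. a j (g s) \<partial>Leb01) = dU i (\<lambda>j. \<integral>s. b j (g s) \<partial>Leb01)"
        by (rule C1_Rm_deriv_cong[OF C i int[OF that(1)]])
      moreover have "a' i (g t) = b' i (g t)" using b[OF i] G0_bounds[OF that] by simp
      ultimately show "dU i (\<lambda>j. \<integral>s. a j (g s) \<partial>Leb01) * a' i (g t) = dU i (\<lambda>j. \<integral>s. b j (g s) \<partial>Leb01) * b' i (g t)" by simp
    qed
  qed (use b in blast)+
qed

lemma Z1I:
  assumes "C1_Rm m U dU" "\<And>i x. i < m \<Longrightarrow> (b i has_real_derivative b' i x) (at x)" "\<And>i. i < m \<Longrightarrow> continuous_on UNIV (b' i)"
  shows "(\<lambda>g. U (\<lambda>i. \<integral>s. b i (g s) \<partial>Leb01), \<lambda>g t. \<Sum>i<m. dU i (\<lambda>j. \<integral>s. b j (g s) \<partial>Leb01) * b' i (g t)) \<in> Z1"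
proof -
  have "\<forall>i<m. C1_01 (b i) (b' i)"
    using assms(2,3) unfolding C1_01_def by (auto intro: continuous_on_subset has_field_derivative_at_within)
  then show ?thesis unfolding Z1_def using assms(1) by blast
qed

lemma compose_path_measurable:
  fixes b :: "real \<Rightarrow> real"
  assumes "continuous_on UNIV b"
  shows "(\<lambda>x. b (fst x (snd x))) \<in> borel_measurable QL" "g \<in> G0 \<Longrightarrow> (\<lambda>t. b (g t)) \<in> borel_measurable Leb01"
    "(\<lambda>g. \<integral>s. b (g s) \<partial>Leb01) \<in> borel_measurable Q"
proof -
  have bm: "b \<in> borel_measurable borel" by (rule borel_measurable_continuous_onI[OF assms])
  show 1: "(\<lambda>x. b (fst x (snd x))) \<in> borel_measurable QL" by (rule measurable_compose[OF joint_measurable bm])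
  show "(\<lambda>t. b (g t)) \<in> borel_measurable Leb01" if "g \<in> G0" by (rule measurable_compose[OF path_measurable[OF that] bm])
  show "(\<lambda>g. \<integral>s. b (g s) \<partial>Leb01) \<in> borel_measurable Q"
    using Leb01.borel_measurable_lebesgue_integral[of "\<lambda>g s. b (g s)" Q] 1 by (simp add: case_prod_unfold)
qed

lemma L2_snd:
  assumes "L2 Leb01 f" shows "L2 QL (\<lambda>x. f (snd x))"
proof -
  have m: "(\<lambda>x. f (snd x)) \<in> borel_measurable QL" by (rule measurable_compose[OF measurable_snd L2_measurable[OF assms]])
  have "(\<integral>\<^sup>+x. ennreal ((f (snd x))\<^sup>2) \<partial>QL) = (\<integral>\<^sup>+g. \<integral>\<^sup>+t. ennreal ((f (snd (g, t)))\<^sup>2) \<partial>Leb01 \<partial>Q)"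
    by (rule Leb01.nn_integral_fst[symmetric]) (intro measurable_compose[OF _ measurable_ennreal] borel_measurable_power m)
  also have "\<dots> = (\<integral>\<^sup>+t. ennreal ((f t)\<^sup>2) \<partial>Leb01)" by (simp add: Q.emeasure_space_1[unfolded space_Q])
  also have "\<dots> < \<infinity>" using assms by (simp add: L2_def)
  finally show ?thesis using m by (simp add: L2_def)
qed

lemma abs_integral_le:
  fixes f :: "real \<Rightarrow> real"
  assumes "f \<in> borel_measurable Leb01" "\<And>t. t \<in> {0..1} \<Longrightarrow> \<bar>f t\<bar> \<le> M"
  shows "\<bar>\<integral>t. f t \<partial>Leb01\<bar> \<le> M"
proof -
  have "L2 Leb01 f" by (rule Leb01.L2_bounded[OF assms(1), of M]) (use assms(2) in simp)
  then have i: "integrable Leb01 f" by (rule Leb01.L2_integrable)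
  have "\<bar>\<integral>t. f t \<partial>Leb01\<bar> \<le> (\<integral>t. \<bar>f t\<bar> \<partial>Leb01)" by (rule integral_abs_bound)
  also have "\<dots> \<le> (\<integral>t. M \<partial>Leb01)" by (rule integral_mono) (use i assms(2) in auto)
  finally show ?thesis using Leb01.prob_space by simp
qed

text \<open>Convergence almost everywhere on the product is checked path by path, and only along
  strictly increasing paths. The measurability assumptions make the set of convergence measurable in
  the product, so that Fubini applies to it.\<close>

lemma AE_QL_tendsto:
  assumes "\<And>n. ks n \<in> borel_measurable QL" "k \<in> borel_measurable QL"
    "\<And>g. g \<in> G0 \<Longrightarrow> strict_path g \<Longrightarrow> AE t in Leb01. (\<lambda>n. ks n (g, t)) \<longlonglongrightarrow> (k (g, t) :: real)"
  shows "AE x in QL. (\<lambda>n. ks n x) \<longlonglongrightarrow> k x"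
proof (rule P.AE_pair_measure)
  have "Measurable.pred QL (\<lambda>x. (\<lambda>n. ks n x) \<longlonglongrightarrow> k x)" by (rule measurable_limit2[OF assms(1,2)])
  then show "{x \<in> space QL. (\<lambda>n. ks n x) \<longlonglongrightarrow> k x} \<in> sets QL" by (simp add: pred_def)
  show "AE g in Q. AE t in Leb01. (\<lambda>n. ks n (g, t)) \<longlonglongrightarrow> k (g, t)"
    using AE_strict_path AE_space
    by eventually_elim (rule assms(3), simp_all)
qed

lemma cylinder_L2:
  assumes C: "C1_Rm m U dU"
    and lm: "\<And>i. i < m \<Longrightarrow> l i \<in> borel_measurable Q"
    and km: "\<And>i. i < m \<Longrightarrow> L2 QL (k i)"
    and lb: "\<And>i g. i < m \<Longrightarrow> g \<in> G0 \<Longrightarrow> \<bar>l i g\<bar> \<le> B"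
  shows "L2 Q (\<lambda>g. U (\<lambda>i. l i g))" "L2 QL (\<lambda>x. \<Sum>i<m. dU i (\<lambda>j. l j (fst x)) * k i x)"
proof -
  note * = cylinder_L2conv[OF C, of "\<lambda>_. l" l "\<lambda>_. k" k B "\<lambda>i x. \<bar>k i x\<bar>"]
  show "L2 Q (\<lambda>g. U (\<lambda>i. l i g))"
    by (rule L2conv_L2_lim[OF *(1)]) (use lm km lb in \<open>auto intro: L2_measurable L2_abs\<close>)
  show "L2 QL (\<lambda>x. \<Sum>i<m. dU i (\<lambda>j. l j (fst x)) * k i x)"
    by (rule L2conv_L2_lim[OF *(2)]) (use lm km lb in \<open>auto intro: L2_measurable L2_abs\<close>)
qed

lemma sum_bound_member: "i < m \<Longrightarrow> B i \<le> (\<Sum>i<m. \<bar>B i\<bar>)" for B :: "nat \<Rightarrow> real"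
  using member_le_sum[of i "{..<m}" "\<lambda>i. \<bar>B i\<bar>"] by auto

lemma linear_bound:
  assumes "L2 Leb01 f" "g \<in> G0"
  shows "\<bar>\<integral>t. f t * g t \<partial>Leb01\<bar> \<le> (\<integral>t. \<bar>f t\<bar> \<partial>Leb01)"
proof -
  have "(\<lambda>n. \<integral>t. f t * stepped n g t \<partial>Leb01) \<longlonglongrightarrow> (\<integral>t. f t * g t \<partial>Leb01)"
    using stepped_integral_tendsto[OF assms(2,1), of "\<lambda>y. y" 1] by simp
  from tendsto_rabs[OF this] show ?thesis
    by (rule tendsto_upperbound) (use stepped_integral_bound[OF assms(2,1), of "\<lambda>y. y" 1] in auto)
qed

lemma C1_L2:
  assumes "(u, Du) \<in> C1" shows "L2 Q u" "L2 QL (case_prod Du)"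
proof -
  obtain m U dU f where C: "C1_Rm m U dU" and f: "\<And>i. i < m \<Longrightarrow> L2 Leb01 (f i)" and
    u: "u = (\<lambda>g. U (\<lambda>i. \<integral>t. f i t * g t \<partial>Leb01))" and
    Du: "Du = (\<lambda>g t. \<Sum>i<m. dU i (\<lambda>j. \<integral>s. f j s * g s \<partial>Leb01) * f i t)"
    using assms unfolding C1_iff by blast
  note * = cylinder_L2[OF C, of "\<lambda>i g. \<integral>t. f i t * g t \<partial>Leb01" "\<lambda>i x. f i (snd x)" "\<Sum>i<m. \<bar>\<integral>t. \<bar>f i t\<bar> \<partial>Leb01\<bar>"]
  have b: "\<bar>\<integral>t. f i t * g t \<partial>Leb01\<bar> \<le> (\<Sum>i<m. \<bar>\<integral>t. \<bar>f i t\<bar> \<partial>Leb01\<bar>)" if "i < m" "g \<in> G0" for i g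
    by (rule order_trans[OF linear_bound[OF f[OF that(1)] that(2)] sum_bound_member[OF that(1), of "\<lambda>i. \<integral>t. \<bar>f i t\<bar> \<partial>Leb01"]])
  show "L2 Q u" unfolding u by (rule *(1)) (use linear_measurable f L2_snd b in auto)
  have "L2 QL (\<lambda>x. \<Sum>i<m. dU i (\<lambda>j. \<integral>t. f j t * fst x t \<partial>Leb01) * f i (snd x))"
    by (rule *(2)) (use linear_measurable f L2_snd b in auto)
  then show "L2 QL (case_prod Du)" by (simp add: Du case_prod_unfold)
qed

lemma L2_cong_space:
  assumes "L2 M f" "\<And>x. x \<in> space M \<Longrightarrow> f x = g x" shows "L2 M g"
proof -
  have "g \<in> borel_measurable M" using L2_measurable[OF assms(1)] by (rule measurable_cong[THEN iffD1, rotated]) (rule assms(2))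
  then show ?thesis using assms by (intro L2_bound[OF assms(1)]) auto
qed

lemma Z1_L2:
  assumes "(u, Du) \<in> Z1" shows "L2 Q u" "L2 QL (case_prod Du)"
proof -
  obtain m U dU b b' where C: "C1_Rm m U dU" and
    b: "\<And>i x. i < m \<Longrightarrow> (b i has_real_derivative b' i x) (at x)" and b': "\<And>i. i < m \<Longrightarrow> continuous_on UNIV (b' i)" and
    u: "\<And>g. g \<in> G0 \<Longrightarrow> u g = U (\<lambda>i. \<integral>s. b i (g s) \<partial>Leb01)" and
    Du: "\<And>g t. g \<in> G0 \<Longrightarrow> t \<in> {0..1} \<Longrightarrow> Du g t = (\<Sum>i<m. dU i (\<lambda>j. \<integral>s. b j (g s) \<partial>Leb01) * b' i (g t))"
    using Z1_extend[OF assms] by blast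
  have bc: "continuous_on UNIV (b i)" if "i < m" for i by (rule continuous_on_DERIV[OF b[OF that]])
  have "\<exists>M. \<forall>x\<in>{0..1}. \<bar>b i x\<bar> \<le> M" if "i < m" for i using continuous_bounded_unit[OF bc[OF that]] by metis
  then obtain M where M: "\<And>i x. i < m \<Longrightarrow> x \<in> {0..1} \<Longrightarrow> \<bar>b i x\<bar> \<le> M i" by metis
  note * = cylinder_L2[OF C, of "\<lambda>i g. \<integral>s. b i (g s) \<partial>Leb01" "\<lambda>i x. b' i (fst x (snd x))" "\<Sum>i<m. \<bar>M i\<bar>"]
  have 1: "(\<lambda>g. \<integral>s. b i (g s) \<partial>Leb01) \<in> borel_measurable Q" if "i < m" for i by (rule compose_path_measurable(3)[OF bc[OF that]])
  have 2: "L2 QL (\<lambda>x. b' i (fst x (snd x)))" if i: "i < m" for i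
  proof -
    obtain R where R: "\<And>x. x \<in> {0..1} \<Longrightarrow> \<bar>b' i x\<bar> \<le> R" by (rule continuous_bounded_unit[OF b'[OF i]]) blast
    show ?thesis
    proof (rule P.L2_bounded[OF compose_path_measurable(1)[OF b'[OF i]], of R])
      fix x assume "x \<in> space QL"
      then have "fst x (snd x) \<in> {0..1}" using G0_bounds by auto
      then show "\<bar>b' i (fst x (snd x))\<bar> \<le> R" by (rule R)
    qed
  qed
  have 3: "\<bar>\<integral>s. b i (g s) \<partial>Leb01\<bar> \<le> (\<Sum>i<m. \<bar>M i\<bar>)" if "i < m" "g \<in> G0" for i g
  proof (rule order_trans[OF _ sum_bound_member[OF that(1)]], rule abs_integral_le)
    show "(\<lambda>s. b i (g s)) \<in> borel_measurable Leb01" by (rule compose_path_measurable(2)[OF bc[OF that(1)] that(2)])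
    show "\<bar>b i (g t)\<bar> \<le> M i" if "t \<in> {0..1}" for t
      using M[OF \<open>i < m\<close>, of "g t"] G0_bounds[OF \<open>g \<in> G0\<close> that] by simp
  qed
  have "L2 Q (\<lambda>g. U (\<lambda>i. \<integral>s. b i (g s) \<partial>Leb01))" by (rule *(1)) (use 1 2 3 in auto)
  then show "L2 Q u" by (rule L2_cong_space) (simp add: u)
  have "L2 QL (\<lambda>x. \<Sum>i<m. dU i (\<lambda>j. \<integral>s. b j (fst x s) \<partial>Leb01) * b' i (fst x (snd x)))" by (rule *(2)) (use 1 2 3 in auto)
  then show "L2 QL (case_prod Du)" by (rule L2_cong_space) (auto simp: Du)
qed

text \<open>The indicator of a cell, normalised to integral 1. The index k counts from 0, as the
  arguments in \<open>C1_Rm\<close> do, whereas \<open>idx\<close> counts from 1.\<close>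

definition cellfun :: "nat \<Rightarrow> nat \<Rightarrow> real \<Rightarrow> real" where
  "cellfun N k s = real N * indicator {s. idx N s = Suc k} s"

lemma cellfun_facts:
  assumes "k < N"
  shows "L2 Leb01 (cellfun N k)" "0 \<le> cellfun N k s" "(\<integral>s. cellfun N k s \<partial>Leb01) = 1"
proof -
  have "(\<lambda>s. real N * (if idx N s = Suc k then 1 else 0)) \<in> borel_measurable Leb01" by measurable
  then have m: "cellfun N k \<in> borel_measurable Leb01" by (simp add: cellfun_def[abs_def] indicator_def of_bool_def)
  show "L2 Leb01 (cellfun N k)"
    by (rule Leb01.L2_bounded[OF m, of "real N"]) (auto simp: cellfun_def indicator_def)
  show "0 \<le> cellfun N k s" by (simp add: cellfun_def)
  have "(\<integral>s. cellfun N k s \<partial>Leb01) = real N * (\<integral>s. indicator {s. idx N s = Suc k} s \<partial>Leb01)"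
    unfolding cellfun_def by (rule integral_mult_right_zero)
  also have "\<dots> = 1" by (subst integral_cell) (use assms in auto)
  finally show "(\<integral>s. cellfun N k s \<partial>Leb01) = 1" .
qed

definition cellmean :: "nat \<Rightarrow> (real \<Rightarrow> real) \<Rightarrow> nat \<Rightarrow> real" where
  "cellmean N g k = (\<integral>s. cellfun N k s * g s \<partial>Leb01)"

lemma cellmean_close:
  assumes g: "g \<in> G0" and k: "k < N" and e: "\<And>s. s \<in> {0..1} \<Longrightarrow> idx N s = Suc k \<Longrightarrow> \<bar>g s - c\<bar> \<le> e"
  shows "\<bar>cellmean N g k - c\<bar> \<le> e"
  unfolding cellmean_def
proof (rule weighted_mean_bound)
  show "integrable Leb01 (cellfun N k)" by (intro Leb01.L2_integrable cellfun_facts k)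
  have "L2 Leb01 g" by (rule Leb01.L2_bounded[OF path_measurable[OF g], of 1]) (use G0_bounds[OF g] in auto)
  then show "integrable Leb01 (\<lambda>s. cellfun N k s * g s)" by (intro L2_mult_integrable cellfun_facts k)
  show "\<bar>g s - c\<bar> \<le> e" if "s \<in> {0..1}" "cellfun N k s \<noteq> 0" for s
    by (rule e) (use that in \<open>auto simp: cellfun_def indicator_def split: if_splits\<close>)
qed (use cellfun_facts[OF k] in auto)

lemma cellmean_unit:
  assumes "g \<in> G0" "k < N" shows "cellmean N g k \<in> {0..1}"
proof -
  \<comment> \<open>Distance at most 1/2 from 1/2 expresses membership in [0,1], which turns the
    claim into an instance of \<open>cellmean_close\<close>.\<close>
  have "\<bar>g s - 1/2\<bar> \<le> 1/2" if "s \<in> {0..1}" for s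
    using G0_bounds[OF assms(1) that] by linarith
  then have "\<bar>cellmean N g k - 1/2\<bar> \<le> 1/2" by (intro cellmean_close[OF assms])
  then have "0 \<le> cellmean N g k" "cellmean N g k \<le> 1" by linarith+
  then show ?thesis by simp
qed

lemma cellmean_measurable: "k < N \<Longrightarrow> (\<lambda>g. cellmean N g k) \<in> borel_measurable Q"
  unfolding cellmean_def by (intro linear_measurable cellfun_facts)

text \<open>Cell means look to both sides of t, so right continuity does not suffice for their
  convergence. A monotone path has at most countably many jumps.\<close>

lemma AE_continuous_path: "g \<in> G0 \<Longrightarrow> AE t in Leb01. continuous (at t within {0..1}) g"
proof -
  assume g: "g \<in> G0"
  have "mono_on {0..1} g" by (intro mono_onI) (use G0_mono[OF g] in auto)
  then have "countable {t \<in> {0..1}. \<not> continuous (at t within {0..1}) g}" by (rule mono_on_ctble_discont)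
  from AE_Leb01_countable[OF this] show ?thesis using AE_space[of Leb01] by eventually_elim auto
qed

lemma same_cell_close:
  assumes "s \<in> {0..1}" "t \<in> {0..1}" "idx N s = idx N t" "N > 0"
  shows "\<bar>s - t\<bar> \<le> 1 / real N"
proof -
  have b: "(real (idx N s) - 1) / real N \<le> s \<and> s \<le> real (idx N s) / real N" if "s \<in> {0..1}" for s
  proof (cases "s = 1")
    case True
    then show ?thesis using assms(4) by (simp add: idx_one)
  qed (use idx_bounds[of s N] that assms(4) in auto)
  show ?thesis using b[OF assms(1)] b[OF assms(2)] assms(3) by (auto simp: abs_le_iff diff_divide_distrib)
qed

lemma cellmean_tendsto:
  assumes g: "g \<in> G0" and t: "t \<in> {0..1}" and c: "continuous (at t within {0..1}) g"
  shows "(\<lambda>n. cellmean (Suc n) g (idx (Suc n) t - 1)) \<longlonglongrightarrow> g t"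
proof (rule LIMSEQ_I)
  fix r :: real assume r: "0 < r"
  obtain d where d: "d > 0" "\<And>s. s \<in> {0..1} \<Longrightarrow> dist s t < d \<Longrightarrow> dist (g s) (g t) < r / 2"
    using c r unfolding continuous_within_eps_delta by (metis half_gt_zero)
  have "\<forall>\<^sub>F n in sequentially. inverse (real (Suc n)) < d"
    by (rule order_tendstoD(2)[OF LIMSEQ_inverse_real_of_nat d(1)])
  then obtain n0 where n0: "\<And>n. n \<ge> n0 \<Longrightarrow> inverse (real (Suc n)) < d" unfolding eventually_sequentially by blast
  have "norm (cellmean (Suc n) g (idx (Suc n) t - 1) - g t) < r" if "n \<ge> n0" for n
  proof -
    have i: "idx (Suc n) t \<in> {1..Suc n}" by (rule idx_mem) simp
    have "\<bar>cellmean (Suc n) g (idx (Suc n) t - 1) - g t\<bar> \<le> r / 2"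
    proof (rule cellmean_close[OF g])
      fix s assume s: "s \<in> {0..1}" "idx (Suc n) s = Suc (idx (Suc n) t - 1)"
      then have "\<bar>s - t\<bar> \<le> 1 / real (Suc n)" using i by (intro same_cell_close t) auto
      then have "dist s t < d" using n0[OF that] by (simp add: dist_real_def inverse_eq_divide)
      from d(2)[OF s(1) this] show "\<bar>g s - g t\<bar> \<le> r / 2" by (simp add: dist_real_def)
    qed (use i in auto)
    then show ?thesis using r by simp
  qed
  then show "\<exists>no. \<forall>n\<ge>no. norm (cellmean (Suc n) g (idx (Suc n) t - 1) - g t) < r" by blast
qed

lemma sum_cells:
  assumes "N > 0"
  shows "(\<Sum>k<N. \<psi> k / real N) = (\<integral>t. \<psi> (idx N t - 1) \<partial>Leb01)"
    "(\<Sum>k<N. \<psi> k / real N * cellfun N k t) = (\<psi> (idx N t - 1) :: real)"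
proof -
  have "(\<integral>t. \<psi> (idx N t - 1) \<partial>Leb01) = (\<Sum>k\<in>{1..N}. \<psi> (k - 1)) / real N"
    using integral_step_mean[OF assms, of "\<lambda>k. \<psi> (k - 1)"] by simp
  also have "(\<Sum>k\<in>{1..N}. \<psi> (k - 1)) = (\<Sum>k<N. \<psi> k)" by (simp add: sum.atLeast1_atMost_eq)
  finally show "(\<Sum>k<N. \<psi> k / real N) = (\<integral>t. \<psi> (idx N t - 1) \<partial>Leb01)" by (simp add: sum_divide_distrib)
  have i: "idx N t - 1 < N" "Suc (idx N t - 1) = idx N t" using idx_mem[OF assms, of t] by auto
  have "(\<Sum>k<N. \<psi> k / real N * cellfun N k t) = (\<Sum>k<N. if k = idx N t - 1 then \<psi> k else 0)"
    by (rule sum.cong[OF refl]) (use assms i in \<open>auto simp: cellfun_def indicator_def\<close>)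
  also have "\<dots> = \<psi> (idx N t - 1)" using i by (simp add: sum.delta')
  finally show "(\<Sum>k<N. \<psi> k / real N * cellfun N k t) = \<psi> (idx N t - 1)" .
qed

text \<open>The integral of \<open>b i\<close> along the path is replaced by the average of
  \<open>b i\<close> over the cell means. These means are linear functionals with square integrable
  coefficients, so the result belongs to \<open>C1\<close>. In its gradient the height N of
  \<open>cellfun\<close> cancels the weight 1 / N of the average, leaving \<open>b' i\<close> at the
  mean of the cell that contains t.\<close>

lemma Z1_subset_closure_C1: "Z1 \<subseteq> op_closure Q C1"
proof
  fix p assume "p \<in> Z1"
  obtain u Du where p: "p = (u, Du)" by (cases p)
  then have uZ: "(u, Du) \<in> Z1" using \<open>p \<in> Z1\<close> by simp
  obtain m U dU b b' where C: "C1_Rm m U dU" and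
    b: "\<And>i x. i < m \<Longrightarrow> (b i has_real_derivative b' i x) (at x)" and b': "\<And>i. i < m \<Longrightarrow> continuous_on UNIV (b' i)" and
    u: "\<And>g. g \<in> G0 \<Longrightarrow> u g = U (\<lambda>i. \<integral>s. b i (g s) \<partial>Leb01)" and
    Du: "\<And>g t. g \<in> G0 \<Longrightarrow> t \<in> {0..1} \<Longrightarrow> Du g t = (\<Sum>i<m. dU i (\<lambda>j. \<integral>s. b j (g s) \<partial>Leb01) * b' i (g t))"
    using Z1_extend[OF uZ] by blast
  have bc: "continuous_on UNIV (b i)" if "i < m" for i by (rule continuous_on_DERIV[OF b[OF that]])
  have bm: "b i \<in> borel_measurable borel" "b' i \<in> borel_measurable borel" if "i < m" for i
    using bc[OF that] b'[OF that] by (auto intro: borel_measurable_continuous_onI)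
  have "\<exists>M. \<forall>x\<in>{0..1}. \<bar>b i x\<bar> \<le> M" if "i < m" for i using continuous_bounded_unit[OF bc[OF that]] by metis
  then obtain M where M: "\<And>i x. i < m \<Longrightarrow> x \<in> {0..1} \<Longrightarrow> \<bar>b i x\<bar> \<le> M i" by metis
  have "\<exists>M. \<forall>x\<in>{0..1}. \<bar>b' i x\<bar> \<le> M" if "i < m" for i using continuous_bounded_unit[OF b'[OF that]] by metis
  then obtain M' where M': "\<And>i x. i < m \<Longrightarrow> x \<in> {0..1} \<Longrightarrow> \<bar>b' i x\<bar> \<le> M' i" by metis
  define ls where "ls n i g = (\<Sum>k<Suc n. b i (cellmean (Suc n) g k) / real (Suc n))" for n i g
  define ks where "ks n i x = (\<Sum>k<Suc n. b' i (cellmean (Suc n) (fst x) k) / real (Suc n) * cellfun (Suc n) k (snd x))"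
    for n i and x :: "(real \<Rightarrow> real) \<times> real"
  have ls_eq: "ls n i g = (\<integral>t. b i (cellmean (Suc n) g (idx (Suc n) t - 1)) \<partial>Leb01)" for n i g
    unfolding ls_def by (rule sum_cells(1)) simp
  have ks_eq: "ks n i x = b' i (cellmean (Suc n) (fst x) (idx (Suc n) (snd x) - 1))" for n i x
    unfolding ks_def by (rule sum_cells(2)) simp
  have unit: "cellmean (Suc n) g (idx (Suc n) t - 1) \<in> {0..1}" if "g \<in> G0" for n g t
    by (rule cellmean_unit[OF that]) (use idx_mem[of "Suc n" t] in auto)
  define V where "V n y = U (\<lambda>i. 0 + (\<Sum>k<Suc n. b i (y k) / real (Suc n)))" for n and y :: "nat \<Rightarrow> real"
  define dV where "dV n k y = (\<Sum>i<m. dU i (\<lambda>i. 0 + (\<Sum>k<Suc n. b i (y k) / real (Suc n))) * (b' i (y k) / real (Suc n)))" for n k and y :: "nat \<Rightarrow> real"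
  have CV: "C1_Rm (Suc n) (V n) (dV n)" for n
    unfolding V_def dV_def
    by (rule C1_Rm_sum_comp[OF C]) (auto intro!: DERIV_cdivide b continuous_on_divide b' continuous_on_const simp del: of_nat_Suc)
  define us where "us n g = V n (\<lambda>k. \<integral>s. cellfun (Suc n) k s * g s \<partial>Leb01)" for n g
  define Ds where "Ds n g t = (\<Sum>k<Suc n. dV n k (\<lambda>k. \<integral>s. cellfun (Suc n) k s * g s \<partial>Leb01) * cellfun (Suc n) k t)" for n g t
  have inC1: "(us n, Ds n) \<in> C1" for n
    unfolding C1_iff us_def[abs_def] Ds_def[abs_def] using CV[of n] cellfun_facts(1) by blast
  have us_eq: "us n = (\<lambda>g. U (\<lambda>i. ls n i g))" for n
    by (simp add: us_def V_def ls_def cellmean_def fun_eq_iff)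
  have Ds_eq: "case_prod (Ds n) = (\<lambda>x. \<Sum>i<m. dU i (\<lambda>j. ls n j (fst x)) * ks n i x)" for n
  proof
    fix x
    have "case_prod (Ds n) x = (\<Sum>k<Suc n. \<Sum>i<m. dU i (\<lambda>j. ls n j (fst x)) * (b' i (cellmean (Suc n) (fst x) k) / real (Suc n) * cellfun (Suc n) k (snd x)))"
      by (simp add: case_prod_unfold Ds_def dV_def ls_def cellmean_def sum_distrib_right mult.assoc)
    also have "\<dots> = (\<Sum>i<m. dU i (\<lambda>j. ls n j (fst x)) * ks n i x)"
      unfolding ks_def sum_distrib_left by (rule sum.swap)
    finally show "case_prod (Ds n) x = (\<Sum>i<m. dU i (\<lambda>j. ls n j (fst x)) * ks n i x)" .
  qed
  have lsm: "ls n i \<in> borel_measurable Q" if "i < m" for n i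
    unfolding ls_def[abs_def]
    by (intro borel_measurable_sum borel_measurable_divide borel_measurable_const measurable_compose[OF cellmean_measurable bm(1)[OF that]]) simp
  have lm: "(\<lambda>g. \<integral>s. b i (g s) \<partial>Leb01) \<in> borel_measurable Q" if "i < m" for i by (rule compose_path_measurable(3)[OF bc[OF that]])
  have ksm: "ks n i \<in> borel_measurable QL" if "i < m" for n i
    unfolding ks_def[abs_def]
    by (intro borel_measurable_sum borel_measurable_times borel_measurable_divide borel_measurable_const
        measurable_compose[OF measurable_compose[OF measurable_fst cellmean_measurable] bm(2)[OF that]]
        measurable_compose[OF measurable_snd L2_measurable[OF cellfun_facts(1)]]) simp_all
  have km: "(\<lambda>x. b' i (fst x (snd x))) \<in> borel_measurable QL" if "i < m" for i by (rule compose_path_measurable(1)[OF b'[OF that]])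
  have mean_m: "(\<lambda>t. b i (cellmean (Suc n) g (idx (Suc n) t - 1))) \<in> borel_measurable Leb01" for n i g
    by (rule measurable_compose[OF measurable_idx]) simp
  have lsb: "\<bar>ls n i g\<bar> \<le> (\<Sum>i<m. \<bar>M i\<bar>)" if "i < m" "g \<in> G0" for n i g
    unfolding ls_eq
    by (rule order_trans[OF abs_integral_le sum_bound_member[OF that(1)]]) (use mean_m M[OF that(1) unit[OF that(2)]] in auto)
  have ll: "(\<lambda>n. ls n i g) \<longlonglongrightarrow> (\<integral>s. b i (g s) \<partial>Leb01)" if "i < m" "g \<in> G0" for i g
    unfolding ls_eq
  proof (rule integral_dominated_convergence[where w="\<lambda>_. M i"])
    show "(\<lambda>s. b i (g s)) \<in> borel_measurable Leb01" by (rule compose_path_measurable(2)[OF bc[OF that(1)] that(2)])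
    show "AE t in Leb01. (\<lambda>n. b i (cellmean (Suc n) g (idx (Suc n) t - 1))) \<longlonglongrightarrow> b i (g t)"
      using AE_continuous_path[OF that(2)] AE_space
    proof eventually_elim
      case (elim t)
      then have "(\<lambda>n. cellmean (Suc n) g (idx (Suc n) t - 1)) \<longlonglongrightarrow> g t" by (intro cellmean_tendsto that) auto
      then show ?case using continuous_on_tendsto_compose[OF bc[OF that(1)]] by simp
    qed
  qed (use mean_m M[OF that(1) unit[OF that(2)]] in auto)
  have kl: "AE x in QL. (\<lambda>n. ks n i x) \<longlonglongrightarrow> b' i (fst x (snd x))" if "i < m" for i
  proof (rule AE_QL_tendsto[OF ksm[OF that] km[OF that]])
    fix g assume g: "g \<in> G0"
    show "AE t in Leb01. (\<lambda>n. ks n i (g, t)) \<longlonglongrightarrow> b' i (fst (g, t) (snd (g, t)))"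
      using AE_continuous_path[OF g] AE_space
    proof eventually_elim
      case (elim t)
      then have "(\<lambda>n. cellmean (Suc n) g (idx (Suc n) t - 1)) \<longlonglongrightarrow> g t" by (intro cellmean_tendsto g) auto
      then show ?case using continuous_on_tendsto_compose[OF b'[OF that]] by (simp add: ks_eq)
    qed
  qed
  have h: "L2 QL (\<lambda>x. M' i)" for i by (rule P.L2_bounded[of _ "\<bar>M' i\<bar>"]) auto
  have kb: "\<bar>ks n i x\<bar> \<le> M' i" if "i < m" "x \<in> space QL" for n i x
    unfolding ks_eq by (rule M'[OF that(1) unit]) (use that in auto)
  note conv = cylinder_L2conv[where ls=ls and l="\<lambda>i g. \<integral>s. b i (g s) \<partial>Leb01" and ks=ks and k="\<lambda>i x. b' i (fst x (snd x))"
      and B="\<Sum>i<m. \<bar>M i\<bar>" and h="\<lambda>i x. M' i", OF C]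
  have AEl: "AE g in Q. (\<lambda>n. ls n i g) \<longlonglongrightarrow> (\<integral>s. b i (g s) \<partial>Leb01)" if "i < m" for i
    by (rule AE_I2) (use ll[OF that] in simp)
  have "(\<lambda>g. U (\<lambda>i. \<integral>s. b i (g s) \<partial>Leb01), \<lambda>g t. \<Sum>i<m. dU i (\<lambda>j. \<integral>s. b j (g s) \<partial>Leb01) * b' i (g t)) \<in> op_closure Q C1"
  proof (rule op_closureI[of us Ds, OF inC1])
    show "L2conv Q us (\<lambda>g. U (\<lambda>i. \<integral>s. b i (g s) \<partial>Leb01))"
      unfolding us_eq[abs_def] by (rule conv(1)) (rule lsm lm ksm km lsb AEl kl h kb; assumption)+
    show "L2conv QL (\<lambda>n. case_prod (Ds n)) (\<lambda>(g, t). \<Sum>i<m. dU i (\<lambda>j. \<integral>s. b j (g s) \<partial>Leb01) * b' i (g t))"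
      unfolding Ds_eq unfolding case_prod_unfold by (rule conv(2)) (rule lsm lm ksm km lsb AEl kl h kb; assumption)+
  qed
  \<comment> \<open>The extended functions agree with the original ones on [0,1], so both graphs
    coincide over \<open>G0\<close> and the closure does not distinguish them.\<close>
  then show "p \<in> op_closure Q C1"
    unfolding p by (rule op_closure_cong[OF _ Z1_L2[OF uZ]]) (auto intro!: AE_I2 simp: u Du)
qed

end

section \<open>\<open>C1\<close> lies in the closure of \<open>Z1\<close>\<close>

text \<open>The hat function on [-1,1], written as a second difference of the positive part; in this
  form the sum over integer shifts telescopes.\<close>

definition tent :: "real \<Rightarrow> real" where
  "tent z = max 0 (z + 1) - 2 * max 0 z + max 0 (z - 1)"

text \<open>A C^1 transition from 0 at -1 to 1 at 1 with derivative \<open>tent\<close>. The shifts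
  by -1 and 0 are written out to match \<open>has_real_derivative_max0_powr_shift\<close>.\<close>

definition ramp :: "real \<Rightarrow> real" where
  "ramp z = (max 0 (z - (-1)) powr (1 + 1) - 2 * max 0 (z - 0) powr (1 + 1) + max 0 (z - 1) powr (1 + 1)) / 2"

lemma ramp_DERIV: "(ramp has_real_derivative tent z) (at z)"
proof -
  have "(ramp has_real_derivative ((1 + 1) * max 0 (z - (-1)) powr 1 - 2 * ((1 + 1) * max 0 (z - 0) powr 1) + (1 + 1) * max 0 (z - 1) powr 1) / 2) (at z)"
    unfolding ramp_def[abs_def]
    by (intro DERIV_cdivide DERIV_add DERIV_diff DERIV_cmult has_real_derivative_max0_powr_shift) simp_all
  then show ?thesis by (rule DERIV_cong) (simp add: tent_def field_simps)
qed

lemma tent_cont: "continuous_on S tent"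
  unfolding tent_def[abs_def] by (intro continuous_intros)

lemma tent_nonneg: "0 \<le> tent z" and tent_zero: "\<bar>z\<bar> \<ge> 1 \<Longrightarrow> tent z = 0"
  by (auto simp: tent_def max_def)

lemma ramp_low: "z \<le> -1 \<Longrightarrow> ramp z = 0" and ramp_high: "z \<ge> 1 \<Longrightarrow> ramp z = 1"
  by (simp_all add: ramp_def power2_eq_square algebra_simps)

lemma ramp_mono: "x \<le> y \<Longrightarrow> ramp x \<le> ramp y"
  by (rule DERIV_nonneg_imp_nondecreasing[of x y ramp]) (use ramp_DERIV tent_nonneg in blast)+

lemma ramp_unit: "ramp z \<in> {0..1}"
  using ramp_mono[of "min z (-1)" z] ramp_mono[of z "max z 1"] ramp_low[of "min z (-1)"] ramp_high[of "max z 1"] by simp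

text \<open>Second differences telescope, and both end terms are explicit because y lies between 0
  and N. The right end point carries a hat of its own, hence the extra node in the sums of
  \<open>C1_continuous_in_closure_Z1\<close>.\<close>

lemma sum_tent:
  assumes "0 \<le> y" "y \<le> real N"
  shows "(\<Sum>k<Suc N. tent (y - real k)) = 1"
proof -
  define d where "d k = max 0 (y - real k + 1) - max 0 (y - real k)" for k
  have "(\<Sum>k<Suc N. tent (y - real k)) = (\<Sum>k<Suc N. d k - d (Suc k))"
    by (rule sum.cong[OF refl]) (simp add: tent_def d_def algebra_simps)
  also have "\<dots> = d 0 - d (Suc N)" by (rule sum_lessThan_telescope')
  also have "\<dots> = 1" using assms by (simp add: d_def)
  finally show ?thesis .
qed

interpretation LL: pair_prob_space Leb01 Leb01 ..

context entropic
begin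

text \<open>A smoothed distribution function of the path, evaluated at \<open>k / (n + 1)\<close>.\<close>

definition scdf :: "nat \<Rightarrow> (real \<Rightarrow> real) \<Rightarrow> nat \<Rightarrow> real" where
  "scdf n g k = (\<integral>s. 1 - ramp (real (Suc n) * g s - real k) \<partial>Leb01)"

definition cdf :: "(real \<Rightarrow> real) \<Rightarrow> real \<Rightarrow> real" where
  "cdf g x = (\<integral>s. indicator {s. g s \<le> x} s \<partial>Leb01)"

lemma scdf_kernel_DERIV:
  "((\<lambda>y. 1 - ramp (real (Suc n) * y - real k)) has_real_derivative - (real (Suc n) * tent (real (Suc n) * y - real k))) (at y)"
proof -
  have "((\<lambda>y. real (Suc n) * y - real k) has_real_derivative real (Suc n)) (at y)"
    by (auto intro!: derivative_eq_intros)
  from DERIV_chain2[OF ramp_DERIV this]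
  have "((\<lambda>y. ramp (real (Suc n) * y - real k)) has_real_derivative tent (real (Suc n) * y - real k) * real (Suc n)) (at y)" .
  from DERIV_diff[OF DERIV_const[of 1] this] show ?thesis by (simp add: mult.commute)
qed

lemma scdf_kernel_cont: "continuous_on UNIV (\<lambda>y. 1 - ramp (real (Suc n) * y - real k))"
  by (rule continuous_on_DERIV[OF scdf_kernel_DERIV])

lemma scdf_measurable: "(\<lambda>g. scdf n g k) \<in> borel_measurable Q"
  unfolding scdf_def by (rule compose_path_measurable(3)[OF scdf_kernel_cont])

lemma scdf_unit:
  assumes "g \<in> G0" shows "scdf n g k \<in> {0..1}"
proof -
  have m: "(\<lambda>s. 1 - ramp (real (Suc n) * g s - real k)) \<in> borel_measurable Leb01"
    by (rule compose_path_measurable(2)[OF scdf_kernel_cont assms])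
  have "\<bar>scdf n g k\<bar> \<le> 1" unfolding scdf_def
    by (rule abs_integral_le[OF m]) (use ramp_unit in \<open>auto simp: abs_le_iff\<close>)
  moreover have "0 \<le> scdf n g k" unfolding scdf_def
    by (rule Bochner_Integration.integral_nonneg) (use ramp_unit in auto)
  ultimately show ?thesis by simp
qed

lemma level_measurable: "g \<in> G0 \<Longrightarrow> (\<lambda>s. indicator {s. g s \<le> x} s :: real) \<in> borel_measurable Leb01"
proof -
  assume g: "g \<in> G0"
  have "(\<lambda>y. indicator {..x} y :: real) \<in> borel_measurable borel" by measurable
  from measurable_compose[OF path_measurable[OF g] this] show ?thesis by (simp add: indicator_def)
qed

text \<open>A nonzero hat places the node k / (n + 1) within 1 / (n + 1) of g t, and the ramp is
  constant beyond distance 1 / (n + 1) from that node. So the integrand of \<open>scdf\<close>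
  equals the indicator of [0,t] unless g s is within 2 / (n + 1) of g t, and the error is at most
  the time the path spends there.\<close>

lemma scdf_close:
  assumes g: "g \<in> G0" and t: "t \<in> {0..1}" and k: "tent (real (Suc n) * g t - real k) \<noteq> 0"
  shows "\<bar>scdf n g k - t\<bar> \<le> (\<integral>s. indicator {s. \<bar>g s - g t\<bar> \<le> 2 / real (Suc n)} s \<partial>Leb01)"
proof -
  define N where "N = real (Suc n)"
  have N: "N > 0" by (simp add: N_def)
  have kt: "\<bar>N * g t - real k\<bar> < 1" using tent_zero[of "N * g t - real k"] k unfolding N_def by fastforce
  have m1: "(\<lambda>s. 1 - ramp (N * g s - real k)) \<in> borel_measurable Leb01"
    unfolding N_def by (rule compose_path_measurable(2)[OF scdf_kernel_cont g])
  have L1: "L2 Leb01 (\<lambda>s. 1 - ramp (N * g s - real k))"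
    by (rule Leb01.L2_bounded[OF m1, of 1]) (use ramp_unit in \<open>auto simp: abs_le_iff\<close>)
  have L2: "L2 Leb01 (\<lambda>s. indicator {0..t} s)"
    by (rule Leb01.L2_bounded[of _ 1]) (auto intro!: borel_measurable_Leb01 simp: indicator_def)
  have m3: "(\<lambda>s. indicator {s. \<bar>g s - g t\<bar> \<le> 2 / N} s :: real) \<in> borel_measurable Leb01"
  proof -
    have "(\<lambda>y. indicator {g t - 2 / N..g t + 2 / N} y :: real) \<in> borel_measurable borel" by measurable
    from measurable_compose[OF path_measurable[OF g] this] show ?thesis
      by (rule measurable_cong[THEN iffD1, rotated]) (auto simp: indicator_def abs_le_iff)
  qed
  have L3: "L2 Leb01 (\<lambda>s. indicator {s. \<bar>g s - g t\<bar> \<le> 2 / N} s)"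
    by (rule Leb01.L2_bounded[OF m3, of 1]) (auto simp: indicator_def)
  have i12: "integrable Leb01 (\<lambda>s. 1 - ramp (N * g s - real k) - indicator {0..t} s)"
    by (intro Leb01.L2_integrable L2_diff L1 L2)
  have "t = (\<integral>s. indicator {0..t} s \<partial>Leb01)" using integral_interval_Leb01[of 0 t] t by simp
  then have "scdf n g k - t = (\<integral>s. 1 - ramp (N * g s - real k) - indicator {0..t} s \<partial>Leb01)"
    unfolding scdf_def N_def[symmetric]
    using Bochner_Integration.integral_diff[OF Leb01.L2_integrable[OF L1] Leb01.L2_integrable[OF L2]] by metis
  then have "\<bar>scdf n g k - t\<bar> \<le> (\<integral>s. \<bar>1 - ramp (N * g s - real k) - indicator {0..t} s\<bar> \<partial>Leb01)"
    by (simp only: integral_abs_bound)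
  also have "\<dots> \<le> (\<integral>s. indicator {s. \<bar>g s - g t\<bar> \<le> 2 / N} s \<partial>Leb01)"
  proof (rule integral_mono)
    show "integrable Leb01 (\<lambda>s. \<bar>1 - ramp (N * g s - real k) - indicator {0..t} s\<bar>)" by (rule integrable_abs[OF i12])
    show "integrable Leb01 (\<lambda>s. indicator {s. \<bar>g s - g t\<bar> \<le> 2 / N} s :: real)" by (rule Leb01.L2_integrable[OF L3])
    fix s assume "s \<in> space Leb01"
    then have s: "s \<in> {0..1}" by simp
    show "\<bar>1 - ramp (N * g s - real k) - indicator {0..t} s\<bar> \<le> (indicator {s. \<bar>g s - g t\<bar> \<le> 2 / N} s :: real)"
    proof (cases "\<bar>g s - g t\<bar> \<le> 2 / N")
      case True
      then show ?thesis using ramp_unit[of "N * g s - real k"] by (auto simp: indicator_def)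
    next
      case False
      then have far: "\<bar>N * g s - N * g t\<bar> > 2"
      proof -
        have "2 < N * \<bar>g s - g t\<bar>" using False N by (simp add: field_simps not_le)
        also have "N * \<bar>g s - g t\<bar> = \<bar>N * g s - N * g t\<bar>"
          using N by (simp add: abs_mult flip: right_diff_distrib)
        finally show ?thesis .
      qed
      show ?thesis
      proof (cases "s \<le> t")
        case True
        then have "N * g s \<le> N * g t" using G0_mono[OF g, of s t] s t N by simp
        then have "N * g s - real k \<le> -1" using far kt by linarith
        then show ?thesis using True s by (simp add: ramp_low)
      next
        case False
        then have "N * g t \<le> N * g s" using G0_mono[OF g, of t s] s t N by simp
        then have "N * g s - real k \<ge> 1" using far kt by linarith
        then show ?thesis using False s by (simp add: ramp_high)
      qed
    qed
  qed
  finally show ?thesis by (simp add: N_def)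
qed

text \<open>A strictly increasing path attains the level g t at t alone, so these sets shrink to one
  point.\<close>

lemma near_level_tendsto:
  assumes g: "g \<in> G0" and str: "strict_path g" and t: "t \<in> {0..1}"
  shows "(\<lambda>n. \<integral>s. indicator {s. \<bar>g s - g t\<bar> \<le> 2 / real (Suc n)} s \<partial>Leb01) \<longlonglongrightarrow> (0::real)"
proof -
  have "(\<lambda>n. \<integral>s. indicator {s. \<bar>g s - g t\<bar> \<le> 2 / real (Suc n)} s \<partial>Leb01) \<longlonglongrightarrow> (\<integral>s. (0::real) \<partial>Leb01)"
  proof (rule integral_dominated_convergence[where w="\<lambda>_. 1"])
    show "(\<lambda>s. indicator {s. \<bar>g s - g t\<bar> \<le> 2 / real (Suc n)} s :: real) \<in> borel_measurable Leb01" for n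
    proof -
      have "(\<lambda>y. indicator {g t - 2 / real (Suc n)..g t + 2 / real (Suc n)} y :: real) \<in> borel_measurable borel" by measurable
      from measurable_compose[OF path_measurable[OF g] this] show ?thesis
        by (rule measurable_cong[THEN iffD1, rotated]) (auto simp: indicator_def abs_le_iff simp del: of_nat_Suc)
    qed
    show "AE s in Leb01. (\<lambda>n. indicator {s. \<bar>g s - g t\<bar> \<le> 2 / real (Suc n)} s) \<longlonglongrightarrow> (0::real)"
      using AE_Leb01_neq[of t] AE_space
    proof eventually_elim
      case (elim s)
      have "g s \<noteq> g t"
        using str t elim unfolding strict_path_def by (cases s t rule: linorder_cases) force+
      then have pos: "0 < \<bar>g s - g t\<bar>" by simp
      have "(\<lambda>n. 2 * inverse (real (Suc n))) \<longlonglongrightarrow> 0" by (rule tendsto_mult_right_zero[OF LIMSEQ_inverse_real_of_nat])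
      then have "\<forall>\<^sub>F n in sequentially. 2 * inverse (real (Suc n)) < \<bar>g s - g t\<bar>"
        by (rule order_tendstoD(2)[OF _ pos])
      then show ?case
        by (intro tendsto_eventually) (auto elim!: eventually_mono simp: divide_inverse simp del: of_nat_Suc)
    qed
  qed (auto simp: indicator_def)
  then show ?thesis by simp
qed

text \<open>The node used for x is the left end of its cell, and for each s with g s different from
  x the ramp is eventually constant. Strict monotonicity reduces the exceptional level set to at
  most one point.\<close>

lemma scdf_tendsto:
  assumes g: "g \<in> G0" and str: "strict_path g" and x: "x \<in> {0..<1}"
  shows "(\<lambda>n. scdf n g (idx (Suc n) x - 1)) \<longlonglongrightarrow> cdf g x"
  unfolding scdf_def cdf_def
proof (rule integral_dominated_convergence[where w="\<lambda>_. 1"])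
  show "(\<lambda>s. 1 - ramp (real (Suc n) * g s - real (idx (Suc n) x - 1))) \<in> borel_measurable Leb01" for n
    by (rule compose_path_measurable(2)[OF scdf_kernel_cont g])
  show "(\<lambda>s. indicator {s. g s \<le> x} s :: real) \<in> borel_measurable Leb01" by (rule level_measurable[OF g])
  show "AE s in Leb01. norm (1 - ramp (real (Suc n) * g s - real (idx (Suc n) x - 1))) \<le> 1" for n
    by (rule AE_I2) (use ramp_unit in \<open>auto simp: abs_le_iff\<close>)
  have "AE s in Leb01. g s \<noteq> x"
  proof (cases "\<exists>s0\<in>{0..1}. g s0 = x")
    case True
    then obtain s0 where s0: "s0 \<in> {0..1}" "g s0 = x" by blast
    show ?thesis using AE_Leb01_neq[of s0] AE_space
    proof eventually_elim
      case (elim s)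
      then show ?case using str s0 unfolding strict_path_def by (cases s s0 rule: linorder_cases) force+
    qed
  next
    case False
    then show ?thesis by (intro AE_I2) auto
  qed
  then show "AE s in Leb01. (\<lambda>n. 1 - ramp (real (Suc n) * g s - real (idx (Suc n) x - 1))) \<longlonglongrightarrow> (indicator {s. g s \<le> x} s :: real)"
  proof eventually_elim
    case (elim s)
    \<comment> \<open>Scaled by n + 1, the node lies below x by less than 1, so the argument of the
      ramp exceeds (n + 1) (g s - x) by at most 1. It leaves [-1,1] up to the end points as soon as
      (n + 1) |g s - x| is at least 2.\<close>
    have i: "real (Suc n) * (g s - x) \<le> real (Suc n) * g s - real (idx (Suc n) x - 1)"
      "real (Suc n) * g s - real (idx (Suc n) x - 1) \<le> real (Suc n) * (g s - x) + 1" for n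
    proof -
      have m: "idx (Suc n) x \<in> {1..Suc n}" by (rule idx_mem) simp
      have "(real (idx (Suc n) x) - 1) / real (Suc n) \<le> x" "x < real (idx (Suc n) x) / real (Suc n)"
        using idx_bounds[OF x, of "Suc n"] by auto
      then have "real (idx (Suc n) x) - 1 \<le> real (Suc n) * x" "real (Suc n) * x < real (idx (Suc n) x)"
        by (simp_all add: field_simps del: of_nat_Suc)
      moreover have "real (idx (Suc n) x - 1) = real (idx (Suc n) x) - 1" using m by (simp add: of_nat_diff)
      ultimately show "real (Suc n) * (g s - x) \<le> real (Suc n) * g s - real (idx (Suc n) x - 1)"
        "real (Suc n) * g s - real (idx (Suc n) x - 1) \<le> real (Suc n) * (g s - x) + 1"
        unfolding right_diff_distrib by linarith+
    qed
    define c where "c = \<bar>g s - x\<bar>"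
    have c: "c > 0" using elim by (simp add: c_def)
    have ev: "\<forall>\<^sub>F n in sequentially. real (Suc n) * c \<ge> 2"
    proof -
      have "filterlim (\<lambda>n. c * real (Suc n)) at_top sequentially"
        by (intro filterlim_tendsto_pos_mult_at_top[OF tendsto_const c] filterlim_compose[OF filterlim_real_sequentially filterlim_Suc])
      then have "\<forall>\<^sub>F n in sequentially. 2 \<le> c * real (Suc n)" by (simp add: filterlim_at_top del: of_nat_Suc)
      then show ?thesis by (simp only: mult.commute)
    qed
    show ?case
    proof (cases "g s < x")
      case True
      have "\<forall>\<^sub>F n in sequentially. 1 - ramp (real (Suc n) * g s - real (idx (Suc n) x - 1)) = indicator {s. g s \<le> x} s"
        using ev
      proof eventually_elim
        case (elim n)
        have "real (Suc n) * (g s - x) = - (real (Suc n) * c)" using True by (simp add: c_def algebra_simps)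
        then have "real (Suc n) * g s - real (idx (Suc n) x - 1) \<le> -1" using i(2)[of n] elim by linarith
        then show ?case using True by (simp only: ramp_low) simp
      qed
      then show ?thesis by (rule tendsto_eventually)
    next
      case False
      then have gt: "g s > x" using \<open>g s \<noteq> x\<close> by simp
      have "\<forall>\<^sub>F n in sequentially. 1 - ramp (real (Suc n) * g s - real (idx (Suc n) x - 1)) = indicator {s. g s \<le> x} s"
        using ev
      proof eventually_elim
        case (elim n)
        have "real (Suc n) * (g s - x) = real (Suc n) * c" using gt by (simp add: c_def)
        then have "real (Suc n) * g s - real (idx (Suc n) x - 1) \<ge> 1" using i(1)[of n] elim by linarith
        then show ?case using gt by (simp only: ramp_high) simp
      qed
      then show ?thesis by (rule tendsto_eventually)
    qed
  qed
qed auto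

text \<open>The value g t is the length of the set of x below it. After Fubini, the integral over
  time runs over those t with g t > x, which by monotonicity form the interval from
  \<open>cdf g x\<close> to 1 up to one point. A linear functional thus becomes an integral of a
  function of the distribution function, which \<open>Z1\<close> can approximate.\<close>

lemma layer_cake:
  assumes g: "g \<in> G0" and F: "\<And>x. (F has_real_derivative f x) (at x)" and f: "continuous_on UNIV f"
  shows "(\<integral>x. F 1 - F (cdf g x) \<partial>Leb01) = (\<integral>t. f t * g t \<partial>Leb01)"
proof -
  obtain M where M: "\<And>x. x \<in> {0..1} \<Longrightarrow> \<bar>f x\<bar> \<le> M" by (rule continuous_bounded_unit[OF f]) blast
  have fm: "f \<in> borel_measurable borel" by (rule borel_measurable_continuous_onI[OF f])
  define k where "k x t = f t * (if x < g t then 1 else 0)" for x t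
  have inner: "F 1 - F (cdf g x) = (\<integral>t. k x t \<partial>Leb01)" if "x \<in> {0..1}" for x
  proof -
    define a where "a = cdf g x"
    have lev: "L2 Leb01 (\<lambda>s. indicator {s. g s \<le> x} s)"
      by (rule Leb01.L2_bounded[OF level_measurable[OF g], where B=1]) (auto simp: indicator_def)
    note levi = Leb01.L2_integrable[OF lev]
    have a01: "a \<in> {0..1}"
    proof -
      have "\<bar>a\<bar> \<le> 1" unfolding a_def cdf_def by (rule abs_integral_le[OF level_measurable[OF g]]) (auto simp: indicator_def)
      moreover have "0 \<le> a" unfolding a_def cdf_def by (rule Bochner_Integration.integral_nonneg) (auto simp: indicator_def)
      ultimately show ?thesis by simp
    qed
    \<comment> \<open>The length a of the set where g \<le> x separates this set from its
      complement: comparison with [0,t] gives t \<le> a inside and a \<le> t outside.\<close>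
    have up: "t \<le> a" if t: "t \<in> {0..1}" "g t \<le> x" for t
    proof -
      have "(\<integral>s. indicator {0..t} s \<partial>Leb01) \<le> ((\<integral>s. indicator {s. g s \<le> x} s \<partial>Leb01) :: real)"
      proof (rule integral_mono[OF _ levi])
        have "L2 Leb01 (\<lambda>s. indicator {0..t} s)"
          by (rule Leb01.L2_bounded[of _ 1]) (auto intro!: borel_measurable_Leb01 simp: indicator_def)
        then show "integrable Leb01 (\<lambda>s. indicator {0..t} s :: real)" by (rule Leb01.L2_integrable)
        fix s assume "s \<in> space Leb01"
        then show "indicator {0..t} s \<le> (indicator {s. g s \<le> x} s :: real)"
          using G0_mono[OF g, of s t] t by (auto simp: indicator_def)
      qed
      then show ?thesis using integral_interval_Leb01[of 0 t] t by (simp add: a_def cdf_def)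
    qed
    have lo: "a \<le> t" if t: "t \<in> {0..1}" "\<not> g t \<le> x" for t
    proof -
      have "((\<integral>s. indicator {s. g s \<le> x} s \<partial>Leb01) :: real) \<le> (\<integral>s. indicator {0..t} s \<partial>Leb01)"
      proof (rule integral_mono[OF levi])
        have "L2 Leb01 (\<lambda>s. indicator {0..t} s)"
          by (rule Leb01.L2_bounded[of _ 1]) (auto intro!: borel_measurable_Leb01 simp: indicator_def)
        then show "integrable Leb01 (\<lambda>s. indicator {0..t} s :: real)" by (rule Leb01.L2_integrable)
        fix s assume "s \<in> space Leb01"
        then show "(indicator {s. g s \<le> x} s :: real) \<le> indicator {0..t} s"
          using G0_mono[OF g, of t s] t by (cases "s \<le> t") (auto simp: indicator_def)
      qed
      then show ?thesis using integral_interval_Leb01[of 0 t] t by (simp add: a_def cdf_def)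
    qed
    have "F 1 - F a = (\<integral>t. f t * indicator {a..1} t \<partial>lborel)"
      by (rule integral_FTC_Icc_real[symmetric]) (use a01 F f in \<open>auto simp: continuous_on_eq_continuous_at\<close>)
    also have "\<dots> = (\<integral>t. indicator {0..1} t * (f t * indicator {a..1} t) \<partial>lborel)"
      by (rule Bochner_Integration.integral_cong) (use a01 in \<open>auto simp: indicator_def\<close>)
    also have "\<dots> = (\<integral>t. f t * indicator {a..1} t \<partial>Leb01)" by (rule integral_Leb01[symmetric])
    also have "\<dots> = (\<integral>t. k x t \<partial>Leb01)"
    proof (rule integral_cong_AE)
      show "(\<lambda>t. f t * indicator {a..1} t) \<in> borel_measurable Leb01"
        by (intro borel_measurable_Leb01 borel_measurable_times fm) simp
      have "(\<lambda>y. if x < y then 1 else 0 :: real) \<in> borel_measurable borel" by measurable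
      then show "(\<lambda>t. k x t) \<in> borel_measurable Leb01" unfolding k_def
        by (intro borel_measurable_times borel_measurable_Leb01[OF fm] measurable_compose[OF path_measurable[OF g]])
      show "AE t in Leb01. f t * indicator {a..1} t = k x t"
        using AE_Leb01_neq[of a] AE_space
      proof eventually_elim
        case (elim t)
        then show ?case using up[of t] lo[of t] by (cases "g t \<le> x") (auto simp: k_def indicator_def)
      qed
    qed
    finally show ?thesis by (simp add: a_def)
  qed
  have km: "(\<lambda>(x, t). k x t) \<in> borel_measurable (Leb01 \<Otimes>\<^sub>M Leb01)"
  proof -
    have f1: "fst \<in> borel_measurable (Leb01 \<Otimes>\<^sub>M Leb01)"
      by (rule measurable_compose[OF measurable_fst borel_measurable_Leb01[of "\<lambda>t. t"]]) simp
    have f2: "(\<lambda>z. g (snd z)) \<in> borel_measurable (Leb01 \<Otimes>\<^sub>M Leb01)"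
      by (rule measurable_compose[OF measurable_snd path_measurable[OF g]])
    have f3: "(\<lambda>z. f (snd z)) \<in> borel_measurable (Leb01 \<Otimes>\<^sub>M Leb01)"
      by (rule measurable_compose[OF measurable_snd borel_measurable_Leb01[OF fm]])
    have "(\<lambda>z. f (snd z) * (if fst z < g (snd z) then 1 else 0)) \<in> borel_measurable (Leb01 \<Otimes>\<^sub>M Leb01)"
      using f1 f2 f3 by measurable
    then show ?thesis by (simp add: k_def case_prod_unfold)
  qed
  have ki: "integrable (Leb01 \<Otimes>\<^sub>M Leb01) (\<lambda>(x, t). k x t)"
  proof -
    have "L2 (Leb01 \<Otimes>\<^sub>M Leb01) (\<lambda>(x, t). k x t)"
      by (rule LL.L2_bounded[OF km, of "\<bar>M\<bar>"]) (use M in \<open>force simp: k_def space_pair_measure\<close>)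
    then show ?thesis by (rule LL.L2_integrable)
  qed
  have "(\<integral>x. F 1 - F (cdf g x) \<partial>Leb01) = (\<integral>x. (\<integral>t. k x t \<partial>Leb01) \<partial>Leb01)"
    by (rule Bochner_Integration.integral_cong) (use inner in auto)
  also have "\<dots> = (\<integral>t. (\<integral>x. k x t \<partial>Leb01) \<partial>Leb01)" by (rule LL.Fubini_integral[OF ki, symmetric])
  also have "\<dots> = (\<integral>t. f t * g t \<partial>Leb01)"
  proof (rule Bochner_Integration.integral_cong[OF refl])
    fix t assume "t \<in> space Leb01"
    then have gt: "0 \<le> g t" "g t \<le> 1" using G0_bounds[OF g] by auto
    have "(\<integral>x. (if x < g t then 1 else 0 :: real) \<partial>Leb01) = (\<integral>x. indicator {0..g t} x \<partial>Leb01)"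
    proof (rule integral_cong_AE)
      show "AE x in Leb01. (if x < g t then 1 else 0 :: real) = indicator {0..g t} x"
        using AE_Leb01_neq[of "g t"] AE_space by eventually_elim (auto simp: indicator_def)
    qed (auto intro!: borel_measurable_Leb01)
    also have "\<dots> = g t" using integral_interval_Leb01[of 0 "g t"] gt by simp
    finally show "(\<integral>x. k x t \<partial>Leb01) = f t * g t" unfolding k_def by simp
  qed
  finally show ?thesis .
qed

end

text \<open>A Lebesgue measurable function is a limit of continuous ones outside a negligible set.
  Truncation at |M| restores the bound and keeps the limit, since f itself obeys the bound on
  [0,1].\<close>

lemma continuous_approximation:
  fixes f :: "real \<Rightarrow> real"
  assumes f: "f \<in> borel_measurable Leb01" and b: "\<And>t. t \<in> {0..1} \<Longrightarrow> \<bar>f t\<bar> \<le> M"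
  obtains fs where "\<And>n. continuous_on UNIV (fs n)" "\<And>n t. \<bar>fs n t\<bar> \<le> \<bar>M\<bar>" "AE t in Leb01. (\<lambda>n. fs n t) \<longlonglongrightarrow> f t"
proof -
  have "(\<lambda>t. indicator {0..1} t *\<^sub>R f t) \<in> borel_measurable lborel"
    using f unfolding Leb01_def by (subst (asm) borel_measurable_restrict_space_iff) auto
  also have "(\<lambda>t. indicator {0..1} t *\<^sub>R f t) = (\<lambda>t. if t \<in> {0..1} then f t else 0)" by (auto simp: indicator_def)
  finally have "(\<lambda>t. if t \<in> {0..1} then f t else 0) \<in> borel_measurable lebesgue" by (rule measurable_completion)
  then have "f \<in> borel_measurable (lebesgue_on {0..1})"
    by (rule borel_measurable_if_D)
  then have "f measurable_on {0..1}" by (subst measurable_on_iff_borel_measurable) auto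
  then obtain N h where N: "negligible N" and h: "\<And>n. continuous_on UNIV (h n)"
    "\<And>x. x \<notin> N \<Longrightarrow> (\<lambda>n. h n x) \<longlonglongrightarrow> (if x \<in> {0..1} then f x else 0)"
    unfolding measurable_on_def by blast
  define fs where "fs n t = max (- \<bar>M\<bar>) (min \<bar>M\<bar> (h n t))" for n :: nat and t
  have "AE t in lebesgue. t \<notin> N" using N unfolding negligible_iff_null_sets by (rule AE_not_in)
  then have "AE t in lborel. t \<notin> N" by (simp only: AE_completion_iff)
  then have AE: "AE t in Leb01. t \<notin> N" unfolding Leb01_def by (subst AE_restrict_space_iff) auto
  show ?thesis
  proof (rule that[of fs])
    show "continuous_on UNIV (fs n)" for n unfolding fs_def[abs_def] by (intro continuous_intros h)
    show "\<bar>fs n t\<bar> \<le> \<bar>M\<bar>" for n t unfolding fs_def by auto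
    show "AE t in Leb01. (\<lambda>n. fs n t) \<longlonglongrightarrow> f t"
      using AE AE_space
    proof eventually_elim
      case (elim t)
      then have t: "t \<in> {0..1}" by simp
      have "(\<lambda>n. h n t) \<longlonglongrightarrow> f t" using h(2)[OF elim(1)] t by simp
      then have "(\<lambda>n. fs n t) \<longlonglongrightarrow> max (- \<bar>M\<bar>) (min \<bar>M\<bar> (f t))" unfolding fs_def by (intro tendsto_intros)
      moreover have "max (- \<bar>M\<bar>) (min \<bar>M\<bar> (f t)) = f t" using b[OF t] by auto
      ultimately show ?case by simp
    qed
  qed
qed

section \<open>Linear cylinder functions as limits of functions in \<open>Z1\<close>\<close>

context entropic
begin

text \<open>In the layer-cake formula the integral becomes a Riemann sum and the distribution
  function becomes \<open>scdf\<close>, the integral of a smooth function of the path. In the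
  gradient the factor n + 1 from the smoothing cancels the mesh, leaving a mean of
  \<open>f i (scdf n g k)\<close> with hat weights. These weights see only nodes near g t, and there
  \<open>scdf\<close> is near t.\<close>

lemma C1_continuous_in_closure_Z1:
  assumes C: "C1_Rm m U dU" and f: "\<And>i. i < m \<Longrightarrow> continuous_on UNIV (f i)"
  shows "(\<lambda>g. U (\<lambda>i. \<integral>t. f i t * g t \<partial>Leb01), \<lambda>g t. \<Sum>i<m. dU i (\<lambda>j. \<integral>s. f j s * g s \<partial>Leb01) * f i t) \<in> op_closure Q Z1"
proof -
  have "\<exists>F. \<forall>x. (F has_real_derivative f i x) (at x)" if "i < m" for i
    using continuous_antiderivative[OF f[OF that]] by blast
  then obtain F where F: "\<And>i x. i < m \<Longrightarrow> (F i has_real_derivative f i x) (at x)" by metis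
  have Fc: "continuous_on UNIV (F i)" if "i < m" for i by (rule continuous_on_DERIV[OF F[OF that]])
  have bm: "F i \<in> borel_measurable borel" "f i \<in> borel_measurable borel" if "i < m" for i
    using Fc[OF that] f[OF that] by (auto intro: borel_measurable_continuous_onI)
  have "\<exists>M. \<forall>x\<in>{0..1}. \<bar>F i x\<bar> \<le> M" if "i < m" for i using continuous_bounded_unit[OF Fc[OF that]] by metis
  then obtain M where M: "\<And>i x. i < m \<Longrightarrow> x \<in> {0..1} \<Longrightarrow> \<bar>F i x\<bar> \<le> M i" by metis
  have "\<exists>M. \<forall>x\<in>{0..1}. \<bar>f i x\<bar> \<le> M" if "i < m" for i using continuous_bounded_unit[OF f[OF that]] by metis
  then obtain M' where M': "\<And>i x. i < m \<Longrightarrow> x \<in> {0..1} \<Longrightarrow> \<bar>f i x\<bar> \<le> M' i" by metis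
  have L2f: "L2 Leb01 (f i)" if "i < m" for i
    by (rule Leb01.L2_bounded[OF borel_measurable_Leb01[OF bm(2)[OF that]]]) (use M'[OF that] in simp)
  \<comment> \<open>The nodes run from 0 to n + 1, one more than there are cells, so that the hats
    form a partition of unity up to the value 1. The surplus term is of order 1 / n and disappears
    in the limit.\<close>
  define ls where "ls n i g = F i 1 + (\<Sum>k<Suc (Suc n). - (F i (scdf n g k) / real (Suc n)))" for n i g
  define ks where "ks n i x = (\<Sum>k<Suc (Suc n). f i (scdf n (fst x) k) * tent (real (Suc n) * fst x (snd x) - real k))"
    for n i and x :: "(real \<Rightarrow> real) \<times> real"
  define V where "V n y = U (\<lambda>i. F i 1 + (\<Sum>k<Suc (Suc n). - (F i (y k) / real (Suc n))))" for n and y :: "nat \<Rightarrow> real"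
  define dV where "dV n k y = (\<Sum>i<m. dU i (\<lambda>i. F i 1 + (\<Sum>k<Suc (Suc n). - (F i (y k) / real (Suc n)))) * - (f i (y k) / real (Suc n)))" for n k and y :: "nat \<Rightarrow> real"
  have CV: "C1_Rm (Suc (Suc n)) (V n) (dV n)" for n
    unfolding V_def dV_def
    by (rule C1_Rm_sum_comp[OF C]) (auto intro!: DERIV_minus DERIV_cdivide F continuous_on_minus continuous_on_divide f continuous_on_const simp del: of_nat_Suc)
  define us where "us n g = V n (\<lambda>k. \<integral>s. 1 - ramp (real (Suc n) * g s - real k) \<partial>Leb01)" for n and g :: "real \<Rightarrow> real"
  define Ds where "Ds n g t = (\<Sum>k<Suc (Suc n). dV n k (\<lambda>k. \<integral>s. 1 - ramp (real (Suc n) * g s - real k) \<partial>Leb01) * - (real (Suc n) * tent (real (Suc n) * g t - real k)))" for n and g :: "real \<Rightarrow> real" and t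
  have inZ1: "(us n, Ds n) \<in> Z1" for n
    unfolding us_def[abs_def] Ds_def[abs_def]
    by (rule Z1I[OF CV]) (intro scdf_kernel_DERIV continuous_intros continuous_on_compose2[OF tent_cont[of UNIV]]; simp)+
  have us_eq: "us n = (\<lambda>g. U (\<lambda>i. ls n i g))" for n
    by (simp add: us_def V_def ls_def scdf_def fun_eq_iff)
  have Ds_eq: "case_prod (Ds n) = (\<lambda>x. \<Sum>i<m. dU i (\<lambda>j. ls n j (fst x)) * ks n i x)" for n
  proof
    fix x
    have N: "real (Suc n) \<noteq> 0" by simp
    have c: "a * - (b / real (Suc n)) * - (real (Suc n) * z) = a * (b * z)" for a b z :: real
      using N by (simp add: field_simps del: of_nat_Suc)
    have "case_prod (Ds n) x = (\<Sum>k<Suc (Suc n). \<Sum>i<m. dU i (\<lambda>j. ls n j (fst x)) * (f i (scdf n (fst x) k) * tent (real (Suc n) * fst x (snd x) - real k)))"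
      unfolding case_prod_unfold Ds_def dV_def ls_def scdf_def sum_distrib_right c ..
    also have "\<dots> = (\<Sum>i<m. dU i (\<lambda>j. ls n j (fst x)) * ks n i x)"
      unfolding ks_def sum_distrib_left by (rule sum.swap)
    finally show "case_prod (Ds n) x = (\<Sum>i<m. dU i (\<lambda>j. ls n j (fst x)) * ks n i x)" .
  qed
  have ls_eq: "ls n i g = F i 1 - (\<integral>x. F i (scdf n g (idx (Suc n) x - 1)) \<partial>Leb01) - F i (scdf n g (Suc n)) * inverse (real (Suc n))" for n i g
  proof -
    have "(\<Sum>k<Suc (Suc n). - (F i (scdf n g k) / real (Suc n))) = - (\<Sum>k<Suc n. F i (scdf n g k) / real (Suc n)) - F i (scdf n g (Suc n)) * inverse (real (Suc n))"
      by (subst sum.lessThan_Suc) (simp only: sum_negf divide_inverse diff_conv_add_uminus)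
    then show ?thesis unfolding ls_def using sum_cells(1)[of "Suc n" "\<lambda>k. F i (scdf n g k)"] by simp
  qed
  have lsm: "ls n i \<in> borel_measurable Q" if "i < m" for n i
    unfolding ls_def[abs_def]
    by (intro borel_measurable_sum borel_measurable_add borel_measurable_uminus borel_measurable_divide borel_measurable_const
        measurable_compose[OF scdf_measurable bm(1)[OF that]])
  have lm: "(\<lambda>g. \<integral>t. f i t * g t \<partial>Leb01) \<in> borel_measurable Q" if "i < m" for i by (rule linear_measurable[OF L2f[OF that]])
  have ksm: "ks n i \<in> borel_measurable QL" if "i < m" for n i
    unfolding ks_def[abs_def]
  proof (intro borel_measurable_sum borel_measurable_times)
    fix k
    show "(\<lambda>x. f i (scdf n (fst x) k)) \<in> borel_measurable QL"
      by (rule measurable_compose[OF measurable_compose[OF measurable_fst scdf_measurable] bm(2)[OF that]])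
    show "(\<lambda>x. tent (real (Suc n) * fst x (snd x) - real k)) \<in> borel_measurable QL"
      by (rule compose_path_measurable(1)) (intro continuous_on_compose2[OF tent_cont[of UNIV]] continuous_intros; simp)
  qed
  have km: "(\<lambda>x. f i (snd x)) \<in> borel_measurable QL" if "i < m" for i by (rule L2_measurable[OF L2_snd[OF L2f[OF that]]])
  have mean_m: "(\<lambda>x. F i (scdf n g (idx (Suc n) x - 1))) \<in> borel_measurable Leb01" for n i g
    by (rule measurable_compose[OF measurable_idx]) simp
  \<comment> \<open>The factor 3 counts the parts of \<open>ls_eq\<close>: the value at 1, the
    Riemann sum, and the surplus node. Each is at most \<open>M i\<close>.\<close>
  define B where "B = (\<Sum>i<m. \<bar>3 * M i\<bar>)"
  have lsb: "\<bar>ls n i g\<bar> \<le> B" if "i < m" "g \<in> G0" for n i g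
  proof -
    have 1: "\<bar>F i 1\<bar> \<le> M i" by (rule M[OF that(1)]) simp
    have 2: "\<bar>\<integral>x. F i (scdf n g (idx (Suc n) x - 1)) \<partial>Leb01\<bar> \<le> M i"
      by (rule abs_integral_le[OF mean_m]) (rule M[OF that(1) scdf_unit[OF that(2)]])
    have "\<bar>F i (scdf n g (Suc n))\<bar> * inverse (real (Suc n)) \<le> M i * 1"
      using M[OF that(1) scdf_unit[OF that(2)], of n "Suc n"] 1 by (intro mult_mono) (auto simp: inverse_le_1_iff)
    then have 3: "\<bar>F i (scdf n g (Suc n)) * inverse (real (Suc n))\<bar> \<le> M i" by (simp add: abs_mult)
    have "\<bar>ls n i g\<bar> \<le> 3 * M i" unfolding ls_eq using 1 2 3 by linarith
    also have "\<dots> \<le> B" unfolding B_def by (rule sum_bound_member[OF that(1), of "\<lambda>i. 3 * M i"])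
    finally show ?thesis .
  qed
  have ll: "AE g in Q. (\<lambda>n. ls n i g) \<longlonglongrightarrow> (\<integral>t. f i t * g t \<partial>Leb01)" if "i < m" for i
    using AE_strict_path AE_space
  proof eventually_elim
    case (elim g)
    then have g: "g \<in> G0" "strict_path g" by simp_all
    have cdfm: "(\<lambda>x. F i (cdf g x)) \<in> borel_measurable Leb01"
    proof -
      have "(\<lambda>z. indicator {s. g s \<le> fst z} (snd z) :: real) \<in> borel_measurable (Leb01 \<Otimes>\<^sub>M Leb01)"
      proof -
        have f1: "fst \<in> borel_measurable (Leb01 \<Otimes>\<^sub>M Leb01)"
          by (rule measurable_compose[OF measurable_fst borel_measurable_Leb01[of "\<lambda>t. t"]]) simp
        have f2: "(\<lambda>z. g (snd z)) \<in> borel_measurable (Leb01 \<Otimes>\<^sub>M Leb01)"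
          by (rule measurable_compose[OF measurable_snd path_measurable[OF g(1)]])
        have "(\<lambda>z. if g (snd z) \<le> fst z then 1 else 0 :: real) \<in> borel_measurable (Leb01 \<Otimes>\<^sub>M Leb01)"
          using f1 f2 by measurable
        then show ?thesis by (simp add: indicator_def of_bool_def)
      qed
      then have "(\<lambda>x. cdf g x) \<in> borel_measurable Leb01"
        unfolding cdf_def using Leb01.borel_measurable_lebesgue_integral[of "\<lambda>x s. indicator {s. g s \<le> x} s :: real" Leb01]
        by (simp add: case_prod_unfold)
      then show ?thesis by (rule measurable_compose[OF _ bm(1)[OF that]])
    qed
    have 1: "(\<lambda>n. \<integral>x. F i (scdf n g (idx (Suc n) x - 1)) \<partial>Leb01) \<longlonglongrightarrow> (\<integral>x. F i (cdf g x) \<partial>Leb01)"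
    proof (rule integral_dominated_convergence[where w="\<lambda>_. M i"])
      show "AE x in Leb01. (\<lambda>n. F i (scdf n g (idx (Suc n) x - 1))) \<longlonglongrightarrow> F i (cdf g x)"
        using AE_Leb01_neq[of 1] AE_space
      proof eventually_elim
        case (elim x)
        then have "(\<lambda>n. scdf n g (idx (Suc n) x - 1)) \<longlonglongrightarrow> cdf g x" by (intro scdf_tendsto g) auto
        then show ?case using continuous_on_tendsto_compose[OF Fc[OF that]] by simp
      qed
    qed (use mean_m cdfm M[OF that scdf_unit[OF g(1)]] in auto)
    have 2: "(\<lambda>n. F i (scdf n g (Suc n)) * inverse (real (Suc n))) \<longlonglongrightarrow> 0"
    proof (rule Lim_null_comparison)
      have "\<bar>F i (scdf n g (Suc n))\<bar> * inverse (real (Suc n)) \<le> M i * inverse (real (Suc n))" for n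
        by (rule mult_right_mono[OF M[OF that scdf_unit[OF g(1)]]]) simp
      then show "\<forall>\<^sub>F n in sequentially. norm (F i (scdf n g (Suc n)) * inverse (real (Suc n))) \<le> M i * inverse (real (Suc n))"
        by (intro always_eventually allI) (simp add: abs_mult del: of_nat_Suc)
      show "(\<lambda>n. M i * inverse (real (Suc n))) \<longlonglongrightarrow> 0" by (rule tendsto_mult_right_zero[OF LIMSEQ_inverse_real_of_nat])
    qed
    have "(\<lambda>n. ls n i g) \<longlonglongrightarrow> F i 1 - (\<integral>x. F i (cdf g x) \<partial>Leb01) - 0"
      unfolding ls_eq by (intro tendsto_diff tendsto_const 1 2)
    also have "F i 1 - (\<integral>x. F i (cdf g x) \<partial>Leb01) - 0 = (\<integral>t. f i t * g t \<partial>Leb01)"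
    proof -
      have cu: "cdf g x \<in> {0..1}" for x
      proof -
        have "\<bar>cdf g x\<bar> \<le> 1" unfolding cdf_def by (rule abs_integral_le[OF level_measurable[OF g(1)]]) (auto simp: indicator_def)
        moreover have "0 \<le> cdf g x" unfolding cdf_def by (rule Bochner_Integration.integral_nonneg) (auto simp: indicator_def)
        ultimately show ?thesis by simp
      qed
      have "L2 Leb01 (\<lambda>x. F i (cdf g x))" by (rule Leb01.L2_bounded[OF cdfm]) (rule M[OF that cu])
      then have "integrable Leb01 (\<lambda>x. F i (cdf g x))" by (rule Leb01.L2_integrable)
      then have "(\<integral>x. F i 1 - F i (cdf g x) \<partial>Leb01) = F i 1 - (\<integral>x. F i (cdf g x) \<partial>Leb01)"
        using Leb01.prob_space by (subst Bochner_Integration.integral_diff) auto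
      then show ?thesis using layer_cake[OF g(1) F[OF that] f[OF that]] by simp
    qed
    finally show ?case .
  qed
  have kl: "AE x in QL. (\<lambda>n. ks n i x) \<longlonglongrightarrow> f i (snd x)" if "i < m" for i
  proof (rule AE_QL_tendsto[OF ksm[OF that] km[OF that]])
    fix g assume g: "g \<in> G0" "strict_path g"
    have "(\<lambda>n. ks n i (g, t)) \<longlonglongrightarrow> f i t" if t: "t \<in> {0..1}" for t
    proof (rule LIMSEQ_I)
      fix r :: real assume r: "0 < r"
      obtain d where d: "d > 0" "\<And>s. dist s t < d \<Longrightarrow> dist (f i s) (f i t) < r / 2"
        using f[OF \<open>i < m\<close>] r unfolding continuous_on_iff by (metis UNIV_I half_gt_zero)
      have "\<forall>\<^sub>F n in sequentially. (\<integral>s. indicator {s. \<bar>g s - g t\<bar> \<le> 2 / real (Suc n)} s \<partial>Leb01) < d"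
        by (rule order_tendstoD(2)[OF near_level_tendsto[OF g t] d(1)])
      then obtain n0 where n0: "\<And>n. n \<ge> n0 \<Longrightarrow> (\<integral>s. indicator {s. \<bar>g s - g t\<bar> \<le> 2 / real (Suc n)} s \<partial>Leb01) < d"
        unfolding eventually_sequentially by blast
      have "norm (ks n i (g, t) - f i t) < r" if n: "n \<ge> n0" for n
      proof -
        \<comment> \<open>The hat weights are nonnegative with sum 1, so the error is a weighted
          mean of increments of \<open>f i\<close>; a nonzero weight forces \<open>scdf\<close> to
          within d of t.\<close>
        define w where "w k = tent (real (Suc n) * g t - real k)" for k
        have s1: "(\<Sum>k<Suc (Suc n). w k) = 1" unfolding w_def
          by (rule sum_tent) (use G0_bounds[OF g(1) t] in \<open>auto simp: mult_left_le\<close>)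
        have "ks n i (g, t) - f i t = (\<Sum>k<Suc (Suc n). f i (scdf n g k) * w k) - (\<Sum>k<Suc (Suc n). f i t * w k)"
          unfolding sum_distrib_left[symmetric] s1 by (simp add: ks_def w_def)
        also have "\<dots> = (\<Sum>k<Suc (Suc n). (f i (scdf n g k) - f i t) * w k)"
          by (simp only: sum_subtractf left_diff_distrib)
        finally have "\<bar>ks n i (g, t) - f i t\<bar> \<le> (\<Sum>k<Suc (Suc n). \<bar>(f i (scdf n g k) - f i t) * w k\<bar>)"
          by (simp only: sum_abs)
        also have "\<dots> \<le> (\<Sum>k<Suc (Suc n). r / 2 * w k)"
        proof (rule sum_mono)
          fix k
          show "\<bar>(f i (scdf n g k) - f i t) * w k\<bar> \<le> r / 2 * w k"
          proof (cases "w k = 0")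
            case False
            then have "\<bar>scdf n g k - t\<bar> < d"
              using scdf_close[OF g(1) t, of n k] n0[OF n] unfolding w_def by linarith
            then have "\<bar>f i (scdf n g k) - f i t\<bar> \<le> r / 2" using d(2)[of "scdf n g k"] by (simp add: dist_real_def)
            then show ?thesis using tent_nonneg r unfolding abs_mult w_def by (intro mult_mono) auto
          qed simp
        qed
        also have "\<dots> = r / 2" unfolding sum_distrib_left[symmetric] s1 by simp
        finally show ?thesis using r by simp
      qed
      then show "\<exists>no. \<forall>n\<ge>no. norm (ks n i (g, t) - f i t) < r" by blast
    qed
    then show "AE t in Leb01. (\<lambda>n. ks n i (g, t)) \<longlonglongrightarrow> f i (snd (g, t))" by (intro AE_I2) simp
  qed
  have h: "L2 QL (\<lambda>x. M' i)" for i by (rule P.L2_bounded[of _ "\<bar>M' i\<bar>"]) auto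
  have kb: "\<bar>ks n i x\<bar> \<le> M' i" if i: "i < m" and x: "x \<in> space QL" for n i x
  proof -
    have g: "fst x \<in> G0" "snd x \<in> {0..1}" using x by auto
    have s1: "(\<Sum>k<Suc (Suc n). tent (real (Suc n) * fst x (snd x) - real k)) = 1"
      by (rule sum_tent) (use G0_bounds[OF g] in \<open>auto simp: mult_left_le\<close>)
    have "\<bar>ks n i x\<bar> \<le> (\<Sum>k<Suc (Suc n). M' i * tent (real (Suc n) * fst x (snd x) - real k))"
      unfolding ks_def
    proof (rule order_trans[OF sum_abs], rule sum_mono)
      fix k
      show "\<bar>f i (scdf n (fst x) k) * tent (real (Suc n) * fst x (snd x) - real k)\<bar> \<le> M' i * tent (real (Suc n) * fst x (snd x) - real k)"
        unfolding abs_mult using M'[OF i scdf_unit[OF g(1)]] tent_nonneg by (intro mult_mono) (auto intro: order_trans[OF abs_ge_zero])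
    qed
    then show ?thesis unfolding sum_distrib_left[symmetric] s1 by simp
  qed
  note conv = cylinder_L2conv[where ls=ls and l="\<lambda>i g. \<integral>t. f i t * g t \<partial>Leb01" and ks=ks and k="\<lambda>i x. f i (snd x)"
      and B=B and h="\<lambda>i x. M' i", OF C]
  show ?thesis
  proof (rule op_closureI[of us Ds, OF inZ1])
    show "L2conv Q us (\<lambda>g. U (\<lambda>i. \<integral>t. f i t * g t \<partial>Leb01))"
      unfolding us_eq[abs_def] by (rule conv(1)) (rule lsm lm ksm km lsb ll kl h kb; assumption)+
    show "L2conv QL (\<lambda>n. case_prod (Ds n)) (\<lambda>(g, t). \<Sum>i<m. dU i (\<lambda>j. \<integral>s. f j s * g s \<partial>Leb01) * f i t)"
      unfolding Ds_eq unfolding case_prod_unfold by (rule conv(2)) (rule lsm lm ksm km lsb ll kl h kb; assumption)+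
  qed
qed

text \<open>The coefficients enter the linear functionals and the gradient alike, and one square
  integrable majorant controls both. The rule is applied twice: from continuous to bounded
  coefficients, then from bounded to square integrable ones.\<close>

lemma C1_coefficient_limit:
  assumes C: "C1_Rm m U dU"
    and cl: "\<And>n. (\<lambda>g. U (\<lambda>i. \<integral>t. fs n i t * g t \<partial>Leb01), \<lambda>g t. \<Sum>i<m. dU i (\<lambda>j. \<integral>s. fs n j s * g s \<partial>Leb01) * fs n i t) \<in> op_closure Q R"
    and fs: "\<And>n i. i < m \<Longrightarrow> fs n i \<in> borel_measurable Leb01" and f: "\<And>i. i < m \<Longrightarrow> f i \<in> borel_measurable Leb01"
    and h: "\<And>i. i < m \<Longrightarrow> L2 Leb01 (h i)"
    and b: "\<And>n i t. i < m \<Longrightarrow> t \<in> {0..1} \<Longrightarrow> \<bar>fs n i t\<bar> \<le> h i t"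
    and lim: "\<And>i. i < m \<Longrightarrow> AE t in Leb01. (\<lambda>n. fs n i t) \<longlonglongrightarrow> f i t"
  shows "(\<lambda>g. U (\<lambda>i. \<integral>t. f i t * g t \<partial>Leb01), \<lambda>g t. \<Sum>i<m. dU i (\<lambda>j. \<integral>s. f j s * g s \<partial>Leb01) * f i t) \<in> op_closure Q R"
proof -
  have L2fs: "L2 Leb01 (fs n i)" if "i < m" for n i
    by (rule L2_bound[OF h[OF that] fs[OF that]]) (use b[OF that] in \<open>auto intro!: AE_I2 intro: order_trans[OF _ abs_ge_self]\<close>)
  have L2f: "L2 Leb01 (f i)" if "i < m" for i
    by (rule L2conv_L2_lim[OF L2conv_dominated[OF h[OF that] fs[OF that] f[OF that] lim[OF that]]]) (use b[OF that] in auto)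
  define ls where "ls n i g = (\<integral>t. fs n i t * g t \<partial>Leb01)" for n i and g :: "real \<Rightarrow> real"
  define ks where "ks n i x = fs n i (snd x)" for n i and x :: "(real \<Rightarrow> real) \<times> real"
  define B where "B = (\<Sum>i<m. \<bar>\<integral>t. h i t \<partial>Leb01\<bar>)"
  have lsm: "ls n i \<in> borel_measurable Q" if "i < m" for n i
    unfolding ls_def by (rule linear_measurable[OF L2fs[OF that]])
  have lm: "(\<lambda>g. \<integral>t. f i t * g t \<partial>Leb01) \<in> borel_measurable Q" if "i < m" for i by (rule linear_measurable[OF L2f[OF that]])
  have ksm: "ks n i \<in> borel_measurable QL" if "i < m" for n i
    unfolding ks_def by (rule L2_measurable[OF L2_snd[OF L2fs[OF that]]])
  have km: "(\<lambda>x. f i (snd x)) \<in> borel_measurable QL" if "i < m" for i by (rule L2_measurable[OF L2_snd[OF L2f[OF that]]])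
  have lsb: "\<bar>ls n i g\<bar> \<le> B" if "i < m" "g \<in> G0" for n i g
  proof -
    have "\<bar>ls n i g\<bar> \<le> (\<integral>t. \<bar>fs n i t\<bar> \<partial>Leb01)" unfolding ls_def by (rule linear_bound[OF L2fs[OF that(1)] that(2)])
    also have "\<dots> \<le> (\<integral>t. h i t \<partial>Leb01)"
      by (rule integral_mono) (use b[OF that(1)] in \<open>auto intro!: L2_abs Leb01.L2_integrable L2fs h that\<close>)
    also have "\<dots> \<le> B" unfolding B_def by (rule sum_bound_member[OF that(1), of "\<lambda>i. \<integral>t. h i t \<partial>Leb01"])
    finally show ?thesis .
  qed
  have ll: "AE g in Q. (\<lambda>n. ls n i g) \<longlonglongrightarrow> (\<integral>t. f i t * g t \<partial>Leb01)" if "i < m" for i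
  proof (rule AE_I2)
    fix g assume "g \<in> space Q"
    then have g: "g \<in> G0" by simp
    have L2g: "L2 Leb01 g" by (rule Leb01.L2_bounded[OF path_measurable[OF g], of 1]) (use G0_bounds[OF g] in auto)
    show "(\<lambda>n. ls n i g) \<longlonglongrightarrow> (\<integral>t. f i t * g t \<partial>Leb01)"
      unfolding ls_def
      by (rule L2conv_integral_mult[OF L2conv_dominated[OF h[OF that] fs[OF that] f[OF that] lim[OF that]] L2conv_const[OF L2g]])
         (use b[OF that] in auto)
  qed
  have kl: "AE x in QL. (\<lambda>n. ks n i x) \<longlonglongrightarrow> f i (snd x)" if "i < m" for i
    unfolding ks_def by (rule AE_pair_snd[OF lim[OF that] Leb01.sigma_finite_measure_axioms])
  have hh: "L2 QL (\<lambda>x. h i (snd x))" if "i < m" for i by (rule L2_snd[OF h[OF that]])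
  have kb: "\<bar>ks n i x\<bar> \<le> h i (snd x)" if "i < m" "x \<in> space QL" for n i x
    unfolding ks_def by (rule b[OF that(1)]) (use that(2) in auto)
  note conv = cylinder_L2conv[where ls=ls and l="\<lambda>i g. \<integral>t. f i t * g t \<partial>Leb01" and ks=ks and k="\<lambda>i x. f i (snd x)"
      and B=B and h="\<lambda>i x. h i (snd x)", OF C]
  show ?thesis
  proof (rule op_closure_closed[OF cl])
    show "L2conv Q (\<lambda>n g. U (\<lambda>i. \<integral>t. fs n i t * g t \<partial>Leb01)) (\<lambda>g. U (\<lambda>i. \<integral>t. f i t * g t \<partial>Leb01))"
      unfolding ls_def[symmetric] by (rule conv(1)) (rule lsm lm ksm km lsb ll kl hh kb; assumption)+
    have "L2conv QL (\<lambda>n x. \<Sum>i<m. dU i (\<lambda>j. ls n j (fst x)) * ks n i x) (\<lambda>x. \<Sum>i<m. dU i (\<lambda>j. \<integral>t. f j t * fst x t \<partial>Leb01) * f i (snd x))"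
      by (rule conv(2)) (rule lsm lm ksm km lsb ll kl hh kb; assumption)+
    then show "L2conv QL (\<lambda>n. \<lambda>(g, t). \<Sum>i<m. dU i (\<lambda>j. \<integral>s. fs n j s * g s \<partial>Leb01) * fs n i t)
       (\<lambda>(g, t). \<Sum>i<m. dU i (\<lambda>j. \<integral>s. f j s * g s \<partial>Leb01) * f i t)"
      by (simp add: ls_def ks_def case_prod_unfold)
  qed
qed

lemma C1_subset_closure_Z1: "C1 \<subseteq> op_closure Q Z1"
proof
  fix p assume "p \<in> C1"
  obtain u Du where p: "p = (u, Du)" by (cases p)
  then obtain m U dU f where C: "C1_Rm m U dU" and f: "\<And>i. i < m \<Longrightarrow> L2 Leb01 (f i)" and
    u: "u = (\<lambda>g. U (\<lambda>i. \<integral>t. f i t * g t \<partial>Leb01))" and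
    Du: "Du = (\<lambda>g t. \<Sum>i<m. dU i (\<lambda>j. \<integral>s. f j s * g s \<partial>Leb01) * f i t)"
    using \<open>p \<in> C1\<close> unfolding p C1_iff by blast
  have fm: "f i \<in> borel_measurable Leb01" if "i < m" for i by (rule L2_measurable[OF f[OF that]])
  have bounded: "(\<lambda>g. U (\<lambda>i. \<integral>t. e i t * g t \<partial>Leb01), \<lambda>g t. \<Sum>i<m. dU i (\<lambda>j. \<integral>s. e j s * g s \<partial>Leb01) * e i t) \<in> op_closure Q Z1"
    if e: "\<And>i. i < m \<Longrightarrow> e i \<in> borel_measurable Leb01" and M: "\<And>i t. i < m \<Longrightarrow> t \<in> {0..1} \<Longrightarrow> \<bar>e i t\<bar> \<le> M" for e M
  proof -
    have "\<exists>fs. (\<forall>n. continuous_on UNIV (fs n)) \<and> (\<forall>n t. \<bar>fs n t\<bar> \<le> \<bar>M\<bar>) \<and> (AE t in Leb01. (\<lambda>n. fs n t) \<longlonglongrightarrow> e i t)"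
      if i: "i < m" for i
      using continuous_approximation[OF e[OF i] M[OF i]] by metis
    then obtain fs where fs: "\<And>i. i < m \<Longrightarrow> (\<forall>n. continuous_on UNIV (fs i n)) \<and> (\<forall>n t. \<bar>fs i n t\<bar> \<le> \<bar>M\<bar>) \<and> (AE t in Leb01. (\<lambda>n. fs i n t) \<longlonglongrightarrow> e i t)"
      by metis
    show ?thesis
    proof (rule C1_coefficient_limit[where fs="\<lambda>n i. fs i n" and h="\<lambda>_ _. \<bar>M\<bar>", OF C])
      show "(\<lambda>g. U (\<lambda>i. \<integral>t. fs i n t * g t \<partial>Leb01), \<lambda>g t. \<Sum>i<m. dU i (\<lambda>j. \<integral>s. fs j n s * g s \<partial>Leb01) * fs i n t) \<in> op_closure Q Z1" for n
        by (rule C1_continuous_in_closure_Z1[OF C]) (use fs in blast)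
      show "fs i n \<in> borel_measurable Leb01" if "i < m" for i n
        using fs[OF that] by (intro borel_measurable_Leb01 borel_measurable_continuous_onI) blast
      show "L2 Leb01 (\<lambda>_. \<bar>M\<bar>)" by (rule Leb01.L2_bounded[of _ "\<bar>M\<bar>"]) auto
    qed (use fs e in blast)+
  qed
  \<comment> \<open>Truncation at level n is eventually inactive at each t and never increases the
    modulus, so |f i| itself is the majorant.\<close>
  define fs where "fs n i t = max (- real n) (min (real n) (f i t))" for n :: nat and i t
  have "(u, Du) \<in> op_closure Q Z1"
    unfolding u Du
  proof (rule C1_coefficient_limit[where fs=fs and h="\<lambda>i t. \<bar>f i t\<bar>", OF C])
    have fsm: "fs n i \<in> borel_measurable Leb01" if "i < m" for n i
      unfolding fs_def[abs_def] using fm[OF that] by measurable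
    show "(\<lambda>g. U (\<lambda>i. \<integral>t. fs n i t * g t \<partial>Leb01), \<lambda>g t. \<Sum>i<m. dU i (\<lambda>j. \<integral>s. fs n j s * g s \<partial>Leb01) * fs n i t) \<in> op_closure Q Z1" for n
      by (rule bounded[of "fs n" "real n"], erule fsm) (auto simp: fs_def)
    show "fs n i \<in> borel_measurable Leb01" if "i < m" for n i by (rule fsm[OF that])
    show "AE t in Leb01. (\<lambda>n. fs n i t) \<longlonglongrightarrow> f i t" for i
    proof (rule AE_I2)
      fix t
      have "\<forall>\<^sub>F n in sequentially. \<bar>f i t\<bar> \<le> real n"
        by (rule eventually_sequentiallyI[of "nat \<lceil>\<bar>f i t\<bar>\<rceil>"]) linarith
      then have "\<forall>\<^sub>F n in sequentially. fs n i t = f i t"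
        by eventually_elim (auto simp: fs_def)
      then show "(\<lambda>n. fs n i t) \<longlonglongrightarrow> f i t" by (rule tendsto_eventually)
    qed
    show "\<bar>fs n i t\<bar> \<le> \<bar>f i t\<bar>" for n i t unfolding fs_def by auto
  qed (use f fm in \<open>auto intro: L2_abs\<close>)
  then show "p \<in> op_closure Q Z1" by (simp add: p)
qed

lemma op_closure_C1_eq_Z1: "op_closure Q C1 = op_closure Q Z1"
  using op_closure_mono[OF C1_subset_closure_Z1] op_closure_mono[OF Z1_subset_closure_C1] by blast

end

section \<open>Chain rule and locality\<close>

lemma L2conv_lipschitz:
  assumes fs: "L2conv M fs f" and g: "\<And>n. gs n \<in> borel_measurable M" "L2 M g"
    and K: "\<And>n. AE x in M. \<bar>gs n x - g x\<bar> \<le> K * \<bar>fs n x - f x\<bar>"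
  shows "L2conv M gs g"
proof -
  have d: "L2 M (\<lambda>x. gs n x - g x)" for n
  proof (rule L2_bound)
    show "L2 M (\<lambda>x. K * (fs n x - f x))" using fs by (intro L2_cmult L2_diff) (auto intro: L2conv_L2 L2conv_L2_lim)
    show "(\<lambda>x. gs n x - g x) \<in> borel_measurable M" using g L2_measurable by (intro borel_measurable_diff) auto
    show "AE x in M. \<bar>gs n x - g x\<bar> \<le> \<bar>K * (fs n x - f x)\<bar>"
      using K[of n]
    proof eventually_elim
      case (elim x)
      also have "K * \<bar>fs n x - f x\<bar> \<le> \<bar>K * (fs n x - f x)\<bar>" unfolding abs_mult by (intro mult_right_mono) auto
      finally show ?case .
    qed
  qed
  have L: "L2 M (gs n)" for n using L2_add[OF d[of n] g(2)] by simp
  have i: "integrable M (\<lambda>x. (fs n x - f x)\<^sup>2)" for n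
    using fs by (intro L2_square_integrable L2_diff) (auto intro: L2conv_L2 L2conv_L2_lim)
  have le: "(\<integral>x. (gs n x - g x)\<^sup>2 \<partial>M) \<le> K\<^sup>2 * (\<integral>x. (fs n x - f x)\<^sup>2 \<partial>M)" for n
  proof -
    have "(\<integral>x. (gs n x - g x)\<^sup>2 \<partial>M) \<le> (\<integral>x. K\<^sup>2 * (fs n x - f x)\<^sup>2 \<partial>M)"
    proof (rule integral_mono_AE)
      show "AE x in M. (gs n x - g x)\<^sup>2 \<le> K\<^sup>2 * (fs n x - f x)\<^sup>2"
        using K[of n]
      proof eventually_elim
        case (elim x)
        then have "\<bar>gs n x - g x\<bar>\<^sup>2 \<le> (K * \<bar>fs n x - f x\<bar>)\<^sup>2" by (intro power_mono) auto
        then show ?case by (simp add: power_mult_distrib)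
      qed
    qed (use L2_square_integrable[OF d] i in auto)
    then show ?thesis by simp
  qed
  have "(\<lambda>n. \<integral>x. (fs n x - f x)\<^sup>2 \<partial>M) \<longlonglongrightarrow> 0" using fs unfolding L2conv_iff by blast
  from tendsto_mult_right_zero[OF this, of "K\<^sup>2"]
  have "(\<lambda>n. \<integral>x. (gs n x - g x)\<^sup>2 \<partial>M) \<longlonglongrightarrow> 0"
    by (rule tendsto_sandwich[OF _ _ tendsto_const, rotated 2]) (use le in auto)
  then show ?thesis unfolding L2conv_iff using L g(2) by blast
qed

context entropic
begin

lemma closure_diff:
  assumes "(u, F) \<in> op_closure Q C1" "(v, G) \<in> op_closure Q C1"
  shows "(\<lambda>g. u g - v g, \<lambda>g t. F g t - G g t) \<in> op_closure Q C1"
proof -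
  obtain s where s: "\<And>n. s n \<in> C1" "L2conv Q (\<lambda>n. fst (s n)) u" "L2conv QL (\<lambda>n. case_prod (snd (s n))) (case_prod F)"
    using assms(1) unfolding op_closure_iff by blast
  obtain r where r: "\<And>n. r n \<in> C1" "L2conv Q (\<lambda>n. fst (r n)) v" "L2conv QL (\<lambda>n. case_prod (snd (r n))) (case_prod G)"
    using assms(2) unfolding op_closure_iff by blast
  show ?thesis
  proof (rule op_closureI)
    show "(\<lambda>g. fst (s n) g - fst (r n) g, \<lambda>g t. snd (s n) g t - snd (r n) g t) \<in> C1" for n
      by (rule C1_diff) (use s(1) r(1) in auto)
    show "L2conv Q (\<lambda>n g. fst (s n) g - fst (r n) g) (\<lambda>g. u g - v g)" by (rule L2conv_diff[OF s(2) r(2)])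
    show "L2conv QL (\<lambda>n. \<lambda>(g, t). snd (s n) g t - snd (r n) g t) (\<lambda>(g, t). F g t - G g t)"
      using L2conv_diff[OF s(3) r(3)] by (simp add: case_prod_unfold)
  qed
qed

text \<open>Closability in its working form. The difference of the two gradients is a limit of
  gradients along functions that tend to zero, so the closure has at most one gradient for each
  function.\<close>

lemma closure_unique:
  assumes "(u, F) \<in> op_closure Q C1" "(v, G) \<in> op_closure Q C1" "AE g in Q. u g = v g"
  shows "AE x in QL. case_prod F x = case_prod G x"
proof -
  note d = closure_diff[OF assms(1,2)]
  have "((\<lambda>_. 0), \<lambda>g t. F g t - G g t) \<in> op_closure Q C1"
    by (rule op_closure_cong[OF d _ op_closure_L2(2)[OF d]]) (use assms(3) in \<open>auto intro: Q.L2_bounded[of _ 0]\<close>)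
  then obtain s where "\<And>n. s n \<in> C1" "L2conv Q (\<lambda>n. fst (s n)) (\<lambda>_. 0)" "L2conv QL (grad_seq s) (\<lambda>(g, t). F g t - G g t)"
    unfolding op_closure_def by blast
  then have "AE x in QL. (\<lambda>(g, t). F g t - G g t) x = 0"
    using op_closable_C1 unfolding op_closable_def by blast
  then show ?thesis by eventually_elim (auto simp: case_prod_unfold)
qed

lemma form_closable_C1: "form_closable Q C1"
  unfolding form_closable_def
proof (intro allI impI)
  fix s assume s: "(\<forall>n. s n \<in> C1) \<and> L2conv Q (\<lambda>n. fst (s n)) (\<lambda>_. 0) \<and> L2cauchy QL (grad_seq s)"
  obtain F where F: "L2conv QL (grad_seq s) F" using P.L2_complete s by blast
  then have z: "AE x in QL. F x = 0" using op_closable_C1 s unfolding op_closable_def by blast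
  have "(\<integral>x. (F x)\<^sup>2 \<partial>QL) = (\<integral>x. 0 \<partial>QL)"
  proof (rule integral_cong_AE)
    show "(\<lambda>x. (F x)\<^sup>2) \<in> borel_measurable QL" using L2_measurable[OF L2conv_L2_lim[OF F]] by simp
    show "AE x in QL. (F x)\<^sup>2 = 0" using z by eventually_elim simp
  qed simp
  then show "(\<lambda>n. formE Q (s n) (s n)) \<longlonglongrightarrow> 0"
    using L2conv_norm[OF F] by (simp add: formE_def grad_seq_def case_prod_unfold power2_eq_square)
qed

lemma C1_outer:
  assumes "(u, Du) \<in> C1" and \<psi>: "\<And>x. (\<psi> has_real_derivative \<psi>' x) (at x)" "\<And>x. isCont \<psi>' x"
  shows "(\<lambda>g. \<psi> (u g), \<lambda>g t. \<psi>' (u g) * Du g t) \<in> C1"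
proof -
  obtain m U dU f where C: "C1_Rm m U dU" and f: "\<forall>i<m. L2 Leb01 (f i)" and
    u: "u = (\<lambda>g. U (\<lambda>i. \<integral>t. f i t * g t \<partial>Leb01))" and
    Du: "Du = (\<lambda>g t. \<Sum>i<m. dU i (\<lambda>j. \<integral>s. f j s * g s \<partial>Leb01) * f i t)"
    using assms(1) unfolding C1_iff by blast
  have C': "C1_Rm m (\<lambda>x. \<psi> (U x)) (\<lambda>i x. \<psi>' (U x) * dU i x)" by (rule C1_Rm_outer[OF C \<psi>])
  show ?thesis
    unfolding C1_iff
  proof (intro exI conjI)
    show "(\<lambda>g t. \<psi>' (u g) * Du g t) = (\<lambda>g t. \<Sum>i<m. (\<psi>' (U (\<lambda>j. \<integral>s. f j s * g s \<partial>Leb01)) * dU i (\<lambda>j. \<integral>s. f j s * g s \<partial>Leb01)) * f i t)"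
      unfolding u Du sum_distrib_left mult.assoc ..
  qed (use C' f u in auto)
qed

text \<open>The bound on \<psi>' makes \<psi> Lipschitz, which handles the values. For the gradient
  a subsequence is taken along which the functions converge almost everywhere, so that \<psi>' of
  them converges as well.\<close>

lemma closure_chain:
  assumes "(u, F) \<in> op_closure Q C1" and \<psi>: "\<And>x. (\<psi> has_real_derivative \<psi>' x) (at x)" "\<And>x. isCont \<psi>' x"
    and K: "\<And>x. \<bar>\<psi>' x\<bar> \<le> K"
  shows "(\<lambda>g. \<psi> (u g), \<lambda>g t. \<psi>' (u g) * F g t) \<in> op_closure Q C1"
proof -
  obtain s where s: "\<And>n. s n \<in> C1" "L2conv Q (\<lambda>n. fst (s n)) u" "L2conv QL (\<lambda>n. case_prod (snd (s n))) (case_prod F)"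
    using assms(1) unfolding op_closure_iff by blast
  obtain r :: "nat \<Rightarrow> nat" where r: "strict_mono r" "AE g in Q. (\<lambda>n. fst (s (r n)) g) \<longlonglongrightarrow> u g"
    by (rule L2conv_AE_subseq[OF s(2)])
  define us where "us n = fst (s (r n))" for n
  define Fs where "Fs n = snd (s (r n))" for n
  have in_C1: "(us n, Fs n) \<in> C1" for n using s(1) by (simp add: us_def Fs_def)
  have us: "L2conv Q us u" using L2conv_subseq[OF s(2) r(1)] by (simp add: us_def[abs_def])
  have Fs: "L2conv QL (\<lambda>n. case_prod (Fs n)) (case_prod F)" using L2conv_subseq[OF s(3) r(1)] by (simp add: Fs_def)
  have AEu: "AE x in QL. (\<lambda>n. us n (fst x)) \<longlonglongrightarrow> u (fst x)"
    using AE_pair_fst[OF r(2) Leb01.sigma_finite_measure_axioms] by (simp add: us_def)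
  have \<psi>m: "\<psi> \<in> borel_measurable borel" "\<psi>' \<in> borel_measurable borel"
    using continuous_on_DERIV[OF \<psi>(1)] \<psi>(2) by (auto intro!: borel_measurable_continuous_onI continuous_at_imp_continuous_on)
  have um: "us n \<in> borel_measurable Q" "u \<in> borel_measurable Q" for n
    using L2conv_L2[OF us] L2conv_L2_lim[OF us] by (auto intro: L2_measurable)
  have Fm: "case_prod (Fs n) \<in> borel_measurable QL" "case_prod F \<in> borel_measurable QL" for n
    using L2conv_L2[OF Fs] L2conv_L2_lim[OF Fs] by (auto intro: L2_measurable)
  have \<psi>'m: "(\<lambda>x. \<psi>' (us n (fst x))) \<in> borel_measurable QL" "(\<lambda>x. \<psi>' (u (fst x))) \<in> borel_measurable QL" for n
    by (rule measurable_compose[OF measurable_compose[OF measurable_fst] \<psi>m(2)], rule um)+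
  have K0: "0 \<le> K" using K[of 0] by linarith
  have lip: "\<bar>\<psi> a - \<psi> b\<bar> \<le> K * \<bar>a - b\<bar>" for a b
    using field_differentiable_bound[of UNIV \<psi> \<psi>' K a b] \<psi>(1) K by simp
  have L\<psi>: "L2 Q (\<lambda>g. \<psi> (u g))"
  proof (rule L2_bound)
    show "L2 Q (\<lambda>g. \<bar>\<psi> 0\<bar> + K * \<bar>u g\<bar>)"
      by (intro L2_add L2_cmult L2_abs L2conv_L2_lim[OF us] Q.L2_bounded[of _ "\<bar>\<psi> 0\<bar>"]) auto
    show "(\<lambda>g. \<psi> (u g)) \<in> borel_measurable Q" by (rule measurable_compose[OF um(2) \<psi>m(1)])
    show "AE g in Q. \<bar>\<psi> (u g)\<bar> \<le> \<bar>\<bar>\<psi> 0\<bar> + K * \<bar>u g\<bar>\<bar>"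
    proof (rule AE_I2)
      fix g show "\<bar>\<psi> (u g)\<bar> \<le> \<bar>\<bar>\<psi> 0\<bar> + K * \<bar>u g\<bar>\<bar>" using lip[of "u g" 0] by simp
    qed
  qed
  show ?thesis
  proof (rule op_closureI)
    show "(\<lambda>g. \<psi> (us n g), \<lambda>g t. \<psi>' (us n g) * Fs n g t) \<in> C1" for n by (rule C1_outer[OF in_C1 \<psi>])
    show "L2conv Q (\<lambda>n g. \<psi> (us n g)) (\<lambda>g. \<psi> (u g))"
      by (rule L2conv_lipschitz[OF us measurable_compose[OF um(1) \<psi>m(1)] L\<psi>]) (use lip in auto)
    have z: "L2 QL (\<lambda>_. 0)" by (rule P.L2_bounded[of _ 0]) auto
    \<comment> \<open>The approximating gradient is split as \<psi>'(u_n) (F_n - F) + \<psi>'(u_n)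
      F. Boundedness of \<psi>' controls the first part, dominated convergence with majorant K |F|
      the second.\<close>
    have 1: "L2conv QL (\<lambda>n x. \<psi>' (us n (fst x)) * (case_prod (Fs n) x - case_prod F x)) (\<lambda>_. 0)"
    proof (rule L2conv_lipschitz[OF Fs _ z])
      show "(\<lambda>x. \<psi>' (us n (fst x)) * (case_prod (Fs n) x - case_prod F x)) \<in> borel_measurable QL" for n
        by (intro borel_measurable_times borel_measurable_diff \<psi>'m Fm)
      show "AE x in QL. \<bar>\<psi>' (us n (fst x)) * (case_prod (Fs n) x - case_prod F x) - 0\<bar> \<le> K * \<bar>case_prod (Fs n) x - case_prod F x\<bar>" for n
        by (rule AE_I2) (simp add: abs_mult mult_right_mono K)
    qed
    have 2: "L2conv QL (\<lambda>n x. \<psi>' (us n (fst x)) * case_prod F x) (\<lambda>x. \<psi>' (u (fst x)) * case_prod F x)"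
    proof (rule L2conv_dominated[OF L2_cmult[OF L2_abs[OF L2conv_L2_lim[OF Fs]], of K]])
      show "(\<lambda>x. \<psi>' (us n (fst x)) * case_prod F x) \<in> borel_measurable QL" for n by (intro borel_measurable_times \<psi>'m Fm)
      show "(\<lambda>x. \<psi>' (u (fst x)) * case_prod F x) \<in> borel_measurable QL" by (intro borel_measurable_times \<psi>'m Fm)
      show "AE x in QL. (\<lambda>n. \<psi>' (us n (fst x)) * case_prod F x) \<longlonglongrightarrow> \<psi>' (u (fst x)) * case_prod F x"
        using AEu by eventually_elim (intro tendsto_mult tendsto_const isCont_tendsto_compose[OF \<psi>(2)])
      show "AE x in QL. \<bar>\<psi>' (us n (fst x)) * case_prod F x\<bar> \<le> K * \<bar>case_prod F x\<bar>" for n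
        by (rule AE_I2) (simp add: abs_mult mult_right_mono K)
    qed
    show "L2conv QL (\<lambda>n. \<lambda>(g, t). \<psi>' (us n g) * Fs n g t) (\<lambda>(g, t). \<psi>' (u g) * F g t)"
      using L2conv_add[OF 1 2] by (simp add: case_prod_unfold algebra_simps)
  qed
qed

text \<open>The functions \<psi> tend to zero uniformly, while their derivatives stay bounded by 1
  and tend to the indicator of the point c. So the zero function has the restriction of
  \<open>F\<close> to the set where u = c as a gradient, and uniqueness makes this restriction
  vanish.\<close>

lemma closure_level_set:
  assumes "(u, F) \<in> op_closure Q C1"
  shows "AE x in QL. u (fst x) = c \<longrightarrow> case_prod F x = 0"
proof -
  note L2 = op_closure_L2[OF assms]
  define \<psi> where "\<psi> n x = arctan (real (Suc n) * (x - c)) / real (Suc n)" for n x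
  define \<psi>' where "\<psi>' n x = inverse (1 + (real (Suc n) * (x - c))\<^sup>2)" for n x
  define F0 where "F0 g t = (if u g = c then F g t else 0)" for g t
  have um: "(\<lambda>x. u (fst x)) \<in> borel_measurable QL" by (rule measurable_compose[OF measurable_fst L2_measurable[OF L2(1)]])
  have Fm: "case_prod F \<in> borel_measurable QL" by (rule L2_measurable[OF L2(2)])
  have pos: "1 + (real (Suc n) * (x - c))\<^sup>2 \<noteq> 0" for n x
    using zero_le_power2[of "real (Suc n) * (x - c)"] by linarith
  have D: "(\<psi> n has_real_derivative \<psi>' n x) (at x)" for n x
  proof -
    have "((\<lambda>x. arctan (real (Suc n) * (x - c))) has_real_derivative inverse (1 + (real (Suc n) * (x - c))\<^sup>2) * real (Suc n)) (at x)"
      by (rule DERIV_chain2[OF DERIV_arctan]) (auto intro!: derivative_eq_intros simp del: of_nat_Suc)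
    from DERIV_cdivide[OF this, of "real (Suc n)"] show ?thesis by (simp add: \<psi>_def[abs_def] \<psi>'_def del: of_nat_Suc)
  qed
  have cont: "isCont (\<psi>' n) x" for n x unfolding \<psi>'_def using pos[of n x] by (intro continuous_intros)
  have bd: "\<bar>\<psi>' n x\<bar> \<le> 1" for n x
    unfolding \<psi>'_def using zero_le_power2[of "real (Suc n) * (x - c)"] by (subst abs_of_nonneg) (auto intro!: inverse_le_1_iff[THEN iffD2] simp del: of_nat_Suc)
  have cl: "(\<lambda>g. \<psi> n (u g), \<lambda>g t. \<psi>' n (u g) * F g t) \<in> op_closure Q C1" for n
    by (rule closure_chain[OF assms D cont bd])
  have F0m: "case_prod F0 \<in> borel_measurable QL"
  proof -
    have "(\<lambda>x. if u (fst x) = c then case_prod F x else 0) \<in> borel_measurable QL" using um Fm by measurable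
    then show ?thesis unfolding F0_def case_prod_unfold .
  qed
  have "((\<lambda>_. 0), F0) \<in> op_closure Q C1"
  proof (rule op_closure_closed[OF cl])
    have \<psi>b: "\<bar>\<psi> n x\<bar> \<le> 2 * inverse (real (Suc n))" for n x
    proof -
      \<comment> \<open>The crude bound 2 in place of pi / 2 follows from pi < 4.\<close>
      have "\<bar>arctan (real (Suc n) * (x - c))\<bar> \<le> 2" using arctan_bounded[of "real (Suc n) * (x - c)"] pi_less_4 by (simp only: abs_le_iff) linarith
      then have "\<bar>arctan (real (Suc n) * (x - c))\<bar> * inverse (real (Suc n)) \<le> 2 * inverse (real (Suc n))" by (rule mult_right_mono) simp
      then show ?thesis unfolding \<psi>_def divide_inverse abs_mult by (simp del: of_nat_Suc)
    qed
    have \<psi>m: "(\<lambda>g. \<psi> n (u g)) \<in> borel_measurable Q" for n by (rule L2_measurable[OF op_closure_L2(1)[OF cl]])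
    show "L2conv Q (\<lambda>n g. \<psi> n (u g)) (\<lambda>_. 0)"
    proof (rule L2conv_dominated[where h="\<lambda>_. 2"])
      show "L2 Q (\<lambda>_. 2)" by (rule Q.L2_bounded[of _ 2]) auto
      show "AE g in Q. (\<lambda>n. \<psi> n (u g)) \<longlonglongrightarrow> 0"
      proof (rule AE_I2, rule Lim_null_comparison)
        fix g
        show "\<forall>\<^sub>F n in sequentially. norm (\<psi> n (u g)) \<le> 2 * inverse (real (Suc n))" using \<psi>b by (intro always_eventually allI) (simp del: of_nat_Suc)
        show "(\<lambda>n. 2 * inverse (real (Suc n))) \<longlonglongrightarrow> 0" by (rule tendsto_mult_right_zero[OF LIMSEQ_inverse_real_of_nat])
      qed
      have "2 * inverse (real (Suc n)) \<le> 2" for n by (simp add: inverse_le_1_iff)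
      then show "AE g in Q. \<bar>\<psi> n (u g)\<bar> \<le> 2" for n using order_trans[OF \<psi>b] by (intro AE_I2) blast
    qed (use \<psi>m in auto)
    show "L2conv QL (\<lambda>n. \<lambda>(g, t). \<psi>' n (u g) * F g t) (case_prod F0)"
    proof (rule L2conv_dominated[OF L2_abs[OF L2(2)]])
      show "(\<lambda>(g, t). \<psi>' n (u g) * F g t) \<in> borel_measurable QL" for n by (rule L2_measurable[OF op_closure_L2(2)[OF cl]])
      show "case_prod F0 \<in> borel_measurable QL" by (rule F0m)
      have lim: "(\<lambda>n. \<psi>' n y) \<longlonglongrightarrow> (if y = c then 1 else 0)" for y
      proof (cases "y = c")
        case False
        have "filterlim (\<lambda>n. real (Suc n)) at_top sequentially"
          by (rule filterlim_compose[OF filterlim_real_sequentially filterlim_Suc])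
        then have "filterlim (\<lambda>n. (real (Suc n))\<^sup>2) at_top sequentially" by (intro filterlim_pow_at_top) auto
        then have "filterlim (\<lambda>n. (y - c)\<^sup>2 * (real (Suc n))\<^sup>2) at_top sequentially"
          by (rule filterlim_tendsto_pos_mult_at_top[OF tendsto_const, rotated]) (use False in simp)
        then have "filterlim (\<lambda>n. 1 + (y - c)\<^sup>2 * (real (Suc n))\<^sup>2) at_top sequentially"
          by (rule filterlim_tendsto_add_at_top[OF tendsto_const])
        then have "(\<lambda>n. inverse (1 + (y - c)\<^sup>2 * (real (Suc n))\<^sup>2)) \<longlonglongrightarrow> 0" by (rule tendsto_inverse_0_at_top)
        then show ?thesis using False by (simp add: \<psi>'_def power_mult_distrib mult.commute del: of_nat_Suc)
      qed (simp add: \<psi>'_def)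
      show "AE x in QL. (\<lambda>n. case x of (g, t) \<Rightarrow> \<psi>' n (u g) * F g t) \<longlonglongrightarrow> case_prod F0 x"
      proof (rule AE_I2)
        fix x
        have "(\<lambda>n. \<psi>' n (u (fst x)) * F (fst x) (snd x)) \<longlonglongrightarrow> (if u (fst x) = c then 1 else 0) * F (fst x) (snd x)"
          by (intro tendsto_mult tendsto_const lim)
        then show "(\<lambda>n. case x of (g, t) \<Rightarrow> \<psi>' n (u g) * F g t) \<longlonglongrightarrow> case_prod F0 x"
          by (simp add: F0_def case_prod_unfold split: if_splits)
      qed
      show "AE x in QL. \<bar>case x of (g, t) \<Rightarrow> \<psi>' n (u g) * F g t\<bar> \<le> \<bar>case_prod F x\<bar>" for n
        by (rule AE_I2) (auto simp: case_prod_unfold abs_mult intro!: mult_left_le_one_le bd)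
    qed
  qed
  moreover have "((\<lambda>_. 0), \<lambda>_ _. 0) \<in> op_closure Q C1"
    using closure_diff[OF assms assms] by simp
  ultimately have "AE x in QL. case_prod F0 x = (\<lambda>(_, _). 0) x"
    by (rule closure_unique) simp
  then show ?thesis by eventually_elim (auto simp: F0_def case_prod_unfold split: if_splits)
qed

text \<open>At almost every path either u = -a or v = 0, so one of the two gradients vanishes there
  for almost every time. The constant \<open>a\<close> expresses that u is constant where v does not
  vanish.\<close>

lemma strongly_local:
  assumes "(u, v, c) \<in> form_closure Q C1" "AE g in Q. (u g + a) * v g = 0"
  shows "c = 0"
proof -
  obtain F G where F: "(u, F) \<in> op_closure Q C1" and G: "(v, G) \<in> op_closure Q C1" and
    c: "c = (\<integral>x. case_prod F x * case_prod G x \<partial>QL)"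
    using assms(1) form_closure_iff[OF Q.prob_space_axioms] by blast
  have "c = (\<integral>x. 0 \<partial>QL)"
    unfolding c
  proof (rule integral_cong_AE)
    show "(\<lambda>x. case_prod F x * case_prod G x) \<in> borel_measurable QL"
      by (intro borel_measurable_times L2_measurable op_closure_L2(2)[OF F] op_closure_L2(2)[OF G])
    show "AE x in QL. case_prod F x * case_prod G x = 0"
      using closure_level_set[OF F, of "- a"] closure_level_set[OF G, of 0]
        AE_pair_fst[OF assms(2) Leb01.sigma_finite_measure_axioms]
      by eventually_elim (metis add.commute add_eq_0_iff mult_eq_0_iff)
  qed simp
  then show ?thesis by simp
qed

end

section \<open>Square field operator and the distance function\<close>

context entropic
begin

lemma graph_in_closure:
  assumes "p \<in> Z1 \<union> C1" shows "p \<in> op_closure Q C1"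
  using assms
proof
  assume C: "p \<in> C1"
  obtain u Du where p: "p = (u, Du)" by (cases p)
  show ?thesis
    unfolding p by (rule op_closureI[of "\<lambda>_. u" "\<lambda>_. Du"]) (use C C1_L2[of u Du] p in \<open>auto intro: L2conv_const\<close>)
qed (use Z1_subset_closure_C1 in blast)

lemma section_measurable: "L2 QL (case_prod F) \<Longrightarrow> g \<in> G0 \<Longrightarrow> (\<lambda>t. F g t) \<in> borel_measurable Leb01"
  using measurable_Pair2[OF L2_measurable, of Q Leb01 "case_prod F" g] by simp

lemma sqfield_cong_AE:
  assumes "L2 QL (case_prod F)" "L2 QL (case_prod F')" "L2 QL (case_prod G)" "L2 QL (case_prod G')"
    "AE x in QL. case_prod F x = case_prod F' x" "AE x in QL. case_prod G x = case_prod G' x"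
  shows "AE g in Q. sqfield F G g = sqfield F' G' g"
  using P.AE_pair[OF assms(5)] P.AE_pair[OF assms(6)] AE_space
proof eventually_elim
  case (elim g)
  then have g: "g \<in> G0" by simp
  show ?case
    unfolding sqfield_def
  proof (rule integral_cong_AE)
    show "AE t in Leb01. F g t * G g t = F' g t * G' g t" using elim(1,2) by eventually_elim simp
  qed (use assms(1-4)[THEN section_measurable, OF g] in auto)
qed

lemma integral_sqfield:
  assumes "L2 QL (case_prod F)" "L2 QL (case_prod G)"
  shows "(\<integral>x. case_prod F x * case_prod G x \<partial>QL) = (\<integral>g. sqfield F G g \<partial>Q)"
  using P.integral_fst'[OF L2_mult_integrable[OF assms]] by (simp add: sqfield_def)

section \<open>The distance to a fixed path\<close>

lemma L2_path: "g \<in> G0 \<Longrightarrow> L2 Leb01 g"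
  by (rule Leb01.L2_bounded[OF path_measurable, of _ 1]) (use G0_bounds in auto)

lemma L2dist_sq:
  assumes "f \<in> G0" "g \<in> G0"
  shows "(L2dist f g)\<^sup>2 = (\<integral>s. (g s)\<^sup>2 \<partial>Leb01) - ((\<integral>s. (2 * f s) * g s \<partial>Leb01) - (\<integral>s. (f s)\<^sup>2 \<partial>Leb01))"
    and "0 \<le> L2dist f g" "L2dist f g \<le> 1"
proof -
  note f = L2_path[OF assms(1)] and g = L2_path[OF assms(2)]
  have i: "integrable Leb01 (\<lambda>s. (g s)\<^sup>2)" "integrable Leb01 (\<lambda>s. (2 * f s) * g s)" "integrable Leb01 (\<lambda>s. (f s)\<^sup>2)"
    by (intro L2_square_integrable L2_mult_integrable L2_cmult f g)+
  have "(\<integral>s. (f s - g s)\<^sup>2 \<partial>Leb01) = (\<integral>s. (g s)\<^sup>2 - ((2 * f s) * g s - (f s)\<^sup>2) \<partial>Leb01)"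
    by (rule Bochner_Integration.integral_cong) (auto simp: power2_eq_square algebra_simps)
  also have "\<dots> = (\<integral>s. (g s)\<^sup>2 \<partial>Leb01) - ((\<integral>s. (2 * f s) * g s \<partial>Leb01) - (\<integral>s. (f s)\<^sup>2 \<partial>Leb01))"
    by (subst Bochner_Integration.integral_diff Bochner_Integration.integral_diff) (use i in auto)
  finally have eq: "(\<integral>s. (f s - g s)\<^sup>2 \<partial>Leb01) = (\<integral>s. (g s)\<^sup>2 \<partial>Leb01) - ((\<integral>s. (2 * f s) * g s \<partial>Leb01) - (\<integral>s. (f s)\<^sup>2 \<partial>Leb01))"
    .
  have "(L2dist f g)\<^sup>2 = (\<integral>s. (f s - g s)\<^sup>2 \<partial>Leb01)"
    unfolding L2dist_def by (rule real_sqrt_pow2) (simp add: Bochner_Integration.integral_nonneg)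
  then show "(L2dist f g)\<^sup>2 = (\<integral>s. (g s)\<^sup>2 \<partial>Leb01) - ((\<integral>s. (2 * f s) * g s \<partial>Leb01) - (\<integral>s. (f s)\<^sup>2 \<partial>Leb01))"
    unfolding eq .
  show "0 \<le> L2dist f g" by (simp add: L2dist_def)
  have "\<bar>\<integral>s. (f s - g s)\<^sup>2 \<partial>Leb01\<bar> \<le> 1"
  proof (rule abs_integral_le)
    show "(\<lambda>s. (f s - g s)\<^sup>2) \<in> borel_measurable Leb01"
      using path_measurable assms by (intro borel_measurable_power borel_measurable_diff)
    show "\<bar>(f t - g t)\<^sup>2\<bar> \<le> 1" if "t \<in> {0..1}" for t
      using G0_bounds[OF assms(1) that] G0_bounds[OF assms(2) that] by (simp add: abs_square_le_1 abs_le_iff)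
  qed
  then show "L2dist f g \<le> 1" by (simp add: L2dist_def)
qed

text \<open>Expanding the square leaves the integral of the squared path, which belongs to
  \<open>Z1\<close>, minus an affine function in \<open>C1\<close>. The difference is taken in the
  common closure of the two classes.\<close>

lemma L2dist_sq_in_closure:
  assumes f: "f \<in> G0"
  shows "(\<lambda>g. (L2dist f g)\<^sup>2, \<lambda>g t. 2 * g t - 2 * f t) \<in> op_closure Q C1"
proof -
  have Z: "(\<lambda>g. \<integral>s. (g s)\<^sup>2 \<partial>Leb01, \<lambda>g t. 2 * g t) \<in> Z1"
  proof -
    have "((\<lambda>x::real. x\<^sup>2) has_real_derivative 2 * x) (at x)" for x by (auto intro!: derivative_eq_intros)
    moreover have "continuous_on UNIV (\<lambda>x::real. 2 * x)" by (intro continuous_intros)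
    ultimately show ?thesis
      using Z1I[OF C1_Rm_proj[of 1], of "\<lambda>_ x. x\<^sup>2" "\<lambda>_ x. 2 * x"] by simp
  qed
  define c where "c = (\<integral>s. (f s)\<^sup>2 \<partial>Leb01)"
  have "(\<lambda>g. (\<integral>s. (2 * f s) * g s \<partial>Leb01) - c, \<lambda>g t. 2 * f t) \<in> C1"
    unfolding C1_iff
  proof (intro exI conjI)
    have "((\<lambda>y. y - c) has_real_derivative 1) (at y)" for y by (auto intro!: derivative_eq_intros)
    then show "C1_Rm 1 (\<lambda>x. x 0 - c) (\<lambda>i x. 1 * (if i = 0 then 1 else 0))"
      by (intro C1_Rm_outer[OF C1_Rm_proj]) auto
    show "\<forall>i<1. L2 Leb01 ((\<lambda>_ s. 2 * f s) i)" by (auto intro: L2_cmult L2_path f)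
  qed auto
  then have cl: "(\<lambda>g. (\<integral>s. (g s)\<^sup>2 \<partial>Leb01) - ((\<integral>s. (2 * f s) * g s \<partial>Leb01) - c), \<lambda>g t. 2 * g t - 2 * f t) \<in> op_closure Q C1"
    by (intro closure_diff graph_in_closure UnI1[OF Z] UnI2)
  have eq: "(\<integral>s. (g s)\<^sup>2 \<partial>Leb01) - ((\<integral>s. (2 * f s) * g s \<partial>Leb01) - c) = (L2dist f g)\<^sup>2" if "g \<in> G0" for g
    using L2dist_sq(1)[OF f that] by (simp add: c_def)
  show ?thesis
    by (rule op_closure_cong[OF cl L2_cong_space[OF op_closure_L2(1)[OF cl]] op_closure_L2(2)[OF cl]])
      (use eq in auto)
qed

text \<open>Where the distance is 0 the division returns 0, which agrees with the gradients of the
  smooth approximations there.\<close>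

definition dist_grad :: "(real \<Rightarrow> real) \<Rightarrow> (real \<Rightarrow> real) \<Rightarrow> real \<Rightarrow> real" where
  "dist_grad f g t = (g t - f t) / L2dist f g"

text \<open>Normalisation makes the square field equal to 1, except at distance 0, where it is 0.
  The inequality thus holds at every path, with no event to exclude.\<close>

lemma sqfield_dist_grad:
  assumes "f \<in> G0" "g \<in> G0"
  shows "integrable Leb01 (\<lambda>t. (dist_grad f g t)\<^sup>2)" "sqfield (dist_grad f) (dist_grad f) g \<le> 1"
proof -
  have e: "dist_grad f g t = inverse (L2dist f g) * (g t - f t)" for t by (simp add: dist_grad_def divide_inverse)
  show "integrable Leb01 (\<lambda>t. (dist_grad f g t)\<^sup>2)"
    unfolding e by (intro L2_square_integrable L2_cmult L2_diff L2_path assms)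
  have "sqfield (dist_grad f) (dist_grad f) g = (\<integral>t. (inverse (L2dist f g))\<^sup>2 * (f t - g t)\<^sup>2 \<partial>Leb01)"
    unfolding sqfield_def e by (rule Bochner_Integration.integral_cong) (auto simp: power2_eq_square algebra_simps)
  also have "\<dots> = (inverse (L2dist f g))\<^sup>2 * (L2dist f g)\<^sup>2"
    unfolding integral_mult_right_zero L2dist_def by (simp only: real_sqrt_pow2[OF Bochner_Integration.integral_nonneg] zero_le_power2)
  also have "\<dots> \<le> 1" by (cases "L2dist f g = 0") (simp_all add: power_inverse)
  finally show "sqfield (dist_grad f) (dist_grad f) g \<le> 1" .
qed

lemma L2_dist_grad:
  assumes f: "f \<in> G0" shows "L2 QL (case_prod (dist_grad f))"
proof -
  note cl = op_closure_L2[OF L2dist_sq_in_closure[OF f]]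
  have "(\<lambda>g. sqrt ((L2dist f g)\<^sup>2)) \<in> borel_measurable Q" using L2_measurable[OF cl(1)] by measurable
  also have "(\<lambda>g. sqrt ((L2dist f g)\<^sup>2)) = L2dist f" by (simp add: fun_eq_iff L2dist_def)
  finally have d: "L2dist f \<in> borel_measurable Q" .
  have "(\<lambda>x. (case x of (g, t) \<Rightarrow> 2 * g t - 2 * f t) / (2 * L2dist f (fst x))) \<in> borel_measurable QL"
    by (intro borel_measurable_divide borel_measurable_times borel_measurable_const L2_measurable[OF cl(2)] measurable_compose[OF measurable_fst d])
  also have "(\<lambda>x. (case x of (g, t) \<Rightarrow> 2 * g t - 2 * f t) / (2 * L2dist f (fst x))) = case_prod (dist_grad f)"
  proof -
    have "(2 * a - 2 * b) / (2 * d) = (a - b) / d" for a b d :: real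
      by (simp only: right_diff_distrib[symmetric] mult_divide_mult_cancel_left)
    then show ?thesis by (auto simp only: fun_eq_iff dist_grad_def case_prod_unfold)
  qed
  finally have m: "case_prod (dist_grad f) \<in> borel_measurable QL" .
  have "(\<integral>\<^sup>+x. ennreal ((case_prod (dist_grad f) x)\<^sup>2) \<partial>QL) = (\<integral>\<^sup>+g. (\<integral>\<^sup>+t. ennreal ((case_prod (dist_grad f) (g, t))\<^sup>2) \<partial>Leb01) \<partial>Q)"
    by (rule Leb01.nn_integral_fst[symmetric]) (intro measurable_compose[OF _ measurable_ennreal] borel_measurable_power m)
  also have "\<dots> \<le> (\<integral>\<^sup>+g. 1 \<partial>Q)"
  proof (rule nn_integral_mono)
    fix g assume "g \<in> space Q"
    then have g: "g \<in> G0" by simp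
    have "(\<integral>\<^sup>+t. ennreal ((dist_grad f g t)\<^sup>2) \<partial>Leb01) = ennreal (sqfield (dist_grad f) (dist_grad f) g)"
      unfolding sqfield_def using nn_integral_eq_integral[OF sqfield_dist_grad(1)[OF f g]] by (simp add: power2_eq_square)
    also have "\<dots> \<le> 1" using sqfield_dist_grad(2)[OF f g] by simp
    finally show "(\<integral>\<^sup>+t. ennreal ((case_prod (dist_grad f) (g, t))\<^sup>2) \<partial>Leb01) \<le> 1" by simp
  qed
  also have "\<dots> < \<infinity>" using Q.emeasure_space_1 by simp
  finally show ?thesis using m by (simp add: L2_def)
qed

text \<open>The square root is replaced by the smooth functions $x \mapsto (\varepsilon + x^2)^{1/4}$, applied to the squared distance.\<close>

lemma L2dist_in_closure:
  assumes f: "f \<in> G0"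
  shows "(L2dist f, dist_grad f) \<in> op_closure Q C1"
proof -
  note sq = L2dist_sq_in_closure[OF f]
  define e where "e n = inverse (real (Suc n))" for n
  have e: "e n > 0" "e n \<le> 1" for n unfolding e_def by (auto simp: inverse_le_1_iff)
  have e0: "e \<longlonglongrightarrow> 0" unfolding e_def[abs_def] by (rule LIMSEQ_inverse_real_of_nat)
  \<comment> \<open>The square under the root keeps the radicand positive for every real x, as
    \<open>closure_chain\<close> asks for differentiability on the whole line; the root of
    \<open>e n + x\<close> would fail for negative x.\<close>
  define r where "r n x = sqrt (e n + x\<^sup>2)" for n x
  define \<psi> where "\<psi> n x = sqrt (r n x)" for n x
  define \<psi>' where "\<psi>' n x = inverse (sqrt (r n x)) / 2 * (inverse (r n x) / 2 * (2 * x))" for n x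
  have pos: "e n + x\<^sup>2 > 0" for n x using e[of n] by (simp add: add_pos_nonneg)
  have r0: "r n x > 0" for n x unfolding r_def using pos[of n x] by simp
  have D: "(\<psi> n has_real_derivative \<psi>' n x) (at x)" for n x
  proof -
    have "((\<lambda>x. e n + x\<^sup>2) has_real_derivative 2 * x) (at x)" by (auto intro!: derivative_eq_intros)
    from DERIV_chain2[OF DERIV_real_sqrt[OF pos] this]
    have "(r n has_real_derivative inverse (r n x) / 2 * (2 * x)) (at x)" by (simp add: r_def[abs_def])
    from DERIV_chain2[OF DERIV_real_sqrt[OF r0] this] show ?thesis by (simp add: \<psi>_def[abs_def] \<psi>'_def)
  qed
  have cont: "isCont (\<psi>' n) x" for n x
  proof -
    have "isCont (r n) x" unfolding r_def by (intro continuous_intros)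
    then show ?thesis unfolding \<psi>'_def using r0[of n x] by (intro continuous_intros) auto
  qed
  have rx: "\<bar>x\<bar> \<le> r n x" for n x unfolding r_def using e[of n] by (intro real_le_rsqrt) simp
  have re: "sqrt (e n) \<le> r n x" for n x unfolding r_def by simp
  have \<psi>'_eq: "\<psi>' n x = x / r n x * inverse (sqrt (r n x)) / 2" for n x
    unfolding \<psi>'_def using r0[of n x] by (simp add: field_simps)
  have quot: "\<bar>x / r n x\<bar> \<le> 1" for n x using rx[of x n] r0[of n x] by (simp add: abs_divide)
  \<comment> \<open>This bound grows with n. It serves to apply the chain rule for each n; the
    domination uniform in n comes from \<open>dist_grad\<close> below.\<close>
  have bd: "\<bar>\<psi>' n x\<bar> \<le> inverse (sqrt (sqrt (e n)))" for n x
  proof -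
    have s: "inverse (sqrt (r n x)) \<le> inverse (sqrt (sqrt (e n)))" using re[of n x] e[of n] by (intro le_imp_inverse_le) auto
    have "\<bar>x / r n x\<bar> * \<bar>inverse (sqrt (r n x))\<bar> \<le> 1 * inverse (sqrt (sqrt (e n)))"
      using s r0[of n x] by (intro mult_mono quot) (auto simp: less_imp_le)
    then have "\<bar>x / r n x * inverse (sqrt (r n x))\<bar> \<le> inverse (sqrt (sqrt (e n)))" by (simp only: abs_mult mult_1)
    moreover have "\<bar>t / 2\<bar> \<le> \<bar>t\<bar>" for t :: real by linarith
    ultimately show ?thesis unfolding \<psi>'_eq by (rule order_trans[rotated])
  qed
  have cl: "(\<lambda>g. \<psi> n ((L2dist f g)\<^sup>2), \<lambda>g t. \<psi>' n ((L2dist f g)\<^sup>2) * (2 * g t - 2 * f t)) \<in> op_closure Q C1" for n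
    by (rule closure_chain[OF sq D cont bd])
  have rlim: "(\<lambda>n. r n x) \<longlonglongrightarrow> \<bar>x\<bar>" for x
  proof -
    have "(\<lambda>n. r n x) \<longlonglongrightarrow> sqrt (0 + x\<^sup>2)" unfolding r_def by (intro tendsto_intros e0)
    then show ?thesis by simp
  qed
  have dm: "L2dist f \<in> borel_measurable Q"
  proof -
    have "(\<lambda>g. sqrt ((L2dist f g)\<^sup>2)) \<in> borel_measurable Q" using L2_measurable[OF op_closure_L2(1)[OF sq]] by measurable
    moreover have "(\<lambda>g. sqrt ((L2dist f g)\<^sup>2)) = L2dist f" by (simp add: fun_eq_iff L2dist_def)
    ultimately show ?thesis by simp
  qed
  show ?thesis
  proof (rule op_closure_closed[OF cl])
    show "L2conv Q (\<lambda>n g. \<psi> n ((L2dist f g)\<^sup>2)) (L2dist f)"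
    proof (rule L2conv_dominated[where h="\<lambda>_. 2"])
      show "L2 Q (\<lambda>_. 2)" by (rule Q.L2_bounded[of _ 2]) auto
      show "(\<lambda>g. \<psi> n ((L2dist f g)\<^sup>2)) \<in> borel_measurable Q" for n by (rule L2_measurable[OF op_closure_L2(1)[OF cl]])
      show "AE g in Q. (\<lambda>n. \<psi> n ((L2dist f g)\<^sup>2)) \<longlonglongrightarrow> L2dist f g"
      proof (rule AE_I2)
        fix g
        have "(\<lambda>n. \<psi> n ((L2dist f g)\<^sup>2)) \<longlonglongrightarrow> sqrt \<bar>(L2dist f g)\<^sup>2\<bar>" unfolding \<psi>_def by (intro tendsto_real_sqrt rlim)
        then show "(\<lambda>n. \<psi> n ((L2dist f g)\<^sup>2)) \<longlonglongrightarrow> L2dist f g" by (simp add: L2dist_def)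
      qed
      show "AE g in Q. \<bar>\<psi> n ((L2dist f g)\<^sup>2)\<bar> \<le> 2" for n
      proof (rule AE_I2)
        fix g assume "g \<in> space Q"
        then have "((L2dist f g)\<^sup>2)\<^sup>2 \<le> 1" using L2dist_sq(2,3)[OF f, of g] by (simp add: power_le_one)
        then have "e n + ((L2dist f g)\<^sup>2)\<^sup>2 \<le> 4\<^sup>2" using e(2)[of n] by simp
        then have "r n ((L2dist f g)\<^sup>2) \<le> 2\<^sup>2" unfolding r_def by (subst (2) power2_eq_square) (rule real_le_lsqrt, simp_all)
        then show "\<bar>\<psi> n ((L2dist f g)\<^sup>2)\<bar> \<le> 2" unfolding \<psi>_def using r0[of n "(L2dist f g)\<^sup>2"] by (simp add: real_le_lsqrt)
      qed
    qed (rule dm)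
    show "L2conv QL (\<lambda>n. \<lambda>(g, t). \<psi>' n ((L2dist f g)\<^sup>2) * (2 * g t - 2 * f t)) (case_prod (dist_grad f))"
    proof (rule L2conv_dominated[OF L2_abs[OF L2_dist_grad[OF f]]])
      show "(\<lambda>(g, t). \<psi>' n ((L2dist f g)\<^sup>2) * (2 * g t - 2 * f t)) \<in> borel_measurable QL" for n
        by (rule L2_measurable[OF op_closure_L2(2)[OF cl]])
      show "case_prod (dist_grad f) \<in> borel_measurable QL" by (rule L2_measurable[OF L2_dist_grad[OF f]])
      \<comment> \<open>At squared distance the derivative is at most its limit 1 / (2 d), so
        |dist_grad| dominates all approximating gradients. For d = 0 both statements hold because
        \<psi>' vanishes at 0 and the inverse of 0 is 0.\<close>
      have lim: "(\<lambda>n. \<psi>' n (d\<^sup>2)) \<longlonglongrightarrow> inverse d / 2" and le: "\<bar>\<psi>' n (d\<^sup>2)\<bar> \<le> inverse d / 2" if "d \<ge> 0" for d n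
      proof -
        have "(\<lambda>n. \<psi>' n (d\<^sup>2)) \<longlonglongrightarrow> inverse d / 2 \<and> \<bar>\<psi>' n (d\<^sup>2)\<bar> \<le> inverse d / 2"
        proof (cases "d = 0")
          case False
          then have d: "d > 0" using that by simp
          have "(\<lambda>n. \<psi>' n (d\<^sup>2)) \<longlonglongrightarrow> d\<^sup>2 / \<bar>d\<^sup>2\<bar> * inverse (sqrt \<bar>d\<^sup>2\<bar>) / 2"
            unfolding \<psi>'_eq by (intro tendsto_intros rlim) (use d in auto)
          moreover have "\<bar>d\<^sup>2 / r n (d\<^sup>2)\<bar> * \<bar>inverse (sqrt (r n (d\<^sup>2)))\<bar> \<le> 1 * inverse d"
          proof (rule mult_mono[OF quot])
            have "d \<le> sqrt (r n (d\<^sup>2))" using rx[of "d\<^sup>2" n] by (intro real_le_rsqrt) simp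
            then show "\<bar>inverse (sqrt (r n (d\<^sup>2)))\<bar> \<le> inverse d" using d by (simp add: le_imp_inverse_le)
          qed auto
          ultimately show ?thesis using d unfolding \<psi>'_eq abs_mult abs_divide by simp
        qed (simp add: \<psi>'_def)
        then show "(\<lambda>n. \<psi>' n (d\<^sup>2)) \<longlonglongrightarrow> inverse d / 2" "\<bar>\<psi>' n (d\<^sup>2)\<bar> \<le> inverse d / 2" by auto
      qed
      have d0: "L2dist f g \<ge> 0" for g by (simp add: L2dist_def)
      have grad: "dist_grad f g t = inverse (L2dist f g) / 2 * (2 * g t - 2 * f t)" for g t
        unfolding dist_grad_def by (cases "L2dist f g = 0") (auto simp: field_simps)
      show "AE x in QL. (\<lambda>n. case x of (g, t) \<Rightarrow> \<psi>' n ((L2dist f g)\<^sup>2) * (2 * g t - 2 * f t)) \<longlonglongrightarrow> case_prod (dist_grad f) x"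
        unfolding case_prod_unfold grad by (intro AE_I2 tendsto_mult tendsto_const lim d0)
      show "AE x in QL. \<bar>case x of (g, t) \<Rightarrow> \<psi>' n ((L2dist f g)\<^sup>2) * (2 * g t - 2 * f t)\<bar> \<le> \<bar>case_prod (dist_grad f) x\<bar>" for n
        unfolding case_prod_unfold grad abs_mult by (intro AE_I2 mult_right_mono order_trans[OF le[OF d0] abs_ge_self]) auto
    qed
  qed
qed

lemma form_closure_C1_eq_Z1: "form_closure Q C1 = form_closure Q Z1"
  by (auto simp: form_closure_iff[OF Q.prob_space_axioms] op_closure_C1_eq_Z1)

text \<open>By uniqueness, a gradient in the closure agrees almost everywhere on the product with
  the explicit one. Fubini passes this to almost every path, where the inner product in time is
  taken.\<close>

lemma sqfield_graph:
  assumes p: "p \<in> Z1 \<union> C1" and q: "q \<in> Z1 \<union> C1"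
  shows "(fst p, F) \<in> op_closure Q C1 \<Longrightarrow> (fst q, G) \<in> op_closure Q C1 \<Longrightarrow>
      AE g in Q. sqfield F G g = sqfield (snd p) (snd q) g"
    and "(fst p, fst q, c) \<in> form_closure Q C1 \<Longrightarrow> c = (\<integral>g. sqfield (snd p) (snd q) g \<partial>Q)"
proof -
  have cl: "(fst p, snd p) \<in> op_closure Q C1" "(fst q, snd q) \<in> op_closure Q C1"
    using graph_in_closure p q by auto
  note L2 = cl[THEN op_closure_L2(2)]
  have AE: "AE x in QL. case_prod F x = case_prod (snd p) x" "AE x in QL. case_prod G x = case_prod (snd q) x"
    if FG: "(fst p, F) \<in> op_closure Q C1" "(fst q, G) \<in> op_closure Q C1" for F G
    by (rule closure_unique[OF FG(1) cl(1)] closure_unique[OF FG(2) cl(2)], simp)+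
  show "AE g in Q. sqfield F G g = sqfield (snd p) (snd q) g"
    if FG: "(fst p, F) \<in> op_closure Q C1" "(fst q, G) \<in> op_closure Q C1"
    by (rule sqfield_cong_AE[OF FG(1)[THEN op_closure_L2(2)] L2(1) FG(2)[THEN op_closure_L2(2)] L2(2) AE[OF FG]])
  assume "(fst p, fst q, c) \<in> form_closure Q C1"
  then obtain F G where FG: "(fst p, F) \<in> op_closure Q C1" "(fst q, G) \<in> op_closure Q C1"
    and c: "c = (\<integral>x. case_prod F x * case_prod G x \<partial>QL)"
    using form_closure_iff[OF Q.prob_space_axioms] by blast
  have "c = (\<integral>x. case_prod (snd p) x * case_prod (snd q) x \<partial>QL)"
    unfolding c
  proof (rule integral_cong_AE)
    show "AE x in QL. case_prod F x * case_prod G x = case_prod (snd p) x * case_prod (snd q) x"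
      using AE[OF FG] by eventually_elim simp
  qed (intro borel_measurable_times L2_measurable L2 FG[THEN op_closure_L2(2)])+
  also have "\<dots> = (\<integral>g. sqfield (snd p) (snd q) g \<partial>Q)" by (rule integral_sqfield[OF L2])
  finally show "c = (\<integral>g. sqfield (snd p) (snd q) g \<partial>Q)" .
qed

lemma sqfield_L2dist_le_one:
  assumes f: "f \<in> G0" and F: "(L2dist f, F) \<in> op_closure Q C1"
  shows "AE g in Q. sqfield F F g \<le> 1"
proof -
  note cl = L2dist_in_closure[OF f]
  have AE: "AE x in QL. case_prod F x = case_prod (dist_grad f) x" by (rule closure_unique[OF F cl]) simp
  have "AE g in Q. sqfield F F g = sqfield (dist_grad f) (dist_grad f) g"
    by (rule sqfield_cong_AE[OF _ _ _ _ AE AE]) (use op_closure_L2(2)[OF F] L2_dist_grad[OF f] in auto)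
  then show ?thesis
    using AE_space by eventually_elim (simp add: sqfield_dist_grad(2)[OF f])
qed

lemma L2dist_in_form_dom:
  assumes "f \<in> G0" shows "L2dist f \<in> form_dom Q C1"
  using L2dist_in_closure[OF assms] unfolding form_dom_def form_closure_iff[OF Q.prob_space_axioms] by blast

end

theorem theorem7p8:
  fixes \<beta> :: real and Q :: "(real \<Rightarrow> real) measure"
  assumes "\<beta> > 0" and "is_entropic_measure \<beta> Q"
  shows
    \<comment> \<open>(i)\<close>
    "form_closable Q C1 \<and> form_closure Q C1 = form_closure Q Z1 \<and>
     op_closable Q C1 \<and> op_closure Q C1 = op_closure Q Z1
     \<comment> \<open>(ii)\<close>
     \<and> (\<forall>p \<in> Z1 \<union> C1. \<forall>q \<in> Z1 \<union> C1.
          p \<in> op_closure Q Z1 \<and>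
          (\<forall>F G. (fst p, F) \<in> op_closure Q Z1 \<longrightarrow> (fst q, G) \<in> op_closure Q Z1 \<longrightarrow>
             (AE g in Q. sqfield F G g = sqfield (snd p) (snd q) g)) \<and>
          (\<forall>c. (fst p, fst q, c) \<in> form_closure Q Z1 \<longrightarrow>
             c = (\<integral>g. sqfield (snd p) (snd q) g \<partial>Q)))
     \<comment> \<open>(iii)\<close>
     \<and> (\<forall>f \<in> G0. (\<lambda>g. L2dist f g) \<in> form_dom Q Z1 \<and>
          (\<exists>F. ((\<lambda>g. L2dist f g), F) \<in> op_closure Q Z1) \<and>
          (\<forall>F. ((\<lambda>g. L2dist f g), F) \<in> op_closure Q Z1 \<longrightarrow> (AE g in Q. sqfield F F g \<le> 1)))
     \<comment> \<open>(iv)\<close>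
     \<and> (\<forall>u v c a. (u, v, c) \<in> form_closure Q Z1 \<longrightarrow> (AE g in Q. (u g + a) * v g = 0) \<longrightarrow> c = 0)"
proof -
  interpret entropic \<beta> Q by standard (rule assms)+
  have dom: "form_dom Q C1 = form_dom Q Z1" by (simp add: form_dom_def form_closure_C1_eq_Z1)
  show ?thesis
    \<comment> \<open>All parts were established for the closures of \<open>C1\<close>; rewriting
      with the equality of closures turns the claims about \<open>Z1\<close> into them.\<close>
    unfolding op_closure_C1_eq_Z1[symmetric] form_closure_C1_eq_Z1[symmetric] dom[symmetric]
    by (intro conjI ballI allI impI refl form_closable_C1 op_closable_C1 graph_in_closure L2dist_in_form_dom)
      (assumption | rule sqfield_graph sqfield_L2dist_le_one strongly_local, assumption+ | rule exI, erule L2dist_in_closure)+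
qed

end
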